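(* Let $f\in L^2(\Omega,\mathbb{R})$ and let $(\sigma,u)\in H(\mathrm{div},\Omega,\mathbb{R}^2)\times L^2(\Omega,\mathbb{R})$ be the solution of $$(\sigma,\tau)-(u,\mathrm{div}\,\tau)=0\ \ \forall\,\tau\in H(\mathrm{div},\Omega,\mathbb{R}^2),\qquad (v,\mathrm{div}\,\sigma)=(f,v)\ \ \forall\, v\in L^2(\Omega,\mathbb{R}),$$ with $\sigma\in H^{5/2}(\Omega,\mathbb{R}^2)$. Let $\mathcal{T}_h$ be a uniform triangulation of $\Omega$ and let $(\sigma_h,u_h)\in \mathrm{RT}(\mathcal{T}_h)\times U_{\mathrm{RT}}$ be the solution of $$(\sigma_h,\tau_h)-(u_h,\mathrm{div}\,\tau_h)=0\ \ \forall\,\tau_h\in \mathrm{RT}(\mathcal{T}_h),\qquad (v_h,\mathrm{div}\,\sigma_h)=(f,v_h)\ \ \forall\, v_h\in U_{\mathrm{RT}}.$$ Then $$\|\sigma_h-\Pi_h^{\mathrm{RT}}\sigma\|_{0,\Omega}\lesssim h^2\big(|\sigma|_{5/2,\Omega}+\kappa|\ln h|^{1/2}|\sigma|_{1,\infty,\Omega}\big).$$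
   Context: $\Omega\subset\mathbb{R}^2$ is a bounded polygonal domain exactly covered by a shape-regular triangulation $\mathcal{T}_h$ into triangles; $h_K$ is the diameter of $K\in\mathcal{T}_h$ and $h=\max_K h_K$ (asymptotic regime: $h$ bounded away from $1$ from above). $\mathcal{E}_h$ is the set of all edges, and $\mathbf{n}_e$ a unit normal of the edge $e$. $\mathcal{T}_h$ is called uniform if any two adjacent triangles of $\mathcal{T}_h$ form a parallelogram. $(\cdot,\cdot)$ is the $L^2(\Omega)$ inner product, $\|\cdot\|_{s,\Omega}$, $|\cdot|_{s,\Omega}$ are the Sobolev norm and seminorm of $H^s(\Omega)$, and $|\cdot|_{k,\infty,\Omega}$ is the seminorm of $W^{k,\infty}(\Omega)$. $A\lesssim B$ means $A\le CB$ with a constant $C>0$ independent of the mesh size. $H(\mathrm{div},\Omega,\mathbb{R}^2)=\{\tau\in L^2(\Omega,\mathbb{R}^2):\mathrm{div}\,\tau\in L^2(\Omega,\mathbb{R})\}$. Raviart-Thomas (RT) space: $\mathrm{RT}(\mathcal{T}_h)=\{\tau\in H(\mathrm{div},\Omega,\mathbb{R}^2):\tau|_K\in (P_0(K))^2+\mathbf{x}P_0(K)\ \forall K\in\mathcal{T}_h\}$, where $P_r(K)$ denotes polynomials of degree $\le r$ on $K$; $U_{\mathrm{RT}}=\{v\in L^2(\Omega,\mathbb{R}): v|_K\in P_0(K)\ \forall K\in\mathcal{T}_h\}$. The Fortin interpolation $\Pi_h^{\mathrm{RT}}:H^1(\Omega,\mathbb{R}^2)\to\mathrm{RT}(\mathcal{T}_h)$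 is defined by $\int_e(\Pi_h^{\mathrm{RT}}\tau-\tau)^T\mathbf{n}_e\,ds=0$ for all $e\in\mathcal{E}_h$. Definition of $\kappa$: on a uniform triangulation all triangles have the same three edge directions. From the three outer unit normals of a triangle let $\mathbf{f}_1,\mathbf{f}_2$ be the two which are closest to orthogonal (any choice if not unique; only directions matter). For $i=1,2$, partition $\Omega$ into parallelograms $N_{\mathbf{f}_i}$, each consisting of two triangles sharing an edge with normal $\pm\mathbf{f}_i$, and the remaining boundary triangles, denoted $K_{\mathbf{f}_i}$. Let $\mathcal{P}_b=\{\mathbf{p}\in\partial\Omega:\mathbf{p}\text{ is a vertex of some }K_{\mathbf{f}_i}\}$, let $\mathcal{P}_b^1\subset\mathcal{P}_b$ be the set of those points that are vertices (corners) of the domain $\Omega$, and $\kappa=|\mathcal{P}_b^1|$ its cardinality (a fixed number independent of $h$). *)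

theory Defs
  imports "HOL-Analysis.Analysis" "HOL-Probability.Essential_Supremum"
begin

type_synonym plane = "real^2"


section \<open>Smooth functions and test functions\<close>

definition pd :: "2 \<Rightarrow> (plane \<Rightarrow> real) \<Rightarrow> plane \<Rightarrow> real" where
  "pd i \<phi> x = frechet_derivative \<phi> (at x) (axis i 1)"

text \<open>A multi-index \<open>\<alpha> = (i, j)\<close> stands for \<open>i\<close> derivatives in the first and \<open>j\<close> derivatives in
  the second variable.\<close>

definition mpd :: "nat \<times> nat \<Rightarrow> (plane \<Rightarrow> real) \<Rightarrow> plane \<Rightarrow> real" where
  "mpd \<alpha> \<phi> = (pd 1 ^^ fst \<alpha>) ((pd 2 ^^ snd \<alpha>) \<phi>)"

definition mi_order :: "nat \<times> nat \<Rightarrow> nat" where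
  "mi_order \<alpha> = fst \<alpha> + snd \<alpha>"

lemma finite_mi_order: "finite {\<alpha>. mi_order \<alpha> = k}"
  by (rule finite_subset[of _ "{..k} \<times> {..k}"]) (auto simp: mi_order_def)

primrec C_k :: "nat \<Rightarrow> (plane \<Rightarrow> real) \<Rightarrow> bool" where
  "C_k 0 \<phi> \<longleftrightarrow> continuous_on UNIV \<phi>"
| "C_k (Suc k) \<phi> \<longleftrightarrow> (\<forall>x. \<phi> differentiable (at x)) \<and> (\<forall>i. C_k k (pd i \<phi>))"

definition smooth :: "(plane \<Rightarrow> real) \<Rightarrow> bool" where
  "smooth \<phi> \<longleftrightarrow> (\<forall>k. C_k k \<phi>)"

definition test_function :: "plane set \<Rightarrow> (plane \<Rightarrow> real) \<Rightarrow> bool" where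
  "test_function \<Omega> \<phi> \<longleftrightarrow>
     smooth \<phi> \<and> compact (closure {x. \<phi> x \<noteq> 0}) \<and> closure {x. \<phi> x \<noteq> 0} \<subseteq> \<Omega>"


section \<open>Lebesgue and Sobolev spaces\<close>

text \<open>Elements of function spaces are represented by functions on the whole plane of which only
  the values almost everywhere in \<open>\<Omega>\<close> are relevant.\<close>

definition L2 :: "'a::euclidean_space set \<Rightarrow> ('a \<Rightarrow> 'b::euclidean_space) \<Rightarrow> bool" where
  "L2 \<Omega> v \<longleftrightarrow> v \<in> borel_measurable (lebesgue_on \<Omega>) \<and> integrable (lebesgue_on \<Omega>) (\<lambda>x. (norm (v x))\<^sup>2)"

definition L2_inner ::
    "'a::euclidean_space set \<Rightarrow> ('a \<Rightarrow> 'b::euclidean_space) \<Rightarrow> ('a \<Rightarrow> 'b) \<Rightarrow> real" where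
  "L2_inner \<Omega> v w = (LINT x|lebesgue_on \<Omega>. v x \<bullet> w x)"

definition L2_norm :: "'a::euclidean_space set \<Rightarrow> ('a \<Rightarrow> 'b::euclidean_space) \<Rightarrow> real" where
  "L2_norm \<Omega> v = sqrt (LINT x|lebesgue_on \<Omega>. (norm (v x))\<^sup>2)"

definition locally_integrable :: "plane set \<Rightarrow> (plane \<Rightarrow> 'b::euclidean_space) \<Rightarrow> bool" where
  "locally_integrable \<Omega> v \<longleftrightarrow> (\<forall>S. compact S \<and> S \<subseteq> \<Omega> \<longrightarrow> v absolutely_integrable_on S)"

definition has_weak_deriv ::
    "plane set \<Rightarrow> nat \<times> nat \<Rightarrow> (plane \<Rightarrow> real) \<Rightarrow> (plane \<Rightarrow> real) \<Rightarrow> bool" where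
  "has_weak_deriv \<Omega> \<alpha> v g \<longleftrightarrow> locally_integrable \<Omega> v \<and> locally_integrable \<Omega> g \<and>
     (\<forall>\<phi>. test_function \<Omega> \<phi> \<longrightarrow>
        (LINT x|lebesgue_on \<Omega>. v x * mpd \<alpha> \<phi> x) =
        (- 1) ^ mi_order \<alpha> * (LINT x|lebesgue_on \<Omega>. g x * \<phi> x))"

definition weak_deriv :: "plane set \<Rightarrow> nat \<times> nat \<Rightarrow> (plane \<Rightarrow> real) \<Rightarrow> plane \<Rightarrow> real" where
  "weak_deriv \<Omega> \<alpha> v = (SOME g. has_weak_deriv \<Omega> \<alpha> v g)"

text \<open>The square of the Sobolev--Slobodeckij seminorm of order \<open>\<theta> \<in> (0, 1)\<close>; the exponent of the
  kernel is \<open>n + 2 * \<theta>\<close> with dimension \<open>n = 2\<close>.\<close>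

definition slobodeckij :: "real \<Rightarrow> plane set \<Rightarrow> (plane \<Rightarrow> real) \<Rightarrow> ennreal" where
  "slobodeckij \<theta> \<Omega> g =
     (\<integral>\<^sup>+x. \<integral>\<^sup>+y. ennreal ((g x - g y)\<^sup>2 / norm (x - y) powr (2 + 2 * \<theta>)) \<partial>lebesgue_on \<Omega> \<partial>lebesgue_on \<Omega>)"

text \<open>The space \<open>H\<^sup>s(\<Omega>)\<close> for real \<open>s \<ge> 0\<close>.\<close>

definition sobolev_space :: "real \<Rightarrow> plane set \<Rightarrow> (plane \<Rightarrow> real) \<Rightarrow> bool" where
  "sobolev_space s \<Omega> v \<longleftrightarrow> L2 \<Omega> v \<and>
     (\<forall>\<alpha>. mi_order \<alpha> \<le> nat \<lfloor>s\<rfloor> \<longrightarrow> (\<exists>g. L2 \<Omega> g \<and> has_weak_deriv \<Omega> \<alpha> v g)) \<and>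
     (frac s > 0 \<longrightarrow>
        (\<forall>\<alpha>. mi_order \<alpha> = nat \<lfloor>s\<rfloor> \<longrightarrow> slobodeckij (frac s) \<Omega> (weak_deriv \<Omega> \<alpha> v) < \<infinity>))"

definition sobolev_seminorm :: "real \<Rightarrow> plane set \<Rightarrow> (plane \<Rightarrow> real) \<Rightarrow> real" where
  "sobolev_seminorm s \<Omega> v = sqrt (\<Sum>\<alpha> | mi_order \<alpha> = nat \<lfloor>s\<rfloor>.
     if frac s = 0 then (L2_norm \<Omega> (weak_deriv \<Omega> \<alpha> v))\<^sup>2
     else enn2real (slobodeckij (frac s) \<Omega> (weak_deriv \<Omega> \<alpha> v)))"

definition sobolev_space_vec :: "real \<Rightarrow> plane set \<Rightarrow> (plane \<Rightarrow> plane) \<Rightarrow> bool" where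
  "sobolev_space_vec s \<Omega> \<tau> \<longleftrightarrow> (\<forall>i. sobolev_space s \<Omega> (\<lambda>x. \<tau> x $ i))"

definition sobolev_seminorm_vec :: "real \<Rightarrow> plane set \<Rightarrow> (plane \<Rightarrow> plane) \<Rightarrow> real" where
  "sobolev_seminorm_vec s \<Omega> \<tau> = sqrt (\<Sum>i\<in>UNIV. (sobolev_seminorm s \<Omega> (\<lambda>x. \<tau> x $ i))\<^sup>2)"

text \<open>The seminorm of \<open>W\<^bsup>k,\<infinity>\<^esup>(\<Omega>)\<close>, which is \<open>\<infinity>\<close> if some derivative of order \<open>k\<close> is unbounded.\<close>

definition W_inf_seminorm_vec :: "nat \<Rightarrow> plane set \<Rightarrow> (plane \<Rightarrow> plane) \<Rightarrow> ereal" where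
  "W_inf_seminorm_vec k \<Omega> \<tau> = (SUP (i, \<alpha>) \<in> UNIV \<times> {\<alpha>. mi_order \<alpha> = k}.
     esssup (lebesgue_on \<Omega>) (\<lambda>x. ereal \<bar>weak_deriv \<Omega> \<alpha> (\<lambda>y. \<tau> y $ i) x\<bar>))"

definition has_weak_div :: "plane set \<Rightarrow> (plane \<Rightarrow> plane) \<Rightarrow> (plane \<Rightarrow> real) \<Rightarrow> bool" where
  "has_weak_div \<Omega> \<tau> d \<longleftrightarrow> locally_integrable \<Omega> \<tau> \<and> locally_integrable \<Omega> d \<and>
     (\<forall>\<phi>. test_function \<Omega> \<phi> \<longrightarrow>
        (LINT x|lebesgue_on \<Omega>. (\<Sum>i\<in>UNIV. \<tau> x $ i * pd i \<phi> x)) = - (LINT x|lebesgue_on \<Omega>. d x * \<phi> x))"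

definition weak_div :: "plane set \<Rightarrow> (plane \<Rightarrow> plane) \<Rightarrow> plane \<Rightarrow> real" where
  "weak_div \<Omega> \<tau> = (SOME d. has_weak_div \<Omega> \<tau> d)"

definition H_div :: "plane set \<Rightarrow> (plane \<Rightarrow> plane) set" where
  "H_div \<Omega> = {\<tau>. L2 \<Omega> \<tau> \<and> (\<exists>d. L2 \<Omega> d \<and> has_weak_div \<Omega> \<tau> d)}"


section \<open>Polygonal domains and triangulations\<close>

text \<open>The condition \<open>interior (closure \<Omega>) = \<Omega>\<close> excludes slits and punctures, which a mesh
  covering \<open>closure \<Omega>\<close> could not see.\<close>

definition polygonal_domain :: "plane set \<Rightarrow> bool" where
  "polygonal_domain \<Omega> \<longleftrightarrow> \<Omega> \<noteq> {} \<and> open \<Omega> \<and> connected \<Omega> \<and> bounded \<Omega> \<and>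
     interior (closure \<Omega>) = \<Omega> \<and>
     (\<exists>S. finite S \<and> (\<forall>s\<in>S. \<exists>a b. s = closed_segment a b) \<and> frontier \<Omega> = \<Union>S)"

definition domain_corner :: "plane set \<Rightarrow> plane \<Rightarrow> bool" where
  "domain_corner \<Omega> p \<longleftrightarrow> p \<in> frontier \<Omega> \<and>
     \<not> (\<exists>n r. n \<noteq> 0 \<and> r > 0 \<and> \<Omega> \<inter> ball p r = {x. n \<bullet> (x - p) < 0} \<inter> ball p r)"

text \<open>The library's \<open>triangulation\<close> contains conformity: any two members meet in a common face.\<close>

definition triangulation_of :: "plane set set \<Rightarrow> plane set \<Rightarrow> bool" where
  "triangulation_of \<T> \<Omega> \<longleftrightarrow> triangulation \<T> \<and> (\<forall>K\<in>\<T>. 2 simplex K) \<and> \<Union>\<T> = closure \<Omega>"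

definition inball_diameter :: "plane set \<Rightarrow> real" where
  "inball_diameter K = Sup {2 * r | r. r \<ge> 0 \<and> (\<exists>x. cball x r \<subseteq> K)}"

definition shape_regular :: "real \<Rightarrow> plane set set \<Rightarrow> bool" where
  "shape_regular \<gamma> \<T> \<longleftrightarrow> (\<forall>K\<in>\<T>. diameter K \<le> \<gamma> * inball_diameter K)"

definition mesh_size :: "plane set set \<Rightarrow> real" where
  "mesh_size \<T> = Max (diameter ` \<T>)"

definition parallelogram :: "plane set \<Rightarrow> bool" where
  "parallelogram P \<longleftrightarrow> (\<exists>a b c. \<not> collinear {a, b, c} \<and> P = convex hull {a, b, c, b + c - a})"

definition uniform_mesh :: "plane set set \<Rightarrow> bool" where
  "uniform_mesh \<T> \<longleftrightarrow>
     (\<forall>K\<in>\<T>. \<forall>K'\<in>\<T>. K \<noteq> K' \<and> (\<exists>e. e edge_of K \<and> e edge_of K') \<longrightarrow> parallelogram (K \<union> K'))"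

definition unit_normal :: "plane set \<Rightarrow> plane \<Rightarrow> bool" where
  "unit_normal e n \<longleftrightarrow> norm n = 1 \<and> (\<forall>x\<in>e. \<forall>y\<in>e. n \<bullet> (x - y) = 0)"

definition outer_unit_normals :: "plane set \<Rightarrow> plane set" where
  "outer_unit_normals K =
     {n. \<exists>e. e edge_of K \<and> unit_normal e n \<and> (\<forall>x\<in>K. \<forall>y\<in>e. n \<bullet> (x - y) \<le> 0)}"

text \<open>Both \<open>f\<close> and \<open>g\<close> have unit length, so the angle between their directions is closest to a
  right angle when \<open>\<bar>f \<bullet> g\<bar>\<close> is smallest.\<close>

definition most_orthogonal_normals :: "plane set set \<Rightarrow> plane \<Rightarrow> plane \<Rightarrow> bool" where
  "most_orthogonal_normals \<T> f g \<longleftrightarrow> (\<exists>K\<in>\<T>.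
     f \<in> outer_unit_normals K \<and> g \<in> outer_unit_normals K \<and> f \<noteq> g \<and>
     (\<forall>f'\<in>outer_unit_normals K. \<forall>g'\<in>outer_unit_normals K. f' \<noteq> g' \<longrightarrow> \<bar>f \<bullet> g\<bar> \<le> \<bar>f' \<bullet> g'\<bar>))"

text \<open>Each triangle of a uniform mesh has exactly one edge with normal \<open>\<plusminus>f\<close>, so the partition of the
  mesh into parallelograms and remaining triangles is determined by \<open>f\<close>.\<close>

definition unpaired_triangles :: "plane set set \<Rightarrow> plane \<Rightarrow> plane set set" where
  "unpaired_triangles \<T> f =
     {K\<in>\<T>. \<not> (\<exists>K'\<in>\<T>. K' \<noteq> K \<and> (\<exists>e. e edge_of K \<and> e edge_of K' \<and> unit_normal e f))}"

definition boundary_points :: "plane set \<Rightarrow> plane set set \<Rightarrow> plane \<Rightarrow> plane \<Rightarrow> plane set" where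
  "boundary_points \<Omega> \<T> f g = {p \<in> frontier \<Omega>.
     \<exists>K \<in> unpaired_triangles \<T> f \<union> unpaired_triangles \<T> g. p extreme_point_of K}"

definition kappa :: "plane set \<Rightarrow> plane set set \<Rightarrow> plane \<Rightarrow> plane \<Rightarrow> nat" where
  "kappa \<Omega> \<T> f g = card {p \<in> boundary_points \<Omega> \<T> f g. domain_corner \<Omega> p}"


section \<open>Raviart--Thomas elements and Fortin interpolation\<close>

definition RT :: "plane set \<Rightarrow> plane set set \<Rightarrow> (plane \<Rightarrow> plane) set" where
  "RT \<Omega> \<T> = {\<tau> \<in> H_div \<Omega>. \<forall>K\<in>\<T>. \<exists>a b. AE x in lebesgue_on K. \<tau> x = a + b *\<^sub>R x}"

definition U_RT :: "plane set \<Rightarrow> plane set set \<Rightarrow> (plane \<Rightarrow> real) set" where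
  "U_RT \<Omega> \<T> = {v. L2 \<Omega> v \<and> (\<forall>K\<in>\<T>. \<exists>c. AE x in lebesgue_on K. v x = c)}"

text \<open>\<open>g\<close> is the trace of \<open>v \<in> H\<^sup>1(interior K)\<close> on the edge of \<open>K\<close> with end points \<open>a\<close> and \<open>b\<close>: the
  common limit, in \<open>H\<^sup>1(interior K)\<close> and in \<open>L\<^sup>2\<close> of the edge, of smooth functions.  The edge is
  parametrised by \<open>linepath a b\<close>.\<close>

definition has_edge_trace ::
    "plane set \<Rightarrow> plane \<Rightarrow> plane \<Rightarrow> (plane \<Rightarrow> real) \<Rightarrow> (plane \<Rightarrow> real) \<Rightarrow> bool" where
  "has_edge_trace K a b v g \<longleftrightarrow>
     sobolev_space 1 (interior K) v \<and> L2 {0..1} (g \<circ> linepath a b) \<and>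
     (\<exists>\<phi>. (\<forall>n. smooth (\<phi> n)) \<and>
        (\<lambda>n. L2_norm (interior K) (\<lambda>x. \<phi> n x - v x)) \<longlonglongrightarrow> 0 \<and>
        (\<lambda>n. sobolev_seminorm 1 (interior K) (\<lambda>x. \<phi> n x - v x)) \<longlonglongrightarrow> 0 \<and>
        (\<lambda>n. L2_norm {0..1} ((\<lambda>x. \<phi> n x - g x) \<circ> linepath a b)) \<longlonglongrightarrow> 0)"

definition edge_integral :: "plane \<Rightarrow> plane \<Rightarrow> (plane \<Rightarrow> real) \<Rightarrow> real" where
  "edge_integral a b g = norm (b - a) * (LINT t|lebesgue_on {0..1}. g (linepath a b t))"

text \<open>\<open>\<pi>\<close> is the Fortin interpolant of \<open>\<tau>\<close>.  It is determined by \<open>\<tau>\<close> up to a null set.\<close>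

definition fortin_interpolant ::
    "plane set \<Rightarrow> plane set set \<Rightarrow> (plane \<Rightarrow> plane) \<Rightarrow> (plane \<Rightarrow> plane) \<Rightarrow> bool" where
  "fortin_interpolant \<Omega> \<T> \<tau> \<pi> \<longleftrightarrow> sobolev_space_vec 1 \<Omega> \<tau> \<and> \<pi> \<in> RT \<Omega> \<T> \<and>
     (\<forall>K\<in>\<T>. \<forall>a b n. closed_segment a b edge_of K \<and> unit_normal (closed_segment a b) n \<longrightarrow>
        (\<exists>g. (\<forall>i. has_edge_trace K a b (\<lambda>x. (\<pi> x - \<tau> x) $ i) (\<lambda>x. g x $ i)) \<and>
             edge_integral a b (\<lambda>x. g x \<bullet> n) = 0))"


section \<open>The mixed problem and its discretisation\<close>

definition mixed_solution ::
    "plane set \<Rightarrow> (plane \<Rightarrow> real) \<Rightarrow> (plane \<Rightarrow> plane) \<Rightarrow> (plane \<Rightarrow> real) \<Rightarrow> bool" where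
  "mixed_solution \<Omega> f \<sigma> u \<longleftrightarrow> \<sigma> \<in> H_div \<Omega> \<and> L2 \<Omega> u \<and>
     (\<forall>\<tau>\<in>H_div \<Omega>. L2_inner \<Omega> \<sigma> \<tau> - L2_inner \<Omega> u (weak_div \<Omega> \<tau>) = 0) \<and>
     (\<forall>v. L2 \<Omega> v \<longrightarrow> L2_inner \<Omega> v (weak_div \<Omega> \<sigma>) = L2_inner \<Omega> f v)"

definition discrete_mixed_solution ::
    "plane set \<Rightarrow> plane set set \<Rightarrow> (plane \<Rightarrow> real) \<Rightarrow> (plane \<Rightarrow> plane) \<Rightarrow> (plane \<Rightarrow> real) \<Rightarrow> bool" where
  "discrete_mixed_solution \<Omega> \<T> f \<sigma>h uh \<longleftrightarrow> \<sigma>h \<in> RT \<Omega> \<T> \<and> uh \<in> U_RT \<Omega> \<T> \<and>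
     (\<forall>\<tau>\<in>RT \<Omega> \<T>. L2_inner \<Omega> \<sigma>h \<tau> - L2_inner \<Omega> uh (weak_div \<Omega> \<tau>) = 0) \<and>
     (\<forall>v\<in>U_RT \<Omega> \<T>. L2_inner \<Omega> v (weak_div \<Omega> \<sigma>h) = L2_inner \<Omega> f v)"

end

theory Submission
  imports Defs "HOL-Real_Asymp.Real_Asymp"
begin

text \<open>
  The error \<open>\<tau> = \<sigma>h - \<pi>\<close> is divergence free, hence constant on each triangle, and orthogonal to \<open>\<sigma>\<close>
  and \<open>\<sigma>h\<close>, so that the square of its norm is the sum over all triangles of \<open>\<tau>\<close> times the integral of
  \<open>\<sigma> - \<pi>\<close>. Up to second derivatives of \<open>\<sigma>\<close>, this integral is a combination of moments of the gradient
  of \<open>\<sigma>\<close>, with the fluxes of \<open>\<tau>\<close> through the three edges as coefficients. These fluxes are continuous and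
  sum to zero on each triangle, and on a uniform mesh the moments of the two triangles at an edge agree
  up to second derivatives; so everything cancels except at the boundary. There the three directions are
  blended with weights that select, at an edge on the boundary, the direction of that edge. At distance
  \<open>d\<close> of finitely many points the weights are Lipschitz with a constant of order \<open>1 / d\<close>, and the integral
  of the square of \<open>h / d\<close> is of order \<open>h\<^sup>2 * \<bar>ln h\<bar>\<close>. This costs \<open>h\<^sup>2 * sqrt \<bar>ln h\<bar>\<close> times the maximum of
  the gradient of \<open>\<sigma>\<close>, which the right hand side provides because \<open>\<kappa>\<close> is never zero: a vertex farthest
  from the origin always counts. As \<open>\<kappa>\<close> and \<open>\<bar>ln h\<bar>\<close> are bounded below, the gradient bound also serves to
  control the second derivatives by the fractional seminorm.
\<close>

section \<open>Smooth functions and cutoffs\<close>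

text \<open>Neither \<open>\<sigma>\<close> nor \<open>\<sigma>h - \<pi>\<close> comes with boundary
  values: only weak derivatives and a weak divergence are given. Integration by parts on a polygon
  is therefore carried out with fields whose normal components vanish linearly at the sides, so that
  cutoffs can be removed in the limit. Suitable fields of this kind compare two moments on one
  triangle, compare the moments of two neighbours, and show that fluxes are continuous. The Fortin
  condition enters through an identity that writes the mean over an edge as an integral over the
  triangle; having it for all three edges, one can solve for the integral of
  \<open>\<sigma> - \<pi>\<close>. The cancellation across edges presupposes one set of three
  directions for the whole mesh. This is derived from the parallelogram condition and the
  connectedness of the domain: two differently shaped families of triangles could meet in finitely
  many points only. The exceptional points and the Lipschitz constant of the weights come from the
  segments of the frontier alone and serve all directions at once, so that they do not change with
  the mesh.\<close>

definition flat :: "nat \<Rightarrow> real \<Rightarrow> real" where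
  "flat n t = (if t \<le> 0 then 0 else exp (- 1 / t) / t ^ n)"

lemma flat_nonneg [simp]: "0 \<le> flat n t"
  by (simp add: flat_def)

lemma power_le_fact_mult_exp:
  assumes "0 \<le> x" shows "x ^ n \<le> fact n * exp (x::real)"
proof -
  have "(\<Sum>k\<in>{n}. x ^ k /\<^sub>R fact k) \<le> (\<Sum>k. x ^ k /\<^sub>R fact k)"
    by (rule sum_le_suminf) (use assms summable_exp_generic[of x] in auto)
  then show ?thesis
    by (simp add: exp_def field_simps)
qed

lemma flat_le: "flat n t \<le> fact n"
proof (cases "t \<le> 0")
  case False
  then have t: "t > 0" by simp
  have "(1/t)^n \<le> exp (1/t) * fact n"
    using t power_le_fact_mult_exp[of "1/t" n] by (simp add: mult.commute)
  then show ?thesis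
    using t by (simp add: flat_def exp_minus field_simps power_one_over)
qed (simp add: flat_def)

text \<open>Powers of \<open>t\<close> are traded for a larger index:
  \<open>flat n t = flat (n + k) t * t ^ k\<close>, and every \<open>flat (n + k)\<close> is
  bounded. So \<open>flat n\<close> vanishes to any order at \<open>0\<close>.\<close>

lemma flat_le_power:
  assumes "0 < t" shows "flat n t \<le> fact (n + k) * t ^ k"
proof -
  have "flat n t = flat (n + k) t * t ^ k"
    using assms by (simp add: flat_def power_add)
  also have "\<dots> \<le> fact (n + k) * t ^ k"
    using assms by (intro mult_right_mono flat_le) auto
  finally show ?thesis .
qed

text \<open>The denominators \<open>t ^ n\<close> are carried along because they make the family
  closed under differentiation; smoothness of composites with \<open>flat\<close> is then an
  induction on the order.\<close>

lemma DERIV_flat: "(flat n has_real_derivative flat (n + 2) t - real n * flat (n + 1) t) (at t)"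
proof -
  consider "t < 0" | "t = 0" | "t > 0" by linarith
  then show ?thesis
  proof cases
    case 1
    have "((\<lambda>_. 0) has_real_derivative 0) (at t)" by simp
    then have "(flat n has_real_derivative 0) (at t)"
      by (rule DERIV_cong_ev[THEN iffD1, rotated -1])
         (use 1 in \<open>auto simp: flat_def intro!: eventually_nhds_in_open[of "{..<0}", THEN eventually_mono]\<close>)
    then show ?thesis using 1 by (simp add: flat_def)
  next
    case 2
    have "((\<lambda>h. flat n h / h) \<longlongrightarrow> 0) (at 0)"
    proof (rule Lim_null_comparison)
      have "norm (flat n h / h) \<le> fact (n+2) * \<bar>h\<bar>" for h
      proof (cases "h > 0")
        case True
        \<comment> \<open>Quadratic decay, the case \<open>k = 2\<close>, makes the difference
          quotient at \<open>0\<close> of order \<open>h\<close>.\<close>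
        then have "flat n h \<le> fact (n+2) * h^2" by (rule flat_le_power)
        then show ?thesis using True by (simp add: field_simps power2_eq_square)
      next
        case False
        then have "flat n h = 0" by (simp add: flat_def)
        then show ?thesis by (simp del: fact_Suc)
      qed
      then show "\<forall>\<^sub>F h in at 0. norm (flat n h / h) \<le> fact (n+2) * \<bar>h\<bar>" by simp
      show "((\<lambda>h. fact (n+2) * \<bar>h\<bar>) \<longlongrightarrow> 0) (at (0::real))"
        by (auto intro!: tendsto_eq_intros)
    qed
    then show ?thesis using 2 by (simp add: DERIV_def flat_def)
  next
    case 3
    have "((\<lambda>t. exp (- 1 / t) / t ^ n) has_real_derivative flat (n + 2) t - real n * flat (n + 1) t) (at t)"
      using 3 by (auto intro!: derivative_eq_intros simp: flat_def field_simps power2_eq_square)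
        (cases n; simp add: field_simps)
    then show ?thesis
      by (rule DERIV_cong_ev[THEN iffD1, rotated -1])
         (use 3 in \<open>auto simp: flat_def intro!: eventually_nhds_in_open[of "{0<..}", THEN eventually_mono]\<close>)
  qed
qed

section \<open>Partial derivatives and the calculus of smooth functions\<close>

lemma pd_eq:
  assumes "(f has_derivative f') (at x)" shows "pd i f x = f' (axis i 1)"
  using frechet_derivative_at[OF assms] by (simp add: pd_def)

lemma differentiable_has_derivative:
  "\<phi> differentiable (at x) \<Longrightarrow> (\<phi> has_derivative frechet_derivative \<phi> (at x)) (at x)"
  by (simp add: frechet_derivative_works)

lemma C_k_Suc_imp: "C_k (Suc k) \<phi> \<Longrightarrow> C_k k \<phi>"
proof (induction k arbitrary: \<phi>)
  case 0
  then show ?case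
    by (auto simp: differentiable_imp_continuous_within intro!: continuous_at_imp_continuous_on)
next
  case (Suc k)
  then show ?case by (metis C_k.simps(2))
qed

lemma C_k_continuous: "C_k k \<phi> \<Longrightarrow> continuous_on UNIV \<phi>"
proof (induction k arbitrary: \<phi>)
  case (Suc k)
  then show ?case using C_k_Suc_imp by blast
qed simp

lemma pd_const [simp]: "pd i (\<lambda>x. c) = (\<lambda>x. 0)"
  by (rule ext, subst pd_eq[where f' = "\<lambda>_. 0"]) auto

lemma pd_inner [simp]: "pd i (\<lambda>x. a \<bullet> x) = (\<lambda>x. a $ i)"
  by (rule ext, subst pd_eq[where f' = "\<lambda>x. a \<bullet> x"])
     (auto intro!: derivative_eq_intros simp: inner_axis)

lemma pd_add:
  assumes "f differentiable at x" "g differentiable at x"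
  shows "pd i (\<lambda>x. f x + g x) x = pd i f x + pd i g x"
  using has_derivative_add[OF assms[THEN differentiable_has_derivative]]
  by (subst pd_eq) (auto simp: pd_def)

lemma pd_mult:
  assumes "f differentiable at x" "g differentiable at x"
  shows "pd i (\<lambda>x. f x * g x) x = f x * pd i g x + pd i f x * g x"
  using has_derivative_mult[OF assms[THEN differentiable_has_derivative]]
  by (subst pd_eq) (auto simp: pd_def)

lemma pd_chain:
  assumes "g differentiable at x" "(f has_real_derivative f') (at (g x))"
  shows "pd i (\<lambda>x. f (g x)) x = f' * pd i g x"
    and "(\<lambda>x. f (g x)) differentiable at x"
proof -
  have "((\<lambda>x. f (g x)) has_derivative (\<lambda>h. f' * frechet_derivative g (at x) h)) (at x)"
    using has_derivative_compose[OF differentiable_has_derivative[OF assms(1)]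
      assms(2)[unfolded has_field_derivative_def]] .
  then show "pd i (\<lambda>x. f (g x)) x = f' * pd i g x" "(\<lambda>x. f (g x)) differentiable at x"
    by (auto simp: pd_eq[where f' = "\<lambda>h. f' * frechet_derivative g (at x) h"] pd_def[of i g]
      differentiable_def)
qed

lemma C_k_const: "C_k k (\<lambda>x. c)"
  by (induction k arbitrary: c) auto

lemma C_k_inner: "C_k k (\<lambda>x. a \<bullet> x)"
  by (cases k) (auto intro!: continuous_intros C_k_const derivative_intros)

lemma C_k_add: "C_k k f \<Longrightarrow> C_k k g \<Longrightarrow> C_k k (\<lambda>x. f x + g x)"
proof (induction k arbitrary: f g)
  case (Suc k)
  then have "pd i (\<lambda>x. f x + g x) = (\<lambda>x. pd i f x + pd i g x)" for i
    by (auto simp: pd_add)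
  with Suc show ?case by auto
qed (auto intro: continuous_intros)

lemma C_k_mult: "C_k k f \<Longrightarrow> C_k k g \<Longrightarrow> C_k k (\<lambda>x. f x * g x)"
proof (induction k arbitrary: f g)
  case (Suc k)
  then have "pd i (\<lambda>x. f x * g x) = (\<lambda>x. f x * pd i g x + pd i f x * g x)" for i
    by (auto simp: pd_mult)
  moreover have "C_k k f" "C_k k g" using Suc.prems C_k_Suc_imp by auto
  ultimately show ?case using Suc by (auto intro!: C_k_add derivative_intros)
qed (auto intro: continuous_intros)

text \<open>The induction is on \<open>k\<close> with \<open>n\<close> arbitrary, since each
  derivative raises the index by one or two while \<open>k\<close> drops by one.\<close>

lemma C_k_flat: "C_k k g \<Longrightarrow> C_k k (\<lambda>x. flat n (g x))"
proof (induction k arbitrary: n)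
  case 0
  have "continuous_on UNIV (flat n)"
    using DERIV_isCont[OF DERIV_flat] by (auto intro: continuous_at_imp_continuous_on)
  with 0 show ?case by (auto intro: continuous_on_compose2)
next
  case (Suc k)
  then have d: "g differentiable at x" for x by auto
  have "pd i (\<lambda>x. flat n (g x)) =
      (\<lambda>x. (flat (n+2) (g x) + (- real n) * flat (n+1) (g x)) * pd i g x)" for i
    by (rule ext, subst pd_chain[OF d DERIV_flat]) (auto simp: algebra_simps)
  moreover have "C_k k g" using Suc.prems C_k_Suc_imp by auto
  then have "C_k k (\<lambda>x. (flat (n+2) (g x) + (- real n) * flat (n+1) (g x)) * pd i g x)" for i
    using Suc by (intro C_k_mult C_k_add C_k_const) auto
  ultimately show ?case
    unfolding C_k.simps using pd_chain(2)[OF d DERIV_flat] by metis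
qed

named_theorems smooth_intros

lemma smooth_const [smooth_intros]: "smooth (\<lambda>x. c)"
  and smooth_inner [smooth_intros]: "smooth (\<lambda>x. a \<bullet> x)"
  and smooth_add [smooth_intros]: "smooth f \<Longrightarrow> smooth g \<Longrightarrow> smooth (\<lambda>x. f x + g x)"
  and smooth_mult [smooth_intros]: "smooth f \<Longrightarrow> smooth g \<Longrightarrow> smooth (\<lambda>x. f x * g x)"
  and smooth_flat [smooth_intros]: "smooth f \<Longrightarrow> smooth (\<lambda>x. flat n (f x))"
  by (auto simp: smooth_def C_k_const C_k_inner C_k_add C_k_mult C_k_flat)

lemma smooth_uminus [smooth_intros]: "smooth f \<Longrightarrow> smooth (\<lambda>x. - f x)"
  using smooth_mult[OF smooth_const[of "-1"]] by auto

lemma smooth_diff [smooth_intros]: "smooth f \<Longrightarrow> smooth g \<Longrightarrow> smooth (\<lambda>x. f x - g x)"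
  using smooth_add[OF _ smooth_uminus, of f g] by auto

lemma smooth_prod [smooth_intros]: "(\<And>i. i \<in> I \<Longrightarrow> smooth (f i)) \<Longrightarrow> smooth (\<lambda>x. \<Prod>i\<in>I. f i x)"
  by (induction I rule: infinite_finite_induct) (auto intro: smooth_intros)

lemma smooth_nth [smooth_intros]: "smooth (\<lambda>x. x $ i)"
  using smooth_inner[of "axis i 1"] by (simp add: inner_axis inner_commute)

lemma smooth_pd [smooth_intros]: "smooth f \<Longrightarrow> smooth (pd i f)"
  unfolding smooth_def by (metis C_k.simps(2))

lemma smooth_differentiable: "smooth f \<Longrightarrow> f differentiable at x"
  unfolding smooth_def by (metis C_k.simps(2))

lemma smooth_continuous: "smooth f \<Longrightarrow> continuous_on S f"
  unfolding smooth_def using C_k_continuous continuous_on_subset by blast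

lemma flat_le_inverse_power: "0 < t \<Longrightarrow> flat n t \<le> 1 / t ^ n"
  by (simp add: flat_def divide_right_mono)

lemma flat_0_le_1: "flat 0 t \<le> 1"
  by (simp add: flat_def)

lemma tendsto_flat_at_top: "((\<lambda>t. flat (Suc n) t) \<longlongrightarrow> 0) at_top"
proof (rule Lim_null_comparison)
  show "\<forall>\<^sub>F t in at_top. norm (flat (Suc n) t) \<le> 1 / t"
    using eventually_ge_at_top[of 1]
  proof eventually_elim
    case (elim t)
    have "flat (Suc n) t \<le> 1 / t ^ Suc n" using elim by (intro flat_le_inverse_power) auto
    also have "\<dots> \<le> 1 / t ^ 1"
      using elim by (intro divide_left_mono power_increasing) auto
    finally show ?case by simp
  qed
  show "((\<lambda>t. 1 / t) \<longlongrightarrow> 0) (at_top :: real filter)"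
    by real_asymp
qed

lemma tendsto_flat_0_at_top: "((\<lambda>t. flat 0 t) \<longlongrightarrow> 1) at_top"
proof -
  have "((\<lambda>t::real. exp (- 1 / t)) \<longlongrightarrow> 1) at_top" by real_asymp
  then show ?thesis
    by (rule Lim_transform_eventually)
       (rule eventually_mono[OF eventually_gt_at_top[of 0]], simp add: flat_def)
qed

section \<open>Test functions and the restriction of weak derivatives to smaller sets\<close>

lemma test_functionI:
  assumes "smooth \<phi>" "compact S" "S \<subseteq> U" "\<And>x. \<phi> x \<noteq> 0 \<Longrightarrow> x \<in> S"
  shows "test_function U \<phi>"
proof -
  have "closure {x. \<phi> x \<noteq> 0} \<subseteq> S"
    using assms by (intro closure_minimal) (auto intro: compact_imp_closed)
  with assms show ?thesis
    unfolding test_function_def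
    using compact_Int_closed[OF assms(2) closed_closure, of "{x. \<phi> x \<noteq> 0}"]
    by (simp add: Int_absorb1)
qed

lemma pd_eq_0_off_support:
  assumes "x \<notin> closure {x. \<phi> x \<noteq> 0}" shows "pd i \<phi> x = 0"
proof -
  have "(\<phi> has_derivative (\<lambda>_. 0)) (at x)"
    by (rule has_derivative_transform_within_open[OF has_derivative_const[of 0], of "- closure {x. \<phi> x \<noteq> 0}"])
       (use assms closure_subset[of "{x. \<phi> x \<noteq> 0}"] in auto)
  then show ?thesis by (rule pd_eq)
qed

lemma test_function_pd:
  assumes "test_function U \<phi>" shows "test_function U (pd i \<phi>)"
  by (rule test_functionI[of _ "closure {x. \<phi> x \<noteq> 0}"])
     (use assms pd_eq_0_off_support in \<open>auto simp: test_function_def intro: smooth_intros\<close>)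

lemma test_function_mono: "test_function U \<phi> \<Longrightarrow> U \<subseteq> \<Omega> \<Longrightarrow> test_function \<Omega> \<phi>"
  by (auto simp: test_function_def)

lemma test_function_eq_0: "test_function U \<phi> \<Longrightarrow> x \<notin> U \<Longrightarrow> \<phi> x = 0"
  using closure_subset[of "{x. \<phi> x \<noteq> 0}"] by (auto simp: test_function_def)

lemma integral_lebesgue_on_subset:
  fixes f :: "plane \<Rightarrow> real"
  assumes "U \<in> sets lebesgue" "\<Omega> \<in> sets lebesgue" "U \<subseteq> \<Omega>" "\<And>x. x \<in> \<Omega> \<Longrightarrow> x \<notin> U \<Longrightarrow> f x = 0"
  shows "(LINT x|lebesgue_on U. f x) = (LINT x|lebesgue_on \<Omega>. f x)"
  using assms by (simp add: integral_restrict_space indicator_def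
      if_distrib if_distribR cong: if_cong)
    (intro Bochner_Integration.integral_cong, auto)

lemma integrable_mult_continuous:
  fixes f g :: "plane \<Rightarrow> real"
  assumes f: "integrable (lebesgue_on U) f" and g: "continuous_on (closure U) g"
    and U: "bounded U" "U \<in> sets lebesgue"
  shows "integrable (lebesgue_on U) (\<lambda>x. f x * g x)"
proof -
  have "compact (g ` closure U)"
    using g U by (intro compact_continuous_image) (auto simp: compact_closure)
  then obtain B where B: "\<And>x. x \<in> closure U \<Longrightarrow> \<bar>g x\<bar> \<le> B"
    using compact_imp_bounded[of "g ` closure U"] unfolding bounded_iff by auto
  have m: "g \<in> borel_measurable (lebesgue_on U)"
    using g U(2) by (intro continuous_imp_measurable_on_sets_lebesgue)
      (auto intro: continuous_on_subset[OF _ closure_subset])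
  show ?thesis
  proof (rule Bochner_Integration.integrable_bound[OF integrable_mult_right[OF f, of B]])
    show "AE x in lebesgue_on U. norm (f x * g x) \<le> norm (B * f x)"
    proof (rule AE_I2)
      fix x assume "x \<in> space (lebesgue_on U)"
      then have "\<bar>g x\<bar> \<le> \<bar>B\<bar>" using B[of x] closure_subset[of U] by fastforce
      then show "norm (f x * g x) \<le> norm (B * f x)"
        by (simp add: abs_mult mult.commute[of "\<bar>f x\<bar>"] mult_right_mono)
    qed
  qed (use f m in auto)
qed

lemma integrable_mult_smooth:
  fixes f :: "plane \<Rightarrow> real"
  assumes "integrable (lebesgue_on U) f" "smooth g" "bounded U" "U \<in> sets lebesgue"
  shows "integrable (lebesgue_on U) (\<lambda>x. f x * g x)"
  using assms by (intro integrable_mult_continuous smooth_continuous)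

lemma locally_integrable_subset:
  "locally_integrable \<Omega> v \<Longrightarrow> U \<subseteq> \<Omega> \<Longrightarrow> locally_integrable U v"
  unfolding locally_integrable_def by blast

lemma has_weak_div_subset:
  assumes "has_weak_div \<Omega> V d" "open U" "open \<Omega>" "U \<subseteq> \<Omega>"
  shows "has_weak_div U V d"
  unfolding has_weak_div_def
proof (intro conjI allI impI)
  fix \<phi> assume \<phi>: "test_function U \<phi>"
  then have "test_function \<Omega> \<phi>" using assms test_function_mono by blast
  then have *: "(LINT x|lebesgue_on \<Omega>. (\<Sum>i\<in>UNIV. V x $ i * pd i \<phi> x)) = - (LINT x|lebesgue_on \<Omega>. d x * \<phi> x)"
    using assms by (auto simp: has_weak_div_def)
  show "(LINT x|lebesgue_on U. (\<Sum>i\<in>UNIV. V x $ i * pd i \<phi> x)) = - (LINT x|lebesgue_on U. d x * \<phi> x)"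
    using assms test_function_eq_0[OF \<phi>] test_function_eq_0[OF test_function_pd[OF \<phi>]]
    by (subst (1 2) integral_lebesgue_on_subset[of U \<Omega>]) (auto simp: *)
qed (use assms locally_integrable_subset in \<open>auto simp: has_weak_div_def\<close>)

lemma has_weak_deriv_subset:
  assumes "has_weak_deriv \<Omega> \<alpha> v g" "open U" "open \<Omega>" "U \<subseteq> \<Omega>" "mi_order \<alpha> = 1"
  shows "has_weak_deriv U \<alpha> v g"
  unfolding has_weak_deriv_def
proof (intro conjI allI impI)
  fix \<phi> assume \<phi>: "test_function U \<phi>"
  then have "test_function \<Omega> \<phi>" using assms test_function_mono by blast
  then have *: "(LINT x|lebesgue_on \<Omega>. v x * mpd \<alpha> \<phi> x) =
        (- 1) ^ mi_order \<alpha> * (LINT x|lebesgue_on \<Omega>. g x * \<phi> x)"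
    using assms by (auto simp: has_weak_deriv_def)
  have "test_function U ((pd i ^^ n) \<psi>)" if "test_function U \<psi>" for i n \<psi>
    using that by (induction n) (auto intro: test_function_pd)
  then have "test_function U (mpd \<alpha> \<phi>)"
    using \<phi> by (simp add: mpd_def)
  then show "(LINT x|lebesgue_on U. v x * mpd \<alpha> \<phi> x) =
        (- 1) ^ mi_order \<alpha> * (LINT x|lebesgue_on U. g x * \<phi> x)"
    using assms test_function_eq_0[OF \<phi>] test_function_eq_0
    by (subst (1 2) integral_lebesgue_on_subset[of U \<Omega>]) (auto simp: *)
qed (use assms locally_integrable_subset in \<open>auto simp: has_weak_deriv_def\<close>)

text \<open>The gradient of the cutoff to a polygon is bounded by the inverse distance to the sides, so that no
  boundary term survives in the limit if the normal component of a field decays linearly there.\<close>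

definition cutoff :: "'i set \<Rightarrow> ('i \<Rightarrow> real) \<Rightarrow> ('i \<Rightarrow> plane) \<Rightarrow> nat \<Rightarrow> plane \<Rightarrow> real" where
  "cutoff I c a n x = (\<Prod>i\<in>I. flat 0 ((c i + a i \<bullet> x) * real (Suc n) - 1))"

text \<open>The coefficient of the normal \<open>a i\<close> in the gradient of the cutoff.
  \<open>flat 2\<close> appears as the derivative of \<open>flat 0\<close>.\<close>

definition cutoff_deriv :: "'i set \<Rightarrow> ('i \<Rightarrow> real) \<Rightarrow> ('i \<Rightarrow> plane) \<Rightarrow> 'i \<Rightarrow> nat \<Rightarrow> plane \<Rightarrow> real" where
  "cutoff_deriv I c a i n x = real (Suc n) * flat 2 ((c i + a i \<bullet> x) * real (Suc n) - 1) *
     cutoff (I - {i}) c a n x"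

lemma cutoff_bounds: "0 \<le> cutoff I c a n x" "cutoff I c a n x \<le> 1"
  by (auto simp: cutoff_def flat_0_le_1 intro!: prod_nonneg prod_le_1)

lemma smooth_cutoff [smooth_intros]: "smooth (cutoff I c a n)"
  unfolding cutoff_def by (intro smooth_intros)

lemma pd_cutoff:
  assumes "finite I"
  shows "pd j (cutoff I c a n) x = (\<Sum>i\<in>I. a i $ j * cutoff_deriv I c a i n x)"
proof -
  have "(cutoff I c a n has_derivative (\<lambda>h. \<Sum>i\<in>I. (a i \<bullet> h) * cutoff_deriv I c a i n x)) (at x)"
  proof -
    have "((\<lambda>x. flat 0 ((c i + a i \<bullet> x) * real (Suc n) - 1)) has_derivative
        (\<lambda>h. flat 2 ((c i + a i \<bullet> x) * real (Suc n) - 1) * ((a i \<bullet> h) * real (Suc n)))) (at x)" for i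
      by (rule has_derivative_compose[OF _ DERIV_flat[of 0, unfolded has_field_derivative_def], THEN has_derivative_eq_rhs])
         (auto intro!: derivative_eq_intros simp: fun_eq_iff numeral_2_eq_2)
    from has_derivative_prod[where I=I and f = "\<lambda>i x. flat 0 ((c i + a i \<bullet> x) * real (Suc n) - 1)", OF this]
    show ?thesis
      unfolding cutoff_def by (simp add: cutoff_deriv_def cutoff_def mult_ac)
  qed
  then show ?thesis
    by (auto simp: pd_eq inner_axis)
qed

text \<open>Each factor of the cutoff vanishes unless the affine function of its side is at least
  \<open>1 / Suc n\<close>, which confines the support to a compact subset of the open
  polygon.\<close>

lemma test_function_cutoff:
  assumes "smooth \<phi>" "finite I" "bounded {x. \<forall>i\<in>I. 0 < c i + a i \<bullet> x}"
  shows "test_function {x. \<forall>i\<in>I. 0 < c i + a i \<bullet> x} (\<lambda>x. \<phi> x * cutoff I c a n x)"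
proof (rule test_functionI)
  let ?S = "{x. \<forall>i\<in>I. 1 / real (Suc n) \<le> c i + a i \<bullet> x}"
  show "?S \<subseteq> {x. \<forall>i\<in>I. 0 < c i + a i \<bullet> x}"
    by (auto intro: less_le_trans[rotated])
  then have "bounded ?S" using assms bounded_subset by blast
  moreover have "closed ?S"
    unfolding Ball_def
    by (intro closed_Collect_all closed_Collect_imp open_Collect_const closed_Collect_le continuous_intros)
  ultimately show "compact ?S" by (simp add: compact_eq_bounded_closed)
  show "x \<in> ?S" if "\<phi> x * cutoff I c a n x \<noteq> 0" for x
  proof safe
    fix i assume "i \<in> I"
    then have "flat 0 ((c i + a i \<bullet> x) * real (Suc n) - 1) \<noteq> 0"
      using that assms by (auto simp: cutoff_def)
    then have "(c i + a i \<bullet> x) * real (Suc n) \<ge> 1"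
      by (auto simp: flat_def split: if_splits)
    then show "1 / real (Suc n) \<le> c i + a i \<bullet> x"
      by (simp add: field_simps)
  qed
qed (intro smooth_intros assms)

lemma cutoff_tendsto:
  assumes "\<And>i. i \<in> I \<Longrightarrow> 0 < c i + a i \<bullet> x"
  shows "(\<lambda>n. cutoff I c a n x) \<longlonglongrightarrow> 1"
proof -
  have "(\<lambda>n. flat 0 ((c i + a i \<bullet> x) * real (Suc n) - 1)) \<longlonglongrightarrow> 1" if "i \<in> I" for i
  proof (rule filterlim_compose[OF tendsto_flat_0_at_top])
    have "0 < c i + a i \<bullet> x" using assms that by auto
    then show "filterlim (\<lambda>n. (c i + a i \<bullet> x) * real (Suc n) - 1) at_top sequentially" by real_asymp
  qed
  from tendsto_prod[OF this] show ?thesis unfolding cutoff_def by simp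
qed

text \<open>With \<open>t\<close> for the argument of \<open>flat\<close>, the distance function
  times \<open>Suc n\<close> is \<open>t + 1\<close>, and
  \<open>(t + 1) * flat 2 t = flat 1 t + flat 2 t\<close>. The growth of the gradient with
  \<open>n\<close> is thus absorbed completely by one factor of the distance.\<close>

lemma cutoff_deriv_eq:
  "(c i + a i \<bullet> x) * cutoff_deriv I c a i n x =
    (flat 1 ((c i + a i \<bullet> x) * real (Suc n) - 1) + flat 2 ((c i + a i \<bullet> x) * real (Suc n) - 1))
      * cutoff (I - {i}) c a n x"
proof -
  have "(t + 1) * flat 2 t = flat 1 t + flat 2 t" for t
    by (simp add: flat_def field_simps power2_eq_square)
  from this[of "(c i + a i \<bullet> x) * real (Suc n) - 1"] show ?thesis
    by (simp add: cutoff_deriv_def mult_ac)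
qed

lemma cutoff_deriv_bound: "\<bar>(c i + a i \<bullet> x) * cutoff_deriv I c a i n x\<bar> \<le> 3"
proof -
  \<comment> \<open>The bounds of the two terms are \<open>1!\<close> and \<open>2!\<close>.\<close>
  have "flat 1 t + flat 2 t \<le> 3" for t
    using flat_le[of 1 t] flat_le[of 2 t] by (simp add: numeral_2_eq_2)
  from mult_mono[OF this cutoff_bounds(2) _ cutoff_bounds(1)] show ?thesis
    unfolding cutoff_deriv_eq by (simp add: abs_mult cutoff_bounds(1) del: of_nat_Suc)
qed

lemma cutoff_deriv_tendsto:
  assumes "\<And>i. i \<in> I \<Longrightarrow> 0 < c i + a i \<bullet> x" "i \<in> I"
  shows "(\<lambda>n. (c i + a i \<bullet> x) * cutoff_deriv I c a i n x) \<longlonglongrightarrow> 0"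
proof -
  have lim: "filterlim (\<lambda>n. (c i + a i \<bullet> x) * real (Suc n) - 1) at_top sequentially"
  proof -
    have "0 < c i + a i \<bullet> x" using assms by auto
    then show ?thesis by real_asymp
  qed
  have "(\<lambda>n. (flat 1 ((c i + a i \<bullet> x) * real (Suc n) - 1) + flat 2 ((c i + a i \<bullet> x) * real (Suc n) - 1))
      * cutoff (I - {i}) c a n x) \<longlonglongrightarrow> (0 + 0) * 1"
    using assms tendsto_flat_at_top[of 0] tendsto_flat_at_top[of 1]
    by (intro tendsto_mult tendsto_add cutoff_tendsto filterlim_compose[OF _ lim])
       (auto simp: numeral_2_eq_2)
  then show ?thesis by (simp add: cutoff_deriv_eq)
qed

lemma sum_2_plane: "(\<Sum>i\<in>(UNIV::2 set). x $ i * y $ i) = x \<bullet> (y::plane)"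
  by (simp add: inner_vec_def)

text \<open>Extends the weak divergence identity from test functions to arbitrary smooth
  \<open>\<phi> m\<close>. Multiplying by the cutoff produces terms with its gradient; by assumption
  \<open>r\<close> these carry the distance to the side as a factor, so they are bounded and tend to
  zero pointwise. The fields are summed over \<open>m\<close> because it may be only their
  combination whose normal component vanishes.\<close>

lemma weak_div_limit:
  fixes V :: "'m \<Rightarrow> plane \<Rightarrow> plane" and I :: "'i set"
  assumes U: "U = {x. \<forall>i\<in>I. 0 < c i + a i \<bullet> x}" and "bounded U" "finite I" "finite M"
    and wd: "\<And>m. m \<in> M \<Longrightarrow> has_weak_div U (V m) (d m)"
    and int_V: "\<And>m j. m \<in> M \<Longrightarrow> integrable (lebesgue_on U) (\<lambda>x. V m x $ j)"
    and int_d: "\<And>m. m \<in> M \<Longrightarrow> integrable (lebesgue_on U) (d m)"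
    and \<phi>: "\<And>m. m \<in> M \<Longrightarrow> smooth (\<phi> m)"
    and int_r: "\<And>i. i \<in> I \<Longrightarrow> integrable (lebesgue_on U) (r i)"
    and r: "\<And>i x. i \<in> I \<Longrightarrow> x \<in> U \<Longrightarrow>
              (\<Sum>m\<in>M. \<phi> m x * (V m x \<bullet> a i)) = (c i + a i \<bullet> x) * r i x"
  shows "(LINT x|lebesgue_on U. (\<Sum>m\<in>M. (\<Sum>j\<in>UNIV. V m x $ j * pd j (\<phi> m) x) + d m x * \<phi> m x)) = 0"
proof -
  define \<eta> where "\<eta> = cutoff I c a"
  define \<rho> where "\<rho> = cutoff_deriv I c a"
  define F where "F x = (\<Sum>m\<in>M. (\<Sum>j\<in>UNIV. V m x $ j * pd j (\<phi> m) x) + d m x * \<phi> m x)" for x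
  \<comment> \<open>The integrand of the weak identity for the test functions
    \<open>\<phi> m * \<eta> n\<close>, sorted by whether the derivative falls on
    \<open>\<phi> m\<close> or on the cutoff.\<close>
  define s where "s n x = F x * \<eta> n x + (\<Sum>i\<in>I. ((c i + a i \<bullet> x) * \<rho> i n x) * r i x)" for n x
  have "U = (\<Inter>i\<in>I. {x. 0 < c i + a i \<bullet> x})" unfolding U by auto
  then have "open U"
    using \<open>finite I\<close> by (auto intro!: open_INT open_Collect_less continuous_intros)
  then have Um: "U \<in> sets lebesgue" by auto
  note int = integrable_mult_smooth[OF _ _ \<open>bounded U\<close> Um]
  have int_F: "integrable (lebesgue_on U) F"
    unfolding F_def using int_V int_d \<phi>
    by (intro Bochner_Integration.integrable_sum Bochner_Integration.integrable_add int smooth_intros) auto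
  have int_s: "integrable (lebesgue_on U) (s n)" and int_s0: "(LINT x|lebesgue_on U. s n x) = 0" for n
  proof -
    let ?g = "\<lambda>m x. (\<Sum>j\<in>UNIV. V m x $ j * pd j (\<lambda>x. \<phi> m x * \<eta> n x) x) + d m x * (\<phi> m x * \<eta> n x)"
    have s_eq: "s n x = (\<Sum>m\<in>M. ?g m x)" if x: "x \<in> U" for x
    proof -
      have "(\<Sum>m\<in>M. ?g m x) = (\<Sum>m\<in>M. (\<Sum>j\<in>UNIV. V m x $ j * pd j (\<phi> m) x * \<eta> n x)
          + (\<Sum>j\<in>UNIV. V m x $ j * \<phi> m x * pd j (\<eta> n) x) + d m x * \<phi> m x * \<eta> n x)"
        using \<phi> by (intro sum.cong refl)
          (simp add: pd_mult smooth_differentiable \<eta>_def smooth_cutoff algebra_simps sum.distrib)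
      also have "\<dots> = F x * \<eta> n x + (\<Sum>m\<in>M. \<Sum>j\<in>UNIV. V m x $ j * \<phi> m x * pd j (\<eta> n) x)"
        by (simp add: F_def sum.distrib sum_distrib_right sum_distrib_left algebra_simps)
      also have "(\<Sum>m\<in>M. \<Sum>j\<in>UNIV. V m x $ j * \<phi> m x * pd j (\<eta> n) x) =
          (\<Sum>i\<in>I. \<rho> i n x * (\<Sum>m\<in>M. \<phi> m x * (V m x \<bullet> a i)))"
        unfolding \<eta>_def pd_cutoff[OF \<open>finite I\<close>] \<rho>_def[symmetric] sum_2_plane[symmetric]
          sum_distrib_left
        by (subst sum.swap[of _ M I], rule sum.cong[OF refl], subst sum.swap[of _ _ I]) (simp add: mult_ac)
      also have "\<dots> = (\<Sum>i\<in>I. ((c i + a i \<bullet> x) * \<rho> i n x) * r i x)"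
        using r[OF _ x] by (intro sum.cong) (auto simp: mult_ac)
      finally show ?thesis by (simp add: s_def)
    qed
    have tf: "test_function U (\<lambda>x. \<phi> m x * \<eta> n x)" if "m \<in> M" for m
      unfolding U \<eta>_def by (intro test_function_cutoff \<phi> that assms(2)[unfolded U] \<open>finite I\<close>)
    have ig: "integrable (lebesgue_on U) (\<lambda>x. \<Sum>j\<in>UNIV. V m x $ j * pd j (\<lambda>x. \<phi> m x * \<eta> n x) x)"
      "integrable (lebesgue_on U) (\<lambda>x. d m x * (\<phi> m x * \<eta> n x))" if "m \<in> M" for m
      using int_V int_d \<phi> that unfolding \<eta>_def
      by (intro Bochner_Integration.integrable_sum int smooth_intros; auto)+
    then have "integrable (lebesgue_on U) (\<lambda>x. \<Sum>m\<in>M. ?g m x)" by auto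
    then show "integrable (lebesgue_on U) (s n)"
      by (rule Bochner_Integration.integrable_cong[THEN iffD1, rotated -1]) (auto simp: s_eq)
    have "(LINT x|lebesgue_on U. s n x) = (LINT x|lebesgue_on U. (\<Sum>m\<in>M. ?g m x))"
      by (rule Bochner_Integration.integral_cong) (auto simp: s_eq)
    also have "\<dots> = (\<Sum>m\<in>M. LINT x|lebesgue_on U. ?g m x)"
      by (rule Bochner_Integration.integral_sum) (use ig in auto)
    also have "\<dots> = 0"
      using ig wd tf by (intro sum.neutral) (auto simp: has_weak_div_def)
    finally show "(LINT x|lebesgue_on U. s n x) = 0" .
  qed
  \<comment> \<open>Every \<open>s n\<close> has integral zero, and it is dominated by
    \<open>\<bar>F\<bar>\<close> plus three times the sum of the \<open>\<bar>r i\<bar>\<close>,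
    where 3 bounds distance times gradient.\<close>
  have "(\<lambda>n. LINT x|lebesgue_on U. s n x) \<longlonglongrightarrow> (LINT x|lebesgue_on U. F x)"
  proof (rule integral_dominated_convergence)
    show "integrable (lebesgue_on U) (\<lambda>x. \<bar>F x\<bar> + (\<Sum>i\<in>I. 3 * \<bar>r i x\<bar>))"
      using int_F int_r by auto
    show "AE x in lebesgue_on U. (\<lambda>n. s n x) \<longlonglongrightarrow> F x"
    proof (rule AE_I2)
      fix x assume "x \<in> space (lebesgue_on U)"
      then have x: "0 < c i + a i \<bullet> x" if "i \<in> I" for i
        using that by (auto simp: U)
      have "(\<lambda>n. F x * \<eta> n x + (\<Sum>i\<in>I. ((c i + a i \<bullet> x) * \<rho> i n x) * r i x))
          \<longlonglongrightarrow> F x * 1 + (\<Sum>i\<in>I. 0 * r i x)"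
        unfolding \<eta>_def \<rho>_def
        by (intro tendsto_add tendsto_mult tendsto_sum tendsto_const cutoff_tendsto cutoff_deriv_tendsto x)
      then show "(\<lambda>n. s n x) \<longlonglongrightarrow> F x" by (simp add: s_def)
    qed
    fix n
    show "AE x in lebesgue_on U. norm (s n x) \<le> \<bar>F x\<bar> + (\<Sum>i\<in>I. 3 * \<bar>r i x\<bar>)"
    proof (rule AE_I2)
      fix x
      have "\<bar>F x * \<eta> n x\<bar> \<le> \<bar>F x\<bar>"
        using cutoff_bounds[of I c a n x] by (simp add: \<eta>_def abs_mult mult_left_le)
      moreover have "\<bar>((c i + a i \<bullet> x) * \<rho> i n x) * r i x\<bar> \<le> 3 * \<bar>r i x\<bar>" for i
        unfolding \<rho>_def abs_mult[of _ "r i x"] by (intro mult_right_mono cutoff_deriv_bound) auto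
      then have "\<bar>\<Sum>i\<in>I. ((c i + a i \<bullet> x) * \<rho> i n x) * r i x\<bar> \<le> (\<Sum>i\<in>I. 3 * \<bar>r i x\<bar>)"
        by (intro order_trans[OF sum_abs] sum_mono)
      ultimately show "norm (s n x) \<le> \<bar>F x\<bar> + (\<Sum>i\<in>I. 3 * \<bar>r i x\<bar>)"
        unfolding s_def by simp
    qed
  qed (use int_F int_s in auto)
  then show ?thesis
    unfolding int_s0 F_def by (simp add: LIMSEQ_const_iff)
qed

definition unit_index :: "2 \<Rightarrow> nat \<times> nat" where
  "unit_index j = (if j = 1 then (1, 0) else (0, 1))"

lemma mi_order_unit_index [simp]: "mi_order (unit_index j) = 1"
  by (simp add: unit_index_def mi_order_def)

lemma mpd_unit_index [simp]: "mpd (unit_index j) = pd j"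
  using exhaust_2[of j] by (auto simp: unit_index_def mpd_def fun_eq_iff)

lemma has_weak_deriv_imp_weak_div:
  assumes "has_weak_deriv U (unit_index j) v g"
  shows "has_weak_div U (\<lambda>x. v x *\<^sub>R axis j 1) g"
proof -
  have "locally_integrable U (\<lambda>x. v x *\<^sub>R axis j 1 :: plane)"
    using assms by (auto simp: has_weak_deriv_def locally_integrable_def
        intro!: absolutely_integrable_scaleR_right absolutely_integrable_scaleR_left)
  moreover have "(\<Sum>i\<in>UNIV. (v x *\<^sub>R axis j 1 :: plane) $ i * pd i \<phi> x) = v x * pd j \<phi> x" for x \<phi>
    using exhaust_2[of j] by (auto simp: sum_2 axis_def)
  ultimately show ?thesis
    using assms by (auto simp: has_weak_deriv_def has_weak_div_def)
qed

text \<open>The divergence theorem for \<open>v\<close> times a field \<open>\<Phi>\<close> that is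
  tangential on the sides: there \<open>a i \<bullet> \<Phi>\<close> contains the distance to side
  \<open>i\<close> as a factor, so that no boundary term arises. It follows from the previous lemma
  with the fields \<open>v\<close> times a unit vector and the components of \<open>\<Phi>\<close>
  as factors.\<close>

lemma weak_gradient_limit:
  fixes I :: "'i set"
  assumes U: "U = {x. \<forall>i\<in>I. 0 < c i + a i \<bullet> x}" and "bounded U" "finite I"
    and wd: "\<And>j. has_weak_deriv U (unit_index j) v (g j)"
    and int: "integrable (lebesgue_on U) v" "\<And>j. integrable (lebesgue_on U) (g j)"
    and \<Phi>: "\<And>j. smooth (\<lambda>x. \<Phi> x $ j)" and r: "\<And>i. i \<in> I \<Longrightarrow> smooth (r i)"
    and \<Phi>_r: "\<And>i x. i \<in> I \<Longrightarrow> x \<in> U \<Longrightarrow> a i \<bullet> \<Phi> x = (c i + a i \<bullet> x) * r i x"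
  shows "(LINT x|lebesgue_on U. v x * (\<Sum>j\<in>UNIV. pd j (\<lambda>x. \<Phi> x $ j) x) + (\<Sum>j\<in>UNIV. g j x * \<Phi> x $ j)) = 0"
proof -
  have "U = (\<Inter>i\<in>I. {x. 0 < c i + a i \<bullet> x})" unfolding U by auto
  then have "open U"
    using \<open>finite I\<close> by (auto intro!: open_INT open_Collect_less continuous_intros)
  then have Um: "U \<in> sets lebesgue" by auto
  have ax: "(v x *\<^sub>R axis m 1 :: plane) $ j = (if j = m then v x else 0)" for m j x
    by (simp add: axis_def)
  have "(LINT x|lebesgue_on U. (\<Sum>m\<in>UNIV. (\<Sum>j\<in>UNIV. (v x *\<^sub>R axis m 1 :: plane) $ j * pd j (\<lambda>x. \<Phi> x $ m) x)
      + g m x * \<Phi> x $ m)) = 0"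
  proof (rule weak_div_limit[OF U assms(2,3), where r = "\<lambda>i x. v x * r i x"])
    show "integrable (lebesgue_on U) (\<lambda>x. (v x *\<^sub>R axis m 1 :: plane) $ j)" for m j
      using int by (cases "m = j") (auto simp: axis_def)
    show "integrable (lebesgue_on U) (\<lambda>x. v x * r i x)" if "i \<in> I" for i
      using r[OF that] int Um assms(2) by (intro integrable_mult_smooth)
    show "(\<Sum>m\<in>UNIV. \<Phi> x $ m * ((v x *\<^sub>R axis m 1) \<bullet> a i)) = (c i + a i \<bullet> x) * (v x * r i x)"
      if "i \<in> I" "x \<in> U" for i x
    proof -
      have "(\<Sum>m\<in>UNIV. \<Phi> x $ m * ((v x *\<^sub>R axis m 1) \<bullet> a i)) = v x * (a i \<bullet> \<Phi> x)"
        by (simp add: inner_vec_def axis_def sum_2 algebra_simps)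
      also have "\<dots> = (c i + a i \<bullet> x) * (v x * r i x)"
        using \<Phi>_r[OF that] by simp
      finally show ?thesis .
    qed
  qed (use wd int \<Phi> has_weak_deriv_imp_weak_div in auto)
  then show ?thesis
    unfolding ax by (simp add: sum_2 algebra_simps)
qed

section \<open>Weak derivatives\<close>

text \<open>Puts a box into the form that \<open>weak_div_limit\<close> expects. An index is a
  coordinate together with a flag, true for the lower and false for the upper bound.\<close>

lemma box_eq_halfplanes:
  "box l u = {x::plane. \<forall>i\<in>UNIV. 0 < (if snd i then - l $ fst i else u $ fst i)
      + (if snd i then axis (fst i) 1 else - axis (fst i) 1) \<bullet> x}" (is "_ = ?R")
proof -
  let ?P = "\<lambda>x j b. 0 < (if b then - l $ j else u $ j) + (if b then axis j 1 else - axis j 1) \<bullet> x"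
  have "(\<forall>i\<in>UNIV. ?P x (fst i) (snd i)) \<longleftrightarrow> (\<forall>j. ?P x j True \<and> ?P x j False)" for x
  proof (intro iffI allI ballI conjI)
    fix j assume *: "\<forall>i\<in>UNIV. ?P x (fst i) (snd i)"
    show "?P x j True" using bspec[OF * UNIV_I, of "(j, True)"] by (simp only: fst_conv snd_conv)
    show "?P x j False" using bspec[OF * UNIV_I, of "(j, False)"] by (simp only: fst_conv snd_conv)
  next
    fix i :: "2 \<times> bool" assume *: "\<forall>j. ?P x j True \<and> ?P x j False"
    show "?P x (fst i) (snd i)" using spec[OF *, of "fst i"] by (cases "snd i") (simp_all only:)
  qed
  moreover have "(?P x j True \<and> ?P x j False) \<longleftrightarrow> l $ j < x $ j \<and> x $ j < u $ j" for x j
    by (simp add: inner_axis')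
  ultimately show ?thesis
    unfolding set_eq_iff mem_Collect_eq mem_box_cart by blast
qed

text \<open>Open boxes generate the Borel sets and are stable under intersection, so a Dynkin
  argument passes from boxes to all Borel sets. Complements need the integral over the whole plane,
  which is the integral over one large box because \<open>f\<close> has bounded support.\<close>

lemma AE_eq_0_box_integrals:
  fixes f :: "plane \<Rightarrow> real"
  assumes f: "integrable lborel f" and supp: "\<And>x. x \<notin> cbox p q \<Longrightarrow> f x = 0"
    and box: "\<And>l u. (LINT x|lborel. indicator (box l u) x * f x) = 0"
  shows "AE x in lborel. f x = 0"
proof (rule sigma_finite_measure.density_zero[OF lborel.sigma_finite_measure_axioms f])
  obtain r where "cbox p q \<subseteq> ball 0 r"
    using bounded_cbox bounded_subset_ballD by blast
  then have ind: "indicator (box (\<chi> i. - r) (\<chi> i. r)) x * f x = f x" for x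
  proof (cases "x \<in> cbox p q")
    case True
    with \<open>cbox p q \<subseteq> ball 0 r\<close> have "norm x < r" by auto
    then have "- r < x $ i \<and> x $ i < r" for i
      using component_le_norm_cart[of x i] by linarith
    then have "x \<in> box (\<chi> i. - r) (\<chi> i. r)"
      by (simp add: mem_box_cart)
    then show ?thesis by simp
  qed (simp add: supp)
  have int0: "(LINT x|lborel. f x) = 0"
    using box[of "\<chi> i. - r" "\<chi> i. r"] unfolding ind .
  fix A :: "plane set" assume "A \<in> sets lborel"
  then have A: "A \<in> sigma_sets UNIV (range (\<lambda>(a, b). box a b))"
    by (simp add: borel_eq_box)
  have "Int_stable (range (\<lambda>(a, b). box a b :: plane set))"
    by (auto simp: Int_stable_def box_Int_box)
  moreover have "range (\<lambda>(a, b). box a b :: plane set) \<subseteq> Pow UNIV" by simp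
  ultimately show "set_lebesgue_integral lborel A f = 0"
    using A
  proof (induct rule: sigma_sets_induct_disjoint)
    case (basic A)
    then show ?case using box by (auto simp: set_lebesgue_integral_def)
  next
    case empty
    then show ?case by (simp add: set_lebesgue_integral_def)
  next
    case (compl A)
    then have A: "A \<in> sets lborel" by (simp add: borel_eq_box)
    have "set_lebesgue_integral lborel (UNIV - A) f = (LINT x|lborel. f x - indicator A x *\<^sub>R f x)"
      unfolding set_lebesgue_integral_def
      by (rule Bochner_Integration.integral_cong) (auto simp: indicator_def)
    also have "\<dots> = 0"
      using compl int0 f A integrable_mult_indicator[OF A f]
      by (subst Bochner_Integration.integral_diff) (auto simp: set_lebesgue_integral_def)
    finally show ?case .
  next
    case (union A)
    have A: "A i \<in> sets lborel" for i
    proof -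
      have "A i \<in> sigma_sets UNIV (range (\<lambda>(a, b). box a b))" using union by blast
      then show ?thesis by (simp add: borel_eq_box)
    qed
    have "set_lebesgue_integral lborel (\<Union>i. A i) f = (\<Sum>i. set_lebesgue_integral lborel (A i) f)"
    proof (rule lebesgue_integral_countable_add)
      show "set_integrable lborel (\<Union>i. A i) f"
        unfolding set_integrable_def using A f by (intro integrable_mult_indicator) auto
      show "A i \<inter> A j = {}" if "i \<noteq> j" for i j
        using union(1) that by (auto simp: disjoint_family_on_def)
    qed (fact A)
    then show ?case using union by simp
  qed
qed

text \<open>The fundamental lemma of the calculus of variations, obtained without mollifiers: the
  mean of \<open>h\<close> over every box in \<open>W\<close> vanishes, and boxes determine a
  function almost everywhere.\<close>

lemma weak_zero_imp_AE_zero: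
  assumes "open W" and loc: "locally_integrable W h"
    and zero: "\<And>\<phi>. test_function W \<phi> \<Longrightarrow> (LINT x|lebesgue_on W. h x * \<phi> x) = 0"
  shows "AE x in lebesgue_on W. h x = 0"
proof -
  have box0: "(LINT x|lebesgue_on (box l u). h x) = 0" if "cbox l u \<subseteq> W" for l u
  proof -
    have sub: "box l u \<subseteq> W" using that box_subset_cbox by blast
    have int: "integrable (lebesgue_on (box l u)) h"
    proof -
      have "h absolutely_integrable_on cbox l u"
        using loc that by (auto simp: locally_integrable_def)
      then have "integrable lebesgue (\<lambda>x. indicator (box l u) x *\<^sub>R (indicator (cbox l u) x *\<^sub>R h x))"
        unfolding set_integrable_def by (rule integrable_mult_indicator[rotated]) auto
      moreover have "(\<lambda>x. indicator (box l u) x *\<^sub>R (indicator (cbox l u) x *\<^sub>R h x)) = (\<lambda>x. indicator (box l u) x *\<^sub>R h x)"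
        using box_subset_cbox[of l u] by (auto simp: indicator_def fun_eq_iff)
      ultimately have "integrable lebesgue (\<lambda>x. indicator (box l u) x *\<^sub>R h x)" by simp
      then show ?thesis
        by (subst integrable_restrict_space) auto
    qed
    \<comment> \<open>On the box \<open>h\<close> is a weak divergence of the zero field. Its normal
      components vanish trivially, so the constant \<open>1\<close> is admissible in
      \<open>weak_div_limit\<close> and yields the integral of \<open>h\<close>.\<close>
    have wd: "has_weak_div (box l u) (\<lambda>_. 0) h"
      unfolding has_weak_div_def
    proof (intro conjI allI impI)
      fix \<phi> assume \<phi>: "test_function (box l u) \<phi>"
      have "(LINT x|lebesgue_on (box l u). h x * \<phi> x) = (LINT x|lebesgue_on W. h x * \<phi> x)"
        using sub \<open>open W\<close> test_function_eq_0[OF \<phi>] by (intro integral_lebesgue_on_subset) auto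
      then show "(LINT x|lebesgue_on (box l u). (\<Sum>i\<in>UNIV. (0::plane) $ i * pd i \<phi> x)) = - (LINT x|lebesgue_on (box l u). h x * \<phi> x)"
        using zero[OF test_function_mono[OF \<phi> sub]] by simp
    qed (use locally_integrable_subset[OF loc sub] in \<open>auto simp: locally_integrable_def\<close>)
    have "(LINT x|lebesgue_on (box l u). (\<Sum>m\<in>{()}. (\<Sum>j\<in>UNIV. (0::plane) $ j * pd j (\<lambda>_. 1) x) + h x * 1)) = 0"
      by (rule weak_div_limit[OF box_eq_halfplanes, where r = "\<lambda>_ _. 0"])
        (simp_all add: wd int smooth_const)
    then show ?thesis by simp
  qed
  obtain D where D: "countable D" "D \<subseteq> Pow W" "\<And>X. X \<in> D \<Longrightarrow> \<exists>a b. X = cbox a b" "\<Union>D = W"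
    using open_countable_Union_open_cbox[OF \<open>open W\<close>] by metis
  have "AE x in lebesgue. x \<in> X \<longrightarrow> h x = 0" if "X \<in> D" for X
  proof -
    obtain p q where X: "X = cbox p q" "cbox p q \<subseteq> W" using D(2) D(3)[OF \<open>X \<in> D\<close>] \<open>X \<in> D\<close> by auto
    then have "h absolutely_integrable_on cbox p q"
      using loc by (auto simp: locally_integrable_def)
    then have i: "integrable lebesgue (\<lambda>x. indicator (cbox p q) x * h x)"
      by (simp add: set_integrable_def)
    \<comment> \<open>A Borel representative, because the argument with boxes takes place in
      \<open>lborel\<close>.\<close>
    then obtain f where f: "f \<in> borel_measurable lborel" "AE x in lborel. indicator (cbox p q) x * h x = f x"
      using completion_ex_borel_measurable_real[OF borel_measurable_integrable[OF i]] by auto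
    define f' where "f' x = indicator (cbox p q) x * f x" for x
    have f': "f' \<in> borel_measurable lborel" "AE x in lborel. indicator (cbox p q) x * h x = f' x"
    proof -
      show "f' \<in> borel_measurable lborel" using f unfolding f'_def by auto
      show "AE x in lborel. indicator (cbox p q) x * h x = f' x"
        using f(2) by eventually_elim (auto simp: f'_def indicator_def split: if_splits)
    qed
    then have f'l: "AE x in lebesgue. indicator (cbox p q) x * h x = f' x"
      by (simp add: AE_completion)
    have "integrable lebesgue f'"
      using i f'l measurable_completion[OF f'(1)] borel_measurable_integrable[OF i]
        integrable_cong_AE[of "\<lambda>x. indicator (cbox p q) x * h x" lebesgue f'] by blast
    then have "integrable lborel f'" using f' by (simp add: integrable_completion)
    moreover have "(LINT x|lborel. indicator (box l u) x * f' x) = 0" for l u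
    proof -
      obtain l' u' where lu: "box l u \<inter> box p q = box l' u'"
        by (rule that[OF box_Int_box])
      \<comment> \<open>If the intersection is empty, its corners are arbitrary and
        \<open>cbox l' u'\<close> may well leave \<open>W\<close>; the integral is then zero for the
        trivial reason.\<close>
      have cb: "cbox l' u' \<subseteq> W \<or> box l' u' = {}"
      proof (cases "box l' u' = {}")
        case False
        have "closure (box l' u') \<subseteq> cbox p q"
          using lu box_subset_cbox by (intro closure_minimal) auto
        then show ?thesis using closure_box[OF False] X by auto
      qed auto
      have "(LINT x|lborel. indicator (box l u) x * f' x) = (LINT x|lebesgue. indicator (box l u) x * f' x)"
        using f'(1) by (intro integral_completion[symmetric] borel_measurable_times) auto
      also have "\<dots> = (LINT x|lebesgue. indicator (box l' u') x * h x)"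
      proof (rule integral_cong_AE)
        show "(\<lambda>x. indicator (box l u) x * f' x) \<in> borel_measurable lebesgue"
          using borel_measurable_integrable[OF integrable_mult_indicator[OF _ \<open>integrable lebesgue f'\<close>, of "box l u"]] by simp
        have "(\<lambda>x. indicator (box l' u') x * (indicator (cbox p q) x * h x)) \<in> borel_measurable lebesgue"
          using borel_measurable_integrable[OF integrable_mult_indicator[OF _ i, of "box l' u'"]] by simp
        moreover have "indicator (box l' u') x * (indicator (cbox p q) x * h x) = indicator (box l' u') x * h x" for x
          using lu box_subset_cbox[of p q] by (auto simp: indicator_def)
        ultimately show "(\<lambda>x. indicator (box l' u') x * h x) \<in> borel_measurable lebesgue" by simp
        have "negligible (cbox p q - box p q)"
          using negligible_frontier_interval by auto
        then have "AE x in lebesgue. x \<notin> cbox p q - box p q"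
          by (intro AE_not_in) (simp add: negligible_iff_null_sets)
        with f'l show "AE x in lebesgue. indicator (box l u) x * f' x = indicator (box l' u') x * h x"
        proof eventually_elim
          case (elim x)
          have "x \<in> box l' u' \<longleftrightarrow> x \<in> box l u \<and> x \<in> cbox p q"
            using elim(2) lu box_subset_cbox[of p q] by blast
          with elim(1) show ?case
            by (cases "x \<in> box l u"; cases "x \<in> cbox p q") simp_all
        qed
      qed
      also have "\<dots> = (LINT x|lebesgue_on (box l' u'). h x)"
        by (simp add: integral_restrict_space)
      also have "\<dots> = 0"
        using cb
      proof
        assume "cbox l' u' \<subseteq> W"
        then show ?thesis by (rule box0)
      qed (simp add: integral_restrict_space)
      finally show ?thesis .
    qed
    ultimately have "AE x in lborel. f' x = 0"
      by (intro AE_eq_0_box_integrals[of f' p q]) (simp_all add: f'_def indicator_def)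
    then have "AE x in lebesgue. f' x = 0" by (simp add: AE_completion)
    with f'l show ?thesis
      by eventually_elim (auto simp: X indicator_def)
  qed
  then have "AE x in lebesgue. \<forall>X\<in>D. x \<in> X \<longrightarrow> h x = 0"
    using D(1) by (intro AE_ball_countable[THEN iffD2]) auto
  then have "AE x in lebesgue. x \<in> W \<longrightarrow> h x = 0"
    by eventually_elim (use D(4) in auto)
  then show ?thesis
    using \<open>open W\<close> by (subst AE_restrict_space_iff) auto
qed

section \<open>Smooth functions and their weak derivatives\<close>

lemma DERIV_slice:
  assumes "\<phi> differentiable at (x + t *\<^sub>R axis i 1)"
  shows "((\<lambda>t. \<phi> (x + t *\<^sub>R axis i 1)) has_real_derivative pd i \<phi> (x + t *\<^sub>R axis i 1)) (at t)"
proof -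
  have "((\<lambda>t. x + t *\<^sub>R axis i 1) has_derivative (\<lambda>t. t *\<^sub>R axis i 1)) (at t)"
    by (auto intro!: derivative_eq_intros)
  from has_derivative_compose[OF this differentiable_has_derivative[OF assms]]
  have "((\<lambda>t. \<phi> (x + t *\<^sub>R axis i 1)) has_derivative
      (\<lambda>s. frechet_derivative \<phi> (at (x + t *\<^sub>R axis i 1)) (s *\<^sub>R axis i 1))) (at t)" .
  moreover have "frechet_derivative \<phi> (at (x + t *\<^sub>R axis i 1)) (s *\<^sub>R axis i 1) = s * pd i \<phi> (x + t *\<^sub>R axis i 1)" for s
    using linear_frechet_derivative[OF assms] by (simp add: pd_def linear_cmul)
  ultimately show ?thesis
    by (simp add: has_field_derivative_def mult_commute_abs)
qed

text \<open>Translation invariance gives every difference quotient of \<open>\<phi>\<close> the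
  integral zero. The quotients are bounded by the maximum of the derivative and live on a common
  ball, so dominated convergence applies.\<close>

lemma integral_pd_compact_support:
  assumes \<phi>: "smooth \<phi>" and K: "compact K" "\<And>x. \<phi> x \<noteq> 0 \<Longrightarrow> x \<in> K"
  shows "(LINT x|lebesgue. pd i \<phi> x) = 0"
proof -
  let ?e = "axis i 1 :: plane"
  obtain r where r: "K \<subseteq> cball 0 r" 
    using bounded_subset_ballD[OF compact_imp_bounded[OF K(1)], of 0] ball_subset_cball by (metis order_trans)
  \<comment> \<open>The radius is enlarged by 1 because the increments \<open>h n\<close> are at
    most 1.\<close>
  define L where "L = cball (0::plane) (r + 1)"
  have pd0: "pd i \<phi> x = 0" if "x \<notin> K" for x
    using pd_eq_0_off_support[of x \<phi> i] closure_minimal[of "{x. \<phi> x \<noteq> 0}" K] K that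
    by (auto simp: compact_imp_closed)
  have cont: "continuous_on UNIV (pd i \<phi>)" "continuous_on UNIV \<phi>"
    using \<phi> by (auto intro: smooth_continuous smooth_pd)
  have "compact (pd i \<phi> ` K)"
    by (rule compact_continuous_image[OF continuous_on_subset[OF cont(1)] K(1)]) simp
  then obtain B0 where B0: "\<And>x. x \<in> K \<Longrightarrow> \<bar>pd i \<phi> x\<bar> \<le> B0"
    using compact_imp_bounded[of "pd i \<phi> ` K"] unfolding bounded_iff by auto
  define B where "B = max B0 0"
  have B: "\<bar>pd i \<phi> x\<bar> \<le> B" for x
    using B0[of x] pd0[of x] by (cases "x \<in> K") (auto simp: B_def)
  have lip: "\<bar>\<phi> (x + t *\<^sub>R ?e) - \<phi> x\<bar> \<le> B * t" if "t \<ge> 0" for x t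
  proof (cases "t = 0")
    case False
    with that have "0 < t" by simp
    have d: "((\<lambda>t. \<phi> (x + t *\<^sub>R ?e)) has_real_derivative pd i \<phi> (x + t *\<^sub>R ?e)) (at t)" for t
      by (rule DERIV_slice) (rule smooth_differentiable[OF \<phi>])
    obtain z where "\<phi> (x + t *\<^sub>R ?e) - \<phi> (x + 0 *\<^sub>R ?e) = (t - 0) * pd i \<phi> (x + z *\<^sub>R ?e)"
      using MVT2[OF \<open>0 < t\<close>, of "\<lambda>t. \<phi> (x + t *\<^sub>R ?e)", OF d] by blast
    then show ?thesis
      using B[of "x + z *\<^sub>R ?e"] \<open>0 < t\<close> by (simp add: abs_mult mult.commute)
  qed simp
  have cL: "compact L" by (simp add: L_def)
  have KL: "K \<subseteq> L" using r by (auto simp: L_def)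
  have int_phi: "integrable lborel \<phi>"
  proof -
    have "integrable lborel (\<lambda>x. indicator L x *\<^sub>R \<phi> x)"
      using cL cont(2) by (intro borel_integrable_compact) (auto intro: continuous_on_subset)
    moreover have "(\<lambda>x. indicator L x *\<^sub>R \<phi> x) = \<phi>"
      using K(2) KL by (auto simp: indicator_def fun_eq_iff)
    ultimately show ?thesis by simp
  qed
  define h where "h n = 1 / real (Suc n)" for n
  have h: "0 < h n" "h n \<le> 1" for n by (auto simp: h_def)
  define q where "q n x = (\<phi> (x + h n *\<^sub>R ?e) - \<phi> x) / h n" for n x
  have shift: "integrable lborel (\<lambda>x. \<phi> (x + c))" "(LINT x|lborel. \<phi> (x + c)) = (LINT x|lborel. \<phi> x)" for c
  proof -
    have d: "lborel = distr lborel borel ((+) c)" by (rule lborel_distr_plus[symmetric])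
    have m: "\<phi> \<in> borel_measurable borel" using cont(2) by (rule borel_measurable_continuous_onI)
    show "integrable lborel (\<lambda>x. \<phi> (x + c))"
      using int_phi m by (subst (asm) d) (simp add: integrable_distr_eq add.commute)
    show "(LINT x|lborel. \<phi> (x + c)) = (LINT x|lborel. \<phi> x)"
      using m by (subst (2) d) (simp add: integral_distr add.commute)
  qed
  have q0: "(LINT x|lborel. q n x) = 0" for n
    unfolding q_def using shift int_phi by simp
  have "(\<lambda>n. LINT x|lborel. q n x) \<longlonglongrightarrow> (LINT x|lborel. pd i \<phi> x)"
  proof (rule integral_dominated_convergence)
    show "pd i \<phi> \<in> borel_measurable lborel" using cont(1) by (simp add: borel_measurable_continuous_onI)
    show "q n \<in> borel_measurable lborel" for n
      unfolding q_def using shift(1)[of "h n *\<^sub>R ?e"] int_phi by (intro borel_measurable_divide borel_measurable_diff) auto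
    show "integrable lborel (\<lambda>x. indicator L x *\<^sub>R B)"
      using cL by (intro borel_integrable_compact) auto
    show "AE x in lborel. (\<lambda>n. q n x) \<longlonglongrightarrow> pd i \<phi> x"
    proof (rule AE_I2)
      fix x
      have "((\<lambda>t. \<phi> (x + t *\<^sub>R ?e)) has_real_derivative pd i \<phi> (x + 0 *\<^sub>R ?e)) (at 0)"
        by (rule DERIV_slice) (rule smooth_differentiable[OF \<phi>])
      then have "((\<lambda>t. (\<phi> (x + t *\<^sub>R ?e) - \<phi> x) / t) \<longlongrightarrow> pd i \<phi> x) (at 0)"
        by (simp add: DERIV_def)
      moreover have "filterlim h (at 0) sequentially"
        unfolding h_def by real_asymp
      ultimately show "(\<lambda>n. q n x) \<longlonglongrightarrow> pd i \<phi> x"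
        unfolding q_def by (rule filterlim_compose)
    qed
    show "AE x in lborel. norm (q n x) \<le> indicator L x *\<^sub>R B" for n
    proof (rule AE_I2)
      fix x
      show "norm (q n x) \<le> indicator L x *\<^sub>R B"
      proof (cases "x \<in> L")
        case True
        then show ?thesis using lip[of "h n" x] h[of n] by (simp add: q_def field_simps)
      next
        case False
        have "norm x \<le> norm (x + h n *\<^sub>R ?e) + norm (h n *\<^sub>R ?e)"
          using norm_triangle_ineq4[of "x + h n *\<^sub>R ?e" "h n *\<^sub>R ?e"] by simp
        then have "norm (x + h n *\<^sub>R ?e) > r"
          using False h[of n] by (auto simp: L_def)
        then have "\<phi> (x + h n *\<^sub>R ?e) = 0" "\<phi> x = 0"
          using r K(2) False KL by fastforce+
        then show ?thesis by (simp add: q_def False)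
      qed
    qed
  qed
  then have "(LINT x|lborel. pd i \<phi> x) = 0"
    unfolding q0 by (simp add: LIMSEQ_const_iff)
  then show ?thesis
    using cont(1) by (subst integral_completion) (auto intro: borel_measurable_continuous_onI)
qed

text \<open>The product of \<open>\<phi>\<close> with a test function has compact support, so its
  partial derivative integrates to zero; the product rule splits this into the two sides of the weak
  identity.\<close>

lemma smooth_imp_has_weak_deriv:
  assumes "smooth \<phi>" "open U"
  shows "has_weak_deriv U (unit_index j) \<phi> (pd j \<phi>)"
  unfolding has_weak_deriv_def
proof (intro conjI allI impI)
  have loc: "locally_integrable U \<psi>" if "smooth \<psi>" for \<psi>
    unfolding locally_integrable_def
  proof (intro allI impI)
    fix S :: "plane set" assume "compact S \<and> S \<subseteq> U"
    then have "integrable lborel (\<lambda>x. indicator S x *\<^sub>R \<psi> x)"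
      using smooth_continuous[OF that] by (intro borel_integrable_compact) auto
    then show "\<psi> absolutely_integrable_on S"
      unfolding set_integrable_def by (subst integrable_completion) auto
  qed
  show "locally_integrable U \<phi>" "locally_integrable U (pd j \<phi>)"
    using assms loc smooth_pd by auto
  fix \<psi> assume \<psi>: "test_function U \<psi>"
  then have s: "smooth \<psi>" by (simp add: test_function_def)
  let ?K = "closure {x. \<psi> x \<noteq> 0}"
  have K: "compact ?K" using \<psi> by (simp add: test_function_def)
  have int: "integrable lebesgue (\<lambda>x. f x * \<zeta> x)" if "smooth f" "smooth \<zeta>" "\<And>x. x \<notin> ?K \<Longrightarrow> \<zeta> x = 0" for f \<zeta>
  proof -
    have "integrable lborel (\<lambda>x. indicator ?K x *\<^sub>R (f x * \<zeta> x))"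
      using K that by (intro borel_integrable_compact smooth_continuous smooth_intros)
    moreover have "(\<lambda>x. indicator ?K x *\<^sub>R (f x * \<zeta> x)) = (\<lambda>x. f x * \<zeta> x)"
      using that(3) by (auto simp: indicator_def fun_eq_iff)
    ultimately have i: "integrable lborel (\<lambda>x. f x * \<zeta> x)" by simp
    then show ?thesis
      by (rule integrable_completion[THEN iffD2, OF borel_measurable_integrable[OF i]])
  qed
  have \<psi>0: "\<psi> x = 0" if "x \<notin> ?K" for x using that closure_subset[of "{x. \<psi> x \<noteq> 0}"] by auto
  have "(LINT x|lebesgue. pd j (\<lambda>x. \<phi> x * \<psi> x) x) = 0"
  proof (rule integral_pd_compact_support[OF _ K])
    show "smooth (\<lambda>x. \<phi> x * \<psi> x)" using assms(1) s by (rule smooth_mult)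
    show "x \<in> ?K" if "\<phi> x * \<psi> x \<noteq> 0" for x using that \<psi>0[of x] by (cases "x \<in> ?K") simp_all
  qed
  then have "0 = (LINT x|lebesgue. pd j (\<lambda>x. \<phi> x * \<psi> x) x)" by simp
  also have "\<dots> = (LINT x|lebesgue. \<phi> x * pd j \<psi> x + pd j \<phi> x * \<psi> x)"
    by (intro Bochner_Integration.integral_cong refl pd_mult smooth_differentiable assms s)
  also have "\<dots> = (LINT x|lebesgue. \<phi> x * pd j \<psi> x) + (LINT x|lebesgue. pd j \<phi> x * \<psi> x)"
    by (intro Bochner_Integration.integral_add int smooth_pd assms(1) s)
      (fact pd_eq_0_off_support, fact \<psi>0)
  finally have *: "(LINT x|lebesgue. \<phi> x * pd j \<psi> x) = - (LINT x|lebesgue. pd j \<phi> x * \<psi> x)" by simp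
  have r: "(LINT x|lebesgue_on U. f x) = (LINT x|lebesgue. f x)" if "\<And>x. x \<notin> U \<Longrightarrow> f x = 0" for f :: "plane \<Rightarrow> real"
    using integral_lebesgue_on_subset[of U UNIV f] that \<open>open U\<close> by (simp add: lebesgue_on_UNIV_eq)
  have "(LINT x|lebesgue_on U. \<phi> x * pd j \<psi> x) = (LINT x|lebesgue. \<phi> x * pd j \<psi> x)"
    "(LINT x|lebesgue_on U. pd j \<phi> x * \<psi> x) = (LINT x|lebesgue. pd j \<phi> x * \<psi> x)"
    using test_function_eq_0[OF \<psi>] test_function_eq_0[OF test_function_pd[OF \<psi>]] by (intro r; simp)+
  with * show "(LINT x|lebesgue_on U. \<phi> x * mpd (unit_index j) \<psi> x) =
        (- 1) ^ mi_order (unit_index j) * (LINT x|lebesgue_on U. pd j \<phi> x * \<psi> x)"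
    by simp
qed

section \<open>The mean of a function over an edge\<close>

lemma Basis_plane: "(Basis :: plane set) = {axis 1 1, axis 2 1}"
  by (auto simp: Basis_vec_def UNIV_2)

text \<open>Both measures agree on boxes. Vectors indexed by \<open>2\<close> thereby become pairs,
  to which Fubini's theorem applies.\<close>

lemma lborel_plane: "(lborel :: plane measure) = distr (lborel \<Otimes>\<^sub>M lborel) borel (\<lambda>(s, t). vector [s, t])"
proof (rule lborel_eqI)
  have cont: "continuous_on UNIV (\<lambda>(s, t). vector [s, t] :: plane)"
  proof -
    have "(\<lambda>(s, t). vector [s, t] :: plane) = (\<lambda>p. \<chi> i. if i = 1 then fst p else snd p)"
      by (auto simp: fun_eq_iff vec_eq_iff forall_2)
    moreover have "continuous_on UNIV (\<lambda>p::real \<times> real. if i = 1 then fst p else snd p)" for i :: 2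
      by (cases "i = 1") (auto intro!: continuous_intros)
    ultimately show ?thesis by (simp add: continuous_on_vec_lambda)
  qed
  then have m: "(\<lambda>(s, t). vector [s, t] :: plane) \<in> borel_measurable (lborel \<Otimes>\<^sub>M lborel)"
    using borel_measurable_continuous_onI[OF cont] by (simp add: lborel_prod)
  fix l u :: plane assume le: "\<And>b. b \<in> Basis \<Longrightarrow> l \<bullet> b \<le> u \<bullet> b"
  have "emeasure (distr (lborel \<Otimes>\<^sub>M lborel) borel (\<lambda>(s, t). vector [s, t])) (box l u)
      = emeasure (lborel \<Otimes>\<^sub>M lborel) ({l $ 1<..<u $ 1} \<times> {l $ 2<..<u $ 2})"
    using m by (subst emeasure_distr) (auto intro!: arg_cong2[where f = emeasure] simp: mem_box_cart forall_2 space_pair_measure)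
  also have "\<dots> = ennreal (u $ 1 - l $ 1) * ennreal (u $ 2 - l $ 2)"
    using le[of "axis 1 1"] le[of "axis 2 1"]
    by (subst lborel.emeasure_pair_measure_Times) (auto simp: Basis_plane inner_axis)
  also have "\<dots> = (\<Prod>b\<in>Basis. (u - l) \<bullet> b)"
    using le[of "axis 1 1"] le[of "axis 2 1"]
    by (simp add: Basis_plane inner_axis axis_eq_axis ennreal_mult inner_diff_left)
  finally show "emeasure (distr (lborel \<Otimes>\<^sub>M lborel) borel (\<lambda>(s, t). vector [s, t])) (box l u)
      = (\<Prod>b\<in>Basis. (u - l) \<bullet> b)" .
qed simp

definition ref_triangle :: "plane set" where
  "ref_triangle = {y. 0 \<le> y $ 1 \<and> 0 \<le> y $ 2 \<and> y $ 1 + y $ 2 \<le> 1}"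

lemma compact_ref_triangle: "compact ref_triangle"
proof -
  have "ref_triangle \<subseteq> cbox 0 1"
    by (auto simp: ref_triangle_def mem_box_cart forall_2)
  moreover have "closed ref_triangle"
    unfolding ref_triangle_def
    by (intro closed_Collect_conj closed_Collect_le continuous_intros)
  ultimately show ?thesis
    using bounded_subset[OF bounded_cbox] by (auto simp: compact_eq_bounded_closed)
qed

lemma integral_lebesgue_on_continuous:
  fixes f :: "'a::euclidean_space \<Rightarrow> real"
  assumes "compact S" "continuous_on S f"
  shows "integrable (lebesgue_on S) f"
    and "(LINT x|lebesgue_on S. f x) = (LINT x|lborel. indicator S x * f x)"
    and "integrable lborel (\<lambda>x. indicator S x * f x)"
proof -
  have i: "integrable lborel (\<lambda>x. indicator S x * f x)"
    using borel_integrable_compact[OF assms] by simp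
  have S: "S \<in> sets borel" using assms(1) by (auto intro: borel_compact)
  then have S': "S \<in> sets lebesgue" by auto
  show "integrable lborel (\<lambda>x. indicator S x * f x)" by (fact i)
  have "integrable lebesgue (\<lambda>x. indicator S x * f x)"
    by (rule integrable_completion[THEN iffD2, OF borel_measurable_integrable[OF i] i])
  then show "integrable (lebesgue_on S) f"
    using S' by (simp add: integrable_restrict_space)
  have "(LINT x|lebesgue_on S. f x) = (LINT x|lebesgue. indicator S x * f x)"
    using S' by (simp add: integral_restrict_space)
  also have "\<dots> = (LINT x|lborel. indicator S x * f x)"
    by (rule integral_completion[OF borel_measurable_integrable[OF i]])
  finally show "(LINT x|lebesgue_on S. f x) = (LINT x|lborel. indicator S x * f x)" .
qed

lemma measurable_vector_2: "(\<lambda>(s, t). vector [s, t] :: plane) \<in> borel_measurable (lborel \<Otimes>\<^sub>M lborel)"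
proof -
  have "(\<lambda>(s, t). vector [s, t] :: plane) = (\<lambda>p. \<chi> i. if i = 1 then fst p else snd p)"
    by (auto simp: fun_eq_iff vec_eq_iff forall_2)
  moreover have "continuous_on UNIV (\<lambda>p::real \<times> real. if i = 1 then fst p else snd p)" for i :: 2
    by (cases "i = 1") (auto intro!: continuous_intros)
  ultimately have "continuous_on UNIV (\<lambda>(s, t). vector [s, t] :: plane)"
    by (simp add: continuous_on_vec_lambda)
  then show ?thesis
    using borel_measurable_continuous_onI by (simp add: lborel_prod)
qed

lemma integral_plane_iterated:
  fixes f :: "plane \<Rightarrow> real"
  assumes "integrable lborel f"
  shows "(LINT x|lborel. f x) = (LINT t|lborel. LINT s|lborel. f (vector [s, t]))"
    and "(LINT x|lborel. f x) = (LINT s|lborel. LINT t|lborel. f (vector [s, t]))"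
proof -
  have m: "f \<in> borel_measurable borel" using borel_measurable_integrable[OF assms] by simp
  have i: "integrable (lborel \<Otimes>\<^sub>M lborel) (\<lambda>(s, t). f (vector [s, t]))"
    using assms m unfolding lborel_plane
    by (subst (asm) integrable_distr_eq[OF measurable_vector_2]) (auto simp: case_prod_unfold)
  have e: "(LINT x|lborel. f x) = (LINT p|(lborel \<Otimes>\<^sub>M lborel). (\<lambda>(s, t). f (vector [s, t])) p)"
    unfolding lborel_plane using m
    by (subst integral_distr[OF measurable_vector_2]) (auto simp: case_prod_unfold)
  show "(LINT x|lborel. f x) = (LINT t|lborel. LINT s|lborel. f (vector [s, t]))"
    unfolding e using lborel_pair.integral_snd[OF i] by simp
  show "(LINT x|lborel. f x) = (LINT s|lborel. LINT t|lborel. f (vector [s, t]))"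
    unfolding e using lborel_pair.integral_fst[OF i] by simp
qed

lemma vector_2_eq: "(vector [s, t] :: plane) = vector [0, t] + s *\<^sub>R axis 1 1"
  "(vector [s, t] :: plane) = vector [s, 0] + t *\<^sub>R axis 2 1"
  by (auto simp: vec_eq_iff forall_2 axis_def)

text \<open>The slice of the reference triangle at height \<open>t\<close> is the interval from
  \<open>0\<close> to \<open>1 - t\<close>, and on each slice this is the fundamental theorem of
  calculus.\<close>

lemma integral_ref_triangle_pd:
  assumes d: "\<And>x. \<psi> differentiable at x"
  shows "continuous_on UNIV (pd 1 \<psi>) \<Longrightarrow> (LINT x|lebesgue_on ref_triangle. pd 1 \<psi> x) =
      (LINT t|lebesgue_on {0..1}. \<psi> (vector [1 - t, t]) - \<psi> (vector [0, t]))"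
    and "continuous_on UNIV (pd 2 \<psi>) \<Longrightarrow> (LINT x|lebesgue_on ref_triangle. pd 2 \<psi> x) =
      (LINT t|lebesgue_on {0..1}. \<psi> (vector [t, 1 - t]) - \<psi> (vector [t, 0]))"
proof -
  have cont: "continuous_on UNIV \<psi>"
    using d by (auto simp: differentiable_imp_continuous_within intro!: continuous_at_imp_continuous_on)
  have cv: "continuous_on UNIV (\<lambda>t::real. vector [f t, g t] :: plane)"
    if "continuous_on UNIV f" "continuous_on UNIV g" for f g
  proof -
    have "(\<lambda>t::real. vector [f t, g t] :: plane) = (\<lambda>t. \<chi> i. if i = 1 then f t else g t)"
      by (auto simp: fun_eq_iff vec_eq_iff forall_2)
    moreover have "continuous_on UNIV (\<lambda>t. \<chi> i::2. if i = 1 then f t else g t)"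
    proof (rule continuous_on_vec_lambda)
      show "continuous_on UNIV (\<lambda>t. if i = 1 then f t else g t)" for i :: 2
        using that by (cases "i = 1") auto
    qed
    ultimately show ?thesis by (simp only:)
  qed
  have FTC: "(LINT s|lborel. indicator {a..b} s * pd i \<psi> (x + s *\<^sub>R axis i 1))
      = \<psi> (x + b *\<^sub>R axis i 1) - \<psi> (x + a *\<^sub>R axis i 1)"
    if "a \<le> b" "continuous_on UNIV (pd i \<psi>)" for a b :: real and x :: plane and i
  proof -
    have "((\<lambda>t. \<psi> (x + t *\<^sub>R axis i 1)) has_real_derivative pd i \<psi> (x + s *\<^sub>R axis i 1)) (at s within {a..b})" for s
      by (rule DERIV_slice[OF d, THEN DERIV_subset]) simp
    moreover have "continuous_on {a..b} (\<lambda>s. pd i \<psi> (x + s *\<^sub>R axis i 1))"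
      by (rule continuous_on_compose2[OF that(2)]) (auto intro!: continuous_intros)
    ultimately show ?thesis
      using integral_FTC_atLeastAtMost[OF \<open>a \<le> b\<close>, of "\<lambda>t. \<psi> (x + t *\<^sub>R axis i 1)" "\<lambda>s. pd i \<psi> (x + s *\<^sub>R axis i 1)"]
      by (simp add: has_real_derivative_iff_has_vector_derivative)
  qed
  note I = integral_lebesgue_on_continuous
  {
    assume c: "continuous_on UNIV (pd 1 \<psi>)"
    then have c': "continuous_on ref_triangle (pd 1 \<psi>)" by (rule continuous_on_subset) simp
    have inner: "(LINT s|lborel. indicator ref_triangle (vector [s, t]) * pd 1 \<psi> (vector [s, t]))
        = indicator {0..1} t * (\<psi> (vector [1 - t, t]) - \<psi> (vector [0, t]))" for t
    proof (cases "t \<in> {0..1}")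
      case True
      then have "indicator ref_triangle (vector [s, t]) = (indicator {0..1 - t} s :: real)" for s
        by (auto simp: ref_triangle_def indicator_def)
      then show ?thesis
        using FTC[OF _ c, of 0 "1 - t" "vector [0, t]"] True by (simp add: vector_2_eq(1)[symmetric])
    next
      case False
      then have "indicator ref_triangle (vector [s, t]) = (0 :: real)" for s
        by (auto simp: ref_triangle_def indicator_def)
      with False show ?thesis by simp
    qed
    show "(LINT x|lebesgue_on ref_triangle. pd 1 \<psi> x) =
        (LINT t|lebesgue_on {0..1}. \<psi> (vector [1 - t, t]) - \<psi> (vector [0, t]))"
      unfolding I(2)[OF compact_ref_triangle c'] integral_plane_iterated(1)[OF I(3)[OF compact_ref_triangle c']] inner
      by (intro I(2)[symmetric] continuous_intros continuous_on_subset[OF continuous_on_compose2[OF cont cv]]) 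
         (auto intro!: continuous_intros)
  }
  {
    assume c: "continuous_on UNIV (pd 2 \<psi>)"
    then have c': "continuous_on ref_triangle (pd 2 \<psi>)" by (rule continuous_on_subset) simp
    have inner: "(LINT s|lborel. indicator ref_triangle (vector [t, s]) * pd 2 \<psi> (vector [t, s]))
        = indicator {0..1} t * (\<psi> (vector [t, 1 - t]) - \<psi> (vector [t, 0]))" for t
    proof (cases "t \<in> {0..1}")
      case True
      then have "indicator ref_triangle (vector [t, s]) = (indicator {0..1 - t} s :: real)" for s
        by (auto simp: ref_triangle_def indicator_def)
      then show ?thesis
        using FTC[OF _ c, of 0 "1 - t" "vector [t, 0]"] True by (simp add: vector_2_eq(2)[symmetric])
    next
      case False
      then have "indicator ref_triangle (vector [t, s]) = (0 :: real)" for s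
        by (auto simp: ref_triangle_def indicator_def)
      with False show ?thesis by simp
    qed
    show "(LINT x|lebesgue_on ref_triangle. pd 2 \<psi> x) =
        (LINT t|lebesgue_on {0..1}. \<psi> (vector [t, 1 - t]) - \<psi> (vector [t, 0]))"
      unfolding I(2)[OF compact_ref_triangle c'] integral_plane_iterated(2)[OF I(3)[OF compact_ref_triangle c']] inner
      by (intro I(2)[symmetric] continuous_intros continuous_on_subset[OF continuous_on_compose2[OF cont cv]]) 
         (auto intro!: continuous_intros)
  }
qed

lemma integral_reflect_unit_interval:
  fixes f :: "real \<Rightarrow> real"
  shows "(LINT t|lebesgue_on {0..1}. f (1 - t)) = (LINT t|lebesgue_on {0..1}. f t)"
proof -
  have "(LINT t|lebesgue_on {0..1}. f t) = (LINT t|lebesgue. indicator {0..1} t * f t)"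
    by (simp add: integral_restrict_space)
  also have "\<dots> = (LINT t|lebesgue. indicator {0..1} (1 - t) * f (1 - t))"
    using lebesgue_integral_real_affine[of "-1" "\<lambda>t. indicator {0..1} t * f t" 1] by simp
  also have "\<dots> = (LINT t|lebesgue_on {0..1}. f (1 - t))"
    by (auto simp: integral_restrict_space indicator_def intro!: Bochner_Integration.integral_cong)
  finally show ?thesis by simp
qed

lemma integral_affine_image_ref_triangle:
  fixes f :: "plane \<Rightarrow> real" and p u v :: plane
  defines "G \<equiv> \<lambda>y::plane. p + y $ 1 *\<^sub>R u + y $ 2 *\<^sub>R v"
  assumes D: "u $ 1 * v $ 2 - u $ 2 * v $ 1 \<noteq> 0" and f: "continuous_on UNIV f"
  shows "(LINT x|lebesgue_on (G ` ref_triangle). f x) =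
    \<bar>u $ 1 * v $ 2 - u $ 2 * v $ 1\<bar> * (LINT y|lebesgue_on ref_triangle. f (G y))"
proof -
  define G' where "G' = (\<lambda>h::plane. h $ 1 *\<^sub>R u + h $ 2 *\<^sub>R v)"
  define d where "d = u $ 1 * v $ 2 - u $ 2 * v $ 1"
  define S where "S = ref_triangle"
  have S: "compact S" "S \<in> sets lebesgue"
    using compact_ref_triangle by (auto simp: S_def lmeasurable_compact fmeasurableD)
  have contG: "continuous_on A G" for A unfolding G_def by (intro continuous_intros)
  have det: "det (matrix G') = d"
    by (simp add: G'_def matrix_def det_2 d_def axis_def)
  have der: "(G has_derivative G') (at x within S)" for x
    unfolding G_def G'_def
    by (auto intro!: derivative_eq_intros bounded_linear.has_derivative[OF bounded_linear_vec_nth])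
  have inj: "inj_on G S"
  proof (rule inj_onI)
    fix x y assume "G x = G y"
    then have e: "(x - y) $ 1 *\<^sub>R u + (x - y) $ 2 *\<^sub>R v = 0"
      by (simp add: G_def algebra_simps)
    have "(x - y) $ 1 * u $ 1 + (x - y) $ 2 * v $ 1 = 0" "(x - y) $ 1 * u $ 2 + (x - y) $ 2 * v $ 2 = 0"
      using e by (simp_all add: vec_eq_iff forall_2)
    then have "d * (x - y) $ 1 = 0" "d * (x - y) $ 2 = 0"
      unfolding d_def by algebra+
    then show "x = y" using D by (simp add: d_def vec_eq_iff forall_2)
  qed
  have fG: "continuous_on S (\<lambda>y. f (G y))"
    using continuous_on_compose2[OF f contG] by auto
  have GS: "compact (G ` S)" using S contG by (intro compact_continuous_image)
  have fGS: "continuous_on (G ` S) f" using f continuous_on_subset by blast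
  \<comment> \<open>The change of variables formula is applied to functions with values in
    \<open>real^1\<close>; component 1 recovers the scalar integrals.\<close>
  let ?v = "\<lambda>r::real. vec r :: real^1"
  have L: "(\<lambda>x. \<bar>det (matrix G')\<bar> *\<^sub>R ?v (f (G x))) absolutely_integrable_on S"
  proof -
    have "continuous_on S (\<lambda>x. \<bar>d\<bar> *\<^sub>R ?v (f (G x)))"
      unfolding vec_def using fG by (intro continuous_intros continuous_on_vec_lambda)
    then have i: "integrable lborel (\<lambda>x. indicator S x *\<^sub>R (\<bar>d\<bar> *\<^sub>R ?v (f (G x))))"
      by (rule borel_integrable_compact[OF S(1)])
    show ?thesis
      unfolding set_integrable_def det
      by (rule integrable_completion[THEN iffD2, OF borel_measurable_integrable[OF i] i])
  qed
  have "integral S (\<lambda>x. \<bar>det (matrix G')\<bar> *\<^sub>R ?v (f (G x))) = integral (G ` S) (\<lambda>x. ?v (f x))"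
    using has_absolute_integral_change_of_variables[OF S(2) der inj, of "\<lambda>x. ?v (f x)"] L by blast
  moreover have "integral S (\<lambda>x. \<bar>det (matrix G')\<bar> *\<^sub>R ?v (f (G x))) $ 1 = integral S (\<lambda>x. \<bar>d\<bar> * f (G x))"
    using L absolutely_integrable_on_def by (subst integral_component_eq_cart[symmetric]) (auto simp: det)
  moreover have "integral (G ` S) (\<lambda>x. ?v (f x)) $ 1 = integral (G ` S) f"
  proof -
    have "(\<lambda>x. ?v (f x)) absolutely_integrable_on G ` S"
      using has_absolute_integral_change_of_variables[OF S(2) der inj, of "\<lambda>x. ?v (f x)"] L by blast
    then show ?thesis
      using absolutely_integrable_on_def by (subst integral_component_eq_cart[symmetric]) auto
  qed
  ultimately have "integral (G ` S) f = integral S (\<lambda>x. \<bar>d\<bar> * f (G x))" by simp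
  moreover have "integral (G ` S) f = (LINT x|lebesgue_on (G ` S). f x)"
    using integral_lebesgue_on_continuous(1)[OF GS fGS] GS
    by (intro lebesgue_integral_eq_integral[symmetric]) (auto simp: lmeasurable_compact fmeasurableD)
  moreover have "integral S (\<lambda>x. \<bar>d\<bar> * f (G x)) = \<bar>d\<bar> * (LINT x|lebesgue_on S. f (G x))"
    using integral_lebesgue_on_continuous(1)[OF S(1) fG] S
    by (simp add: lebesgue_integral_eq_integral)
  ultimately show ?thesis by (simp add: d_def S_def)
qed

text \<open>The divergence theorem for the field \<open>\<phi> x\<close> times \<open>x - p\<close>,
  whose divergence is the integrand on the left. The vector \<open>x - p\<close> is tangential on
  the two sides through \<open>p\<close> and has a constant normal component on the third, so only
  the mean over the side opposite to \<open>p\<close> survives. The computation is done on the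
  reference triangle.\<close>

lemma triangle_edge_identity:
  fixes p u v :: plane
  defines "G \<equiv> \<lambda>y::plane. p + y $ 1 *\<^sub>R u + y $ 2 *\<^sub>R v"
  assumes D: "u $ 1 * v $ 2 - u $ 2 * v $ 1 \<noteq> 0" and \<phi>: "smooth \<phi>"
  shows "(LINT x|lebesgue_on (G ` ref_triangle). 2 * \<phi> x + (\<Sum>j\<in>UNIV. (x - p) $ j * pd j \<phi> x)) =
    \<bar>u $ 1 * v $ 2 - u $ 2 * v $ 1\<bar> * (LINT t|lebesgue_on {0..1}. \<phi> (p + (1 - t) *\<^sub>R u + t *\<^sub>R v))"
proof -
  have Gder: "(G has_derivative (\<lambda>h. h $ 1 *\<^sub>R u + h $ 2 *\<^sub>R v)) (at y)" for y
    unfolding G_def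
    by (auto intro!: derivative_eq_intros bounded_linear.has_derivative[OF bounded_linear_vec_nth])
  have contG: "continuous_on A G" for A unfolding G_def by (intro continuous_intros)
  define \<psi> where "\<psi> y = \<phi> (G y)" for y
  have \<psi>_der: "(\<psi> has_derivative (\<lambda>h. frechet_derivative \<phi> (at (G y)) (h $ 1 *\<^sub>R u + h $ 2 *\<^sub>R v))) (at y)" for y
    unfolding \<psi>_def
    by (rule has_derivative_compose[OF Gder differentiable_has_derivative[OF smooth_differentiable[OF \<phi>]]])
  have fr: "frechet_derivative \<phi> (at x) w = (\<Sum>j\<in>UNIV. w $ j * pd j \<phi> x)" for x w
  proof -
    have lin: "linear (frechet_derivative \<phi> (at x))"
      by (rule linear_frechet_derivative[OF smooth_differentiable[OF \<phi>]])
    have "w = w $ 1 *\<^sub>R axis 1 1 + w $ 2 *\<^sub>R axis 2 1"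
      by (simp add: vec_eq_iff forall_2 axis_def)
    then have "frechet_derivative \<phi> (at x) w = frechet_derivative \<phi> (at x) (w $ 1 *\<^sub>R axis 1 1 + w $ 2 *\<^sub>R axis 2 1)"
      by (rule arg_cong)
    then show ?thesis by (simp add: linear_add[OF lin] linear_cmul[OF lin] pd_def sum_2)
  qed
  have pd\<psi>: "pd 1 \<psi> y = (\<Sum>j\<in>UNIV. u $ j * pd j \<phi> (G y))" "pd 2 \<psi> y = (\<Sum>j\<in>UNIV. v $ j * pd j \<phi> (G y))" for y
    by (simp_all add: pd_eq[OF \<psi>_der] fr axis_def)
  have \<psi>_diff: "\<psi> differentiable at y" for y
    using \<psi>_der by (auto simp: differentiable_def)
  have cont\<psi>: "continuous_on A \<psi>" for A
    unfolding \<psi>_def using continuous_on_compose2[OF smooth_continuous[OF \<phi>, of UNIV] contG] by auto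
  have contpd: "continuous_on A (\<lambda>y. pd j \<phi> (G y))" for A j
    using continuous_on_compose2[OF smooth_continuous[OF smooth_pd[OF \<phi>], of UNIV] contG] by auto
  have cont1: "continuous_on A (pd 1 \<psi>)" "continuous_on A (pd 2 \<psi>)" for A
    using pd\<psi> by (auto intro!: continuous_intros contpd simp: fun_eq_iff[symmetric] cong: continuous_on_cong)
  have nth_diff: "(\<lambda>y::plane. y $ k) differentiable at y" for k y
    by (rule smooth_differentiable) (rule smooth_nth)
  have pdnth: "pd i (\<lambda>y. y $ k) y = (if i = k then 1 else 0)" for i k y
    by (subst pd_eq[where f' = "\<lambda>h. h $ k"]) (auto intro: bounded_linear_imp_has_derivative bounded_linear_vec_nth simp: axis_def)
  have pdm: "pd k (\<lambda>y. y $ k * \<psi> y) = (\<lambda>y. y $ k * pd k \<psi> y + \<psi> y)" for k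
    by (rule ext) (simp add: pd_mult[OF nth_diff \<psi>_diff] pdnth)
  have md: "(\<lambda>y. y $ k * \<psi> y) differentiable at y" for k y
    using nth_diff \<psi>_diff by (rule differentiable_mult)
  have pieces: "(LINT y|lebesgue_on ref_triangle. y $ 1 * pd 1 \<psi> y + \<psi> y) = (LINT t|lebesgue_on {0..1}. (1 - t) * \<psi> (vector [1 - t, t]))"
    "(LINT y|lebesgue_on ref_triangle. y $ 2 * pd 2 \<psi> y + \<psi> y) = (LINT t|lebesgue_on {0..1}. (1 - t) * \<psi> (vector [t, 1 - t]))"
  proof -
    have c: "continuous_on UNIV (\<lambda>y. y $ 1 * pd 1 \<psi> y + \<psi> y)" "continuous_on UNIV (\<lambda>y. y $ 2 * pd 2 \<psi> y + \<psi> y)"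
      by (intro continuous_intros cont1 cont\<psi>)+
    show "(LINT y|lebesgue_on ref_triangle. y $ 1 * pd 1 \<psi> y + \<psi> y) = (LINT t|lebesgue_on {0..1}. (1 - t) * \<psi> (vector [1 - t, t]))"
      using integral_ref_triangle_pd(1)[of "\<lambda>y. y $ 1 * \<psi> y", OF md, unfolded pdm, OF c(1)] by simp
    show "(LINT y|lebesgue_on ref_triangle. y $ 2 * pd 2 \<psi> y + \<psi> y) = (LINT t|lebesgue_on {0..1}. (1 - t) * \<psi> (vector [t, 1 - t]))"
      using integral_ref_triangle_pd(2)[of "\<lambda>y. y $ 2 * \<psi> y", OF md, unfolded pdm, OF c(2)] by simp
  qed
  have vc: "continuous_on A (\<lambda>t. \<psi> (vector [1 - t, t]))" for A :: "real set"
  proof -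
    have "(\<lambda>t. vector [1 - t, t] :: plane) = (\<lambda>t. vector [1, 0] + t *\<^sub>R vector [-1, 1])"
      by (auto simp: fun_eq_iff vec_eq_iff forall_2)
    then have "continuous_on A (\<lambda>t. vector [1 - t, t] :: plane)" by (simp only:) (intro continuous_intros)
    then show ?thesis using continuous_on_compose2[OF cont\<psi>[of UNIV]] by auto
  qed
  note I = integral_lebesgue_on_continuous(1)
  have "(LINT y|lebesgue_on ref_triangle. 2 * \<phi> (G y) + (\<Sum>j\<in>UNIV. (G y - p) $ j * pd j \<phi> (G y)))
      = (LINT y|lebesgue_on ref_triangle. (y $ 1 * pd 1 \<psi> y + \<psi> y) + (y $ 2 * pd 2 \<psi> y + \<psi> y))"
    unfolding pd\<psi> by (intro Bochner_Integration.integral_cong refl) (simp add: \<psi>_def sum_2 G_def algebra_simps)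
  also have "\<dots> = (LINT t|lebesgue_on {0..1}. (1 - t) * \<psi> (vector [1 - t, t])) + (LINT t|lebesgue_on {0..1}. (1 - t) * \<psi> (vector [t, 1 - t]))"
    by (subst Bochner_Integration.integral_add)
       (auto simp: pieces intro!: I compact_ref_triangle continuous_intros cont1 cont\<psi>)
  \<comment> \<open>Both coordinates contribute an integral over the hypotenuse, but with opposite
    parametrisations. After the reflection the weights are \<open>1 - t\<close> and
    \<open>t\<close>, which add up to 1.\<close>
  also have "(LINT t|lebesgue_on {0..1}. (1 - t) * \<psi> (vector [t, 1 - t])) = (LINT t|lebesgue_on {0..1}. t * \<psi> (vector [1 - t, t]))"
    using integral_reflect_unit_interval[of "\<lambda>t. t * \<psi> (vector [1 - t, t])"] by simp
  also have "(LINT t|lebesgue_on {0..1}. (1 - t) * \<psi> (vector [1 - t, t])) + (LINT t|lebesgue_on {0..1}. t * \<psi> (vector [1 - t, t]))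
      = (LINT t|lebesgue_on {0..1}. (1 - t) * \<psi> (vector [1 - t, t]) + t * \<psi> (vector [1 - t, t]))"
    by (rule Bochner_Integration.integral_add[symmetric]) (auto intro!: I continuous_intros vc)
  also have "\<dots> = (LINT t|lebesgue_on {0..1}. \<phi> (p + (1 - t) *\<^sub>R u + t *\<^sub>R v))"
    by (intro Bochner_Integration.integral_cong refl) (simp add: \<psi>_def G_def algebra_simps)
  finally have "(LINT y|lebesgue_on ref_triangle. 2 * \<phi> (G y) + (\<Sum>j\<in>UNIV. (G y - p) $ j * pd j \<phi> (G y))) =
    (LINT t|lebesgue_on {0..1}. \<phi> (p + (1 - t) *\<^sub>R u + t *\<^sub>R v))" .
  moreover have "continuous_on UNIV (\<lambda>x. 2 * \<phi> x + (\<Sum>j\<in>UNIV. (x - p) $ j * pd j \<phi> x))"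
    by (intro continuous_intros smooth_continuous smooth_pd \<phi>)
  ultimately show ?thesis
    using integral_affine_image_ref_triangle[OF D, of "\<lambda>x. 2 * \<phi> x + (\<Sum>j\<in>UNIV. (x - p) $ j * pd j \<phi> x)" p]
    unfolding G_def by simp
qed

section \<open>Triangles in barycentric coordinates\<close>

lemma triangle_indices:
  fixes i k l m :: 3
  assumes "i \<noteq> k" "i \<noteq> l" "k \<noteq> l"
  shows "m = i \<or> m = k \<or> m = l"
  using assms exhaust_3[of i] exhaust_3[of k] exhaust_3[of l] exhaust_3[of m] by auto

lemma sum_triangle_indices:
  fixes i k l :: 3 and f :: "3 \<Rightarrow> 'a::comm_monoid_add"
  assumes "i \<noteq> k" "i \<noteq> l" "k \<noteq> l"
  shows "(\<Sum>m\<in>UNIV. f m) = f i + (f k + f l)"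
proof -
  have "UNIV = {i, k, l}" using triangle_indices[OF assms] by auto
  then show ?thesis unfolding \<open>UNIV = {i, k, l}\<close> using assms by simp
qed

lemma other_indices:
  fixes i :: 3
  obtains k l where "i \<noteq> k" "i \<noteq> l" "k \<noteq> l"
proof -
  consider "i = 1" | "i = 2" | "i = 3" using exhaust_3[of i] by blast
  then show ?thesis
    by cases (auto intro: that[of 2 3] that[of 1 3] that[of 1 2])
qed

text \<open>The triangles of a uniform mesh are the translates of one triangle and of its reflection.
  \<open>\<omega> i\<close> is the vertex \<open>i\<close> relative to the centroid and \<open>A i\<close> the gradient of the barycentric
  coordinate \<open>i\<close>; the orientation \<open>s\<close> is \<open>1\<close> or \<open>- 1\<close>.\<close>

locale triangle_frame =
  fixes \<omega> A :: "3 \<Rightarrow> plane"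
  assumes sum_\<omega>: "(\<Sum>i\<in>UNIV. \<omega> i) = 0"
    and sum_A: "(\<Sum>i\<in>UNIV. A i) = 0"
    and dual: "\<And>i j. A i \<bullet> \<omega> j = (if i = j then 1 else 0) - 1/3"
begin

definition lam :: "plane \<Rightarrow> real \<Rightarrow> 3 \<Rightarrow> plane \<Rightarrow> real" where
  "lam c s i x = 1/3 + s * (A i \<bullet> (x - c))"

definition vert :: "plane \<Rightarrow> real \<Rightarrow> 3 \<Rightarrow> plane" where
  "vert c s i = c + s *\<^sub>R \<omega> i"

definition otri :: "plane \<Rightarrow> real \<Rightarrow> plane set" where
  "otri c s = {x. \<forall>i. 0 < lam c s i x}"

definition ctri :: "plane \<Rightarrow> real \<Rightarrow> plane set" where
  "ctri c s = {x. \<forall>i. 0 \<le> lam c s i x}"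

text \<open>By duality the matrix of the products of \<open>A 2\<close>, \<open>A 3\<close> with the
  two edge vectors from vertex 1 is the identity, and determinants multiply.\<close>

lemma det_frame: "((\<omega> 2 - \<omega> 1) $ 1 * (\<omega> 3 - \<omega> 1) $ 2 - (\<omega> 2 - \<omega> 1) $ 2 * (\<omega> 3 - \<omega> 1) $ 1) *
    (A 2 $ 1 * A 3 $ 2 - A 2 $ 2 * A 3 $ 1) = 1"
proof -
  have "A i \<bullet> (\<omega> j - \<omega> 1) = (if i = j then 1 else 0)" if "i \<noteq> 1" "j \<noteq> 1" for i j
    using that by (simp add: inner_diff_right dual)
  from this[of 2 2] this[of 2 3] this[of 3 2] this[of 3 3] show ?thesis
    unfolding inner_vec_def sum_2 inner_real_def by simp algebra
qed

text \<open>The difference of the two sides is orthogonal to all \<open>A j\<close>, and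
  \<open>A 2\<close> and \<open>A 3\<close> are linearly independent by the determinant
  identity.\<close>

lemma expand_\<omega>: "(\<Sum>i\<in>UNIV. (A i \<bullet> z) *\<^sub>R \<omega> i) = z"
proof -
  define w where "w = (\<Sum>i\<in>UNIV. (A i \<bullet> z) *\<^sub>R \<omega> i) - z"
  have "A j \<bullet> w = 0" for j
  proof -
    have "A j \<bullet> w = (\<Sum>i\<in>UNIV. (A i \<bullet> z) * ((if j = i then 1 else 0) - 1/3)) - A j \<bullet> z"
      by (simp add: w_def inner_diff_right inner_sum_right dual)
    also have "\<dots> = - ((\<Sum>i\<in>UNIV. A i) \<bullet> z) / 3"
      using exhaust_3[of j] by (auto simp: sum_3 inner_add_left field_simps)
    finally show ?thesis by (simp add: sum_A)
  qed
  from this[of 2] this[of 3] have "w $ 1 = 0" "w $ 2 = 0"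
    using det_frame unfolding inner_vec_def sum_2 inner_real_def by algebra+
  then show ?thesis by (simp add: w_def vec_eq_iff forall_2)
qed

text \<open>The adjoint of the preceding expansion of the identity.\<close>

lemma expand_A: "(\<Sum>i\<in>UNIV. (\<omega> i \<bullet> z) *\<^sub>R A i) = z"
proof -
  have "(\<Sum>i\<in>UNIV. (\<omega> i \<bullet> z) *\<^sub>R A i) \<bullet> y = z \<bullet> y" for y
  proof -
    have "(\<Sum>i\<in>UNIV. (\<omega> i \<bullet> z) *\<^sub>R A i) \<bullet> y = (\<Sum>i\<in>UNIV. (A i \<bullet> y) *\<^sub>R \<omega> i) \<bullet> z"
      by (simp add: inner_sum_left mult.commute)
    then show ?thesis unfolding expand_\<omega> by (simp add: inner_commute)
  qed
  then show ?thesis using vector_eq_rdot by blast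
qed

lemma sum_lam: "(\<Sum>i\<in>UNIV. lam c s i x) = 1"
proof -
  have "(\<Sum>i\<in>UNIV. lam c s i x) = 1 + s * ((\<Sum>i\<in>UNIV. A i) \<bullet> (x - c))"
    by (simp add: lam_def sum_3 inner_add_left algebra_simps)
  then show ?thesis by (simp add: sum_A)
qed

lemma lam_vert: "s * s = 1 \<Longrightarrow> lam c s i (vert c s j) = (if i = j then 1 else 0)"
  by (simp add: lam_def vert_def dual flip: mult.assoc)

lemma lam_eq:
  assumes s: "s * s = 1" shows "x = (\<Sum>i\<in>UNIV. lam c s i x *\<^sub>R vert c s i)"
proof -
  have l: "lam c s i x * s = s / 3 + A i \<bullet> (x - c)" for i
  proof -
    have "lam c s i x * s = s / 3 + (s * s) * (A i \<bullet> (x - c))" unfolding lam_def by (simp add: algebra_simps)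
    then show ?thesis by (simp add: s)
  qed
  have "(\<Sum>i\<in>UNIV. lam c s i x *\<^sub>R vert c s i) = (\<Sum>i\<in>UNIV. lam c s i x) *\<^sub>R c
      + (\<Sum>i\<in>UNIV. (lam c s i x * s) *\<^sub>R \<omega> i)"
    by (simp add: vert_def scaleR_add_right sum.distrib scaleR_sum_left)
  also have "(\<Sum>i\<in>UNIV. (lam c s i x * s) *\<^sub>R \<omega> i) = (s / 3) *\<^sub>R (\<Sum>i\<in>UNIV. \<omega> i) + (\<Sum>i\<in>UNIV. (A i \<bullet> (x - c)) *\<^sub>R \<omega> i)"
    unfolding l by (simp add: scaleR_add_left sum.distrib scaleR_sum_right)
  finally show ?thesis by (simp add: sum_lam sum_\<omega> expand_\<omega>)
qed

lemma lam_affine: "lam c s i x = (1/3 - s * (A i \<bullet> c)) + (s *\<^sub>R A i) \<bullet> x"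
  by (simp add: lam_def inner_diff_right algebra_simps)

lemma lam_diff: "lam c s i (x + y) = lam c s i x + s * (A i \<bullet> y)"
  by (simp add: lam_def inner_diff_right inner_add_right algebra_simps)

lemma continuous_lam [continuous_intros]: "continuous_on S (lam c s i)"
  unfolding lam_def by (intro continuous_intros)

lemma smooth_lam [smooth_intros]: "smooth (lam c s i)"
  unfolding lam_affine by (intro smooth_intros)

lemma pd_lam: "pd j (lam c s i) x = s * A i $ j"
  unfolding lam_def by (subst pd_eq[where f' = "\<lambda>h. s * (A i \<bullet> h)"])
    (auto intro!: derivative_eq_intros simp: inner_axis)

lemma closed_ctri: "closed (ctri c s)" and convex_ctri: "convex (ctri c s)"
proof -
  have e: "ctri c s = (\<Inter>i. {x. 0 \<le> lam c s i x})" by (auto simp: ctri_def)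
  show "closed (ctri c s)"
    unfolding e by (intro closed_INT ballI closed_Collect_le continuous_intros)
  have "{x. 0 \<le> lam c s i x} = {x. (s *\<^sub>R A i) \<bullet> x \<ge> - (1/3 - s * (A i \<bullet> c))}" for i
    by (auto simp: lam_affine)
  then have "convex {x. 0 \<le> lam c s i x}" for i by (simp only: convex_halfspace_ge)
  then show "convex (ctri c s)"
    unfolding e by (intro convex_INT)
qed

lemma ctri_eq_convex_hull:
  assumes s: "s * s = 1" shows "ctri c s = convex hull (range (vert c s))"
proof
  show "ctri c s \<subseteq> convex hull (range (vert c s))"
  proof
    fix x assume "x \<in> ctri c s"
    then have "(\<Sum>i\<in>UNIV. lam c s i x *\<^sub>R vert c s i) \<in> convex hull (range (vert c s))"
      by (intro convex_sum) (auto simp: sum_lam ctri_def hull_inc)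
    then show "x \<in> convex hull (range (vert c s))" by (simp flip: lam_eq[OF s])
  qed
  show "convex hull (range (vert c s)) \<subseteq> ctri c s"
    by (intro hull_minimal convex_ctri) (auto simp: ctri_def lam_vert[OF s])
qed

lemma compact_ctri: "s * s = 1 \<Longrightarrow> compact (ctri c s)"
  by (simp add: ctri_eq_convex_hull finite_imp_compact_convex_hull)

lemma otri_subset_ctri: "otri c s \<subseteq> ctri c s"
  by (auto simp: otri_def ctri_def intro: less_imp_le)

lemma bounded_otri: "s * s = 1 \<Longrightarrow> bounded (otri c s)"
  using compact_ctri otri_subset_ctri compact_imp_bounded bounded_subset by metis

lemma open_otri: "open (otri c s)"
proof -
  have "otri c s = (\<Inter>i. {x. 0 < lam c s i x})" by (auto simp: otri_def)
  then show ?thesis by (auto intro!: open_INT open_Collect_less continuous_intros)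
qed

lemma A_nonzero: "A i \<noteq> 0"
  using dual[of i i] by auto

lemma negligible_lam: "s * s = 1 \<Longrightarrow> negligible {x. lam c s i x = b}"
proof -
  assume s: "s * s = 1"
  have "{x. lam c s i x = b} = {x. (s *\<^sub>R A i) \<bullet> x = b - (1/3 - s * (A i \<bullet> c))}"
    by (auto simp: lam_affine)
  moreover have "s *\<^sub>R A i \<noteq> 0" using s A_nonzero by auto
  ultimately show ?thesis using negligible_hyperplane by metis
qed

text \<open>From an interior point one can move a little against the gradient of each barycentric
  coordinate without leaving the triangle; the coordinate drops strictly and is still
  nonnegative.\<close>

lemma interior_ctri:
  assumes s: "s * s = 1" shows "interior (ctri c s) = otri c s"
proof
  show "otri c s \<subseteq> interior (ctri c s)"
    using interior_maximal[OF otri_subset_ctri open_otri] .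
  show "interior (ctri c s) \<subseteq> otri c s"
  proof
    fix x assume "x \<in> interior (ctri c s)"
    then obtain e where e: "e > 0" "cball x e \<subseteq> ctri c s"
      using mem_interior_cball by blast
    have "0 < lam c s i x" for i
    proof -
      \<comment> \<open>A step of length \<open>e\<close> down the gradient, which lowers the
        coordinate by \<open>e * norm (A i)\<close>.\<close>
      define y where "y = x + - (s * e / norm (A i)) *\<^sub>R A i"
      have "norm (y - x) = e"
      proof -
        have "\<bar>s\<bar> = 1" using s by (auto simp: square_eq_1_iff)
        then show ?thesis using A_nonzero[of i] e by (simp add: y_def abs_mult)
      qed
      then have "y \<in> ctri c s" using e by (auto simp: dist_norm norm_minus_commute)
      then have "0 \<le> lam c s i y" by (simp add: ctri_def)
      also have "lam c s i y = lam c s i x - s * s * e * norm (A i)"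
        unfolding y_def lam_diff using A_nonzero[of i]
        by (simp add: dot_square_norm power2_eq_square mult_ac)
      finally show ?thesis using s e A_nonzero[of i] by (auto intro: less_le_trans[rotated])
    qed
    then show "x \<in> otri c s" by (simp add: otri_def)
  qed
qed

lemma sets_otri: "otri c s \<in> sets lebesgue"
  using open_otri by auto

lemma AE_not_edge: "s * s = 1 \<Longrightarrow> AE x in lebesgue. lam c s i x \<noteq> b"
  using AE_not_in[of "{x. lam c s i x = b}" lebesgue] negligible_lam
  by (simp add: negligible_iff_null_sets)

lemma AE_all_not_edge: "s * s = 1 \<Longrightarrow> AE x in lebesgue. \<forall>i. lam c s i x \<noteq> b"
  using AE_not_edge by (simp add: AE_all_countable)

lemma integral_ctri:
  fixes f :: "plane \<Rightarrow> real"
  assumes s: "s * s = 1" and f: "continuous_on UNIV f"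
  shows "(LINT x|lebesgue_on (ctri c s). f x) = (LINT x|lebesgue_on (otri c s). f x)"
    and "integrable (lebesgue_on (otri c s)) f"
proof -
  have m: "ctri c s \<in> sets lebesgue" using closed_ctri by auto
  have i: "integrable (lebesgue_on (ctri c s)) f"
    by (rule integral_lebesgue_on_continuous(1)[OF compact_ctri[OF s] continuous_on_subset[OF f]]) simp
  then have i': "integrable lebesgue (\<lambda>x. indicator (ctri c s) x *\<^sub>R f x)"
    using m by (simp add: integrable_restrict_space)
  have "integrable lebesgue (\<lambda>x. indicator (otri c s) x *\<^sub>R (indicator (ctri c s) x *\<^sub>R f x))"
    by (rule integrable_mult_indicator[OF sets_otri i'])
  moreover have e: "(\<lambda>x. indicator (otri c s) x *\<^sub>R (indicator (ctri c s) x *\<^sub>R f x)) = (\<lambda>x. indicator (otri c s) x *\<^sub>R f x)"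
    using otri_subset_ctri[of c s] by (auto simp: fun_eq_iff indicator_def)
  ultimately have i'': "integrable lebesgue (\<lambda>x. indicator (otri c s) x *\<^sub>R f x)" by (simp only:)
  then show "integrable (lebesgue_on (otri c s)) f"
    using sets_otri by (simp add: integrable_restrict_space)
  have "(LINT x|lebesgue. indicator (ctri c s) x *\<^sub>R f x) = (LINT x|lebesgue. indicator (otri c s) x *\<^sub>R f x)"
  proof (rule integral_cong_AE)
    show "AE x in lebesgue. indicator (ctri c s) x *\<^sub>R f x = indicator (otri c s) x *\<^sub>R f x"
      using AE_all_not_edge[OF s, of c 0]
      by eventually_elim (auto simp: indicator_def ctri_def otri_def less_le)
  qed (use i' i'' in auto)
  then show "(LINT x|lebesgue_on (ctri c s). f x) = (LINT x|lebesgue_on (otri c s). f x)"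
    using m sets_otri by (simp add: integral_restrict_space)
qed

definition area :: real where
  "area = \<bar>(\<omega> 2 - \<omega> 1) $ 1 * (\<omega> 3 - \<omega> 1) $ 2 - (\<omega> 2 - \<omega> 1) $ 2 * (\<omega> 3 - \<omega> 1) $ 1\<bar> / 2"

lemma area_pos: "0 < area"
  using det_frame by (auto simp: area_def)

lemma area_eq:
  assumes "i \<noteq> k" "i \<noteq> l" "k \<noteq> l"
  shows "\<bar>(\<omega> k - \<omega> i) $ 1 * (\<omega> l - \<omega> i) $ 2 - (\<omega> k - \<omega> i) $ 2 * (\<omega> l - \<omega> i) $ 1\<bar> = 2 * area"
proof -
  have e: "\<omega> 3 = - \<omega> 1 - \<omega> 2"
    using sum_\<omega> by (simp add: sum_3 add_eq_0_iff algebra_simps)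
  show ?thesis
    unfolding area_def using assms exhaust_3[of i] exhaust_3[of k] exhaust_3[of l]
    by (auto simp: e algebra_simps abs_minus_commute abs_if)
qed

lemma ctri_eq_image:
  assumes s: "s * s = 1" and ikl: "i \<noteq> k" "i \<noteq> l" "k \<noteq> l"
  shows "ctri c s = (\<lambda>y. vert c s i + y $ 1 *\<^sub>R (vert c s k - vert c s i) + y $ 2 *\<^sub>R (vert c s l - vert c s i)) ` ref_triangle"
    (is "_ = ?G ` _")
proof -
  have l: "lam c s m (?G y) = (if m = k then y $ 1 else if m = l then y $ 2 else 1 - y $ 1 - y $ 2)" for m y
  proof -
    have "lam c s m (?G y) = lam c s m (vert c s i) + y $ 1 * (lam c s m (vert c s k) - lam c s m (vert c s i))
        + y $ 2 * (lam c s m (vert c s l) - lam c s m (vert c s i))"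
      by (simp add: lam_def inner_diff_right inner_add_right algebra_simps)
    then show ?thesis using triangle_indices[OF ikl, of m] ikl by (auto simp: lam_vert[OF s])
  qed
  show ?thesis
  proof
    show "?G ` ref_triangle \<subseteq> ctri c s"
      by (auto simp: ctri_def l ref_triangle_def)
    show "ctri c s \<subseteq> ?G ` ref_triangle"
    proof
      fix x assume x: "x \<in> ctri c s"
      define y :: plane where "y = vector [lam c s k x, lam c s l x]"
      have sum: "lam c s i x + (lam c s k x + lam c s l x) = 1"
        using sum_lam[of c s x] unfolding sum_triangle_indices[OF ikl] .
      have "x = lam c s i x *\<^sub>R vert c s i + (lam c s k x *\<^sub>R vert c s k + lam c s l x *\<^sub>R vert c s l)"
        using lam_eq[OF s, of x c] unfolding sum_triangle_indices[OF ikl] .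
      moreover have "lam c s i x = 1 - lam c s k x - lam c s l x" using sum by simp
      ultimately have "x = ?G y"
        by (simp add: y_def algebra_simps)
      moreover have "y \<in> ref_triangle"
      proof -
        have "0 \<le> lam c s m x" for m using x by (simp add: ctri_def)
        from this[of i] this[of k] this[of l] show ?thesis
          using sum by (simp add: y_def ref_triangle_def)
      qed
      ultimately show "x \<in> ?G ` ref_triangle" by blast
    qed
  qed
qed

lemma edge_identity:
  assumes s: "s * s = 1" and ikl: "i \<noteq> k" "i \<noteq> l" "k \<noteq> l" and \<phi>: "smooth \<phi>"
  shows "(LINT x|lebesgue_on (otri c s). 2 * \<phi> x + (\<Sum>j\<in>UNIV. (x - vert c s i) $ j * pd j \<phi> x)) =
    2 * area * (LINT t|lebesgue_on {0..1}. \<phi> (linepath (vert c s k) (vert c s l) t))"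
proof -
  let ?u = "vert c s k - vert c s i" and ?v = "vert c s l - vert c s i"
  have "?u $ 1 * ?v $ 2 - ?u $ 2 * ?v $ 1 = (s * s) * ((\<omega> k - \<omega> i) $ 1 * (\<omega> l - \<omega> i) $ 2 - (\<omega> k - \<omega> i) $ 2 * (\<omega> l - \<omega> i) $ 1)"
    by (simp add: vert_def algebra_simps)
  then have D: "\<bar>?u $ 1 * ?v $ 2 - ?u $ 2 * ?v $ 1\<bar> = 2 * area"
    using area_eq[OF ikl] s by simp
  then have D0: "?u $ 1 * ?v $ 2 - ?u $ 2 * ?v $ 1 \<noteq> 0" using area_pos by auto
  have "vert c s i + (1 - t) *\<^sub>R ?u + t *\<^sub>R ?v = linepath (vert c s k) (vert c s l) t" for t
    by (simp add: linepath_def algebra_simps)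
  moreover have "continuous_on UNIV (\<lambda>x. 2 * \<phi> x + (\<Sum>j\<in>UNIV. (x - vert c s i) $ j * pd j \<phi> x))"
    by (intro continuous_intros smooth_continuous smooth_pd \<phi>)
  ultimately show ?thesis
    using triangle_edge_identity[OF D0 \<phi>, of "vert c s i"] integral_ctri(1)[OF s]
    unfolding ctri_eq_image[OF s ikl, symmetric] D by simp
qed

text \<open>The edge identity for the constant \<open>b / 2\<close>, whose gradient vanishes. This
  also identifies \<open>area\<close> with the Lebesgue measure of the triangle.\<close>

lemma integral_otri_const:
  assumes "s * s = 1" shows "(LINT x|lebesgue_on (otri c s). b) = area * b"
proof -
  have "measure (lebesgue_on {0..1::real}) {0..1} = 1"
    by (subst measure_restrict_space) auto
  then show ?thesis
    using edge_identity[OF assms, of 1 2 3 "\<lambda>_. b / 2" c] by (simp add: smooth_const)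
qed

lemma measure_otri: "s * s = 1 \<Longrightarrow> measure lebesgue (otri c s) = area"
  using integral_otri_const[of s c 1] sets_otri[of c s]
  by (simp add: measure_restrict_space)

lemma A_vert_diff:
  "s * s = 1 \<Longrightarrow> (s *\<^sub>R A m) \<bullet> (vert c s i - vert c s k) = (if m = i then 1 else 0) - (if m = k then 1 else 0)"
  by (simp add: vert_def inner_diff_right dual algebra_simps flip: mult.assoc)

lemma otri_halfplanes: "otri c s = {x. \<forall>i\<in>UNIV. 0 < (1/3 - s * (A i \<bullet> c)) + (s *\<^sub>R A i) \<bullet> x}"
  by (simp add: otri_def lam_affine)

text \<open>The field \<open>lam i * lam k * (vert i - vert k)\<close> is tangential on the whole boundary.\<close>

lemma integral_lam_diff:
  assumes s: "s * s = 1" and "i \<noteq> k"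
    and wd: "\<And>j. has_weak_deriv (otri c s) (unit_index j) v (g j)"
    and int: "integrable (lebesgue_on (otri c s)) v" "\<And>j. integrable (lebesgue_on (otri c s)) (g j)"
  shows "(LINT x|lebesgue_on (otri c s). v x * (lam c s k x - lam c s i x)) =
    - (LINT x|lebesgue_on (otri c s). lam c s i x * lam c s k x * (\<Sum>j\<in>UNIV. (vert c s i - vert c s k) $ j * g j x))"
proof -
  define w where "w = vert c s i - vert c s k"
  define \<Phi> where "\<Phi> x = (lam c s i x * lam c s k x) *\<^sub>R w" for x
  have nth: "(\<lambda>x. \<Phi> x $ j) = (\<lambda>x. (lam c s i x * lam c s k x) * w $ j)" for j
    by (simp add: \<Phi>_def fun_eq_iff)
  have smooth: "smooth (\<lambda>x. \<Phi> x $ j)" for j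
    unfolding nth by (intro smooth_mult smooth_lam smooth_const)
  have dl: "lam c s m differentiable at x" for m x by (rule smooth_differentiable[OF smooth_lam])
  have pd: "pd j (\<lambda>x. \<Phi> x $ j) x = (lam c s i x * (s * A k $ j) + (s * A i $ j) * lam c s k x) * w $ j" for j x
    unfolding nth by (simp add: pd_mult dl differentiable_mult pd_lam)
  \<comment> \<open>The derivative along \<open>w = vert i - vert k\<close> is 1 for coordinate
    \<open>i\<close> and -1 for coordinate \<open>k\<close>.\<close>
  have div: "(\<Sum>j\<in>UNIV. pd j (\<lambda>x. \<Phi> x $ j) x) = lam c s k x - lam c s i x" for x
  proof -
    have "(\<Sum>j\<in>UNIV. pd j (\<lambda>x. \<Phi> x $ j) x) = lam c s i x * ((s *\<^sub>R A k) \<bullet> w) + ((s *\<^sub>R A i) \<bullet> w) * lam c s k x"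
      unfolding pd by (simp add: inner_vec_def sum_2 algebra_simps)
    then show ?thesis
      unfolding w_def A_vert_diff[OF s] using \<open>i \<noteq> k\<close> by simp
  qed
  \<comment> \<open>On side \<open>i\<close> the normal component of \<open>\<Phi>\<close> is
    \<open>lam i * lam k\<close>, on side \<open>k\<close> it is the negative of this, and on the
    third side it is zero; \<open>r m\<close> is what remains after the factor
    \<open>lam m\<close>.\<close>
  define r where "r m x = (if m = i then lam c s k x else if m = k then - lam c s i x else 0)" for m x
  have "(LINT x|lebesgue_on (otri c s). v x * (\<Sum>j\<in>UNIV. pd j (\<lambda>x. \<Phi> x $ j) x) + (\<Sum>j\<in>UNIV. g j x * \<Phi> x $ j)) = 0"
  proof (rule weak_gradient_limit[OF otri_halfplanes bounded_otri[OF s]])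
    show "smooth (r m)" for m
      unfolding r_def by (cases "m = i"; cases "m = k") (auto intro: smooth_intros)
    show "(s *\<^sub>R A m) \<bullet> \<Phi> x = (1/3 - s * (A m \<bullet> c) + (s *\<^sub>R A m) \<bullet> x) * r m x" for m x
      unfolding lam_affine[symmetric] \<Phi>_def inner_scaleR_right w_def A_vert_diff[OF s]
      using \<open>i \<noteq> k\<close> by (auto simp: r_def)
  qed (use smooth wd int in auto)
  moreover have "(LINT x|lebesgue_on (otri c s). v x * (\<Sum>j\<in>UNIV. pd j (\<lambda>x. \<Phi> x $ j) x) + (\<Sum>j\<in>UNIV. g j x * \<Phi> x $ j)) =
      (LINT x|lebesgue_on (otri c s). v x * (lam c s k x - lam c s i x)) +
      (LINT x|lebesgue_on (otri c s). (\<Sum>j\<in>UNIV. g j x * \<Phi> x $ j))"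
    unfolding div
    by (intro Bochner_Integration.integral_add Bochner_Integration.integrable_sum
        integrable_mult_smooth[OF _ _ bounded_otri[OF s] sets_otri] int smooth smooth_intros)
  moreover have "(\<Sum>j\<in>UNIV. g j x * \<Phi> x $ j) = lam c s i x * lam c s k x * (\<Sum>j\<in>UNIV. w $ j * g j x)" for x
    by (simp add: \<Phi>_def sum_distrib_left mult_ac)
  ultimately show ?thesis by (simp add: w_def)
qed

text \<open>The parallelogram formed by a triangle and its neighbour across the edge opposite to vertex \<open>i\<close>;
  the neighbour has centre \<open>c - s * \<omega> i\<close> and orientation \<open>- s\<close>.\<close>

definition par :: "plane \<Rightarrow> real \<Rightarrow> 3 \<Rightarrow> plane set" where
  "par c s i = {x. \<forall>m. m \<noteq> i \<longrightarrow> 0 < lam c s m x \<and> lam c s m x < 1}"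

text \<open>Both triangles have coordinate \<open>i\<close> equal to zero on the common edge, and
  across it the coordinate is continued with the opposite sign. The other two coordinates are
  complemented, so that products \<open>lam m * (1 - lam m)\<close> are common to both
  triangles.\<close>

lemma lam_neighbour:
  "s * s = 1 \<Longrightarrow> lam (c - s *\<^sub>R \<omega> i) (- s) m x = (if m = i then 0 else 1) - lam c s m x"
  by (simp add: lam_def inner_diff_right dual algebra_simps flip: mult.assoc)

lemma par_neighbour: "s * s = 1 \<Longrightarrow> par (c - s *\<^sub>R \<omega> i) (- s) i = par c s i"
  by (auto simp: par_def lam_neighbour)

text \<open>Two inequalities for each \<open>m\<close> other than \<open>i\<close>, distinguished by
  a flag that is true for the lower bound, in the form expected by
  \<open>weak_gradient_limit\<close>.\<close>

lemma par_halfplanes: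
  "par c s i = {x. \<forall>p\<in>{m. m \<noteq> i} \<times> UNIV. 0 < (if snd p then 1/3 - s * (A (fst p) \<bullet> c) else 1 - (1/3 - s * (A (fst p) \<bullet> c)))
      + (if snd p then s *\<^sub>R A (fst p) else - (s *\<^sub>R A (fst p))) \<bullet> x}" (is "_ = ?R")
proof -
  let ?P = "\<lambda>x m b. 0 < (if b then 1/3 - s * (A m \<bullet> c) else 1 - (1/3 - s * (A m \<bullet> c)))
      + (if b then s *\<^sub>R A m else - (s *\<^sub>R A m)) \<bullet> x"
  have "(\<forall>p\<in>{m. m \<noteq> i} \<times> UNIV. ?P x (fst p) (snd p)) \<longleftrightarrow> (\<forall>m. m \<noteq> i \<longrightarrow> ?P x m True \<and> ?P x m False)" for x
  proof (intro iffI allI ballI conjI impI)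
    fix m assume *: "\<forall>p\<in>{m. m \<noteq> i} \<times> UNIV. ?P x (fst p) (snd p)" "m \<noteq> i"
    show "?P x m True" using bspec[OF *(1), of "(m, True)"] *(2) by (simp only: fst_conv snd_conv mem_Times_iff) simp
    show "?P x m False" using bspec[OF *(1), of "(m, False)"] *(2) by (simp only: fst_conv snd_conv mem_Times_iff) simp
  next
    fix p :: "3 \<times> bool" assume *: "\<forall>m. m \<noteq> i \<longrightarrow> ?P x m True \<and> ?P x m False" "p \<in> {m. m \<noteq> i} \<times> UNIV"
    then have "fst p \<noteq> i" by auto
    from mp[OF spec[OF *(1), of "fst p"] this]
    show "?P x (fst p) (snd p)" by (cases "snd p") (simp_all only:)
  qed
  moreover have "(?P x m True \<and> ?P x m False) \<longleftrightarrow> 0 < lam c s m x \<and> lam c s m x < 1" for x m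
    by (simp add: lam_affine inner_minus_left) linarith
  ultimately show ?thesis
    unfolding par_def set_eq_iff mem_Collect_eq by blast
qed

lemma open_par: "open (par c s i)"
proof -
  have "par c s i = (\<Inter>m\<in>{m. m \<noteq> i}. {x. 0 < lam c s m x} \<inter> {x. lam c s m x < 1})"
    by (auto simp: par_def)
  then show ?thesis by (auto intro!: open_INT open_Int open_Collect_less continuous_intros)
qed

lemma par_subset:
  assumes s: "s * s = 1" shows "par c s i \<subseteq> ctri c s \<union> ctri (c - s *\<^sub>R \<omega> i) (- s)"
proof
  fix x assume x: "x \<in> par c s i"
  show "x \<in> ctri c s \<union> ctri (c - s *\<^sub>R \<omega> i) (- s)"
  proof (cases "0 \<le> lam c s i x")
    case True
    then have "x \<in> ctri c s" using x by (force simp: ctri_def par_def intro: less_imp_le)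
    then show ?thesis by simp
  next
    case False
    then have "x \<in> ctri (c - s *\<^sub>R \<omega> i) (- s)" using x by (auto simp: ctri_def par_def lam_neighbour[OF s] intro: less_imp_le)
    then show ?thesis by simp
  qed
qed

lemma bounded_par: "s * s = 1 \<Longrightarrow> bounded (par c s i)"
  by (rule bounded_subset[OF _ par_subset]) (auto intro!: compact_imp_bounded compact_ctri)

lemma sets_par: "par c s i \<in> sets lebesgue"
  using open_par by auto

lemma otri_subset_par:
  assumes s: "s * s = 1" shows "otri c s \<subseteq> par c s i"
proof
  fix x assume x: "x \<in> otri c s"
  have "lam c s m x < 1" for m
  proof -
    obtain k l :: 3 where kl: "m \<noteq> k" "m \<noteq> l" "k \<noteq> l"
      by (rule other_indices)
    have "lam c s m x + (lam c s k x + lam c s l x) = 1"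
      using sum_lam[of c s x] unfolding sum_triangle_indices[OF kl] .
    moreover have "0 < lam c s k x" "0 < lam c s l x" using x by (auto simp: otri_def)
    ultimately show ?thesis by linarith
  qed
  with x show "x \<in> par c s i" by (simp add: par_def otri_def)
qed

lemma otri_neighbour_subset_par: "s * s = 1 \<Longrightarrow> otri (c - s *\<^sub>R \<omega> i) (- s) \<subseteq> par c s i"
  using otri_subset_par[of "- s" "c - s *\<^sub>R \<omega> i" i] par_neighbour by simp

lemma otri_neighbour_disjoint: "s * s = 1 \<Longrightarrow> otri c s \<inter> otri (c - s *\<^sub>R \<omega> i) (- s) = {}"
proof -
  assume s: "s * s = 1"
  show ?thesis
  proof safe
    fix x assume "x \<in> otri c s" "x \<in> otri (c - s *\<^sub>R \<omega> i) (- s)"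
    then have "0 < lam c s i x" "0 < lam (c - s *\<^sub>R \<omega> i) (- s) i x" by (simp_all only: otri_def mem_Collect_eq)
    then show "x \<in> {}" unfolding lam_neighbour[OF s] by simp
  qed
qed

lemma AE_par:
  assumes s: "s * s = 1"
  shows "AE x in lebesgue. indicator (par c s i) x = indicator (otri c s) x + (indicator (otri (c - s *\<^sub>R \<omega> i) (- s)) x :: real)"
  using AE_all_not_edge[OF s, of c 0]
proof eventually_elim
  case (elim x)
  have "x \<in> par c s i \<longleftrightarrow> x \<in> otri c s \<or> x \<in> otri (c - s *\<^sub>R \<omega> i) (- s)"
  proof
    assume x: "x \<in> par c s i"
    show "x \<in> otri c s \<or> x \<in> otri (c - s *\<^sub>R \<omega> i) (- s)"
    proof (cases "0 < lam c s i x")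
      case True
      then have "0 < lam c s m x" for m using x by (cases "m = i") (auto simp: par_def)
      then show ?thesis by (simp add: otri_def)
    next
      case False
      then have "lam c s i x < 0" using elim[THEN spec, of i] by linarith
      then have "0 < lam (c - s *\<^sub>R \<omega> i) (- s) m x" for m
        using x by (cases "m = i") (auto simp: par_def lam_neighbour[OF s])
      then show ?thesis by (simp add: otri_def)
    qed
  qed (use otri_subset_par[OF s] otri_neighbour_subset_par[OF s] in blast)
  then show ?case
    using otri_neighbour_disjoint[OF s, of c i] by (auto simp: indicator_def)
qed

lemma integral_par:
  fixes f :: "plane \<Rightarrow> real"
  assumes s: "s * s = 1" and f: "integrable (lebesgue_on (par c s i)) f"
  shows "(LINT x|lebesgue_on (par c s i). f x) =
    (LINT x|lebesgue_on (otri c s). f x) + (LINT x|lebesgue_on (otri (c - s *\<^sub>R \<omega> i) (- s)). f x)"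
    and "integrable (lebesgue_on (otri c s)) f"
    and "integrable (lebesgue_on (otri (c - s *\<^sub>R \<omega> i) (- s))) f"
proof -
  let ?P = "par c s i" and ?K = "otri c s" and ?K' = "otri (c - s *\<^sub>R \<omega> i) (- s)"
  have fi: "integrable lebesgue (\<lambda>x. indicator ?P x *\<^sub>R f x)"
    using f sets_par by (simp add: integrable_restrict_space)
  have i: "integrable lebesgue (\<lambda>x. indicator U x *\<^sub>R f x)" if "U \<subseteq> ?P" "U \<in> sets lebesgue" for U
  proof -
    have "integrable lebesgue (\<lambda>x. indicator U x *\<^sub>R (indicator ?P x *\<^sub>R f x))"
      by (rule integrable_mult_indicator[OF that(2) fi])
    moreover have "(\<lambda>x. indicator U x *\<^sub>R (indicator ?P x *\<^sub>R f x)) = (\<lambda>x. indicator U x *\<^sub>R f x)"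
      using that(1) by (auto simp: fun_eq_iff indicator_def)
    ultimately show ?thesis by (simp only:)
  qed
  note iK = i[OF otri_subset_par[OF s] sets_otri] and iK' = i[OF otri_neighbour_subset_par[OF s] sets_otri]
  show "integrable (lebesgue_on ?K) f" "integrable (lebesgue_on ?K') f"
    using iK iK' sets_otri by (simp_all add: integrable_restrict_space)
  have "(LINT x|lebesgue. indicator ?P x *\<^sub>R f x) = (LINT x|lebesgue. indicator ?K x *\<^sub>R f x + indicator ?K' x *\<^sub>R f x)"
  proof (rule integral_cong_AE)
    show "AE x in lebesgue. indicator ?P x *\<^sub>R f x = indicator ?K x *\<^sub>R f x + indicator ?K' x *\<^sub>R f x"
      using AE_par[OF s, of c i] by eventually_elim (simp add: algebra_simps)
  qed (use fi iK iK' in auto)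
  then show "(LINT x|lebesgue_on ?P. f x) = (LINT x|lebesgue_on ?K. f x) + (LINT x|lebesgue_on ?K'. f x)"
    using iK iK' sets_par sets_otri by (simp add: integral_restrict_space)
qed

section \<open>Moments against barycentric coordinates\<close>

definition lam_moment :: "plane \<Rightarrow> real \<Rightarrow> 3 \<Rightarrow> (plane \<Rightarrow> real) \<Rightarrow> real" where
  "lam_moment c s i v = (LINT x|lebesgue_on (otri c s). v x * lam c s i x)"

lemma norm_vert_diff: "s * s = 1 \<Longrightarrow> norm (vert c s i - vert c s k) = norm (\<omega> i - \<omega> k)"
proof -
  assume "s * s = 1"
  then have "\<bar>s\<bar> = 1" by (auto simp: square_eq_1_iff)
  moreover have "vert c s i - vert c s k = s *\<^sub>R (\<omega> i - \<omega> k)" by (simp add: vert_def algebra_simps)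
  ultimately show ?thesis by simp
qed

lemma abs_gradient_le:
  fixes g :: "2 \<Rightarrow> real" and w :: plane
  assumes "norm w \<le> h"
  shows "\<bar>\<Sum>j\<in>UNIV. w $ j * g j\<bar> \<le> h * (\<Sum>j\<in>UNIV. \<bar>g j\<bar>)"
proof -
  have "\<bar>\<Sum>j\<in>UNIV. w $ j * g j\<bar> \<le> (\<Sum>j\<in>UNIV. \<bar>w $ j\<bar> * \<bar>g j\<bar>)"
    by (rule order_trans[OF sum_abs]) (simp add: abs_mult)
  also have "\<dots> \<le> (\<Sum>j\<in>UNIV. h * \<bar>g j\<bar>)"
    using assms component_le_norm_cart[of w] by (intro sum_mono mult_right_mono) (auto intro: order_trans)
  finally show ?thesis by (simp add: sum_distrib_left)
qed

lemma integral_bound_gradient: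
  fixes g :: "2 \<Rightarrow> plane \<Rightarrow> real"
  assumes U: "U \<in> sets lebesgue" "bounded U"
    and g: "\<And>j. integrable (lebesgue_on U) (g j)" and \<Gamma>: "integrable (lebesgue_on U) \<Gamma>"
    and le: "\<And>x. (\<Sum>j\<in>UNIV. \<bar>g j x\<bar>) \<le> \<Gamma> x"
    and w: "\<And>j. smooth (\<lambda>x. w x $ j)" "\<And>x. x \<in> U \<Longrightarrow> norm (w x) \<le> h"
  shows "\<bar>LINT x|lebesgue_on U. (\<Sum>j\<in>UNIV. w x $ j * g j x)\<bar> \<le> h * (LINT x|lebesgue_on U. \<Gamma> x)"
proof -
  have "integrable (lebesgue_on U) (\<lambda>x. g j x * w x $ j)" for j
    by (rule integrable_mult_smooth[OF g w(1) U(2,1)])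
  then have i: "integrable (lebesgue_on U) (\<lambda>x. \<Sum>j\<in>UNIV. w x $ j * g j x)"
    by (simp add: mult.commute)
  have "\<bar>LINT x|lebesgue_on U. (\<Sum>j\<in>UNIV. w x $ j * g j x)\<bar> \<le> (LINT x|lebesgue_on U. h * \<Gamma> x)"
    unfolding real_norm_def[symmetric]
  proof (rule Bochner_Integration.integral_norm_bound_integral[OF i])
    fix x assume "x \<in> space (lebesgue_on U)"
    then have x: "x \<in> U" by simp
    then have "0 \<le> h" using w(2)[OF x] norm_ge_zero[of "w x"] by linarith
    then show "norm (\<Sum>j\<in>UNIV. w x $ j * g j x) \<le> h * \<Gamma> x"
      using abs_gradient_le[OF w(2)[OF x], of "\<lambda>j. g j x"] mult_left_mono[OF le[of x]] by fastforce
  qed (use \<Gamma> in simp)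
  then show ?thesis by simp
qed

lemma lam_bounds: "x \<in> otri c s \<Longrightarrow> 0 < lam c s i x" "s * s = 1 \<Longrightarrow> x \<in> otri c s \<Longrightarrow> lam c s i x < 1"
proof -
  show "x \<in> otri c s \<Longrightarrow> 0 < lam c s i x" by (simp add: otri_def)
  assume "s * s = 1" "x \<in> otri c s"
  obtain k where "k \<noteq> i" using other_indices by metis
  then show "lam c s i x < 1"
    using otri_subset_par[OF \<open>s * s = 1\<close>, of c k] \<open>x \<in> otri c s\<close> by (auto simp: par_def)
qed

text \<open>\<open>integral_lam_diff\<close> turns the difference exactly into the integral of the
  gradient against a field along the edge from \<open>k\<close> to \<open>i\<close>, whose length is
  at most \<open>h\<close> because the coordinates lie between 0 and 1.\<close>

lemma lam_moment_diff_bound: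
  assumes s: "s * s = 1" and diam: "\<And>a b. norm (\<omega> a - \<omega> b) \<le> h"
    and wd: "\<And>j. has_weak_deriv (otri c s) (unit_index j) v (g j)"
    and int: "integrable (lebesgue_on (otri c s)) v" "\<And>j. integrable (lebesgue_on (otri c s)) (g j)"
    and \<Gamma>: "integrable (lebesgue_on (otri c s)) \<Gamma>" "\<And>x. (\<Sum>j\<in>UNIV. \<bar>g j x\<bar>) \<le> \<Gamma> x"
  shows "\<bar>lam_moment c s k v - lam_moment c s i v\<bar> \<le> h * (LINT x|lebesgue_on (otri c s). \<Gamma> x)"
proof (cases "i = k")
  case True
  have "0 \<le> h" using diam[of 1 1] by simp
  moreover have "0 \<le> \<Gamma> x" for x using \<Gamma>(2)[of x] by (auto intro: order_trans[OF sum_nonneg])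
  ultimately show ?thesis using True by simp
next
  case False
  have i: "integrable (lebesgue_on (otri c s)) (\<lambda>x. v x * lam c s m x)" for m
    by (rule integrable_mult_smooth[OF int(1) smooth_lam bounded_otri[OF s] sets_otri])
  define w where "w x = (lam c s i x * lam c s k x) *\<^sub>R (vert c s i - vert c s k)" for x
  have "lam_moment c s k v - lam_moment c s i v = (LINT x|lebesgue_on (otri c s). v x * (lam c s k x - lam c s i x))"
    unfolding lam_moment_def by (subst Bochner_Integration.integral_diff[symmetric, OF i i]) (simp add: algebra_simps)
  also have "\<dots> = - (LINT x|lebesgue_on (otri c s). (\<Sum>j\<in>UNIV. w x $ j * g j x))"
    unfolding integral_lam_diff[OF s False wd int] by (simp add: w_def sum_distrib_left mult_ac)
  finally have "\<bar>lam_moment c s k v - lam_moment c s i v\<bar> = \<bar>LINT x|lebesgue_on (otri c s). (\<Sum>j\<in>UNIV. w x $ j * g j x)\<bar>"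
    by simp
  also have "\<dots> \<le> h * (LINT x|lebesgue_on (otri c s). \<Gamma> x)"
  proof (rule integral_bound_gradient[OF sets_otri bounded_otri[OF s] int(2) \<Gamma>])
    have "(\<lambda>x. w x $ j) = (\<lambda>x. lam c s i x * lam c s k x * (vert c s i - vert c s k) $ j)" for j
      by (simp add: w_def fun_eq_iff)
    then show "smooth (\<lambda>x. w x $ j)" for j
      by (simp only:) (intro smooth_mult smooth_lam smooth_const)
    fix x assume x: "x \<in> otri c s"
    have "norm (w x) = (lam c s i x * lam c s k x) * norm (\<omega> i - \<omega> k)"
      using lam_bounds(1)[OF x, of i] lam_bounds(1)[OF x, of k]
      by (simp add: w_def norm_vert_diff[OF s] abs_mult)
    also have "\<dots> \<le> 1 * h"
      using lam_bounds(1)[OF x] lam_bounds(2)[OF s x]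
      by (intro mult_mono mult_le_one diam) (auto intro: less_imp_le)
    finally show "norm (w x) \<le> h" by simp
  qed
  finally show ?thesis .
qed

text \<open>The field is \<open>lam m * (1 - lam m)\<close> times the edge vector from vertex
  \<open>i\<close> to vertex \<open>m\<close>, summed over the two \<open>m\<close> other than
  \<open>i\<close>. It is tangential on all four sides of the parallelogram and its divergence is
  \<open>2 * lam i\<close>. As \<open>lam i\<close> is minus the corresponding coordinate of the
  neighbour, integrating \<open>v\<close> against this divergence gives twice the difference of the
  two moments.\<close>

lemma lam_moment_neighbour_bound:
  assumes s: "s * s = 1" and diam: "\<And>a b. norm (\<omega> a - \<omega> b) \<le> h"
    and wd: "\<And>j. has_weak_deriv (par c s i) (unit_index j) v (g j)"
    and int: "integrable (lebesgue_on (par c s i)) v" "\<And>j. integrable (lebesgue_on (par c s i)) (g j)"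
    and \<Gamma>: "integrable (lebesgue_on (par c s i)) \<Gamma>" "\<And>x. (\<Sum>j\<in>UNIV. \<bar>g j x\<bar>) \<le> \<Gamma> x"
  shows "\<bar>lam_moment c s i v - lam_moment (c - s *\<^sub>R \<omega> i) (- s) i v\<bar> \<le> h * (LINT x|lebesgue_on (par c s i). \<Gamma> x)"
proof -
  obtain k l where ikl: "i \<noteq> k" "i \<noteq> l" "k \<noteq> l" by (rule other_indices)
  let ?q = "\<lambda>m x. lam c s m x * (1 - lam c s m x)"
  let ?d = "\<lambda>m. vert c s m - vert c s i"
  define \<Phi> where "\<Phi> x = ?q k x *\<^sub>R ?d k + ?q l x *\<^sub>R ?d l" for x
  have nth: "(\<lambda>x. \<Phi> x $ j) = (\<lambda>x. ?q k x * ?d k $ j + ?q l x * ?d l $ j)" for j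
    by (simp add: \<Phi>_def fun_eq_iff)
  have smooth: "smooth (\<lambda>x. \<Phi> x $ j)" for j
    unfolding nth by (intro smooth_add smooth_mult smooth_lam smooth_diff smooth_const)
  have sq: "smooth (?q m)" for m by (intro smooth_mult smooth_lam smooth_diff smooth_const)
  have pdq: "pd j (\<lambda>x. ?q m x * b) x = (1 - 2 * lam c s m x) * ((s *\<^sub>R A m) $ j * b)" for j m b x
  proof -
    have "((\<lambda>x. ?q m x * b) has_derivative (\<lambda>h. (1 - 2 * lam c s m x) * (s * (A m \<bullet> h)) * b)) (at x)"
      unfolding lam_def by (auto intro!: derivative_eq_intros simp: algebra_simps)
    then show ?thesis by (simp add: pd_eq inner_axis)
  qed
  have dq: "(\<lambda>x. ?q m x * b) differentiable at x" for m b x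
    by (intro smooth_differentiable smooth_mult sq smooth_const)
  have div: "(\<Sum>j\<in>UNIV. pd j (\<lambda>x. \<Phi> x $ j) x) = 2 * lam c s i x" for x
  proof -
    have "(\<Sum>j\<in>UNIV. pd j (\<lambda>x. \<Phi> x $ j) x) =
        (1 - 2 * lam c s k x) * ((s *\<^sub>R A k) \<bullet> ?d k) + (1 - 2 * lam c s l x) * ((s *\<^sub>R A l) \<bullet> ?d l)"
      unfolding nth pd_add[OF dq dq] pdq by (simp add: inner_vec_def sum_2 algebra_simps)
    also have "\<dots> = 2 * (1 - lam c s k x - lam c s l x)"
      unfolding A_vert_diff[OF s] using ikl by simp
    also have "1 - lam c s k x - lam c s l x = lam c s i x"
      using sum_lam[of c s x] unfolding sum_triangle_indices[OF ikl] by simp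
    finally show ?thesis .
  qed
  \<comment> \<open>The factor that is left when the distance to the side, \<open>lam\<close> or
    \<open>1 - lam\<close>, is split off the normal component; for an upper side the sign is that of
    the reversed normal.\<close>
  define r where "r p x = (if snd p then 1 - lam c s (fst p) x else - lam c s (fst p) x)" for p :: "3 \<times> bool" and x
  have "(LINT x|lebesgue_on (par c s i). v x * (\<Sum>j\<in>UNIV. pd j (\<lambda>x. \<Phi> x $ j) x) + (\<Sum>j\<in>UNIV. g j x * \<Phi> x $ j)) = 0"
  proof (rule weak_gradient_limit[OF par_halfplanes bounded_par[OF s]])
    show "smooth (r p)" for p
      unfolding r_def by (cases "snd p") (auto intro!: smooth_uminus smooth_diff smooth_const smooth_lam)
    fix p x assume p: "p \<in> {m. m \<noteq> i} \<times> (UNIV :: bool set)"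
    have A\<Phi>: "(s *\<^sub>R A (fst p)) \<bullet> \<Phi> x = ?q (fst p) x"
      unfolding \<Phi>_def inner_add_right inner_scaleR_right A_vert_diff[OF s]
      using p triangle_indices[OF ikl, of "fst p"] ikl by auto
    show "(if snd p then s *\<^sub>R A (fst p) else - (s *\<^sub>R A (fst p))) \<bullet> \<Phi> x =
        ((if snd p then 1/3 - s * (A (fst p) \<bullet> c) else 1 - (1/3 - s * (A (fst p) \<bullet> c))) +
        (if snd p then s *\<^sub>R A (fst p) else - (s *\<^sub>R A (fst p))) \<bullet> x) * r p x"
      using A\<Phi> by (cases "snd p") (simp_all add: r_def lam_affine[of c s "fst p" x] inner_minus_left algebra_simps)
  qed (use smooth wd int in auto)
  moreover have "(LINT x|lebesgue_on (par c s i). v x * (\<Sum>j\<in>UNIV. pd j (\<lambda>x. \<Phi> x $ j) x) + (\<Sum>j\<in>UNIV. g j x * \<Phi> x $ j)) =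
      (LINT x|lebesgue_on (par c s i). v x * (2 * lam c s i x)) +
      (LINT x|lebesgue_on (par c s i). (\<Sum>j\<in>UNIV. g j x * \<Phi> x $ j))"
    unfolding div
    by (intro Bochner_Integration.integral_add Bochner_Integration.integrable_sum
        integrable_mult_smooth[OF _ _ bounded_par[OF s] sets_par] int smooth smooth_mult smooth_const smooth_lam)
  moreover have vl: "integrable (lebesgue_on (par c s i)) (\<lambda>x. v x * lam c s i x)"
    by (intro integrable_mult_smooth[OF _ _ bounded_par[OF s] sets_par] int smooth_lam)
  moreover have "(LINT x|lebesgue_on (par c s i). v x * (2 * lam c s i x)) = 2 * (LINT x|lebesgue_on (par c s i). v x * lam c s i x)"
    by (subst integral_mult_right_zero[symmetric]) (simp add: mult_ac)
  moreover have "(LINT x|lebesgue_on (par c s i). v x * lam c s i x) = lam_moment c s i v - lam_moment (c - s *\<^sub>R \<omega> i) (- s) i v"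
    unfolding integral_par(1)[OF s vl] lam_moment_def by (simp add: lam_neighbour[OF s])
  ultimately have "2 * (lam_moment c s i v - lam_moment (c - s *\<^sub>R \<omega> i) (- s) i v) =
      - (LINT x|lebesgue_on (par c s i). (\<Sum>j\<in>UNIV. \<Phi> x $ j * g j x))"
    by (simp add: mult.commute)
  moreover have "\<bar>LINT x|lebesgue_on (par c s i). (\<Sum>j\<in>UNIV. \<Phi> x $ j * g j x)\<bar> \<le> (2 * h) * (LINT x|lebesgue_on (par c s i). \<Gamma> x)"
  proof (rule integral_bound_gradient[OF sets_par bounded_par[OF s] int(2) \<Gamma> smooth])
    fix x assume x: "x \<in> par c s i"
    have q: "\<bar>?q m x\<bar> \<le> 1" if "m \<noteq> i" for m
      using x that by (auto simp: par_def abs_mult intro!: mult_le_one)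
    have "norm (\<Phi> x) \<le> \<bar>?q k x\<bar> * norm (?d k) + \<bar>?q l x\<bar> * norm (?d l)"
      unfolding \<Phi>_def by (rule order_trans[OF norm_triangle_ineq]) simp
    also have "\<dots> \<le> 1 * h + 1 * h"
      using q ikl diam by (intro add_mono mult_mono) (auto simp: norm_vert_diff[OF s])
    finally show "norm (\<Phi> x) \<le> 2 * h" by simp
  qed
  ultimately have "\<bar>2 * (lam_moment c s i v - lam_moment (c - s *\<^sub>R \<omega> i) (- s) i v)\<bar> \<le> (2 * h) * (LINT x|lebesgue_on (par c s i). \<Gamma> x)"
    by simp
  then show ?thesis unfolding abs_mult by simp
qed

text \<open>If \<open>g\<close> is the gradient of \<open>v\<close>, this is \<open>2 * area\<close> times the mean of \<open>v\<close> over the edge opposite to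
  vertex \<open>i\<close>, but it makes sense without a trace.\<close>

definition edge_functional :: "plane \<Rightarrow> real \<Rightarrow> 3 \<Rightarrow> (plane \<Rightarrow> real) \<Rightarrow> (2 \<Rightarrow> plane \<Rightarrow> real) \<Rightarrow> real" where
  "edge_functional c s i v g =
     (LINT x|lebesgue_on (otri c s). 2 * v x + (\<Sum>j\<in>UNIV. (x - vert c s i) $ j * g j x))"

text \<open>\<open>expand_A\<close> in coordinates. The centre \<open>c\<close> contributes nothing
  because the \<open>A i\<close> sum to zero.\<close>

lemma sum_A_vert: "s * s = 1 \<Longrightarrow> (\<Sum>i\<in>UNIV. (s * A i $ m) * vert c s i $ j) = (if m = j then 1 else 0)"
proof -
  assume s: "s * s = 1"
  have "(\<Sum>i\<in>UNIV. A i $ m) = 0" using sum_A by (metis sum_component zero_index)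
  moreover have "(\<Sum>i\<in>UNIV. A i $ m * \<omega> i $ j) = (if m = j then 1 else 0)"
  proof -
    have "(\<Sum>i\<in>UNIV. (\<omega> i \<bullet> axis j 1) *\<^sub>R A i) $ m = axis j 1 $ m" by (simp only: expand_A)
    moreover have "axis j 1 $ m = (if m = j then 1 else 0 :: real)" by (simp add: axis_def)
    ultimately show ?thesis by (simp add: inner_axis mult.commute)
  qed
  moreover have "(\<Sum>i\<in>UNIV. (s * A i $ m) * vert c s i $ j) = s * c $ j * (\<Sum>i\<in>UNIV. A i $ m) + (s * s) * (\<Sum>i\<in>UNIV. A i $ m * \<omega> i $ j)"
    by (simp add: vert_def algebra_simps sum.distrib sum_distrib_left)
  ultimately show ?thesis by (simp add: s)
qed

text \<open>Isolates the dependence on the edge: only the opposite vertex enters, and it enters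
  linearly.\<close>

lemma edge_functional_eq:
  assumes s: "s * s = 1" and int: "integrable (lebesgue_on (otri c s)) v" "\<And>j. integrable (lebesgue_on (otri c s)) (g j)"
  shows "edge_functional c s i v g = (LINT x|lebesgue_on (otri c s). 2 * v x + (\<Sum>j\<in>UNIV. x $ j * g j x))
    - (\<Sum>j\<in>UNIV. vert c s i $ j * (LINT x|lebesgue_on (otri c s). g j x))"
proof -
  have xg: "integrable (lebesgue_on (otri c s)) (\<lambda>x. x $ j * g j x)" for j
    using integrable_mult_smooth[OF int(2) smooth_nth bounded_otri[OF s] sets_otri, of j j] by (simp add: mult.commute)
  have "edge_functional c s i v g = (LINT x|lebesgue_on (otri c s). (2 * v x + (\<Sum>j\<in>UNIV. x $ j * g j x)) - (\<Sum>j\<in>UNIV. vert c s i $ j * g j x))"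
    unfolding edge_functional_def by (intro Bochner_Integration.integral_cong refl) (simp add: algebra_simps sum_subtractf)
  also have "\<dots> = (LINT x|lebesgue_on (otri c s). (2 * v x + (\<Sum>j\<in>UNIV. x $ j * g j x))) - (LINT x|lebesgue_on (otri c s). (\<Sum>j\<in>UNIV. vert c s i $ j * g j x))"
    by (rule Bochner_Integration.integral_diff) (use int xg in auto)
  also have "(LINT x|lebesgue_on (otri c s). (\<Sum>j\<in>UNIV. vert c s i $ j * g j x)) = (\<Sum>j\<in>UNIV. vert c s i $ j * (LINT x|lebesgue_on (otri c s). g j x))"
    using int by (subst Bochner_Integration.integral_sum) auto
  finally show ?thesis .
qed

text \<open>The Gauss formula on a triangle, since \<open>s * A i\<close> is the inner unit normal
  of edge \<open>i\<close> times its length over \<open>2 * area\<close>. Here it is pure algebra: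
  the part common to the three edges is killed by the sum of the \<open>A i\<close>, and the sum of
  \<open>A i\<close> times vertex \<open>i\<close> is the identity matrix, which picks out
  \<open>g m\<close>.\<close>

lemma gauss_edge_functional:
  assumes s: "s * s = 1" and int: "integrable (lebesgue_on (otri c s)) v" "\<And>j. integrable (lebesgue_on (otri c s)) (g j)"
  shows "(\<Sum>i\<in>UNIV. (s * A i $ m) * edge_functional c s i v g) = - (LINT x|lebesgue_on (otri c s). g m x)"
proof -
  define F where "F = (LINT x|lebesgue_on (otri c s). 2 * v x + (\<Sum>j\<in>UNIV. x $ j * g j x))"
  define L where "L j = (LINT x|lebesgue_on (otri c s). g j x)" for j
  have "(\<Sum>i\<in>UNIV. A i $ m) = 0" using sum_A by (metis sum_component zero_index)
  then have "(\<Sum>i\<in>UNIV. s * A i $ m) = 0" by (simp flip: sum_distrib_left)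
  moreover have "(\<Sum>i\<in>UNIV. (s * A i $ m) * (F - (\<Sum>j\<in>UNIV. vert c s i $ j * L j))) =
      (\<Sum>i\<in>UNIV. s * A i $ m) * F - (\<Sum>j\<in>UNIV. (\<Sum>i\<in>UNIV. (s * A i $ m) * vert c s i $ j) * L j)"
    by (simp add: sum_3 sum_2 algebra_simps)
  ultimately show ?thesis
    unfolding edge_functional_eq[OF s int] F_def[symmetric] L_def[symmetric] sum_A_vert[OF s]
    using exhaust_2[of m] by (auto simp: sum_2)
qed

end

section \<open>Square integrable functions and uniqueness of weak derivatives\<close>

lemma integrable_mult_L2:
  fixes f g :: "'a \<Rightarrow> real"
  assumes [measurable]: "f \<in> borel_measurable M" "g \<in> borel_measurable M"
    and f: "integrable M (\<lambda>x. (f x)\<^sup>2)" and g: "integrable M (\<lambda>x. (g x)\<^sup>2)"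
  shows "integrable M (\<lambda>x. f x * g x)"
proof (rule Bochner_Integration.integrable_bound[OF Bochner_Integration.integrable_add[OF f g]])
  show "AE x in M. norm (f x * g x) \<le> norm ((f x)\<^sup>2 + (g x)\<^sup>2)"
  proof (rule AE_I2)
    fix x
    have "0 \<le> (\<bar>f x\<bar> - \<bar>g x\<bar>)\<^sup>2" by simp
    then have "2 * (\<bar>f x\<bar> * \<bar>g x\<bar>) \<le> (f x)\<^sup>2 + (g x)\<^sup>2"
      by (simp add: power2_diff)
    moreover have "0 \<le> \<bar>f x\<bar> * \<bar>g x\<bar>" by simp
    ultimately have "\<bar>f x\<bar> * \<bar>g x\<bar> \<le> (f x)\<^sup>2 + (g x)\<^sup>2" by linarith
    then show "norm (f x * g x) \<le> norm ((f x)\<^sup>2 + (g x)\<^sup>2)" by (simp add: abs_mult)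
  qed
qed measurable

lemma cauchy_schwarz_integral:
  fixes f g :: "'a \<Rightarrow> real"
  assumes m: "f \<in> borel_measurable M" "g \<in> borel_measurable M"
    and f: "integrable M (\<lambda>x. (f x)\<^sup>2)" and g: "integrable M (\<lambda>x. (g x)\<^sup>2)"
  shows "\<bar>LINT x|M. f x * g x\<bar> \<le> sqrt (LINT x|M. (f x)\<^sup>2) * sqrt (LINT x|M. (g x)\<^sup>2)"
proof -
  define a where "a = (LINT x|M. (f x)\<^sup>2)"
  define b where "b = (LINT x|M. f x * g x)"
  define d where "d = (LINT x|M. (g x)\<^sup>2)"
  have fg: "integrable M (\<lambda>x. f x * g x)" by (rule integrable_mult_L2[OF m f g])
  have nonneg: "0 \<le> a" "0 \<le> d" by (auto simp: a_def d_def)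
  have q: "0 \<le> a + 2 * t * b + t\<^sup>2 * d" for t
  proof -
    have "0 \<le> (LINT x|M. (f x + t * g x)\<^sup>2)" by simp
    also have "\<dots> = (LINT x|M. (f x)\<^sup>2 + (2 * t) * (f x * g x) + t\<^sup>2 * (g x)\<^sup>2)"
      by (intro Bochner_Integration.integral_cong) (auto simp: power2_eq_square algebra_simps)
    also have "\<dots> = a + 2 * t * b + t\<^sup>2 * d"
      using f g fg by (simp add: a_def b_def d_def)
    finally show ?thesis .
  qed
  have "b\<^sup>2 \<le> a * d"
  proof (cases "d = 0")
    case True
    have "b = 0"
    proof (rule ccontr)
      assume "b \<noteq> 0"
      \<comment> \<open>For \<open>d = 0\<close> the quadratic is linear in \<open>t\<close>, and
        this \<open>t\<close> gives it the value -1.\<close>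
      with q[of "- (a + 1) / (2 * b)"] True show False by (simp add: field_simps)
    qed
    then show ?thesis using True by simp
  next
    case False
    with nonneg have d: "d > 0" by simp
    \<comment> \<open>The minimiser of the quadratic.\<close>
    from q[of "- b / d"] d have "0 \<le> a - b\<^sup>2 / d"
      by (simp add: power2_eq_square field_simps)
    then show ?thesis using d by (simp add: field_simps)
  qed
  then have "sqrt (b\<^sup>2) \<le> sqrt (a * d)" by (rule real_sqrt_le_mono)
  then show ?thesis by (simp add: real_sqrt_mult a_def b_def d_def)
qed

lemma cauchy_schwarz_sum:
  fixes f g :: "'a \<Rightarrow> real"
  shows "(\<Sum>x\<in>X. f x * g x) \<le> sqrt (\<Sum>x\<in>X. (f x)\<^sup>2) * sqrt (\<Sum>x\<in>X. (g x)\<^sup>2)"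
proof -
  have "(\<Sum>x\<in>X. f x * g x)\<^sup>2 \<le> (\<Sum>x\<in>X. (f x)\<^sup>2) * (\<Sum>x\<in>X. (g x)\<^sup>2)"
    by (rule Cauchy_Schwarz_ineq_sum)
  then have "\<bar>\<Sum>x\<in>X. f x * g x\<bar> \<le> sqrt ((\<Sum>x\<in>X. (f x)\<^sup>2) * (\<Sum>x\<in>X. (g x)\<^sup>2))"
    by (rule real_le_rsqrt[OF order_trans[rotated]]) simp
  then show ?thesis by (simp add: real_sqrt_mult)
qed

lemma L2_real_def: "L2 U (v :: 'a::euclidean_space \<Rightarrow> real) \<longleftrightarrow>
    v \<in> borel_measurable (lebesgue_on U) \<and> integrable (lebesgue_on U) (\<lambda>x. (v x)\<^sup>2)"
  by (simp add: L2_def)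

lemma L2_norm_real_def: "L2_norm U (v :: 'a::euclidean_space \<Rightarrow> real) = sqrt (LINT x|lebesgue_on U. (v x)\<^sup>2)"
  by (simp add: L2_norm_def)

lemma L2_add:
  fixes v w :: "'a::euclidean_space \<Rightarrow> real"
  assumes v: "L2 U v" and w: "L2 U w" shows "L2 U (\<lambda>x. v x + w x)"
proof -
  have "integrable (lebesgue_on U) (\<lambda>x. v x * w x)"
    using v w by (intro integrable_mult_L2) (auto simp: L2_real_def)
  then have "integrable (lebesgue_on U) (\<lambda>x. (v x)\<^sup>2 + 2 * (v x * w x) + (w x)\<^sup>2)"
    using v w by (simp add: L2_real_def)
  then show ?thesis
    using v w by (auto simp: L2_real_def power2_eq_square algebra_simps)
qed

lemma L2_cmult:
  fixes v :: "'a::euclidean_space \<Rightarrow> real"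
  assumes "L2 U v" shows "L2 U (\<lambda>x. b * v x)"
  using assms by (auto simp: L2_real_def power_mult_distrib)

lemma L2_diff:
  fixes v w :: "'a::euclidean_space \<Rightarrow> real"
  assumes "L2 U v" "L2 U w" shows "L2 U (\<lambda>x. v x - w x)"
  using L2_add[OF assms(1) L2_cmult[OF assms(2), of "-1"]] by simp

lemma L2_abs:
  fixes v :: "'a::euclidean_space \<Rightarrow> real"
  assumes "L2 U v" shows "L2 U (\<lambda>x. \<bar>v x\<bar>)"
  using assms by (auto simp: L2_real_def)

lemma L2_sum:
  fixes v :: "'i \<Rightarrow> 'a::euclidean_space \<Rightarrow> real"
  assumes "\<And>i. i \<in> I \<Longrightarrow> L2 U (v i)" shows "L2 U (\<lambda>x. \<Sum>i\<in>I. v i x)"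
proof -
  have "L2 U (\<lambda>x. 0 :: real)" by (simp add: L2_def)
  then show ?thesis using assms by (induction I rule: infinite_finite_induct) (auto intro: L2_add)
qed

lemma L2_integrable:
  fixes v :: "'a::euclidean_space \<Rightarrow> real"
  assumes "L2 U v" "U \<in> lmeasurable" shows "integrable (lebesgue_on U) v"
proof -
  have "integrable (lebesgue_on U) (\<lambda>x. 1 :: real)"
    using assms(2) by (simp add: integrable_restrict_space fmeasurableD integrable_on_const lmeasurable_iff_integrable)
  then have "integrable (lebesgue_on U) (\<lambda>x. v x * 1)"
    using assms(1) by (intro integrable_mult_L2) (auto simp: L2_real_def)
  then show ?thesis by simp
qed

lemma integral_abs_le_L2_norm:
  fixes v :: "'a::euclidean_space \<Rightarrow> real"
  assumes "L2 U v" "U \<in> lmeasurable"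
  shows "(LINT x|lebesgue_on U. \<bar>v x\<bar>) \<le> sqrt (measure lebesgue U) * L2_norm U v"
proof -
  have "integrable (lebesgue_on U) (\<lambda>x. 1 :: real)"
    using assms(2) by (simp add: integrable_restrict_space fmeasurableD integrable_on_const lmeasurable_iff_integrable)
  then have "\<bar>LINT x|lebesgue_on U. 1 * \<bar>v x\<bar>\<bar> \<le> sqrt (LINT x|lebesgue_on U. 1\<^sup>2) * sqrt (LINT x|lebesgue_on U. \<bar>v x\<bar>\<^sup>2)"
    using assms(1) by (intro cauchy_schwarz_integral) (auto simp: L2_real_def)
  then show ?thesis
    using assms(2) by (simp add: L2_norm_real_def measure_restrict_space fmeasurableD)
qed

lemma L2_subset:
  fixes v :: "'a::euclidean_space \<Rightarrow> real"
  assumes "L2 \<Omega> v" "U \<subseteq> \<Omega>" "U \<in> sets lebesgue" "\<Omega> \<in> sets lebesgue" shows "L2 U v"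
proof -
  have "v \<in> borel_measurable (lebesgue_on U)"
    using assms(1) by (intro measurable_restrict_mono[OF _ assms(2)]) (simp add: L2_real_def)
  moreover have "integrable lebesgue (\<lambda>x. indicator U x *\<^sub>R (indicator \<Omega> x *\<^sub>R (v x)\<^sup>2))"
    using assms by (intro integrable_mult_indicator[OF assms(3)]) (simp add: L2_real_def integrable_restrict_space)
  moreover have "(\<lambda>x. indicator U x *\<^sub>R (indicator \<Omega> x *\<^sub>R (v x)\<^sup>2)) = (\<lambda>x. indicator U x *\<^sub>R (v x)\<^sup>2)"
    using assms(2) by (auto simp: fun_eq_iff indicator_def)
  ultimately have "integrable lebesgue (\<lambda>x. indicator U x *\<^sub>R (v x)\<^sup>2)" "v \<in> borel_measurable (lebesgue_on U)"
    by (simp_all only:)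
  then show ?thesis
    unfolding L2_real_def using integrable_restrict_space[of U lebesgue "\<lambda>x. (v x)\<^sup>2"] assms(3) by simp
qed

lemma integrable_test_mult:
  fixes v :: "plane \<Rightarrow> real"
  assumes v: "locally_integrable U v" and \<psi>: "test_function U \<psi>" and U: "open U"
  shows "integrable (lebesgue_on U) (\<lambda>x. v x * \<psi> x)"
proof -
  let ?S = "closure {x. \<psi> x \<noteq> 0}"
  have S: "compact ?S" "?S \<subseteq> U" "smooth \<psi>" using \<psi> by (auto simp: test_function_def)
  have Sm: "?S \<in> sets lebesgue" by auto
  have "v absolutely_integrable_on ?S" using v S by (auto simp: locally_integrable_def)
  then have "integrable (lebesgue_on ?S) v"
    using Sm by (simp add: set_integrable_def integrable_restrict_space)
  then have "integrable (lebesgue_on ?S) (\<lambda>x. v x * \<psi> x)"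
    using S Sm by (intro integrable_mult_smooth compact_imp_bounded)
  then have "integrable lebesgue (\<lambda>x. indicator ?S x *\<^sub>R (v x * \<psi> x))"
    using Sm by (simp add: integrable_restrict_space)
  moreover have "(\<lambda>x. indicator ?S x *\<^sub>R (v x * \<psi> x)) = (\<lambda>x. indicator U x *\<^sub>R (v x * \<psi> x))"
  proof
    fix x
    show "indicator ?S x *\<^sub>R (v x * \<psi> x) = indicator U x *\<^sub>R (v x * \<psi> x)"
      using S(2) closure_subset[of "{x. \<psi> x \<noteq> 0}"] by (cases "\<psi> x = 0") (auto simp: indicator_def)
  qed
  ultimately show ?thesis using U by (simp add: integrable_restrict_space)
qed

lemma locally_integrable_diff:
  fixes v w :: "plane \<Rightarrow> 'b::euclidean_space"
  shows "locally_integrable U v \<Longrightarrow> locally_integrable U w \<Longrightarrow> locally_integrable U (\<lambda>x. v x - w x)"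
  unfolding locally_integrable_def by (auto intro!: set_integral_diff)

lemma test_function_mpd_unit_index: "test_function U \<psi> \<Longrightarrow> test_function U (mpd (unit_index j) \<psi>)"
  by (simp add: test_function_pd)

lemma has_weak_deriv_diff:
  assumes v: "has_weak_deriv U (unit_index j) v g" and w: "has_weak_deriv U (unit_index j) w h" and "open U"
  shows "has_weak_deriv U (unit_index j) (\<lambda>x. v x - w x) (\<lambda>x. g x - h x)"
  unfolding has_weak_deriv_def
proof (intro conjI allI impI)
  fix \<phi> assume \<phi>: "test_function U \<phi>"
  note \<phi>' = test_function_mpd_unit_index[OF \<phi>, of j]
  have l: "locally_integrable U v" "locally_integrable U g" "locally_integrable U w" "locally_integrable U h"
    using v w by (auto simp: has_weak_deriv_def)
  have "(LINT x|lebesgue_on U. (v x - w x) * mpd (unit_index j) \<phi> x) =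
      (LINT x|lebesgue_on U. v x * mpd (unit_index j) \<phi> x) - (LINT x|lebesgue_on U. w x * mpd (unit_index j) \<phi> x)"
    unfolding left_diff_distrib
    by (intro Bochner_Integration.integral_diff integrable_test_mult l \<phi>' \<open>open U\<close>)
  also have "\<dots> = - ((LINT x|lebesgue_on U. g x * \<phi> x) - (LINT x|lebesgue_on U. h x * \<phi> x))"
    using v w \<phi> by (simp add: has_weak_deriv_def)
  also have "\<dots> = - (LINT x|lebesgue_on U. (g x - h x) * \<phi> x)"
    unfolding left_diff_distrib
    by (subst Bochner_Integration.integral_diff; (intro integrable_test_mult l \<phi> \<open>open U\<close>)?) simp
  finally show "(LINT x|lebesgue_on U. (v x - w x) * mpd (unit_index j) \<phi> x) =
        (- 1) ^ mi_order (unit_index j) * (LINT x|lebesgue_on U. (g x - h x) * \<phi> x)"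
    by simp
qed (use v w in \<open>auto simp: has_weak_deriv_def intro: locally_integrable_diff\<close>)

lemma has_weak_deriv_unique:
  assumes v: "has_weak_deriv U \<alpha> v g" and w: "has_weak_deriv U \<alpha> v h" and "open U"
  shows "AE x in lebesgue_on U. g x = h x"
proof -
  have l: "locally_integrable U g" "locally_integrable U h"
    using v w by (auto simp: has_weak_deriv_def)
  have "AE x in lebesgue_on U. g x - h x = 0"
  proof (rule weak_zero_imp_AE_zero[OF \<open>open U\<close> locally_integrable_diff[OF l]])
    fix \<phi> assume \<phi>: "test_function U \<phi>"
    then have "(- 1) ^ mi_order \<alpha> * (LINT x|lebesgue_on U. g x * \<phi> x) = (- 1) ^ mi_order \<alpha> * (LINT x|lebesgue_on U. h x * \<phi> x)"
      using v w by (simp add: has_weak_deriv_def)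
    then have "(LINT x|lebesgue_on U. g x * \<phi> x) = (LINT x|lebesgue_on U. h x * \<phi> x)" by simp
    then show "(LINT x|lebesgue_on U. (g x - h x) * \<phi> x) = 0"
      unfolding left_diff_distrib
      by (subst Bochner_Integration.integral_diff; (intro integrable_test_mult l \<phi> \<open>open U\<close>)?) simp
  qed
  then show ?thesis by simp
qed

lemma has_weak_deriv_weak_deriv: "has_weak_deriv U \<alpha> v g \<Longrightarrow> has_weak_deriv U \<alpha> v (weak_deriv U \<alpha> v)"
  unfolding weak_deriv_def by (rule someI[of "has_weak_deriv U \<alpha> v"])

lemma locally_integrable_nth: 
  "locally_integrable U V \<Longrightarrow> locally_integrable U (\<lambda>x. (V x :: plane) $ i)"
  unfolding locally_integrable_def
  using absolutely_integrable_component[of _ _ "axis i 1"] by (fastforce simp: inner_axis)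

lemma has_weak_div_diff:
  assumes v: "has_weak_div U V d" and w: "has_weak_div U W e" and "open U"
  shows "has_weak_div U (\<lambda>x. V x - W x) (\<lambda>x. d x - e x)"
  unfolding has_weak_div_def
proof (intro conjI allI impI)
  fix \<phi> assume \<phi>: "test_function U \<phi>"
  have l: "locally_integrable U d" "locally_integrable U e"
    using v w by (auto simp: has_weak_div_def)
  have "locally_integrable U V" "locally_integrable U W"
    using v w by (auto simp: has_weak_div_def)
  note L = this[THEN locally_integrable_nth]
  have "(LINT x|lebesgue_on U. (\<Sum>i\<in>UNIV. (V x - W x) $ i * pd i \<phi> x)) =
      (LINT x|lebesgue_on U. (\<Sum>i\<in>UNIV. V x $ i * pd i \<phi> x) - (\<Sum>i\<in>UNIV. W x $ i * pd i \<phi> x))"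
    by (simp add: left_diff_distrib sum_subtractf)
  also have "\<dots> = (LINT x|lebesgue_on U. (\<Sum>i\<in>UNIV. V x $ i * pd i \<phi> x)) - (LINT x|lebesgue_on U. (\<Sum>i\<in>UNIV. W x $ i * pd i \<phi> x))"
    by (intro Bochner_Integration.integral_diff Bochner_Integration.integrable_sum integrable_test_mult L test_function_pd \<phi> \<open>open U\<close>)
  also have "\<dots> = - ((LINT x|lebesgue_on U. d x * \<phi> x) - (LINT x|lebesgue_on U. e x * \<phi> x))"
    using v w \<phi> by (simp add: has_weak_div_def)
  also have "\<dots> = - (LINT x|lebesgue_on U. (d x - e x) * \<phi> x)"
    unfolding left_diff_distrib
    by (subst Bochner_Integration.integral_diff; (intro integrable_test_mult l \<phi> \<open>open U\<close>)?) simp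
  finally show "(LINT x|lebesgue_on U. (\<Sum>i\<in>UNIV. (V x - W x) $ i * pd i \<phi> x)) = - (LINT x|lebesgue_on U. (d x - e x) * \<phi> x)" .
qed (use v w in \<open>auto simp: has_weak_div_def intro: locally_integrable_diff\<close>)

lemma has_weak_div_unique:
  assumes v: "has_weak_div U V g" and w: "has_weak_div U V h" and "open U"
  shows "AE x in lebesgue_on U. g x = h x"
proof -
  have l: "locally_integrable U g" "locally_integrable U h"
    using v w by (auto simp: has_weak_div_def)
  have "AE x in lebesgue_on U. g x - h x = 0"
  proof (rule weak_zero_imp_AE_zero[OF \<open>open U\<close> locally_integrable_diff[OF l]])
    fix \<phi> assume \<phi>: "test_function U \<phi>"
    then have "- (LINT x|lebesgue_on U. g x * \<phi> x) = - (LINT x|lebesgue_on U. h x * \<phi> x)"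
      using v w by (simp add: has_weak_div_def)
    then have "(LINT x|lebesgue_on U. g x * \<phi> x) = (LINT x|lebesgue_on U. h x * \<phi> x)" by simp
    then show "(LINT x|lebesgue_on U. (g x - h x) * \<phi> x) = 0"
      unfolding left_diff_distrib
      by (subst Bochner_Integration.integral_diff; (intro integrable_test_mult l \<phi> \<open>open U\<close>)?) simp
  qed
  then show ?thesis by simp
qed

lemma locally_integrable_cong_AE:
  fixes V W :: "plane \<Rightarrow> 'b::euclidean_space"
  assumes V: "locally_integrable U V" and eq: "AE x in lebesgue_on U. V x = W x" and U: "open U"
  shows "locally_integrable U W"
  unfolding locally_integrable_def
proof (intro allI impI)
  fix S assume S: "compact S \<and> S \<subseteq> U"
  then have "V absolutely_integrable_on S" using V by (auto simp: locally_integrable_def)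
  moreover have "AE x in lebesgue. x \<in> U \<longrightarrow> V x = W x"
    using eq U by (subst (asm) AE_restrict_space_iff) auto
  then have "AE x in lebesgue. x \<in> S \<longrightarrow> V x = W x"
    by eventually_elim (use S in auto)
  then have "negligible {x \<in> S. V x \<noteq> W x}"
    by (auto simp: AE_iff_null_sets negligible_iff_null_sets completion.AE_iff_null_sets)
  ultimately show "W absolutely_integrable_on S"
    by (rule absolutely_integrable_spike) auto
qed

text \<open>Integrability gives measurability on each closed box inside \<open>U\<close>, and
  countably many of these cover \<open>U\<close>.\<close>

lemma locally_integrable_measurable:
  fixes v :: "plane \<Rightarrow> 'b::euclidean_space"
  assumes v: "locally_integrable U v" and "open U"
  shows "v \<in> borel_measurable (lebesgue_on U)"
proof -
  obtain D where D: "countable D" "D \<subseteq> Pow U" "\<And>X. X \<in> D \<Longrightarrow> \<exists>a b. X = cbox a b" "\<Union>D = U"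
    using open_countable_Union_open_cbox[OF \<open>open U\<close>] by metis
  show ?thesis
  proof (rule measurable_piecewise_restrict[OF D(1)])
    fix X assume X: "X \<in> D"
    then obtain a b where ab: "X = cbox a b" using D(3) by blast
    have XU: "X \<subseteq> U" using X D(2) by auto
    show "X \<inter> space (lebesgue_on U) \<in> sets (lebesgue_on U)"
      using XU \<open>open U\<close> ab by (auto simp: sets_restrict_space_iff Int_absorb2)
    have "v absolutely_integrable_on X"
      using v XU ab by (auto simp: locally_integrable_def)
    then have "v \<in> borel_measurable (lebesgue_on X)"
      using absolutely_integrable_measurable[of X v] ab by auto
    moreover have "restrict_space (lebesgue_on U) X = lebesgue_on X"
      using XU \<open>open U\<close> by (subst restrict_restrict_space) (auto simp: ab Int_absorb1)
    ultimately show "v \<in> borel_measurable (restrict_space (lebesgue_on U) X)" by simp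
  qed (use D(4) in auto)
qed

section \<open>Fluxes and traces on edges\<close>

context triangle_frame
begin

lemma lam_linepath: "lam c s m (linepath p q t) = (1 - t) * lam c s m p + t * lam c s m q"
  by (simp add: lam_def linepath_def inner_diff_right inner_add_right field_simps)

lemma edge_functional_smooth:
  assumes "s * s = 1" "i \<noteq> k" "i \<noteq> l" "k \<noteq> l" "smooth \<phi>"
  shows "edge_functional c s i \<phi> (\<lambda>j. pd j \<phi>) =
    2 * area * (LINT t|lebesgue_on {0..1}. \<phi> (linepath (vert c s k) (vert c s l) t))"
  unfolding edge_functional_def by (rule edge_identity[OF assms])

text \<open>Chosen to be invariant under complementing the two coordinates, so that it is one and
  the same polynomial for both triangles at edge \<open>i\<close>. It vanishes on the four sides of
  their parallelogram and equals \<open>((1 - t) * t)\<^sup>2\<close> on the common edge.\<close>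

definition bubble :: "plane \<Rightarrow> real \<Rightarrow> 3 \<Rightarrow> 3 \<Rightarrow> plane \<Rightarrow> real" where
  "bubble c s k l x = (lam c s k x * (1 - lam c s k x)) * (lam c s l x * (1 - lam c s l x))"

lemma smooth_bubble: "smooth (bubble c s k l)"
  unfolding bubble_def by (intro smooth_mult smooth_diff smooth_const smooth_lam)

lemma integrable_smooth_otri: "s * s = 1 \<Longrightarrow> smooth \<phi> \<Longrightarrow> integrable (lebesgue_on (otri c s)) \<phi>"
  by (rule integral_ctri(2)[OF _ smooth_continuous])

lemma integral_bubble_pos: "0 < (LINT t|lebesgue_on {0..1}. ((1 - t) * t)\<^sup>2 :: real)"
proof -
  have "(LINT t|lebesgue_on {0..1}. ((1 - t) * t)\<^sup>2 :: real) = (LINT t|lborel. indicator {0..1} t * ((1 - t) * t)\<^sup>2)"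
    by (intro integral_lebesgue_on_continuous continuous_intros) auto
  \<comment> \<open>The antiderivative evaluated at both ends; the value is 1/30.\<close>
  also have "\<dots> = (1 / 3 - 1 / 2 + 1 / 5) - (0 / 3 - 0 / 2 + 0 / 5)"
  proof -
    have "((\<lambda>t. t ^ 3 / 3 - t ^ 4 / 2 + t ^ 5 / 5) has_real_derivative ((1 - t) * t)\<^sup>2) (at t within {0..1})" for t :: real
      by (auto intro!: derivative_eq_intros simp: power2_eq_square power3_eq_cube power4_eq_xxxx algebra_simps)
    then show ?thesis
      using integral_FTC_atLeastAtMost[of 0 1 "\<lambda>t. t ^ 3 / 3 - t ^ 4 / 2 + t ^ 5 / 5" "\<lambda>t. ((1 - t) * t)\<^sup>2"]
      by (simp add: has_real_derivative_iff_has_vector_derivative continuous_intros)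
  qed
  finally show ?thesis by simp
qed

text \<open>In the Gauss formula for the bubble only edge \<open>i\<close> contributes, because the
  bubble vanishes on the other two.\<close>

lemma integral_pd_bubble:
  assumes s: "s * s = 1" and ikl: "i \<noteq> k" "i \<noteq> l" "k \<noteq> l"
  shows "(LINT x|lebesgue_on (otri c s). pd m (bubble c s k l) x) =
    - (s * A i $ m) * (2 * area * (LINT t|lebesgue_on {0..1}. ((1 - t) * t)\<^sup>2))"
proof -
  let ?b = "bubble c s k l"
  have "(\<Sum>e\<in>UNIV. (s * A e $ m) * edge_functional c s e ?b (\<lambda>j. pd j ?b)) = - (LINT x|lebesgue_on (otri c s). pd m ?b x)"
    by (intro gauss_edge_functional s integrable_smooth_otri smooth_bubble smooth_pd)
  moreover have "edge_functional c s i ?b (\<lambda>j. pd j ?b) = 2 * area * (LINT t|lebesgue_on {0..1}. ((1 - t) * t)\<^sup>2)"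
    unfolding edge_functional_smooth[OF s ikl smooth_bubble]
    using ikl by (simp add: bubble_def lam_linepath lam_vert[OF s] power2_eq_square mult_ac)
  moreover have "edge_functional c s k ?b (\<lambda>j. pd j ?b) = 0"
    unfolding edge_functional_smooth[OF s ikl(1)[symmetric] ikl(3,2) smooth_bubble]
    using ikl by (simp add: bubble_def lam_linepath lam_vert[OF s])
  moreover have "edge_functional c s l ?b (\<lambda>j. pd j ?b) = 0"
    unfolding edge_functional_smooth[OF s ikl(2)[symmetric] ikl(3)[symmetric] ikl(1) smooth_bubble]
    using ikl by (simp add: bubble_def lam_linepath lam_vert[OF s])
  ultimately show ?thesis
    unfolding sum_triangle_indices[OF ikl] by simp
qed

text \<open>Zero divergence is tested with the bubble on the parallelogram. On each of the two
  triangles the result is the flux of the constant value through the common edge times the same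
  positive number, with a sign given by the orientation; the orientations are opposite, so the
  fluxes agree.\<close>

lemma normal_continuity:
  assumes s: "s * s = 1" and wd: "has_weak_div (par c s i) V (\<lambda>_. 0)"
    and int: "\<And>j. integrable (lebesgue_on (par c s i)) (\<lambda>x. V x $ j)"
    and V: "AE x in lebesgue_on (otri c s). V x = \<tau>"
      "AE x in lebesgue_on (otri (c - s *\<^sub>R \<omega> i) (- s)). V x = \<tau>'"
  shows "A i \<bullet> \<tau> = A i \<bullet> \<tau>'"
proof -
  obtain k l where ikl: "i \<noteq> k" "i \<noteq> l" "k \<noteq> l" by (rule other_indices)
  let ?q = "\<lambda>m x. lam c s m x * (1 - lam c s m x)"
  let ?b = "bubble c s k l"
  \<comment> \<open>\<open>f p\<close> is the bubble without the factor that vanishes on the side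
    \<open>p\<close>; \<open>oth\<close> names the other one of the two indices \<open>k\<close> and
    \<open>l\<close>.\<close>
  define oth where "oth m = (if m = k then l else k)" for m
  define f where "f p x = (if snd p then (1 - lam c s (fst p) x) else lam c s (fst p) x) * ?q (oth (fst p)) x" for p :: "3 \<times> bool" and x
  define a where "a p = (if snd p then s *\<^sub>R A (fst p) else - (s *\<^sub>R A (fst p)))" for p :: "3 \<times> bool"
  have sf: "smooth (f p)" for p
    unfolding f_def by (cases "snd p") (auto intro!: smooth_mult smooth_diff smooth_const smooth_lam)
  have "(LINT x|lebesgue_on (par c s i). (\<Sum>m\<in>{()}. (\<Sum>j\<in>UNIV. V x $ j * pd j ?b x) + 0 * ?b x)) = 0"
  proof (rule weak_div_limit[OF par_halfplanes bounded_par[OF s], where r = "\<lambda>p x. (\<Sum>j\<in>UNIV. (V x $ j * f p x) * a p $ j)"])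
    show "integrable (lebesgue_on (par c s i)) (\<lambda>x. \<Sum>j\<in>UNIV. (V x $ j * f p x) * a p $ j)" for p
      by (intro Bochner_Integration.integrable_sum integrable_mult_left integrable_mult_smooth[OF int sf bounded_par[OF s] sets_par])
    fix p x assume p: "p \<in> {m. m \<noteq> i} \<times> (UNIV :: bool set)"
    then have "fst p = k \<or> fst p = l" using triangle_indices[OF ikl, of "fst p"] by auto
    then have "?b x = (if snd p then lam c s (fst p) x else 1 - lam c s (fst p) x) * f p x"
      using ikl by (auto simp: f_def oth_def bubble_def)
    moreover have "(if snd p then 1/3 - s * (A (fst p) \<bullet> c) else 1 - (1/3 - s * (A (fst p) \<bullet> c))) +
        (if snd p then s *\<^sub>R A (fst p) else - (s *\<^sub>R A (fst p))) \<bullet> x = (if snd p then lam c s (fst p) x else 1 - lam c s (fst p) x)"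
      by (simp add: lam_affine inner_minus_left)
    ultimately show "(\<Sum>m\<in>{()}. ?b x * (V x \<bullet> (if snd p then s *\<^sub>R A (fst p) else - (s *\<^sub>R A (fst p))))) =
        ((if snd p then 1/3 - s * (A (fst p) \<bullet> c) else 1 - (1/3 - s * (A (fst p) \<bullet> c))) +
        (if snd p then s *\<^sub>R A (fst p) else - (s *\<^sub>R A (fst p))) \<bullet> x) * (\<Sum>j\<in>UNIV. (V x $ j * f p x) * a p $ j)"
      unfolding a_def[symmetric] by (simp add: inner_vec_def sum_2 algebra_simps)
  qed (use wd int in \<open>auto intro: smooth_bubble\<close>)
  then have J0: "(LINT x|lebesgue_on (par c s i). (\<Sum>j\<in>UNIV. V x $ j * pd j ?b x)) = 0" by simp
  have i: "integrable (lebesgue_on (par c s i)) (\<lambda>x. \<Sum>j\<in>UNIV. V x $ j * pd j ?b x)"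
    by (intro Bochner_Integration.integrable_sum integrable_mult_smooth[OF int _ bounded_par[OF s] sets_par] smooth_pd smooth_bubble)
  have split: "(LINT x|lebesgue_on (otri c' s'). (\<Sum>j\<in>UNIV. V x $ j * pd j ?b x)) =
      - s' * (A i \<bullet> \<tau>'') * (2 * area * (LINT t|lebesgue_on {0..1}. ((1 - t) * t)\<^sup>2))"
    if s': "s' * s' = 1" and V': "AE x in lebesgue_on (otri c' s'). V x = \<tau>''" and b: "?b = bubble c' s' k l"
      and i': "integrable (lebesgue_on (otri c' s')) (\<lambda>x. \<Sum>j\<in>UNIV. V x $ j * pd j ?b x)" for c' s' \<tau>''
  proof -
    have i2: "integrable (lebesgue_on (otri c' s')) (\<lambda>x. \<tau>'' $ j * pd j ?b x)" for j
      unfolding b by (intro integrable_mult_right integrable_smooth_otri s' smooth_pd smooth_bubble)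
    have "(LINT x|lebesgue_on (otri c' s'). (\<Sum>j\<in>UNIV. V x $ j * pd j ?b x)) = (LINT x|lebesgue_on (otri c' s'). (\<Sum>j\<in>UNIV. \<tau>'' $ j * pd j ?b x))"
    proof (rule integral_cong_AE)
      show "AE x in lebesgue_on (otri c' s'). (\<Sum>j\<in>UNIV. V x $ j * pd j ?b x) = (\<Sum>j\<in>UNIV. \<tau>'' $ j * pd j ?b x)"
        using V' by eventually_elim simp
    qed (rule borel_measurable_integrable, intro Bochner_Integration.integrable_sum i' i2)+
    also have "\<dots> = (\<Sum>j\<in>UNIV. \<tau>'' $ j * (LINT x|lebesgue_on (otri c' s'). pd j ?b x))"
      using i2 by (subst Bochner_Integration.integral_sum) auto
    finally show ?thesis
      unfolding b integral_pd_bubble[OF s' ikl] by (simp add: inner_vec_def sum_2 algebra_simps)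
  qed
  have "bubble c s k l = bubble (c - s *\<^sub>R \<omega> i) (- s) k l"
    using ikl by (simp add: fun_eq_iff bubble_def lam_neighbour[OF s] mult_ac)
  note b' = this
  define N where "N = 2 * area * (LINT t|lebesgue_on {0..1}. ((1 - t) * t)\<^sup>2)"
  note split' = split[folded N_def]
  have "(- s * (A i \<bullet> \<tau>) + s * (A i \<bullet> \<tau>')) * N = - s * (A i \<bullet> \<tau>) * N + - (- s) * (A i \<bullet> \<tau>') * N"
    by (simp add: algebra_simps)
  also have "\<dots> = (LINT x|lebesgue_on (par c s i). (\<Sum>j\<in>UNIV. V x $ j * pd j ?b x))"
    unfolding integral_par(1)[OF s i]
    using split'[OF s V(1) refl integral_par(2)[OF s i]] split'[of "- s", OF _ V(2) b' integral_par(3)[OF s i]] s by simp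
  also have "\<dots> = 0" by (fact J0)
  finally have "(- s * (A i \<bullet> \<tau>) + s * (A i \<bullet> \<tau>')) * N = 0" .
  moreover have "N \<noteq> 0"
    using mult_pos_pos[OF _ integral_bubble_pos, of "2 * area"] area_pos unfolding N_def by linarith
  ultimately have "- s * (A i \<bullet> \<tau>) + s * (A i \<bullet> \<tau>') = 0" by (simp only: mult_eq_0_iff) simp
  then have "s * (s * (A i \<bullet> \<tau>)) = s * (s * (A i \<bullet> \<tau>'))" by algebra
  then show ?thesis using s by (simp flip: mult.assoc)
qed

section \<open>Traces on edges expressed by edge functionals\<close>

lemma norm_diff_vert_le:
  assumes s: "s * s = 1" and x: "x \<in> otri c s"
  shows "norm (x - vert c s i) \<le> (\<Sum>m\<in>UNIV. norm (\<omega> m - \<omega> i))"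
proof -
  have "x - vert c s i = (\<Sum>m\<in>UNIV. lam c s m x *\<^sub>R vert c s m) - (\<Sum>m\<in>UNIV. lam c s m x) *\<^sub>R vert c s i"
    using lam_eq[OF s, of x c] sum_lam[of c s x] by simp
  also have "\<dots> = (\<Sum>m\<in>UNIV. lam c s m x *\<^sub>R (vert c s m - vert c s i))"
    by (simp add: scaleR_sum_left sum_subtractf scaleR_diff_right)
  also have "norm \<dots> \<le> (\<Sum>m\<in>UNIV. norm (\<omega> m - \<omega> i))"
  proof (rule sum_norm_le)
    fix m
    show "norm (lam c s m x *\<^sub>R (vert c s m - vert c s i)) \<le> norm (\<omega> m - \<omega> i)"
      using lam_bounds(1)[OF x, of m] lam_bounds(2)[OF s x, of m]
      by (simp add: norm_vert_diff[OF s] mult_left_le_one_le)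
  qed
  finally show ?thesis .
qed

lemma lmeasurable_otri: "s * s = 1 \<Longrightarrow> otri c s \<in> lmeasurable"
  using lmeasurable_open[OF bounded_otri open_otri] .

text \<open>Continuity of the edge functional in the norm of the function and its gradient, which
  carries identities for smooth functions over to limits.\<close>

lemma edge_functional_bound:
  assumes s: "s * s = 1" and v: "L2 (otri c s) v" and g: "\<And>j. L2 (otri c s) (g j)"
  shows "\<bar>edge_functional c s i v g\<bar> \<le> sqrt area * (2 * L2_norm (otri c s) v
    + (\<Sum>j\<in>UNIV. (\<Sum>m\<in>UNIV. norm (\<omega> m - \<omega> i)) * L2_norm (otri c s) (g j)))"
proof -
  let ?B = "\<Sum>m\<in>UNIV. norm (\<omega> m - \<omega> i)"
  let ?M = "lebesgue_on (otri c s)"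
  note vi = L2_integrable[OF v lmeasurable_otri[OF s]] and gi = L2_integrable[OF g lmeasurable_otri[OF s]]
  have si: "smooth (\<lambda>x. (x - vert c s i) $ j)" for j
    unfolding vector_minus_component by (intro smooth_diff smooth_nth smooth_const)
  have xg: "integrable ?M (\<lambda>x. (x - vert c s i) $ j * g j x)" for j
    using integrable_mult_smooth[OF gi si bounded_otri[OF s] sets_otri, of j j] by (simp add: mult.commute)
  have "\<bar>edge_functional c s i v g\<bar> \<le> (LINT x|?M. 2 * \<bar>v x\<bar> + (\<Sum>j\<in>UNIV. ?B * \<bar>g j x\<bar>))"
    unfolding edge_functional_def real_norm_def[symmetric]
  proof (rule Bochner_Integration.integral_norm_bound_integral)
    show "integrable ?M (\<lambda>x. 2 * v x + (\<Sum>j\<in>UNIV. (x - vert c s i) $ j * g j x))"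
      by (intro Bochner_Integration.integrable_add Bochner_Integration.integrable_sum integrable_mult_right vi xg)
    show "integrable ?M (\<lambda>x. 2 * norm (v x) + (\<Sum>j\<in>UNIV. ?B * norm (g j x)))"
      by (intro Bochner_Integration.integrable_add Bochner_Integration.integrable_sum integrable_mult_right integrable_norm vi gi)
    fix x assume "x \<in> space ?M"
    then have x: "x \<in> otri c s" by simp
    have "\<bar>(x - vert c s i) $ j * g j x\<bar> \<le> ?B * \<bar>g j x\<bar>" for j
      unfolding abs_mult using component_le_norm_cart[of "x - vert c s i" j] norm_diff_vert_le[OF s x, of i]
      by (intro mult_right_mono) auto
    then have "\<bar>\<Sum>j\<in>UNIV. (x - vert c s i) $ j * g j x\<bar> \<le> (\<Sum>j\<in>UNIV. ?B * \<bar>g j x\<bar>)"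
      by (intro order_trans[OF sum_abs] sum_mono)
    then show "norm (2 * v x + (\<Sum>j\<in>UNIV. (x - vert c s i) $ j * g j x)) \<le> 2 * norm (v x) + (\<Sum>j\<in>UNIV. ?B * norm (g j x))"
      unfolding real_norm_def by linarith
  qed
  also have "\<dots> = 2 * (LINT x|?M. \<bar>v x\<bar>) + (\<Sum>j\<in>UNIV. ?B * (LINT x|?M. \<bar>g j x\<bar>))"
    using vi gi by simp
  also have "\<dots> \<le> 2 * (sqrt area * L2_norm (otri c s) v) + (\<Sum>j\<in>UNIV. ?B * (sqrt area * L2_norm (otri c s) (g j)))"
    using integral_abs_le_L2_norm[OF v lmeasurable_otri[OF s]] integral_abs_le_L2_norm[OF g lmeasurable_otri[OF s]]
    unfolding measure_otri[OF s] by (intro add_mono mult_left_mono sum_mono sum_nonneg) auto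
  finally show ?thesis by (simp add: algebra_simps sum_distrib_left)
qed

lemma tendsto_edge_functional:
  assumes s: "s * s = 1" and v: "\<And>n. L2 (otri c s) (v n)" "(\<lambda>n. L2_norm (otri c s) (v n)) \<longlonglongrightarrow> 0"
    and g: "\<And>n j. L2 (otri c s) (g n j)" "\<And>j. (\<lambda>n. L2_norm (otri c s) (g n j)) \<longlonglongrightarrow> 0"
  shows "(\<lambda>n. edge_functional c s i (v n) (g n)) \<longlonglongrightarrow> 0"
proof (rule Lim_null_comparison)
  show "\<forall>\<^sub>F n in sequentially. norm (edge_functional c s i (v n) (g n)) \<le> sqrt area * (2 * L2_norm (otri c s) (v n)
    + (\<Sum>j\<in>UNIV. (\<Sum>m\<in>UNIV. norm (\<omega> m - \<omega> i)) * L2_norm (otri c s) (g n j)))"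
    using edge_functional_bound[OF s v(1) g(1)] by simp
  have "(\<lambda>n. sqrt area * (2 * L2_norm (otri c s) (v n)
    + (\<Sum>j\<in>UNIV. (\<Sum>m\<in>UNIV. norm (\<omega> m - \<omega> i)) * L2_norm (otri c s) (g n j)))) \<longlonglongrightarrow>
      sqrt area * (2 * 0 + (\<Sum>j\<in>(UNIV::2 set). (\<Sum>m\<in>UNIV. norm (\<omega> m - \<omega> i)) * 0))"
    by (intro tendsto_intros v g)
  then show "(\<lambda>n. sqrt area * (2 * L2_norm (otri c s) (v n)
    + (\<Sum>j\<in>UNIV. (\<Sum>m\<in>UNIV. norm (\<omega> m - \<omega> i)) * L2_norm (otri c s) (g n j)))) \<longlonglongrightarrow> 0" by simp
qed

lemma edge_functional_diff:
  assumes s: "s * s = 1" and "L2 (otri c s) v" "L2 (otri c s) w" "\<And>j. L2 (otri c s) (g j)" "\<And>j. L2 (otri c s) (h j)"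
  shows "edge_functional c s i (\<lambda>x. v x - w x) (\<lambda>j x. g j x - h j x) = edge_functional c s i v g - edge_functional c s i w h"
proof -
  let ?M = "lebesgue_on (otri c s)"
  have si: "smooth (\<lambda>x. (x - vert c s i) $ j)" for j
    unfolding vector_minus_component by (intro smooth_diff smooth_nth smooth_const)
  have xg: "integrable ?M (\<lambda>x. (x - vert c s i) $ j * g j x)" if "L2 (otri c s) (g j)" for j g
    using integrable_mult_smooth[OF L2_integrable[OF that lmeasurable_otri[OF s]] si bounded_otri[OF s] sets_otri, of j] by (simp add: mult.commute)
  have i: "integrable ?M (\<lambda>x. 2 * v x + (\<Sum>j\<in>UNIV. (x - vert c s i) $ j * g j x))"
    if "L2 (otri c s) v" "\<And>j. L2 (otri c s) (g j)" for v g
    by (intro Bochner_Integration.integrable_add Bochner_Integration.integrable_sum integrable_mult_right xg that L2_integrable[OF that(1) lmeasurable_otri[OF s]])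
  show ?thesis
    unfolding edge_functional_def
    by (subst Bochner_Integration.integral_diff[OF i i, symmetric]; (rule assms)?)
       (intro Bochner_Integration.integral_cong refl, simp add: sum_2 algebra_simps)
qed

lemma L2_smooth_otri: "s * s = 1 \<Longrightarrow> smooth \<phi> \<Longrightarrow> L2 (otri c s) \<phi>"
  using integrable_smooth_otri[of s "\<lambda>x. \<phi> x * \<phi> x" c] borel_measurable_integrable[OF integrable_smooth_otri[of s \<phi> c]]
  by (auto simp: L2_real_def power2_eq_square intro: smooth_mult)

lemma L2_norm_le_sobolev_seminorm_1: "L2_norm U (weak_deriv U (unit_index j) v) \<le> sobolev_seminorm 1 U v"
proof -
  have n: "0 \<le> L2_norm U w" for w :: "plane \<Rightarrow> real" by (simp add: L2_norm_real_def)
  have "(L2_norm U (weak_deriv U (unit_index j) v))\<^sup>2 \<le> (\<Sum>\<alpha> | mi_order \<alpha> = 1. (L2_norm U (weak_deriv U \<alpha> v))\<^sup>2)"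
    by (rule member_le_sum[of "unit_index j"]) (use finite_mi_order in auto)
  from real_sqrt_le_mono[OF this] show ?thesis
    using n by (simp add: sobolev_seminorm_def)
qed

lemma L2_norm_cong_AE:
  fixes v w :: "plane \<Rightarrow> real"
  assumes "AE x in lebesgue_on U. v x = w x" "v \<in> borel_measurable (lebesgue_on U)" "w \<in> borel_measurable (lebesgue_on U)"
  shows "L2_norm U v = L2_norm U w"
proof -
  have "(LINT x|lebesgue_on U. (v x)\<^sup>2) = (LINT x|lebesgue_on U. (w x)\<^sup>2)"
    using assms by (intro integral_cong_AE) (auto elim: AE_mp)
  then show ?thesis by (simp add: L2_norm_real_def)
qed

text \<open>Both sides are continuous under the convergence by which \<open>has_edge_trace\<close>
  defines the trace, and they agree for the approximating smooth functions.\<close>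

lemma edge_trace_functional:
  assumes s: "s * s = 1" and ikl: "i \<noteq> k" "i \<noteq> l" "k \<noteq> l"
    and tr: "has_edge_trace (ctri c s) (vert c s k) (vert c s l) v g"
    and wd: "\<And>j. has_weak_deriv (otri c s) (unit_index j) v (d j)"
    and L: "L2 (otri c s) v" "\<And>j. L2 (otri c s) (d j)"
  shows "edge_functional c s i v d = 2 * area * (LINT t|lebesgue_on {0..1}. g (linepath (vert c s k) (vert c s l) t))"
proof -
  let ?p = "linepath (vert c s k) (vert c s l)"
  let ?I = "lebesgue_on {0..1::real}"
  note tr' = tr[unfolded has_edge_trace_def interior_ctri[OF s]]
  have g: "L2 {0..1} (g \<circ> ?p)" using tr' by (elim conjE)
  from tr' obtain \<phi> where "\<forall>n. smooth (\<phi> n)"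
    and l0: "(\<lambda>n. L2_norm (otri c s) (\<lambda>x. \<phi> n x - v x)) \<longlonglongrightarrow> 0"
    and l1: "(\<lambda>n. sobolev_seminorm 1 (otri c s) (\<lambda>x. \<phi> n x - v x)) \<longlonglongrightarrow> 0"
    and l2: "(\<lambda>n. L2_norm {0..1} ((\<lambda>x. \<phi> n x - g x) \<circ> ?p)) \<longlonglongrightarrow> 0"
    by (elim conjE exE)
  then have \<phi>: "\<And>n. smooth (\<phi> n)" by blast
  have L\<phi>: "L2 (otri c s) (\<phi> n)" "L2 (otri c s) (pd j (\<phi> n))" for n j
    by (intro L2_smooth_otri s \<phi> smooth_pd)+
  \<comment> \<open>The seminorm is formed with the weak derivative selected by
    \<open>weak_deriv\<close>; uniqueness identifies it almost everywhere with
    \<open>pd j (\<phi> n) - d j\<close>.\<close>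
  have d0: "(\<lambda>n. L2_norm (otri c s) (\<lambda>x. pd j (\<phi> n) x - d j x)) \<longlonglongrightarrow> 0" for j
  proof (rule Lim_null_comparison[OF _ l1])
    have "L2_norm (otri c s) (\<lambda>x. pd j (\<phi> n) x - d j x) \<le> sobolev_seminorm 1 (otri c s) (\<lambda>x. \<phi> n x - v x)" for n
    proof -
      let ?w = "weak_deriv (otri c s) (unit_index j) (\<lambda>x. \<phi> n x - v x)"
      have w: "has_weak_deriv (otri c s) (unit_index j) (\<lambda>x. \<phi> n x - v x) (\<lambda>x. pd j (\<phi> n) x - d j x)"
        by (intro has_weak_deriv_diff smooth_imp_has_weak_deriv \<phi> wd open_otri)
      have e: "AE x in lebesgue_on (otri c s). pd j (\<phi> n) x - d j x = ?w x"
        by (rule has_weak_deriv_unique[OF w has_weak_deriv_weak_deriv[OF w] open_otri])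
      have m: "(\<lambda>x. pd j (\<phi> n) x - d j x) \<in> borel_measurable (lebesgue_on (otri c s))"
        using L2_diff[OF L\<phi>(2) L(2)] by (simp add: L2_real_def)
      have "?w \<in> borel_measurable (lebesgue_on (otri c s))"
        using has_weak_deriv_weak_deriv[OF w] by (intro locally_integrable_measurable open_otri) (simp add: has_weak_deriv_def)
      then have "L2_norm (otri c s) (\<lambda>x. pd j (\<phi> n) x - d j x) = L2_norm (otri c s) ?w"
        by (rule L2_norm_cong_AE[OF e m])
      then show ?thesis using L2_norm_le_sobolev_seminorm_1 by simp
    qed
    moreover have "0 \<le> L2_norm (otri c s) w" for w :: "plane \<Rightarrow> real" by (simp add: L2_norm_real_def)
    ultimately show "\<forall>\<^sub>F n in sequentially. norm (L2_norm (otri c s) (\<lambda>x. pd j (\<phi> n) x - d j x)) \<le> sobolev_seminorm 1 (otri c s) (\<lambda>x. \<phi> n x - v x)"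
      by simp
  qed
  have "(\<lambda>n. edge_functional c s i (\<lambda>x. \<phi> n x - v x) (\<lambda>j x. pd j (\<phi> n) x - d j x)) \<longlonglongrightarrow> 0"
    by (intro tendsto_edge_functional s L2_diff L\<phi> L l0 d0)
  then have "(\<lambda>n. edge_functional c s i (\<phi> n) (\<lambda>j. pd j (\<phi> n)) - edge_functional c s i v d) \<longlonglongrightarrow> 0"
    unfolding edge_functional_diff[OF s L\<phi>(1) L(1) L\<phi>(2) L(2)] .
  then have lim1: "(\<lambda>n. edge_functional c s i (\<phi> n) (\<lambda>j. pd j (\<phi> n))) \<longlonglongrightarrow> edge_functional c s i v d"
    by (simp add: LIM_zero_iff)
  have \<phi>p: "continuous_on A (\<lambda>t. \<phi> n (?p t))" for n A
    using continuous_on_compose2[OF smooth_continuous[OF \<phi>, of UNIV] continuous_on_linepath[of A]] by auto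
  have L2p: "L2 {0..1} (\<lambda>t. \<phi> n (?p t))" for n
  proof -
    have "integrable ?I (\<lambda>t. (\<phi> n (?p t))\<^sup>2)" "integrable ?I (\<lambda>t. \<phi> n (?p t))"
      by (intro integral_lebesgue_on_continuous(1) continuous_intros \<phi>p compact_Icc)+
    then show ?thesis by (auto simp: L2_real_def)
  qed
  have unit: "{0..1::real} \<in> lmeasurable" "measure lebesgue {0..1::real} = 1" by auto
  have "(\<lambda>n. (LINT t|?I. \<phi> n (?p t)) - (LINT t|?I. g (?p t))) \<longlonglongrightarrow> 0"
  proof (rule Lim_null_comparison[OF _ l2])
    have "norm ((LINT t|?I. \<phi> n (?p t)) - (LINT t|?I. g (?p t))) \<le> L2_norm {0..1} ((\<lambda>x. \<phi> n x - g x) \<circ> ?p)" for n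
    proof -
      have gp: "L2 {0..1} (\<lambda>t. g (?p t))" using g by (simp add: o_def)
      have D: "L2 {0..1} (\<lambda>t. \<phi> n (?p t) - g (?p t))" by (rule L2_diff[OF L2p gp])
      have e: "(LINT t|?I. \<phi> n (?p t)) - (LINT t|?I. g (?p t)) = (LINT t|?I. \<phi> n (?p t) - g (?p t))"
        by (intro Bochner_Integration.integral_diff[symmetric] L2_integrable[OF _ unit(1)] L2p gp)
      have "norm ((LINT t|?I. \<phi> n (?p t)) - (LINT t|?I. g (?p t))) \<le> (LINT t|?I. \<bar>\<phi> n (?p t) - g (?p t)\<bar>)"
        unfolding real_norm_def e by (rule integral_abs_bound)
      also have "\<dots> \<le> L2_norm {0..1} (\<lambda>t. \<phi> n (?p t) - g (?p t))"
        using integral_abs_le_L2_norm[OF D unit(1)] by (simp add: unit(2))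
      finally show ?thesis by (simp add: o_def)
    qed
    then show "\<forall>\<^sub>F n in sequentially. norm ((LINT t|?I. \<phi> n (?p t)) - (LINT t|?I. g (?p t))) \<le> L2_norm {0..1} ((\<lambda>x. \<phi> n x - g x) \<circ> ?p)"
      by simp
  qed
  then have "(\<lambda>n. LINT t|?I. \<phi> n (?p t)) \<longlonglongrightarrow> (LINT t|?I. g (?p t))" by (simp add: LIM_zero_iff)
  then have "(\<lambda>n. 2 * area * (LINT t|?I. \<phi> n (?p t))) \<longlonglongrightarrow> 2 * area * (LINT t|?I. g (?p t))"
    by (intro tendsto_mult tendsto_const)
  then show ?thesis
    using lim1 unfolding edge_functional_smooth[OF s ikl \<phi>] by (metis LIMSEQ_unique)
qed

section \<open>The local consistency error\<close>

lemma lam_moment_1_eq: 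
  assumes s: "s * s = 1" shows "(LINT x|lebesgue_on (otri c s). lam c s i x) = (LINT x|lebesgue_on (otri c s). lam c s k x)"
proof -
  define h where "h = (\<Sum>a\<in>UNIV. \<Sum>b\<in>UNIV. norm (\<omega> a - \<omega> b))"
  have diam: "norm (\<omega> a - \<omega> b) \<le> h" for a b
  proof -
    have "norm (\<omega> a - \<omega> b) \<le> (\<Sum>b\<in>UNIV. norm (\<omega> a - \<omega> b))" by (rule member_le_sum) auto
    also have "\<dots> \<le> h" unfolding h_def by (rule member_le_sum[where f = "\<lambda>a. \<Sum>b\<in>UNIV. norm (\<omega> a - \<omega> b)"]) (auto intro: sum_nonneg)
    finally show ?thesis .
  qed
  \<comment> \<open>The constant has gradient zero, so the bound on differences of moments applies
    with zero on the right.\<close>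
  have "\<bar>lam_moment c s i (\<lambda>_. 1) - lam_moment c s k (\<lambda>_. 1)\<bar> \<le> h * (LINT x|lebesgue_on (otri c s). 0)"
  proof (rule lam_moment_diff_bound[OF s diam])
    show "has_weak_deriv (otri c s) (unit_index j) (\<lambda>_. 1) (\<lambda>_. 0)" for j
      using smooth_imp_has_weak_deriv[OF smooth_const[of 1] open_otri, where j = j] by simp
  qed (auto intro: integrable_smooth_otri[OF s smooth_const])
  then show ?thesis by (simp add: lam_moment_def)
qed

text \<open>The vector \<open>x - vert e\<close> is written in barycentric coordinates, which turns
  the gradient term into moments.\<close>

lemma edge_functional_integrals:
  assumes s: "s * s = 1" and int: "integrable (lebesgue_on (otri c s)) v" "\<And>j. integrable (lebesgue_on (otri c s)) (g j)"
  shows "edge_functional c s e v g = 2 * (LINT x|lebesgue_on (otri c s). v x)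
     + (\<Sum>j\<in>UNIV. \<Sum>l\<in>UNIV. s * (\<omega> l - \<omega> e) $ j * lam_moment c s l (g j))"
proof -
  let ?M = "lebesgue_on (otri c s)"
  have gl: "integrable ?M (\<lambda>x. g j x * lam c s l x)" for j l
    by (rule integrable_mult_smooth[OF int(2) smooth_lam bounded_otri[OF s] sets_otri])
  have x: "(x - vert c s e) $ j * g j x = (\<Sum>l\<in>UNIV. s * (\<omega> l - \<omega> e) $ j * (g j x * lam c s l x))" for x j
  proof -
    have vd: "vert c s m - vert c s e = s *\<^sub>R (\<omega> m - \<omega> e)" for m
      by (simp add: vert_def scaleR_diff_right)
    have "x - vert c s e = (\<Sum>m\<in>UNIV. lam c s m x *\<^sub>R vert c s m) - (\<Sum>m\<in>UNIV. lam c s m x) *\<^sub>R vert c s e"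
      using lam_eq[OF s, of x c] sum_lam[of c s x] by simp
    also have "\<dots> = (\<Sum>m\<in>UNIV. lam c s m x *\<^sub>R (vert c s m - vert c s e))"
      by (simp add: scaleR_sum_left sum_subtractf scaleR_diff_right)
    finally have "x - vert c s e = (\<Sum>m\<in>UNIV. lam c s m x *\<^sub>R (s *\<^sub>R (\<omega> m - \<omega> e)))" unfolding vd .
    then show ?thesis by (simp add: sum_distrib_right sum_distrib_left mult_ac)
  qed
  have "edge_functional c s e v g = (LINT x|?M. 2 * v x + (\<Sum>j\<in>UNIV. \<Sum>l\<in>UNIV. s * (\<omega> l - \<omega> e) $ j * (g j x * lam c s l x)))"
    unfolding edge_functional_def x ..
  also have "\<dots> = 2 * (LINT x|?M. v x) + (\<Sum>j\<in>UNIV. \<Sum>l\<in>UNIV. s * (\<omega> l - \<omega> e) $ j * (LINT x|?M. g j x * lam c s l x))"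
    using int gl by (simp add: Bochner_Integration.integral_sum)
  finally show ?thesis by (simp add: lam_moment_def)
qed

text \<open>The contribution of the scalar \<open>b\<close> drops out because it is the same for the three edges.\<close>

lemma local_consistency:
  assumes s: "s * s = 1"
    and \<sigma>: "\<And>k. integrable (lebesgue_on (otri c s)) (\<lambda>x. \<sigma> x $ k)" and G: "\<And>j k. integrable (lebesgue_on (otri c s)) (G j k)"
    and \<pi>: "\<And>k. integrable (lebesgue_on (otri c s)) (\<lambda>x. \<pi> x $ k)"
    and edges: "\<And>e. (\<Sum>k\<in>UNIV. A e $ k * edge_functional c s e (\<lambda>x. \<pi> x $ k - \<sigma> x $ k) (\<lambda>j x. (if j = k then b else 0) - G j k x)) = 0"
  shows "2 * (\<Sum>k\<in>UNIV. \<tau> $ k * (LINT x|lebesgue_on (otri c s). \<sigma> x $ k - \<pi> x $ k)) =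
    - (\<Sum>i\<in>UNIV. s * (A i \<bullet> \<tau>) * (\<Sum>e\<in>UNIV. (\<omega> i \<bullet> \<omega> e) *
        (\<Sum>j\<in>UNIV. \<Sum>k\<in>UNIV. \<Sum>l\<in>UNIV. A e $ k * (\<omega> l - \<omega> e) $ j * lam_moment c s l (G j k))))"
proof -
  let ?M = "lebesgue_on (otri c s)"
  define E :: plane where "E = (\<chi> k. LINT x|?M. \<sigma> x $ k - \<pi> x $ k)"
  define m where "m = (LINT x|?M. lam c s 1 x)"
  have mom1: "lam_moment c s l (\<lambda>x. 1) = m" for l
    using lam_moment_1_eq[OF s, of c l 1] by (simp add: lam_moment_def m_def)
  have i1: "integrable ?M (\<lambda>x. \<beta>)" for \<beta> :: real
    by (rule integrable_smooth_otri[OF s smooth_const])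
  have mom: "lam_moment c s l (\<lambda>x. (if j = k then b else 0) - G j k x) = (if j = k then b * m else 0) - lam_moment c s l (G j k)" for j k l
  proof -
    have "lam_moment c s l (\<lambda>x. (if j = k then b else 0) - G j k x)
       = (LINT x|?M. (if j = k then b else 0) * (1 * lam c s l x) - G j k x * lam c s l x)"
      unfolding lam_moment_def by (simp add: algebra_simps)
    also have "\<dots> = (if j = k then b else 0) * (LINT x|?M. 1 * lam c s l x) - (LINT x|?M. G j k x * lam c s l x)"
      using integrable_mult_smooth[OF G smooth_lam bounded_otri[OF s] sets_otri] integrable_smooth_otri[OF s smooth_lam] by simp
    finally show ?thesis using mom1[of l] by (simp add: lam_moment_def)
  qed
  define Q where "Q e = (\<Sum>j\<in>UNIV. \<Sum>k\<in>UNIV. \<Sum>l\<in>UNIV. A e $ k * (\<omega> l - \<omega> e) $ j * lam_moment c s l (G j k))" for e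
  have AE: "2 * (A e \<bullet> E) = - s * (2 * b * m) - s * Q e" for e
  proof -
    have "edge_functional c s e (\<lambda>x. \<pi> x $ k - \<sigma> x $ k) (\<lambda>j x. (if j = k then b else 0) - G j k x) =
        - 2 * E $ k + (\<Sum>j\<in>UNIV. \<Sum>l\<in>UNIV. s * (\<omega> l - \<omega> e) $ j * ((if j = k then b * m else 0) - lam_moment c s l (G j k)))" for k
    proof -
      have "(LINT x|?M. \<pi> x $ k - \<sigma> x $ k) = - E $ k"
        using \<sigma> \<pi> by (simp add: E_def)
      then show ?thesis
        using \<sigma> \<pi> G i1 by (subst edge_functional_integrals[OF s]) (simp_all add: mom)
    qed
    then have "0 = (\<Sum>k\<in>UNIV. A e $ k * (- 2 * E $ k + (\<Sum>j\<in>UNIV. \<Sum>l\<in>UNIV. s * (\<omega> l - \<omega> e) $ j * ((if j = k then b * m else 0) - lam_moment c s l (G j k)))))"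
      using edges[of e] by simp
    also have "\<dots> = - 2 * (A e \<bullet> E) + s * (b * m) * (A e \<bullet> ((\<Sum>l\<in>UNIV. \<omega> l) - 3 *\<^sub>R \<omega> e)) - s * Q e"
      unfolding Q_def inner_vec_def by (simp add: sum_2 sum_3 algebra_simps)
    \<comment> \<open>\<open>A e \<bullet> \<omega> e\<close> is 2/3 for every \<open>e\<close>; at
      this point the coefficient of \<open>b\<close> becomes independent of the edge.\<close>
    also have "A e \<bullet> ((\<Sum>l\<in>UNIV. \<omega> l) - 3 *\<^sub>R \<omega> e) = - 2"
      by (simp add: sum_\<omega> inner_diff_right dual)
    finally show ?thesis by (simp add: algebra_simps)
  qed
  have \<omega>E: "2 * (\<omega> i \<bullet> E) = - s * (\<Sum>e\<in>UNIV. (\<omega> i \<bullet> \<omega> e) * Q e)" for i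
  proof -
    have "2 * (\<omega> i \<bullet> E) = 2 * ((\<Sum>e\<in>UNIV. (\<omega> e \<bullet> \<omega> i) *\<^sub>R A e) \<bullet> E)" by (simp only: expand_A)
    also have "\<dots> = (\<Sum>e\<in>UNIV. (\<omega> i \<bullet> \<omega> e) * (2 * (A e \<bullet> E)))"
      by (simp add: inner_sum_left sum_distrib_left inner_commute[of "\<omega> i"] mult_ac)
    also have "\<dots> = - s * (2 * b * m) * (\<omega> i \<bullet> (\<Sum>e\<in>UNIV. \<omega> e)) - s * (\<Sum>e\<in>UNIV. (\<omega> i \<bullet> \<omega> e) * Q e)"
      unfolding AE by (simp add: inner_sum_right sum_3 algebra_simps)
    finally show ?thesis by (simp add: sum_\<omega>)
  qed
  \<comment> \<open>Expanding \<open>\<tau>\<close> in the vectors \<open>\<omega> i\<close> makes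
    its fluxes \<open>A i \<bullet> \<tau>\<close> the coefficients.\<close>
  have "2 * (\<Sum>k\<in>UNIV. \<tau> $ k * E $ k) = 2 * ((\<Sum>i\<in>UNIV. (A i \<bullet> \<tau>) *\<^sub>R \<omega> i) \<bullet> E)"
    by (simp only: expand_\<omega>) (simp add: inner_vec_def)
  also have "\<dots> = (\<Sum>i\<in>UNIV. (A i \<bullet> \<tau>) * (2 * (\<omega> i \<bullet> E)))"
    by (simp add: inner_sum_left sum_distrib_left mult_ac)
  also have "\<dots> = - (\<Sum>i\<in>UNIV. s * (A i \<bullet> \<tau>) * (\<Sum>e\<in>UNIV. (\<omega> i \<bullet> \<omega> e) * Q e))"
    unfolding \<omega>E by (simp add: sum_negf[symmetric] mult_ac)
  finally show ?thesis by (simp add: E_def Q_def)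
qed

text \<open>The leading term of the local consistency error; its argument stands for the moments of the gradient
  of \<open>\<sigma>\<close> against the barycentric coordinate \<open>i\<close>.\<close>

definition mu :: "3 \<Rightarrow> (2 \<Rightarrow> 2 \<Rightarrow> real) \<Rightarrow> real" where
  "mu i M = (3 / 2) * (\<Sum>e\<in>UNIV. (\<omega> i \<bullet> \<omega> e) * (\<Sum>j\<in>UNIV. \<Sum>k\<in>UNIV. A e $ k * \<omega> e $ j * M j k))"

lemma mu_diff: "mu i (\<lambda>j k. M j k - N j k) = mu i M - mu i N"
  by (simp add: mu_def sum_3 sum_2 algebra_simps)

text \<open>Triangles are encoded by centre and orientation, so that crossing edge \<open>i\<close>
  is an involution on all pairs, whether or not the result belongs to the mesh.\<close>

definition nb :: "3 \<Rightarrow> plane \<times> real \<Rightarrow> plane \<times> real" where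
  "nb i x = (fst x - snd x *\<^sub>R \<omega> i, - snd x)"

text \<open>The midpoint of the edge opposite to vertex \<open>i\<close>. Weights are evaluated
  there, where both triangles at the edge see the same value.\<close>

definition mid :: "3 \<Rightarrow> plane \<times> real \<Rightarrow> plane" where
  "mid i x = fst x - (snd x / 2) *\<^sub>R \<omega> i"

lemma nb_nb [simp]: "nb i (nb i x) = x"
  by (simp add: nb_def prod_eq_iff)

lemma mid_nb [simp]: "mid i (nb i x) = mid i x"
  by (simp add: mid_def nb_def algebra_simps flip: scaleR_left_distrib)

end

section \<open>The consistency error\<close>

text \<open>\<open>norm (A i)\<close> is the reciprocal of the height over edge \<open>i\<close>, so
  the last assumption bounds all heights from below by \<open>h / \<rho>\<close>: it is the form in
  which shape regularity is used.\<close>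

locale triangle_frame_size = triangle_frame +
  fixes h \<rho> :: real
  assumes diam: "\<And>a b. norm (\<omega> a - \<omega> b) \<le> h" and h_pos: "0 < h"
    and A_bound: "\<And>i. norm (A i) \<le> \<rho> / h"
begin

lemma rho_pos: "0 < \<rho>"
proof -
  have "0 < norm (A 1)" using A_nonzero by simp
  then have "0 < \<rho> / h" using A_bound[of 1] by linarith
  then show ?thesis using h_pos by (simp add: zero_less_divide_iff)
qed

lemma norm_\<omega>: "norm (\<omega> i) \<le> h"
proof -
  have "3 *\<^sub>R \<omega> i = (\<Sum>k\<in>UNIV. \<omega> i - \<omega> k)"
    using sum_\<omega> by (simp add: sum_subtractf sum_constant_scaleR del: sum_constant)
  then have "3 * norm (\<omega> i) = norm (\<Sum>k\<in>UNIV. \<omega> i - \<omega> k)"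
    by (metis norm_scaleR abs_numeral)
  also have "\<dots> \<le> (\<Sum>k\<in>(UNIV::3 set). h)" by (rule sum_norm_le) (rule diam)
  finally show ?thesis by simp
qed

lemma abs_\<omega>_\<omega>: "\<bar>\<omega> i \<bullet> \<omega> e\<bar> \<le> h\<^sup>2"
proof -
  have "norm (\<omega> i) * norm (\<omega> e) \<le> h * h"
    using h_pos by (intro mult_mono norm_\<omega>) auto
  then show ?thesis
    using Cauchy_Schwarz_ineq2[of "\<omega> i" "\<omega> e"] by (simp add: power2_eq_square)
qed

lemma abs_A_nth: "\<bar>A e $ k\<bar> \<le> \<rho> / h"
  using component_le_norm_cart[of "A e" k] A_bound[of e] by linarith

text \<open>There are three edges \<open>e\<close>, each with a factor \<open>h\<^sup>2\<close> from
  the two vectors \<open>\<omega>\<close>, and \<open>\<rho> / h\<close> from \<open>A e\<close>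
  compensates \<open>h\<close> from \<open>w e\<close>.\<close>

lemma abs_frame_sum_le:
  assumes w: "\<And>e. norm (w e) \<le> h"
  shows "\<bar>\<Sum>e\<in>UNIV. (\<omega> i \<bullet> \<omega> e) * (\<Sum>j\<in>UNIV. \<Sum>k\<in>UNIV. A e $ k * w e $ j * M j k)\<bar> \<le> 3 * h\<^sup>2 * \<rho> * (\<Sum>j\<in>UNIV. \<Sum>k\<in>UNIV. \<bar>M j k\<bar>)"
    (is "\<bar>?S\<bar> \<le> _")
proof -
  have "\<bar>\<Sum>j\<in>UNIV. \<Sum>k\<in>UNIV. A e $ k * w e $ j * M j k\<bar> \<le> \<rho> * (\<Sum>j\<in>UNIV. \<Sum>k\<in>UNIV. \<bar>M j k\<bar>)" for e
  proof -
    have "\<bar>A e $ k * w e $ j * M j k\<bar> \<le> \<rho> * \<bar>M j k\<bar>" for j k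
    proof -
      have "\<bar>A e $ k\<bar> * \<bar>w e $ j\<bar> \<le> (\<rho> / h) * h"
        using abs_A_nth[of e k] component_le_norm_cart[of "w e" j] w[of e] h_pos rho_pos by (intro mult_mono) auto
      then have "\<bar>A e $ k\<bar> * \<bar>w e $ j\<bar> \<le> \<rho>" using h_pos by simp
      then show ?thesis by (simp add: abs_mult mult_right_mono)
    qed
    then have "(\<Sum>j\<in>UNIV. \<Sum>k\<in>UNIV. \<bar>A e $ k * w e $ j * M j k\<bar>) \<le> (\<Sum>j\<in>UNIV. \<Sum>k\<in>UNIV. \<rho> * \<bar>M j k\<bar>)"
      by (intro sum_mono)
    moreover have "\<bar>\<Sum>j\<in>UNIV. \<Sum>k\<in>UNIV. A e $ k * w e $ j * M j k\<bar> \<le> (\<Sum>j\<in>UNIV. \<Sum>k\<in>UNIV. \<bar>A e $ k * w e $ j * M j k\<bar>)"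
      by (intro order_trans[OF sum_abs] sum_mono sum_abs)
    ultimately show ?thesis by (simp add: sum_distrib_left)
  qed
  then have "\<bar>(\<omega> i \<bullet> \<omega> e) * (\<Sum>j\<in>UNIV. \<Sum>k\<in>UNIV. A e $ k * w e $ j * M j k)\<bar> \<le> h\<^sup>2 * (\<rho> * (\<Sum>j\<in>UNIV. \<Sum>k\<in>UNIV. \<bar>M j k\<bar>))" for e
    unfolding abs_mult using abs_\<omega>_\<omega> by (intro mult_mono) auto
  then have "(\<Sum>e\<in>UNIV. \<bar>(\<omega> i \<bullet> \<omega> e) * (\<Sum>j\<in>UNIV. \<Sum>k\<in>UNIV. A e $ k * w e $ j * M j k)\<bar>)
      \<le> (\<Sum>e\<in>(UNIV::3 set). h\<^sup>2 * (\<rho> * (\<Sum>j\<in>UNIV. \<Sum>k\<in>UNIV. \<bar>M j k\<bar>)))"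
    by (intro sum_mono)
  then show ?thesis by (intro order_trans[OF sum_abs]) (simp add: mult.assoc)
qed

text \<open>The factor 3/2 in \<open>mu\<close> times the 3 of the preceding bound is 9/2, rounded
  up to 5.\<close>

lemma abs_mu_le: "\<bar>mu i M\<bar> \<le> 5 * h\<^sup>2 * \<rho> * (\<Sum>j\<in>UNIV. \<Sum>k\<in>UNIV. \<bar>M j k\<bar>)"
proof -
  have "0 \<le> h\<^sup>2 * \<rho> * (\<Sum>j\<in>UNIV. \<Sum>k\<in>UNIV. \<bar>M j k\<bar>)" using rho_pos by (intro mult_nonneg_nonneg sum_nonneg) auto
  then show ?thesis
    using abs_frame_sum_le[of \<omega> i M, OF norm_\<omega>] by (simp add: mu_def abs_mult mult.assoc)
qed

text \<open>In the exact formula the moments against coordinate \<open>l\<close> are replaced by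
  those against coordinate \<open>i\<close>, each at the cost of \<open>h\<close> times the integral
  of \<open>\<Gamma>\<close>; what is left collapses to \<open>mu\<close>. The constant 54 is half
  of 3 times 36, for the three fluxes.\<close>

lemma local_consistency_bound:
  assumes s: "s * s = 1"
    and \<sigma>: "\<And>k. integrable (lebesgue_on (otri c s)) (\<lambda>x. \<sigma> x $ k)" and G: "\<And>j k. integrable (lebesgue_on (otri c s)) (G j k)"
    and wd: "\<And>j k l. has_weak_deriv (otri c s) (unit_index l) (G j k) (g l j k)"
    and g: "\<And>j k l. integrable (lebesgue_on (otri c s)) (g l j k)"
    and \<Gamma>: "integrable (lebesgue_on (otri c s)) \<Gamma>" "\<And>j k x. (\<Sum>l\<in>UNIV. \<bar>g l j k x\<bar>) \<le> \<Gamma> x"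
    and \<pi>: "\<And>k. integrable (lebesgue_on (otri c s)) (\<lambda>x. \<pi> x $ k)"
    and edges: "\<And>e. (\<Sum>k\<in>UNIV. A e $ k * edge_functional c s e (\<lambda>x. \<pi> x $ k - \<sigma> x $ k) (\<lambda>j x. (if j = k then b else 0) - G j k x)) = 0"
  shows "\<bar>(\<Sum>k\<in>UNIV. \<tau> $ k * (LINT x|lebesgue_on (otri c s). \<sigma> x $ k - \<pi> x $ k)) -
      (\<Sum>i\<in>UNIV. s * (A i \<bullet> \<tau>) * mu i (\<lambda>j k. lam_moment c s i (G j k)))\<bar>
    \<le> 54 * \<rho>\<^sup>2 * h\<^sup>2 * norm \<tau> * (LINT x|lebesgue_on (otri c s). \<Gamma> x)"
proof -
  let ?I = "LINT x|lebesgue_on (otri c s). \<Gamma> x"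
  let ?H = "\<lambda>l j k. lam_moment c s l (G j k)"
  have Hd: "\<bar>?H l j k - ?H i j k\<bar> \<le> h * ?I" for i l j k
    by (rule lam_moment_diff_bound[OF s diam wd G g \<Gamma>])
  define D where "D i = (\<Sum>l\<in>UNIV. \<Sum>e\<in>UNIV. (\<omega> i \<bullet> \<omega> e) *
      (\<Sum>j\<in>UNIV. \<Sum>k\<in>UNIV. A e $ k * (\<omega> l - \<omega> e) $ j * (?H l j k - ?H i j k)))" for i
  have R: "(\<Sum>e\<in>UNIV. (\<omega> i \<bullet> \<omega> e) * (\<Sum>j\<in>UNIV. \<Sum>k\<in>UNIV. \<Sum>l\<in>UNIV. X e j k l)) =
      (\<Sum>l\<in>UNIV. \<Sum>e\<in>UNIV. (\<omega> i \<bullet> \<omega> e) * (\<Sum>j\<in>UNIV. \<Sum>k\<in>UNIV. X e j k l))"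
    for i and X :: "3 \<Rightarrow> 2 \<Rightarrow> 2 \<Rightarrow> 3 \<Rightarrow> real"
  proof -
    have "(\<Sum>j\<in>UNIV. \<Sum>k\<in>UNIV. \<Sum>l\<in>UNIV. X e j k l) = (\<Sum>l\<in>UNIV. \<Sum>j\<in>UNIV. \<Sum>k\<in>UNIV. X e j k l)" for e
      by (rule trans[OF sum.cong[OF refl sum.swap] sum.swap])
    then have "(\<Sum>e\<in>UNIV. (\<omega> i \<bullet> \<omega> e) * (\<Sum>j\<in>UNIV. \<Sum>k\<in>UNIV. \<Sum>l\<in>UNIV. X e j k l)) =
      (\<Sum>e\<in>UNIV. \<Sum>l\<in>UNIV. (\<omega> i \<bullet> \<omega> e) * (\<Sum>j\<in>UNIV. \<Sum>k\<in>UNIV. X e j k l))"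
      by (intro sum.cong refl) (simp only: sum_distrib_left)
    then show ?thesis by (rule trans) (rule sum.swap)
  qed
  have mu: "(\<Sum>e\<in>UNIV. (\<omega> i \<bullet> \<omega> e) * (\<Sum>j\<in>UNIV. \<Sum>k\<in>UNIV. \<Sum>l\<in>UNIV. A e $ k * (\<omega> l - \<omega> e) $ j * ?H l j k))
      = D i - 2 * mu i (?H i)" for i
  proof -
    \<comment> \<open>The origin of the factor 3/2 in \<open>mu\<close>: the coefficient -3 is
      halved by the factor 2 on the left of the exact formula.\<close>
    have "(\<Sum>l\<in>UNIV. (\<omega> l - \<omega> e) $ j) = - 3 * \<omega> e $ j" for e j
    proof -
      have "(\<Sum>l\<in>UNIV. \<omega> l) $ j = 0" by (simp add: sum_\<omega>)
      then show ?thesis by (simp add: sum_subtractf)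
    qed
    then have l: "(\<Sum>l\<in>UNIV. A e $ k * (\<omega> l - \<omega> e) $ j * ?H i j k) = - 3 * (A e $ k * \<omega> e $ j * ?H i j k)" for e j k
      by (simp only: sum_distrib_left[symmetric] sum_distrib_right[symmetric])
    have "(\<Sum>e\<in>UNIV. (\<omega> i \<bullet> \<omega> e) * (\<Sum>j\<in>UNIV. \<Sum>k\<in>UNIV. \<Sum>l\<in>UNIV. A e $ k * (\<omega> l - \<omega> e) $ j * ?H l j k))
      = D i + (\<Sum>e\<in>UNIV. (\<omega> i \<bullet> \<omega> e) * (\<Sum>j\<in>UNIV. \<Sum>k\<in>UNIV. \<Sum>l\<in>UNIV. A e $ k * (\<omega> l - \<omega> e) $ j * ?H i j k))"
      unfolding D_def R by (simp only: sum.distrib[symmetric] distrib_left[symmetric] diff_add_cancel)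
    then show ?thesis unfolding l by (simp add: mu_def sum_distrib_left sum_negf mult_ac)
  qed
  \<comment> \<open>36 is 3 values of \<open>l\<close> times the 3 of
    \<open>abs_frame_sum_le\<close> times 4 pairs of \<open>j\<close> and \<open>k\<close>.\<close>
  have Dle: "\<bar>D i\<bar> \<le> 36 * h\<^sup>2 * \<rho> * (h * ?I)" for i
  proof -
    have "\<bar>\<Sum>e\<in>UNIV. (\<omega> i \<bullet> \<omega> e) * (\<Sum>j\<in>UNIV. \<Sum>k\<in>UNIV. A e $ k * (\<omega> l - \<omega> e) $ j * (?H l j k - ?H i j k))\<bar>
        \<le> 3 * h\<^sup>2 * \<rho> * (4 * (h * ?I))" for l
    proof -
      have "(\<Sum>j\<in>(UNIV::2 set). \<Sum>k\<in>(UNIV::2 set). \<bar>?H l j k - ?H i j k\<bar>) \<le> (\<Sum>j\<in>(UNIV::2 set). \<Sum>k\<in>(UNIV::2 set). h * ?I)"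
        by (intro sum_mono Hd)
      then have "(\<Sum>j\<in>(UNIV::2 set). \<Sum>k\<in>(UNIV::2 set). \<bar>?H l j k - ?H i j k\<bar>) \<le> 4 * (h * ?I)" by simp
      then show ?thesis
        using rho_pos by (intro order_trans[OF abs_frame_sum_le[of "\<lambda>e. \<omega> l - \<omega> e", OF diam]] mult_left_mono) auto
    qed
    then have "\<bar>D i\<bar> \<le> (\<Sum>l\<in>(UNIV::3 set). 3 * h\<^sup>2 * \<rho> * (4 * (h * ?I)))"
      unfolding D_def by (rule order_trans[OF sum_abs sum_mono])
    then show ?thesis by simp
  qed
  have eq: "(\<Sum>k\<in>UNIV. \<tau> $ k * (LINT x|lebesgue_on (otri c s). \<sigma> x $ k - \<pi> x $ k)) -
      (\<Sum>i\<in>UNIV. s * (A i \<bullet> \<tau>) * mu i (?H i)) = - (1 / 2) * (\<Sum>i\<in>UNIV. s * (A i \<bullet> \<tau>) * D i)"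
    using local_consistency[OF s \<sigma> G \<pi> edges, of \<tau>] unfolding mu by (simp add: sum_3 algebra_simps)
  have s1: "\<bar>s\<bar> = 1" using s by (auto simp: square_eq_1_iff)
  have "\<bar>s * (A i \<bullet> \<tau>) * D i\<bar> \<le> (\<rho> / h * norm \<tau>) * (36 * h\<^sup>2 * \<rho> * (h * ?I))" for i
  proof -
    have "\<bar>A i \<bullet> \<tau>\<bar> \<le> \<rho> / h * norm \<tau>"
      using Cauchy_Schwarz_ineq2[of "A i" \<tau>] mult_right_mono[OF A_bound[of i], of "norm \<tau>"] by simp
    then show ?thesis
      unfolding abs_mult s1 mult_1 using Dle[of i] rho_pos h_pos by (intro mult_mono) auto
  qed
  then have "\<bar>\<Sum>i\<in>UNIV. s * (A i \<bullet> \<tau>) * D i\<bar> \<le> (\<Sum>i\<in>(UNIV::3 set). (\<rho> / h * norm \<tau>) * (36 * h\<^sup>2 * \<rho> * (h * ?I)))"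
    by (intro order_trans[OF sum_abs] sum_mono)
  also have "\<dots> = 108 * \<rho>\<^sup>2 * h\<^sup>2 * norm \<tau> * ?I"
    using h_pos by (simp add: power2_eq_square field_simps)
  finally show ?thesis unfolding eq by (simp add: abs_mult)
qed

lemma mu_bound: 
  assumes "\<And>j k. \<bar>M j k\<bar> \<le> b" shows "\<bar>mu i M\<bar> \<le> 20 * h\<^sup>2 * \<rho> * b"
proof -
  have "(\<Sum>j\<in>(UNIV::2 set). \<Sum>k\<in>(UNIV::2 set). \<bar>M j k\<bar>) \<le> (\<Sum>j\<in>(UNIV::2 set). \<Sum>k\<in>(UNIV::2 set). b)"
    by (intro sum_mono assms)
  then have "5 * h\<^sup>2 * \<rho> * (\<Sum>j\<in>(UNIV::2 set). \<Sum>k\<in>(UNIV::2 set). \<bar>M j k\<bar>) \<le> 5 * h\<^sup>2 * \<rho> * (4 * b)"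
    using rho_pos by (intro mult_left_mono) auto
  moreover have "5 * h\<^sup>2 * \<rho> * (4 * b) = 20 * h\<^sup>2 * \<rho> * b" by simp
  ultimately show ?thesis using abs_mu_le[of i M] by linarith
qed

lemma mu_diff_bound:
  assumes "\<And>j k. \<bar>M j k - N j k\<bar> \<le> b" shows "\<bar>mu i M - mu i N\<bar> \<le> 20 * h\<^sup>2 * \<rho> * b"
  unfolding mu_diff[symmetric] by (rule mu_bound) (rule assms)

lemma sum_3_abs_le:
  assumes "\<And>j::3. \<bar>f j\<bar> \<le> (b::real)" shows "\<bar>\<Sum>j\<in>UNIV. f j\<bar> \<le> 3 * b"
proof -
  have "\<bar>\<Sum>j\<in>UNIV. f j\<bar> \<le> (\<Sum>j\<in>(UNIV::3 set). b)"
    by (rule order_trans[OF sum_abs sum_mono]) (rule assms)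
  then show ?thesis by simp
qed

text \<open>The fluxes \<open>t i\<close> of a constant field sum to zero, and they change sign across an edge. Writing
  \<open>mu i = Y i + R i\<close>, the sum of \<open>t i * Y i\<close> is therefore small because \<open>Y\<close> depends little on \<open>i\<close>, while
  the \<open>R i\<close> of neighbouring triangles cancel. On a boundary edge of direction \<open>i\<close> the weights \<open>\<chi>'\<close> make
  \<open>R i\<close> vanish, except near the finitely many points where such weights cannot be continuous.\<close>

lemma discrete_bound:
  fixes X :: "(plane \<times> real) set" and \<tau> :: "plane \<times> real \<Rightarrow> plane"
    and H :: "plane \<times> real \<Rightarrow> 3 \<Rightarrow> 2 \<Rightarrow> 2 \<Rightarrow> real" and \<chi>' :: "3 \<Rightarrow> plane \<Rightarrow> real" and w E e :: "plane \<times> real \<Rightarrow> real"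
  assumes "finite X" and orient: "\<And>x. x \<in> X \<Longrightarrow> snd x * snd x = 1"
    and normal: "\<And>x i. x \<in> X \<Longrightarrow> nb i x \<in> X \<Longrightarrow> A i \<bullet> \<tau> (nb i x) = A i \<bullet> \<tau> x"
    and E_e: "\<And>x. x \<in> X \<Longrightarrow> 0 \<le> E x \<and> E x \<le> sqrt area * e x"
    and H_diff: "\<And>x l i j k. x \<in> X \<Longrightarrow> \<bar>H x l j k - H x i j k\<bar> \<le> h * E x"
    and H_nb: "\<And>x i j k. x \<in> X \<Longrightarrow> nb i x \<in> X \<Longrightarrow> \<bar>H x i j k - H (nb i x) i j k\<bar> \<le> h * (E x + E (nb i x))"
    and H_M: "\<And>x i j k. x \<in> X \<Longrightarrow> \<bar>H x i j k\<bar> \<le> M * area"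
    and \<chi>': "\<And>j p. 0 \<le> \<chi>' j p \<and> \<chi>' j p \<le> 1"
    and w: "\<And>x i k j. x \<in> X \<Longrightarrow> \<bar>\<chi>' j (mid i x) - \<chi>' j (mid k x)\<bar> \<le> w x"
    and bd: "\<And>x i. x \<in> X \<Longrightarrow> nb i x \<notin> X \<Longrightarrow> (\<forall>j. \<chi>' j (mid i x) = (if j = i then 1 else 0)) \<or> 1 \<le> w x"
  shows "\<bar>\<Sum>x\<in>X. \<Sum>i\<in>UNIV. snd x * (A i \<bullet> \<tau> x) * mu i (H x i)\<bar> \<le>
    360 * \<rho>\<^sup>2 * sqrt (\<Sum>x\<in>X. area * (norm (\<tau> x))\<^sup>2) *
      (h\<^sup>2 * sqrt (\<Sum>x\<in>X. (e x)\<^sup>2) + h * M * sqrt (\<Sum>x\<in>X. area * (w x)\<^sup>2))"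
proof -
  define t where "t i x = snd x * (A i \<bullet> \<tau> x)" for i x
  define Y where "Y i x = (\<Sum>j\<in>UNIV. \<chi>' j (mid i x) * mu j (H x i))" for i x
  define R where "R i x = (\<Sum>j\<in>UNIV. ((if j = i then 1 else 0) - \<chi>' j (mid i x)) * mu j (H x i))" for i x
  \<comment> \<open>The constant by which \<open>mu\<close> is bounded in terms of the largest entry
    of its argument.\<close>
  define q where "q = 20 * h\<^sup>2 * \<rho>"
  have q: "0 < q" using h_pos rho_pos by (simp add: q_def)
  have w0: "0 \<le> w x" if "x \<in> X" for x using w[OF that, of 1 1 1] by simp
  have Ma: "0 \<le> M * area" if "x \<in> X" for x using order_trans[OF abs_ge_zero H_M[OF that]] .
  have t_le: "\<bar>t i x\<bar> \<le> \<rho> / h * norm (\<tau> x)" if "x \<in> X" for i x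
  proof -
    have "\<bar>snd x\<bar> = 1" using orient[OF that] by (auto simp: square_eq_1_iff)
    then have "\<bar>t i x\<bar> = \<bar>A i \<bullet> \<tau> x\<bar>" by (simp add: t_def abs_mult)
    also have "\<dots> \<le> norm (A i) * norm (\<tau> x)" by (rule Cauchy_Schwarz_ineq2)
    also have "\<dots> \<le> \<rho> / h * norm (\<tau> x)" by (rule mult_right_mono[OF A_bound]) simp
    finally show ?thesis .
  qed
  have t_sum: "(\<Sum>i\<in>UNIV. t i x) = 0" for x
  proof -
    have "(\<Sum>i\<in>UNIV. t i x) = snd x * ((\<Sum>i\<in>UNIV. A i) \<bullet> \<tau> x)"
      by (simp add: t_def inner_sum_left sum_distrib_left)
    then show ?thesis by (simp add: sum_A)
  qed
  have mu_Y_R: "mu i (H x i) = Y i x + R i x" for i x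
  proof -
    have "Y i x + R i x = (\<Sum>j\<in>UNIV. (if j = i then 1 else 0) * mu j (H x i))"
      unfolding Y_def R_def sum.distrib[symmetric] by (simp add: algebra_simps)
    also have "\<dots> = (\<Sum>j\<in>UNIV. if j = i then mu j (H x i) else 0)"
      by (rule sum.cong) auto
    finally show ?thesis by simp
  qed
  \<comment> \<open>The difference of products is split: changing the moment costs
    \<open>h * E x\<close>, and changing the weight costs \<open>w x\<close> times the bound
    \<open>M * area\<close> on the moments.\<close>
  have Y_diff: "\<bar>Y i x - Y k x\<bar> \<le> 3 * q * (h * E x + w x * (M * area))" if x: "x \<in> X" for i k x
  proof -
    have "\<bar>\<chi>' j (mid i x) * mu j (H x i) - \<chi>' j (mid k x) * mu j (H x k)\<bar> \<le> q * (h * E x + w x * (M * area))" for j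
    proof -
      have "\<chi>' j (mid i x) * mu j (H x i) - \<chi>' j (mid k x) * mu j (H x k) =
          \<chi>' j (mid i x) * (mu j (H x i) - mu j (H x k)) + (\<chi>' j (mid i x) - \<chi>' j (mid k x)) * mu j (H x k)"
        by (simp add: algebra_simps)
      also have "\<bar>\<dots>\<bar> \<le> 1 * (q * (h * E x)) + w x * (q * (M * area))"
        unfolding q_def using \<chi>'[of j "mid i x"] w0[OF x] H_diff[OF x] H_M[OF x]
        by (intro order_trans[OF abs_triangle_ineq] add_mono)
          (simp_all only: abs_mult, intro mult_mono mu_diff_bound mu_bound w x; simp)+
      finally show ?thesis by (simp add: algebra_simps)
    qed
    then have "\<bar>\<Sum>j\<in>UNIV. \<chi>' j (mid i x) * mu j (H x i) - \<chi>' j (mid k x) * mu j (H x k)\<bar> \<le> 3 * (q * (h * E x + w x * (M * area)))"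
      by (rule sum_3_abs_le)
    then show ?thesis
      unfolding Y_def sum_subtractf[symmetric] by (simp only: mult.assoc)
  qed
  have Y_sum: "\<bar>\<Sum>i\<in>UNIV. t i x * Y i x\<bar> \<le> 180 * \<rho>\<^sup>2 * h * norm (\<tau> x) * (h * E x + w x * (M * area))" if x: "x \<in> X" for x
  proof -
    \<comment> \<open>As the fluxes sum to zero, a quantity common to the three edges may be
      subtracted. The constant is 180 = 3 * 3 * 20.\<close>
    have "(\<Sum>i\<in>UNIV. t i x * Y i x) = (\<Sum>i\<in>UNIV. t i x * (Y i x - Y 1 x)) + (\<Sum>i\<in>UNIV. t i x) * Y 1 x"
      by (simp add: sum_3 algebra_simps)
    also have "\<dots> = (\<Sum>i\<in>UNIV. t i x * (Y i x - Y 1 x))" by (simp add: t_sum)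
    finally have eq: "(\<Sum>i\<in>UNIV. t i x * Y i x) = (\<Sum>i\<in>UNIV. t i x * (Y i x - Y 1 x))" .
    have "\<bar>t i x * (Y i x - Y 1 x)\<bar> \<le> (\<rho> / h * norm (\<tau> x)) * (3 * q * (h * E x + w x * (M * area)))" for i
      unfolding abs_mult using t_le[OF x] Y_diff[OF x] rho_pos h_pos by (intro mult_mono) auto
    from sum_3_abs_le[OF this] have "\<bar>\<Sum>i\<in>UNIV. t i x * (Y i x - Y 1 x)\<bar> \<le> 3 * ((\<rho> / h * norm (\<tau> x)) * (3 * q * (h * E x + w x * (M * area))))" .
    also have "\<dots> = 180 * \<rho>\<^sup>2 * h * norm (\<tau> x) * (h * E x + w x * (M * area))"
      using h_pos by (simp add: q_def power2_eq_square field_simps)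
    finally show ?thesis unfolding eq .
  qed
  define P where "P x = norm (\<tau> x) * E x" for x
  define W where "W x = norm (\<tau> x) * (w x * (M * area))" for x
  have W0: "0 \<le> W x" if "x \<in> X" for x using w0[OF that] Ma[OF that] by (simp add: W_def)
  define I where "I i = {x \<in> X. nb i x \<in> X}" for i
  have I: "finite (I i)" "I i \<subseteq> X" "nb i ` I i = I i" for i
  proof -
    show "finite (I i)" "I i \<subseteq> X" using \<open>finite X\<close> by (auto simp: I_def)
    show "nb i ` I i = I i"
    proof
      show "nb i ` I i \<subseteq> I i" by (auto simp: I_def)
      show "I i \<subseteq> nb i ` I i"
      proof
        fix x assume "x \<in> I i"
        then have "nb i x \<in> I i" by (simp add: I_def)
        then have "nb i (nb i x) \<in> nb i ` I i" by (rule imageI)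
        then show "x \<in> nb i ` I i" by simp
      qed
    qed
  qed
  have inj: "inj_on (nb i) (I i)" for i by (rule inj_on_inverseI[of _ "nb i"]) simp
  have reindex: "(\<Sum>x\<in>I i. f (nb i x)) = (\<Sum>x\<in>I i. f x)" for i and f :: "plane \<times> real \<Rightarrow> real"
    using sum.reindex[OF inj, of f i] I(3)[of i] by simp
  \<comment> \<open>\<open>nb i\<close> permutes the triangles with a neighbour across edge
    \<open>i\<close>, reverses the flux and fixes the midpoint. Averaging the sum with its reindexed
    copy leaves differences of moments with common weights, hence 30 as half of 60.\<close>
  have R_int: "\<bar>\<Sum>x\<in>I i. t i x * R i x\<bar> \<le> 30 * \<rho>\<^sup>2 * h\<^sup>2 * ((\<Sum>x\<in>I i. norm (\<tau> x) * E x) + (\<Sum>x\<in>I i. norm (\<tau> x) * E (nb i x)))" for i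
  proof -
    have tn: "t i (nb i x) = - t i x" if "x \<in> I i" for x
      using normal[of x i] that by (simp add: I_def t_def nb_def)
    have "2 * (\<Sum>x\<in>I i. t i x * R i x) = (\<Sum>x\<in>I i. t i x * R i x) + (\<Sum>x\<in>I i. t i (nb i x) * R i (nb i x))"
      unfolding reindex[of "\<lambda>x. t i x * R i x"] by simp
    also have "\<dots> = (\<Sum>x\<in>I i. t i x * (R i x - R i (nb i x)))"
      unfolding sum.distrib[symmetric] by (rule sum.cong) (simp_all add: tn algebra_simps)
    finally have eq: "2 * \<bar>\<Sum>x\<in>I i. t i x * R i x\<bar> = \<bar>\<Sum>x\<in>I i. t i x * (R i x - R i (nb i x))\<bar>"
      by (metis abs_mult abs_numeral)
    have "\<bar>t i x * (R i x - R i (nb i x))\<bar> \<le> 60 * \<rho>\<^sup>2 * h\<^sup>2 * (norm (\<tau> x) * E x + norm (\<tau> x) * E (nb i x))" if xI: "x \<in> I i" for x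
    proof -
      have x: "x \<in> X" "nb i x \<in> X" using xI by (auto simp: I_def)
      have "R i x - R i (nb i x) = (\<Sum>j\<in>UNIV. ((if j = i then 1 else 0) - \<chi>' j (mid i x)) * (mu j (H x i) - mu j (H (nb i x) i)))"
        unfolding R_def mid_nb sum_subtractf[symmetric] by (simp add: algebra_simps)
      also have "\<bar>\<dots>\<bar> \<le> 3 * (q * (h * (E x + E (nb i x))))"
      proof (rule sum_3_abs_le)
        fix j
        have "\<bar>(if j = i then 1 else 0) - \<chi>' j (mid i x)\<bar> \<le> 1" using \<chi>'[of j "mid i x"] by auto
        moreover have "\<bar>mu j (H x i) - mu j (H (nb i x) i)\<bar> \<le> q * (h * (E x + E (nb i x)))"
          unfolding q_def by (rule mu_diff_bound) (rule H_nb[OF x])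
        ultimately have "\<bar>(if j = i then 1 else 0) - \<chi>' j (mid i x)\<bar> * \<bar>mu j (H x i) - mu j (H (nb i x) i)\<bar> \<le> 1 * (q * (h * (E x + E (nb i x))))"
          by (rule mult_mono) auto
        then show "\<bar>((if j = i then 1 else 0) - \<chi>' j (mid i x)) * (mu j (H x i) - mu j (H (nb i x) i))\<bar> \<le> q * (h * (E x + E (nb i x)))"
          by (simp add: abs_mult)
      qed
      finally have "\<bar>t i x * (R i x - R i (nb i x))\<bar> \<le> (\<rho> / h * norm (\<tau> x)) * (3 * (q * (h * (E x + E (nb i x)))))"
        unfolding abs_mult using t_le[OF x(1)] rho_pos h_pos by (intro mult_mono) auto
      also have "\<dots> = 60 * \<rho>\<^sup>2 * h\<^sup>2 * (norm (\<tau> x) * E x + norm (\<tau> x) * E (nb i x))"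
        using h_pos by (simp add: q_def power2_eq_square field_simps)
      finally show ?thesis .
    qed
    then have "\<bar>\<Sum>x\<in>I i. t i x * (R i x - R i (nb i x))\<bar> \<le> (\<Sum>x\<in>I i. 60 * \<rho>\<^sup>2 * h\<^sup>2 * (norm (\<tau> x) * E x + norm (\<tau> x) * E (nb i x)))"
      by (rule order_trans[OF sum_abs sum_mono])
    then show ?thesis
      using eq by (simp add: sum_distrib_left[symmetric] sum.distrib)
  qed
  \<comment> \<open>Either the weights at the midpoint single out \<open>i\<close>, and then
    \<open>R i x\<close> is zero, or \<open>w x\<close> is at least 1 and may be inserted as a
    factor.\<close>
  have R_bd: "\<bar>t i x * R i x\<bar> \<le> 60 * \<rho>\<^sup>2 * h * W x" if x: "x \<in> X - I i" for i x
  proof (cases "\<forall>j. \<chi>' j (mid i x) = (if j = i then 1 else 0)")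
    case True
    then show ?thesis using W0[of x] x rho_pos h_pos by (simp add: R_def)
  next
    case False
    have xX: "x \<in> X" "nb i x \<notin> X" using x by (auto simp: I_def)
    then have w1: "1 \<le> w x" using bd False by blast
    have "\<bar>R i x\<bar> \<le> 3 * (q * (M * area))"
      unfolding R_def
    proof (rule sum_3_abs_le)
      fix j
      have "\<bar>(if j = i then 1 else 0) - \<chi>' j (mid i x)\<bar> \<le> 1" using \<chi>'[of j "mid i x"] by auto
      moreover have "\<bar>mu j (H x i)\<bar> \<le> q * (M * area)"
        unfolding q_def by (rule mu_bound) (rule H_M[OF xX(1)])
      ultimately have "\<bar>(if j = i then 1 else 0) - \<chi>' j (mid i x)\<bar> * \<bar>mu j (H x i)\<bar> \<le> 1 * (q * (M * area))"
        by (rule mult_mono) auto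
      then show "\<bar>((if j = i then 1 else 0) - \<chi>' j (mid i x)) * mu j (H x i)\<bar> \<le> q * (M * area)"
        by (simp add: abs_mult)
    qed
    then have "\<bar>t i x * R i x\<bar> \<le> (\<rho> / h * norm (\<tau> x)) * (3 * (q * (M * area)))"
      unfolding abs_mult using t_le[OF xX(1)] rho_pos h_pos by (intro mult_mono) auto
    also have "\<dots> = 60 * \<rho>\<^sup>2 * h * (norm (\<tau> x) * (1 * (M * area)))"
      using h_pos by (simp add: q_def power2_eq_square field_simps)
    also have "\<dots> \<le> 60 * \<rho>\<^sup>2 * h * (norm (\<tau> x) * (w x * (M * area)))"
      using w1 Ma[OF xX(1)] h_pos by (intro mult_left_mono mult_right_mono) auto
    finally show ?thesis by (simp add: W_def)
  qed
  have T2: "(\<Sum>x\<in>X. (sqrt area * norm (\<tau> x))\<^sup>2) = (\<Sum>x\<in>X. area * (norm (\<tau> x))\<^sup>2)"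
    using area_pos by (simp add: power_mult_distrib)
  let ?T = "sqrt (\<Sum>x\<in>X. area * (norm (\<tau> x))\<^sup>2)" and ?\<Gamma> = "sqrt (\<Sum>x\<in>X. (e x)\<^sup>2)" and ?W = "sqrt (\<Sum>x\<in>X. area * (w x)\<^sup>2)"
  have sub: "sqrt (\<Sum>x\<in>J. (f x)\<^sup>2) \<le> sqrt (\<Sum>x\<in>X. (f x)\<^sup>2)" if "J \<subseteq> X" for J and f :: "plane \<times> real \<Rightarrow> real"
    using that \<open>finite X\<close> by (intro real_sqrt_le_mono sum_mono2) auto
  \<comment> \<open>Cauchy--Schwarz with one factor \<open>sqrt area\<close> put to the norm of
    \<open>\<tau>\<close>. The map \<open>f\<close> is the identity or \<open>nb i\<close>; being
    injective it does not enlarge the sum of squares.\<close>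
  have PE: "(\<Sum>x\<in>J. norm (\<tau> x) * E (f x)) \<le> ?T * ?\<Gamma>" if J: "J \<subseteq> X" "f ` J \<subseteq> X" "inj_on f J" for J f
  proof -
    have "(\<Sum>x\<in>J. norm (\<tau> x) * E (f x)) \<le> (\<Sum>x\<in>J. (sqrt area * norm (\<tau> x)) * e (f x))"
    proof (rule sum_mono)
      fix x assume "x \<in> J"
      then have "f x \<in> X" using J by auto
      then have "norm (\<tau> x) * E (f x) \<le> norm (\<tau> x) * (sqrt area * e (f x))"
        using E_e by (intro mult_left_mono) auto
      then show "norm (\<tau> x) * E (f x) \<le> (sqrt area * norm (\<tau> x)) * e (f x)" by (simp add: mult_ac)
    qed
    also have "\<dots> \<le> sqrt (\<Sum>x\<in>J. (sqrt area * norm (\<tau> x))\<^sup>2) * sqrt (\<Sum>x\<in>J. (e (f x))\<^sup>2)"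
      by (rule cauchy_schwarz_sum)
    also have "(\<Sum>x\<in>J. (e (f x))\<^sup>2) = (\<Sum>x\<in>f ` J. (e x)\<^sup>2)"
      by (simp add: sum.reindex[OF J(3)])
    also have "sqrt (\<Sum>x\<in>J. (sqrt area * norm (\<tau> x))\<^sup>2) * sqrt (\<Sum>x\<in>f ` J. (e x)\<^sup>2) \<le> ?T * ?\<Gamma>"
      unfolding T2[symmetric] by (intro mult_mono sub J real_sqrt_ge_zero sum_nonneg) auto
    finally show ?thesis .
  qed
  have WW: "(\<Sum>x\<in>X. W x) \<le> M * ?T * ?W"
  proof (cases "X = {}")
    case False
    then obtain x0 where "x0 \<in> X" by auto
    then have "0 \<le> M" using Ma[of x0] area_pos by (simp add: zero_le_mult_iff)
    have "(\<Sum>x\<in>X. W x) = M * (\<Sum>x\<in>X. (sqrt area * norm (\<tau> x)) * (sqrt area * w x))"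
      unfolding sum_distrib_left
    proof (rule sum.cong)
      fix x
      have "W x = M * ((sqrt area * sqrt area) * norm (\<tau> x) * w x)" using area_pos by (simp add: W_def)
      then show "W x = M * ((sqrt area * norm (\<tau> x)) * (sqrt area * w x))" by (simp only: mult_ac)
    qed simp
    also have "\<dots> \<le> M * (sqrt (\<Sum>x\<in>X. (sqrt area * norm (\<tau> x))\<^sup>2) * sqrt (\<Sum>x\<in>X. (sqrt area * w x)\<^sup>2))"
      using \<open>0 \<le> M\<close> by (intro mult_left_mono cauchy_schwarz_sum)
    finally show ?thesis
      unfolding T2 using area_pos by (simp add: power_mult_distrib mult.assoc)
  qed simp
  have "(\<Sum>x\<in>X. \<Sum>i\<in>UNIV. snd x * (A i \<bullet> \<tau> x) * mu i (H x i)) =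
      (\<Sum>x\<in>X. \<Sum>i\<in>UNIV. t i x * Y i x) + (\<Sum>i\<in>UNIV. \<Sum>x\<in>X. t i x * R i x)"
    unfolding sum.swap[of _ X UNIV] sum.distrib[symmetric] by (simp add: t_def mu_Y_R distrib_left)
  also have "(\<Sum>i\<in>UNIV. \<Sum>x\<in>X. t i x * R i x) = (\<Sum>i\<in>UNIV. (\<Sum>x\<in>I i. t i x * R i x) + (\<Sum>x\<in>X - I i. t i x * R i x))"
    by (intro sum.cong refl) (rule trans[OF sum.subset_diff[OF I(2) \<open>finite X\<close>] add.commute])
  finally have total: "(\<Sum>x\<in>X. \<Sum>i\<in>UNIV. snd x * (A i \<bullet> \<tau> x) * mu i (H x i)) = (\<Sum>x\<in>X. \<Sum>i\<in>UNIV. t i x * Y i x) +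
      (\<Sum>i\<in>UNIV. (\<Sum>x\<in>I i. t i x * R i x) + (\<Sum>x\<in>X - I i. t i x * R i x))" .
  have b1: "\<bar>\<Sum>x\<in>X. \<Sum>i\<in>UNIV. t i x * Y i x\<bar> \<le> 180 * \<rho>\<^sup>2 * (h\<^sup>2 * (?T * ?\<Gamma>) + h * (M * ?T * ?W))"
  proof -
    have "\<bar>\<Sum>x\<in>X. \<Sum>i\<in>UNIV. t i x * Y i x\<bar> \<le> (\<Sum>x\<in>X. 180 * \<rho>\<^sup>2 * h * norm (\<tau> x) * (h * E x + w x * (M * area)))"
      by (rule order_trans[OF sum_abs sum_mono]) (rule Y_sum)
    also have "\<dots> = 180 * \<rho>\<^sup>2 * (h\<^sup>2 * (\<Sum>x\<in>X. norm (\<tau> x) * E (id x)) + h * (\<Sum>x\<in>X. W x))"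
      by (simp add: sum_distrib_left sum.distrib W_def power2_eq_square algebra_simps)
    also have "\<dots> \<le> 180 * \<rho>\<^sup>2 * (h\<^sup>2 * (?T * ?\<Gamma>) + h * (M * ?T * ?W))"
      using h_pos by (intro mult_left_mono add_mono PE WW) auto
    finally show ?thesis .
  qed
  have b2: "\<bar>(\<Sum>x\<in>I i. t i x * R i x) + (\<Sum>x\<in>X - I i. t i x * R i x)\<bar> \<le> 60 * \<rho>\<^sup>2 * (h\<^sup>2 * (?T * ?\<Gamma>) + h * (M * ?T * ?W))" for i
  proof -
    have "\<bar>\<Sum>x\<in>I i. t i x * R i x\<bar> \<le> 30 * \<rho>\<^sup>2 * h\<^sup>2 * ((\<Sum>x\<in>I i. norm (\<tau> x) * E (id x)) + (\<Sum>x\<in>I i. norm (\<tau> x) * E (nb i x)))"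
      using R_int[of i] by simp
    also have "\<dots> \<le> 30 * \<rho>\<^sup>2 * h\<^sup>2 * (?T * ?\<Gamma> + ?T * ?\<Gamma>)"
      using I(2)[of i] I(3)[of i] inj[of i] by (intro mult_left_mono add_mono PE) auto
    finally have 1: "\<bar>\<Sum>x\<in>I i. t i x * R i x\<bar> \<le> 60 * \<rho>\<^sup>2 * (h\<^sup>2 * (?T * ?\<Gamma>))" by (simp add: mult_ac)
    have "\<bar>\<Sum>x\<in>X - I i. t i x * R i x\<bar> \<le> (\<Sum>x\<in>X - I i. 60 * \<rho>\<^sup>2 * h * W x)"
      by (rule order_trans[OF sum_abs sum_mono]) (rule R_bd)
    also have "\<dots> \<le> (\<Sum>x\<in>X. 60 * \<rho>\<^sup>2 * h * W x)"
      using \<open>finite X\<close> W0 h_pos by (intro sum_mono2) auto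
    also have "\<dots> = 60 * \<rho>\<^sup>2 * h * (\<Sum>x\<in>X. W x)" by (simp add: sum_distrib_left)
    also have "\<dots> \<le> 60 * \<rho>\<^sup>2 * h * (M * ?T * ?W)" using WW h_pos by (intro mult_left_mono) auto
    finally have 2: "\<bar>\<Sum>x\<in>X - I i. t i x * R i x\<bar> \<le> 60 * \<rho>\<^sup>2 * (h * (M * ?T * ?W))" by (simp add: mult_ac)
    show ?thesis using abs_triangle_ineq[of "\<Sum>x\<in>I i. t i x * R i x" "\<Sum>x\<in>X - I i. t i x * R i x"] 1 2
      unfolding distrib_left by linarith
  qed
  \<comment> \<open>360 is 180 from \<open>Y\<close> and 60 from \<open>R\<close> for each of the
    three directions.\<close>
  have "\<bar>\<Sum>x\<in>X. \<Sum>i\<in>UNIV. snd x * (A i \<bullet> \<tau> x) * mu i (H x i)\<bar> \<le>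
      180 * \<rho>\<^sup>2 * (h\<^sup>2 * (?T * ?\<Gamma>) + h * (M * ?T * ?W)) + 3 * (60 * \<rho>\<^sup>2 * (h\<^sup>2 * (?T * ?\<Gamma>) + h * (M * ?T * ?W)))"
    unfolding total by (rule order_trans[OF abs_triangle_ineq add_mono[OF b1 sum_3_abs_le[OF b2]]])
  also have "\<dots> = 360 * \<rho>\<^sup>2 * ?T * (h\<^sup>2 * ?\<Gamma> + h * M * ?W)" by (simp add: algebra_simps)
  finally show ?thesis .
qed

end

section \<open>Cutoffs adapted to the boundary\<close>

definition cross2 :: "plane \<Rightarrow> plane \<Rightarrow> real" where
  "cross2 u v = u $ 1 * v $ 2 - u $ 2 * v $ 1"

lemma abs_cross2_le: "\<bar>cross2 u v\<bar> \<le> 2 * norm u * norm v"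
proof -
  have "\<bar>cross2 u v\<bar> \<le> \<bar>u $ 1\<bar> * \<bar>v $ 2\<bar> + \<bar>u $ 2\<bar> * \<bar>v $ 1\<bar>"
    unfolding cross2_def by (simp add: abs_mult[symmetric] abs_triangle_ineq4)
  also have "\<dots> \<le> norm u * norm v + norm u * norm v"
    by (intro add_mono mult_mono component_le_norm_cart) auto
  finally show ?thesis by simp
qed

lemma cross2_nonzero:
  assumes "f \<bullet> u = 0" "f \<bullet> v \<noteq> 0" "u \<noteq> 0" shows "cross2 u v \<noteq> 0"
proof
  assume c: "cross2 u v = 0"
  have "u $ 1 * (f \<bullet> v) = 0" "u $ 2 * (f \<bullet> v) = 0"
    using c assms(1) unfolding cross2_def inner_vec_def sum_2 inner_real_def by algebra+
  then have "u $ 1 = 0" "u $ 2 = 0" using assms(2) by auto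
  then show False using assms(3) by (simp add: vec_eq_iff forall_2)
qed

lemma closed_segment_diff:
  assumes "y \<in> closed_segment a b" "z \<in> closed_segment a b"
  obtains \<alpha> where "y - z = \<alpha> *\<^sub>R (b - a)"
proof -
  obtain s t where y: "y = (1 - s) *\<^sub>R a + s *\<^sub>R b" and z: "z = (1 - t) *\<^sub>R a + t *\<^sub>R b"
    using assms by (auto simp: in_segment)
  have "y - z = (s - t) *\<^sub>R (b - a)" unfolding y z by (simp add: algebra_simps)
  then show ?thesis by (rule that)
qed

text \<open>If the segments meet in \<open>z\<close>, their points \<open>y\<close> and
  \<open>y'\<close> nearest to \<open>x\<close> cannot be close to each other and far from
  \<open>z\<close>: taking \<open>cross2\<close> of \<open>y - y'\<close> with the second direction
  isolates the displacement along the first, which bounds the distance from \<open>y\<close> to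
  \<open>z\<close> by a multiple of that from \<open>y\<close> to \<open>y'\<close>. The multiple
  depends on the angle. Disjoint segments have a positive gap.\<close>

lemma transversal_segments_distance:
  fixes a b a' b' :: plane
  assumes "cross2 (b - a) (b' - a') \<noteq> 0" and "bounded W"
  shows "\<exists>z. \<exists>c>0. \<forall>x\<in>W. c * dist x z \<le> infdist x (closed_segment a b) + infdist x (closed_segment a' b')"
proof (cases "closed_segment a b \<inter> closed_segment a' b' = {}")
  case True
  obtain e where e: "e > 0" "\<And>x y. x \<in> closed_segment a b \<Longrightarrow> y \<in> closed_segment a' b' \<Longrightarrow> e \<le> dist x y"
    using separate_compact_closed[OF compact_segment closed_segment True] by blast
  obtain D where D: "\<And>x. x \<in> W \<Longrightarrow> dist x 0 \<le> D" "0 < D"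
    using \<open>bounded W\<close> unfolding bounded_pos by (auto simp: dist_norm)
  \<comment> \<open>Without a common point any reference point serves, because \<open>W\<close> is
    bounded; \<open>0\<close> is taken.\<close>
  have "(e / D) * dist x 0 \<le> infdist x (closed_segment a b) + infdist x (closed_segment a' b')" if x: "x \<in> W" for x
  proof -
    obtain y where y: "y \<in> closed_segment a b" "infdist x (closed_segment a b) = dist x y"
      using infdist_attains_inf[OF closed_segment, of a b x] by auto
    obtain y' where y': "y' \<in> closed_segment a' b'" "infdist x (closed_segment a' b') = dist x y'"
      using infdist_attains_inf[OF closed_segment, of a' b' x] by auto
    have "(e / D) * dist x 0 \<le> (e / D) * D" using e D x by (intro mult_left_mono) auto
    also have "\<dots> \<le> dist y y'" using e y y' D by simp
    also have "\<dots> \<le> dist x y + dist x y'" by (rule dist_triangle3)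
    finally show ?thesis using y y' by simp
  qed
  then show ?thesis using e D by (intro exI[of _ 0] exI[of _ "e / D"]) auto
next
  case False
  then obtain z where z: "z \<in> closed_segment a b" "z \<in> closed_segment a' b'" by auto
  let ?u = "b - a" and ?v = "b' - a'"
  define K where "K = 2 * norm ?u * norm ?v / \<bar>cross2 ?u ?v\<bar>"
  have K: "0 \<le> K" by (simp add: K_def)
  have "(1 / (1 + K)) * dist x z \<le> infdist x (closed_segment a b) + infdist x (closed_segment a' b')" for x
  proof -
    obtain y where y: "y \<in> closed_segment a b" "infdist x (closed_segment a b) = dist x y"
      using infdist_attains_inf[OF closed_segment, of a b x] by auto
    obtain y' where y': "y' \<in> closed_segment a' b'" "infdist x (closed_segment a' b') = dist x y'"
      using infdist_attains_inf[OF closed_segment, of a' b' x] by auto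
    obtain \<alpha> where \<alpha>: "y - z = \<alpha> *\<^sub>R ?u" using closed_segment_diff[OF y(1) z(1)] .
    obtain \<beta> where \<beta>: "y' - z = \<beta> *\<^sub>R ?v" using closed_segment_diff[OF y'(1) z(2)] .
    have "y - y' = \<alpha> *\<^sub>R ?u - \<beta> *\<^sub>R ?v" using \<alpha> \<beta> by (metis diff_diff_eq2 diff_add_cancel add_diff_cancel_right')
    moreover have "cross2 (\<alpha> *\<^sub>R u - \<beta> *\<^sub>R v) v = \<alpha> * cross2 u v" for u v
      by (simp add: cross2_def algebra_simps)
    ultimately have "cross2 (y - y') ?v = \<alpha> * cross2 ?u ?v" by simp
    then have "\<bar>\<alpha>\<bar> * \<bar>cross2 ?u ?v\<bar> \<le> 2 * norm (y - y') * norm ?v"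
      using abs_cross2_le[of "y - y'" ?v] by (simp add: abs_mult)
    then have "\<bar>\<alpha>\<bar> \<le> 2 * norm (y - y') * norm ?v / \<bar>cross2 ?u ?v\<bar>"
      using assms(1) by (simp add: field_simps)
    then have "\<bar>\<alpha>\<bar> * norm ?u \<le> (2 * norm (y - y') * norm ?v / \<bar>cross2 ?u ?v\<bar>) * norm ?u"
      by (rule mult_right_mono) simp
    moreover have "dist y z = \<bar>\<alpha>\<bar> * norm ?u" using \<alpha> by (simp only: dist_norm norm_scaleR)
    ultimately have yz: "dist y z \<le> K * dist y y'" by (simp add: dist_norm[of y y'] K_def mult_ac)
    have "dist x z \<le> dist x y + dist y z" by (rule dist_triangle)
    also have "\<dots> \<le> dist x y + K * (dist x y + dist x y')"
      using yz K dist_triangle3[of y y' x] mult_left_mono[of "dist y y'" "dist x y + dist x y'" K] by linarith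
    also have "\<dots> \<le> (1 + K) * (dist x y + dist x y')" by (simp add: algebra_simps)
    finally show ?thesis using K y y' by (simp add: field_simps)
  qed
  then show ?thesis using K by (intro exI[of _ z] exI[of _ "1 / (1 + K)"]) auto
qed

text \<open>Over the common denominator the difference is
  \<open>(b - b') * a' - b' * (a - a')\<close> divided by \<open>a' + b'\<close>, which is an
  average of quantities bounded by \<open>d\<close>. Multiplying by \<open>a + b\<close> thus
  removes the singularity where both distances vanish.\<close>

lemma ratio_lipschitz:
  fixes a b a' b' d :: real
  assumes "0 \<le> a" "0 \<le> b" "0 \<le> a'" "0 \<le> b'" and "\<bar>a - a'\<bar> \<le> d" "\<bar>b - b'\<bar> \<le> d"
  shows "\<bar>b / (a + b) - b' / (a' + b')\<bar> * (a + b) \<le> 2 * d"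
proof (cases "a + b = 0")
  case True
  then show ?thesis using assms by simp
next
  case False
  then have ab: "0 < a + b" using assms by linarith
  show ?thesis
  proof (cases "a' + b' = 0")
    case True
    \<comment> \<open>The second ratio is \<open>0 / 0 = 0\<close> here, and the left side is
      \<open>b\<close>, which is at most \<open>d\<close> because \<open>b' = 0\<close>.\<close>
    then have "a' = 0" "b' = 0" using assms by linarith+
    then show ?thesis using ab assms by simp
  next
    case False
    then have ab': "0 < a' + b'" using assms by linarith
    have "(b / (a + b) - b' / (a' + b')) * (a + b) = ((b - b') * a' - b' * (a - a')) / (a' + b')"
    proof -
      define p q where "p = b / (a + b)" and "q = b' / (a' + b')"
      have "b = p * (a + b)" "b' = q * (a' + b')" using ab ab' by (simp_all add: p_def q_def)
      then have "(p - q) * (a + b) * (a' + b') = (b - b') * a' - b' * (a - a')" by algebra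
      then show ?thesis using ab' by (simp add: p_def q_def eq_divide_eq)
    qed
    then have "\<bar>b / (a + b) - b' / (a' + b')\<bar> * (a + b) = \<bar>(b - b') * a' - b' * (a - a')\<bar> / (a' + b')"
      using ab ab' by (metis abs_div_pos abs_mult abs_of_pos)
    also have "\<bar>(b - b') * a' - b' * (a - a')\<bar> \<le> d * a' + b' * d"
      using assms by (intro order_trans[OF abs_triangle_ineq4] add_mono) (auto simp: abs_mult intro!: mult_right_mono mult_left_mono)
    also have "\<dots> / (a' + b') = d" using ab' by (simp add: field_simps)
    finally show ?thesis using ab' assms by (simp add: divide_right_mono)
  qed
qed

lemma infdist_lipschitz: "\<bar>infdist x A - infdist y A\<bar> \<le> dist x y"
  using infdist_triangle[of x A y] infdist_triangle[of y A x] by (simp add: dist_commute abs_le_iff)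

text \<open>The weight is the ratio \<open>b / (a + b)\<close> of the distances \<open>a\<close> to the segments perpendicular to \<open>f\<close> and
  \<open>b\<close> to the others; \<open>Z\<close> contains the points where transversal segments meet.\<close>

lemma segment_cutoff:
  fixes S :: "(plane \<times> plane) set"
  assumes "finite S" "bounded W" and nondeg: "\<And>p. p \<in> S \<Longrightarrow> fst p \<noteq> snd p"
    and SW: "\<And>p. p \<in> S \<Longrightarrow> closed_segment (fst p) (snd p) \<subseteq> W"
  shows "\<exists>Z C. finite Z \<and> Z \<noteq> {} \<and> 0 < C \<and> (\<forall>f. \<exists>\<chi>'. (\<forall>x. 0 \<le> \<chi>' x \<and> \<chi>' x \<le> 1) \<and>
      (\<forall>p\<in>S. \<forall>x\<in>closed_segment (fst p) (snd p) - Z. \<chi>' x = (if f \<bullet> (snd p - fst p) = 0 then 1 else 0)) \<and>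
      (\<forall>x\<in>W. \<forall>y. \<bar>\<chi>' x - \<chi>' y\<bar> * infdist x Z \<le> C * dist x y))"
proof -
  let ?s = "\<lambda>p. closed_segment (fst p) (snd p)"
  define N where "N = {(p, q) \<in> S \<times> S. cross2 (snd p - fst p) (snd q - fst q) \<noteq> 0}"
  have "\<forall>pq\<in>N. \<exists>z c. c > 0 \<and> (\<forall>x\<in>W. c * dist x z \<le> infdist x (?s (fst pq)) + infdist x (?s (snd pq)))"
  proof
    fix pq assume "pq \<in> N"
    then have "cross2 (snd (fst pq) - fst (fst pq)) (snd (snd pq) - fst (snd pq)) \<noteq> 0" by (auto simp: N_def)
    from transversal_segments_distance[OF this \<open>bounded W\<close>]
    show "\<exists>z c. c > 0 \<and> (\<forall>x\<in>W. c * dist x z \<le> infdist x (?s (fst pq)) + infdist x (?s (snd pq)))" by blast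
  qed
  then obtain z c where zc: "\<And>pq. pq \<in> N \<Longrightarrow> c pq > 0"
    "\<And>pq x. pq \<in> N \<Longrightarrow> x \<in> W \<Longrightarrow> c pq * dist x (z pq) \<le> infdist x (?s (fst pq)) + infdist x (?s (snd pq))"
    by metis
  have "finite N" by (rule finite_subset[of _ "S \<times> S"]) (use \<open>finite S\<close> in \<open>auto simp: N_def\<close>)
  \<comment> \<open>\<open>0\<close> is inserted so that the set is nonempty also when no two
    segments are transversal; the \<open>1\<close> in the minimum below has the same
    purpose.\<close>
  define Z where "Z = insert 0 (z ` N)"
  define m where "m = Min (insert 1 (c ` N))"
  have m: "0 < m" "\<And>pq. pq \<in> N \<Longrightarrow> m \<le> c pq"
    using \<open>finite N\<close> zc(1) by (auto simp: m_def)
  have Z: "finite Z" "Z \<noteq> {}" using \<open>finite N\<close> by (auto simp: Z_def)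
  have "\<exists>\<chi>'. (\<forall>x. 0 \<le> \<chi>' x \<and> \<chi>' x \<le> 1) \<and>
      (\<forall>p\<in>S. \<forall>x\<in>?s p - Z. \<chi>' x = (if f \<bullet> (snd p - fst p) = 0 then 1 else 0)) \<and>
      (\<forall>x\<in>W. \<forall>y. \<bar>\<chi>' x - \<chi>' y\<bar> * infdist x Z \<le> (2 / m) * dist x y)" for f
  proof -
    define SA where "SA = {p \<in> S. f \<bullet> (snd p - fst p) = 0}"
    define SB where "SB = {p \<in> S. f \<bullet> (snd p - fst p) \<noteq> 0}"
    define A where "A = \<Union>(?s ` SA)"
    define B where "B = \<Union>(?s ` SB)"
    have fin: "finite SA" "finite SB" using \<open>finite S\<close> by (auto simp: SA_def SB_def)
    have closed: "closed A" "closed B" using fin by (auto simp: A_def B_def intro!: closed_Union)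
    consider "SB = {}" | "SA = {}" | "SA \<noteq> {}" "SB \<noteq> {}" by blast
    then show ?thesis
    proof cases
      case 1
      then show ?thesis by (intro exI[of _ "\<lambda>_. 1"]) (use m in \<open>auto simp: SB_def\<close>)
    next
      case 2
      then show ?thesis by (intro exI[of _ "\<lambda>_. 0"]) (use m in \<open>auto simp: SA_def\<close>)
    next
      case 3
      then have ne: "A \<noteq> {}" "B \<noteq> {}" by (auto simp: A_def B_def)
      define \<chi>' where "\<chi>' x = infdist x B / (infdist x A + infdist x B)" for x
      \<comment> \<open>The point of \<open>A\<close> nearest to \<open>x\<close> lies on a segment
        perpendicular to \<open>f\<close>, that of \<open>B\<close> on one which is not. The two
        segments are transversal, so their pair belongs to \<open>N\<close>.\<close>
      have key: "m * infdist x Z \<le> infdist x A + infdist x B" if x: "x \<in> W" for x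
      proof -
        obtain y where y: "y \<in> A" "infdist x A = dist x y" using infdist_attains_inf[OF closed(1) ne(1)] by metis
        then obtain p where p: "p \<in> SA" "y \<in> ?s p" by (auto simp: A_def)
        obtain y' where y': "y' \<in> B" "infdist x B = dist x y'" using infdist_attains_inf[OF closed(2) ne(2)] by metis
        then obtain q where q: "q \<in> SB" "y' \<in> ?s q" by (auto simp: B_def)
        have pq: "(p, q) \<in> N"
          using p q cross2_nonzero[of f "snd p - fst p" "snd q - fst q"] nondeg[of p]
          by (auto simp: N_def SA_def SB_def)
        have "m * infdist x Z \<le> c (p, q) * dist x (z (p, q))"
          using m pq zc(1)[OF pq] by (intro mult_mono infdist_le) (auto simp: Z_def infdist_nonneg)
        also have "\<dots> \<le> infdist x (?s p) + infdist x (?s q)" using zc(2)[OF pq x] by simp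
        also have "\<dots> \<le> dist x y + dist x y'" by (intro add_mono infdist_le p q)
        finally show ?thesis using y y' by simp
      qed
      show ?thesis
      proof (intro exI[of _ \<chi>'] conjI allI ballI)
        fix x
        show "0 \<le> \<chi>' x" "\<chi>' x \<le> 1"
          using infdist_nonneg[of x A] infdist_nonneg[of x B] by (auto simp: \<chi>'_def divide_le_eq_1)
      next
        fix p x assume p: "p \<in> S" and x: "x \<in> ?s p - Z"
        then have xW: "x \<in> W" using SW by blast
        show "\<chi>' x = (if f \<bullet> (snd p - fst p) = 0 then 1 else 0)"
        proof (cases "f \<bullet> (snd p - fst p) = 0")
          case True
          then have "p \<in> SA" using p by (simp add: SA_def)
          then have "x \<in> A" using x unfolding A_def by blast
          then have "infdist x A = 0" by simp
          \<comment> \<open>Away from \<open>Z\<close> the two distances cannot vanish together, so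
            the ratio is exactly 1 on \<open>A\<close>.\<close>
          moreover have "0 < infdist x Z"
            using x Z finite_imp_closed[of Z] infdist_pos_not_in_closed by auto
          then have "0 < m * infdist x Z" using m by simp
          ultimately have "0 < infdist x B" using key[OF xW] by linarith
          then show ?thesis using True \<open>infdist x A = 0\<close> by (simp add: \<chi>'_def)
        next
          case False
          then have "p \<in> SB" using p by (simp add: SB_def)
          then have "x \<in> B" using x unfolding B_def by blast
          then have "infdist x B = 0" by simp
          then show ?thesis using False by (simp add: \<chi>'_def)
        qed
      next
        fix x y assume x: "x \<in> W"
        have "m * (\<bar>\<chi>' x - \<chi>' y\<bar> * infdist x Z) = \<bar>\<chi>' x - \<chi>' y\<bar> * (m * infdist x Z)" by simp
        also have "\<dots> \<le> \<bar>\<chi>' x - \<chi>' y\<bar> * (infdist x A + infdist x B)"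
          by (intro mult_left_mono key x) simp
        also have "\<dots> \<le> 2 * dist x y"
          unfolding \<chi>'_def by (intro ratio_lipschitz infdist_nonneg infdist_lipschitz)
        finally show "\<bar>\<chi>' x - \<chi>' y\<bar> * infdist x Z \<le> (2 / m) * dist x y"
          using m by (simp add: field_simps)
      qed
    qed
  qed
  then show ?thesis using Z m(1) by (intro exI[of _ Z] exI[of _ "2 / m"]) auto
qed

section \<open>The logarithmic sum over the triangles\<close>

lemma sum_measure_near_points_le:
  fixes K :: "'i \<Rightarrow> plane set" and cen :: "'i \<Rightarrow> plane"
  assumes "finite X" and K: "\<And>x. x \<in> X \<Longrightarrow> K x \<in> lmeasurable" "\<And>x. x \<in> X \<Longrightarrow> K x \<subseteq> cball (cen x) h"
    and disj: "\<And>x y. x \<in> X \<Longrightarrow> y \<in> X \<Longrightarrow> x \<noteq> y \<Longrightarrow> K x \<inter> K y = {}"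
    and Z: "finite Z" "Z \<noteq> {}" and r: "0 \<le> r" "0 \<le> h"
  shows "(\<Sum>x | x \<in> X \<and> infdist (cen x) Z < r. measure lebesgue (K x)) \<le> real (card Z) * (2 * (r + h))\<^sup>2"
proof -
  define Y where "Y = {x \<in> X. infdist (cen x) Z < r}"
  have Y: "finite Y" "Y \<subseteq> X" using \<open>finite X\<close> by (auto simp: Y_def)
  let ?B = "\<lambda>z::plane. cbox (\<chi> i. z $ i - (r + h)) (\<chi> i. z $ i + (r + h))"
  have "(\<Union>x\<in>Y. K x) \<subseteq> (\<Union>z\<in>Z. ?B z)"
  proof
    fix p assume "p \<in> (\<Union>x\<in>Y. K x)"
    then obtain x where x: "x \<in> Y" "p \<in> K x" by auto
    obtain z where z: "z \<in> Z" "infdist (cen x) Z = dist (cen x) z"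
      using infdist_attains_inf[OF finite_imp_closed[OF Z(1)] Z(2)] by metis
    have "dist p z \<le> dist p (cen x) + dist (cen x) z" by (rule dist_triangle)
    also have "dist p (cen x) \<le> h"
    proof -
      have "x \<in> X" using x Y by blast
      then have "p \<in> cball (cen x) h" using K(2) x by blast
      then show ?thesis by (simp add: dist_commute)
    qed
    finally have d: "norm (p - z) \<le> r + h" using x z by (simp add: Y_def dist_norm)
    have "\<bar>p $ i - z $ i\<bar> \<le> r + h" for i
      using component_le_norm_cart[of "p - z" i] d by simp
    then have "p \<in> ?B z" by (simp add: mem_box_cart abs_le_iff) (smt (verit))
    then show "p \<in> (\<Union>z\<in>Z. ?B z)" using z by blast
  qed
  moreover have "(\<Union>x\<in>Y. K x) \<in> sets lebesgue" using K Y by (intro sets.finite_UN) (auto intro: fmeasurableD)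
  moreover have "(\<Union>z\<in>Z. ?B z) \<in> lmeasurable" using Z by (intro fmeasurable.finite_UN) auto
  ultimately have "measure lebesgue (\<Union>x\<in>Y. K x) \<le> measure lebesgue (\<Union>z\<in>Z. ?B z)"
    by (intro measure_mono_fmeasurable)
  also have "\<dots> \<le> (\<Sum>z\<in>Z. measure lebesgue (?B z))" using Z by (intro measure_UNION_le) auto
  also have "\<dots> = (\<Sum>z\<in>Z. (2 * (r + h))\<^sup>2)"
  proof (rule sum.cong)
    fix z :: plane
    have "cbox (\<chi> i. z $ i - (r + h)) (\<chi> i. z $ i + (r + h)) \<noteq> {}"
      using r by (simp add: interval_ne_empty_cart)
    then have "measure lborel (?B z) = (\<Prod>i\<in>(UNIV::2 set). 2 * (r + h))"
      by (simp add: content_cbox_cart)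
    then show "measure lebesgue (?B z) = (2 * (r + h))\<^sup>2" by simp
  qed simp
  finally have "measure lebesgue (\<Union>x\<in>Y. K x) \<le> real (card Z) * (2 * (r + h))\<^sup>2" by simp
  moreover have "measure lebesgue (\<Union>x\<in>Y. K x) = (\<Sum>x\<in>Y. measure lebesgue (K x))"
  proof (rule measure_UNION')
    show "pairwise (\<lambda>i j. disjnt (K i) (K j)) Y"
      unfolding pairwise_def disjnt_def using disj Y by (meson subsetD)
  qed (use Y K in auto)
  ultimately show ?thesis by (simp add: Y_def)
qed

text \<open>Dyadic decomposition: each of the about \<open>\<bar>ln h\<bar>\<close> annuli around the points of \<open>Z\<close> contributes
  a multiple of \<open>h\<^sup>2\<close>.\<close>

lemma log_sum_bound:
  fixes K :: "'i \<Rightarrow> plane set" and cen :: "'i \<Rightarrow> plane"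
  assumes "finite X" and K: "\<And>x. x \<in> X \<Longrightarrow> K x \<in> lmeasurable" "\<And>x. x \<in> X \<Longrightarrow> K x \<subseteq> cball (cen x) h"
    and disj: "\<And>x y. x \<in> X \<Longrightarrow> y \<in> X \<Longrightarrow> x \<noteq> y \<Longrightarrow> K x \<inter> K y = {}"
    and Z: "finite Z" "Z \<noteq> {}" and h: "0 < h" "h \<le> h0" "h0 < 1"
    and D: "\<And>x. x \<in> X \<Longrightarrow> infdist (cen x) Z \<le> D" "1 \<le> D" and "0 \<le> C"
  shows "(\<Sum>x\<in>X. measure lebesgue (K x) * (if infdist (cen x) Z < 2 * h then 1 else C * h / infdist (cen x) Z)\<^sup>2)
    \<le> (1 + C\<^sup>2) * 36 * real (card Z) * ((log 2 D + 1) / \<bar>ln h0\<bar> + 2) * h\<^sup>2 * \<bar>ln h\<bar>"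
proof -
  define d where "d x = infdist (cen x) Z" for x
  define w where "w x = (if d x < 2 * h then 1 else C * h / d x)" for x
  \<comment> \<open>Large enough that the distance \<open>2 ^ (N + 1) * h\<close> exceeds
    \<open>D\<close>, so that the layers up to \<open>N\<close> reach every cell.\<close>
  define N where "N = nat \<lfloor>log 2 (D / h)\<rfloor>"
  have Dh: "1 < D / h" using h D by (simp add: field_simps)
  have N1: "log 2 (D / h) < real N + 1" unfolding N_def using Dh by simp
  have N2: "real N \<le> log 2 (D / h)" unfolding N_def using Dh by (simp add: zero_le_log_cancel_iff)
  have N: "D < 2 ^ (N + 1) * h"
  proof -
    have "D / h = 2 powr log 2 (D / h)" using Dh by simp
    also have "\<dots> < 2 powr (real N + 1)" using N1 by simp
    also have "\<dots> = 2 ^ (N + 1)" by (simp add: powr_add powr_realpow)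
    finally show ?thesis using h by (simp add: field_simps)
  qed
  have lnh: "\<bar>ln h\<bar> = - ln h" "0 < - ln h" "- ln h0 \<le> - ln h" "0 < - ln h0"
    using h by auto
  \<comment> \<open>The term in \<open>D\<close> and the 1 are absorbed by
    \<open>\<bar>ln h\<bar>\<close> because this is at least \<open>\<bar>ln h0\<bar>\<close>; the
    summand 2 bounds \<open>1 / ln 2\<close>.\<close>
  have Nle: "real N + 1 \<le> ((log 2 D + 1) / \<bar>ln h0\<bar> + 2) * \<bar>ln h\<bar>"
  proof -
    have D0: "0 \<le> log 2 D" using D by simp
    have "log 2 (D / h) = log 2 D + - ln h / ln 2"
      using D h by (simp add: log_divide log_def[of 2 h])
    moreover have "- ln h / ln 2 \<le> 2 * (- ln h)"
    proof -
      have "(1::real) / 2 \<le> ln 2" using ln_add_one_self_le_self2 ln2_ge_two_thirds by linarith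
      then have "- ln h * (1 / 2) \<le> - ln h * ln 2" using lnh by (intro mult_left_mono) auto
      then show ?thesis by (simp add: field_simps)
    qed
    moreover have "log 2 D + 1 \<le> (log 2 D + 1) / (- ln h0) * (- ln h)"
      using mult_left_mono[OF lnh(3), of "log 2 D + 1"] D0 lnh by (simp add: field_simps)
    ultimately have "real N + 1 \<le> (log 2 D + 1) / (- ln h0) * (- ln h) + 2 * (- ln h)" using N2 by linarith
    also have "\<dots> = ((log 2 D + 1) / \<bar>ln h0\<bar> + 2) * \<bar>ln h\<bar>" using lnh h by (simp add: algebra_simps)
    finally show ?thesis .
  qed
  \<comment> \<open>One term of the sum suffices. For the least \<open>k\<close> with
    \<open>d x < 2 ^ (k + 1) * h\<close> the distance is at least \<open>2 ^ k * h\<close>, unless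
    \<open>k = 0\<close>, and then \<open>w x\<close> is at most \<open>C / 2 ^ k\<close>.\<close>
  have w_le: "(w x)\<^sup>2 \<le> (1 + C\<^sup>2) * (\<Sum>k\<le>N. (1 / 4 ^ k) * (if d x < 2 ^ (k + 1) * h then 1 else 0))" if x: "x \<in> X" for x
  proof (cases "d x < 2 * h")
    case True
    have "1 = (\<Sum>k\<in>{0::nat}. (1 / 4 ^ k) * (if d x < 2 ^ (k + 1) * h then 1 else (0::real)))" using True by simp
    also have "\<dots> \<le> (\<Sum>k\<le>N. (1 / 4 ^ k) * (if d x < 2 ^ (k + 1) * h then 1 else 0))" by (rule sum_mono2) auto
    finally have "1 * 1 \<le> (1 + C\<^sup>2) * (\<Sum>k\<le>N. (1 / 4 ^ k) * (if d x < 2 ^ (k + 1) * h then 1 else 0))"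
      by (intro mult_mono) auto
    then show ?thesis using True by (simp add: w_def)
  next
    case False
    have dN: "d x < 2 ^ (N + 1) * h" using D(1)[OF x] N by (simp add: d_def)
    define k where "k = (LEAST k. d x < 2 ^ (k + 1) * h)"
    have k1: "d x < 2 ^ (k + 1) * h" unfolding k_def by (rule LeastI[of _ N]) (rule dN)
    have kN: "k \<le> N" unfolding k_def by (rule Least_le) (rule dN)
    have "k \<noteq> 0" using k1 False by (cases "k = 0") auto
    then have "\<not> d x < 2 ^ ((k - 1) + 1) * h"
      unfolding k_def by (intro not_less_Least) (auto simp: k_def)
    then have k2: "2 ^ k * h \<le> d x" using \<open>k \<noteq> 0\<close> by simp
    have "w x = C * h / d x" using False by (simp add: w_def)
    also have "\<dots> \<le> C * h / (2 ^ k * h)" 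
    proof (rule divide_left_mono)
      have "0 < 2 ^ k * h" using h by simp
      then show "0 < d x * (2 ^ k * h)" using k2 by (metis order_less_le_trans mult_pos_pos)
    qed (use k2 h \<open>0 \<le> C\<close> in auto)
    also have "\<dots> = C / 2 ^ k" using h by simp
    finally have "w x \<le> C / 2 ^ k" .
    moreover have "0 \<le> w x" using False h \<open>0 \<le> C\<close> by (auto simp: w_def)
    ultimately have "(w x)\<^sup>2 \<le> (C / 2 ^ k)\<^sup>2" by (intro power_mono)
    also have "\<dots> = C\<^sup>2 * (1 / 4 ^ k)" by (simp add: power_divide power_mult[symmetric] mult.commute[of k] power_mult)
    also have "\<dots> \<le> (1 + C\<^sup>2) * (1 / 4 ^ k)" by (intro mult_right_mono) auto
    also have "1 / 4 ^ k = (\<Sum>k\<in>{k}. (1 / 4 ^ k) * (if d x < 2 ^ (k + 1) * h then 1 else (0::real)))" using k1 by simp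
    also have "(1 + C\<^sup>2) * \<dots> \<le> (1 + C\<^sup>2) * (\<Sum>k\<le>N. (1 / 4 ^ k) * (if d x < 2 ^ (k + 1) * h then 1 else 0))"
      using kN by (intro mult_left_mono sum_mono2) auto
    finally show ?thesis .
  qed
  \<comment> \<open>The squares have side \<open>2 * (2 ^ (k + 1) * h + h)\<close>, at most
    \<open>6 * 2 ^ k * h\<close>. The factor \<open>4 ^ k\<close> cancels against the weight of the
    layer, so that every layer contributes the same amount.\<close>
  have layer: "(\<Sum>x\<in>X. measure lebesgue (K x) * (if d x < 2 ^ (k + 1) * h then 1 else 0)) \<le> 36 * real (card Z) * 4 ^ k * h\<^sup>2" for k
  proof -
    have "(\<Sum>x\<in>X. measure lebesgue (K x) * (if d x < 2 ^ (k + 1) * h then 1 else 0)) =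
        (\<Sum>x | x \<in> X \<and> infdist (cen x) Z < 2 ^ (k + 1) * h. measure lebesgue (K x))"
      using \<open>finite X\<close> by (simp add: d_def if_distrib sum.inter_filter[symmetric] cong: if_cong)
    also have "\<dots> \<le> real (card Z) * (2 * (2 ^ (k + 1) * h + h))\<^sup>2"
      using h by (intro sum_measure_near_points_le \<open>finite X\<close> K disj Z) auto
    also have "\<dots> \<le> real (card Z) * (6 * (2 ^ k * h))\<^sup>2"
    proof -
      have "1 * h \<le> 2 ^ k * h" using h by (intro mult_right_mono) auto
      then show ?thesis using h by (intro mult_left_mono power_mono) auto
    qed
    also have "(6 * (2 ^ k * h))\<^sup>2 = 36 * 4 ^ k * h\<^sup>2"
      by (simp add: power_mult_distrib power_mult[symmetric] mult.commute[of k] power_mult)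
    finally show ?thesis by (simp add: mult_ac)
  qed
  have "(\<Sum>x\<in>X. measure lebesgue (K x) * (w x)\<^sup>2) \<le>
      (\<Sum>x\<in>X. measure lebesgue (K x) * ((1 + C\<^sup>2) * (\<Sum>k\<le>N. (1 / 4 ^ k) * (if d x < 2 ^ (k + 1) * h then 1 else 0))))"
    by (intro sum_mono mult_left_mono w_le) auto
  also have "\<dots> = (1 + C\<^sup>2) * (\<Sum>k\<le>N. (1 / 4 ^ k) * (\<Sum>x\<in>X. measure lebesgue (K x) * (if d x < 2 ^ (k + 1) * h then 1 else 0)))"
    unfolding sum_distrib_left by (subst sum.swap) (simp only: mult_ac)
  also have "\<dots> \<le> (1 + C\<^sup>2) * (\<Sum>k\<le>N. (1 / 4 ^ k) * (36 * real (card Z) * 4 ^ k * h\<^sup>2))"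
    by (intro mult_left_mono sum_mono layer) auto
  also have "\<dots> = (1 + C\<^sup>2) * 36 * real (card Z) * h\<^sup>2 * (real N + 1)" by (simp add: algebra_simps)
  also have "\<dots> \<le> (1 + C\<^sup>2) * 36 * real (card Z) * h\<^sup>2 * (((log 2 D + 1) / \<bar>ln h0\<bar> + 2) * \<bar>ln h\<bar>)"
    by (intro mult_left_mono Nle) auto
  finally show ?thesis unfolding w_def d_def by (simp only: mult_ac)
qed

section \<open>Uniform triangulations\<close>

lemma distinct_index_3: "(1::3) \<noteq> 2" "(1::3) \<noteq> 3" "(2::3) \<noteq> 3" "(2::3) \<noteq> 1" "(3::3) \<noteq> 1" "(3::3) \<noteq> 2"
  by auto

text \<open>The gradient of a barycentric coordinate is the opposite edge vector turned by a right
  angle and divided by twice the signed area, which is \<open>d\<close>.\<close>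

lemma triangle_frame_exists:
  fixes a :: "3 \<Rightarrow> plane"
  assumes "\<not> collinear {a 1, a 2, a 3}"
  obtains A where "triangle_frame (\<lambda>i. a i - (1 / 3) *\<^sub>R (\<Sum>j\<in>UNIV. a j)) A"
proof -
  define d where "d = cross2 (a 2 - a 1) (a 3 - a 1)"
  have d: "d \<noteq> 0"
  proof
    assume "d = 0"
    define u v where "u = a 2 - a 1" and "v = a 3 - a 1"
    have c: "u $ 1 * v $ 2 = u $ 2 * v $ 1"
      using \<open>d = 0\<close> by (simp add: d_def cross2_def u_def v_def)
    have "\<exists>c. v = c *\<^sub>R u" if "u \<noteq> 0"
    proof (cases "u $ 1 = 0")
      case False
      then have "v = (v $ 1 / u $ 1) *\<^sub>R u" using c by (simp add: vec_eq_iff forall_2 field_simps)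
      then show ?thesis ..
    next
      case True
      then have "u $ 2 \<noteq> 0" using that by (auto simp: vec_eq_iff forall_2)
      then have "v = (v $ 2 / u $ 2) *\<^sub>R u" using c True by (simp add: vec_eq_iff forall_2 field_simps)
      then show ?thesis ..
    qed
    then have "collinear {0, u, v}" by (auto simp: collinear_lemma)
    then have "collinear {a 2, a 1, a 3}" 
      using collinear_3[of "a 2" "a 1" "a 3", unfolded NO_MATCH_def] by (simp add: u_def v_def)
    then show False using assms by (simp add: insert_commute)
  qed
  define J :: "plane \<Rightarrow> plane" where "J v = (1 / d) *\<^sub>R vector [- v $ 2, v $ 1]" for v
  have J: "J v \<bullet> w = (v $ 1 * w $ 2 - v $ 2 * w $ 1) / d" for v w
    by (simp add: J_def inner_vec_def sum_2 diff_divide_distrib)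
  define A where "A i = (if i = 1 then J (a 3 - a 2) else if i = 2 then J (a 1 - a 3) else J (a 2 - a 1))" for i :: 3
  note n = distinct_index_3
  have "triangle_frame (\<lambda>i. a i - (1 / 3) *\<^sub>R (\<Sum>j\<in>UNIV. a j)) A"
  proof
    show "(\<Sum>i\<in>UNIV. a i - (1 / 3) *\<^sub>R (\<Sum>j\<in>UNIV. a j)) = 0"
      by (simp add: sum_subtractf sum_constant_scaleR del: sum_constant)
    show "(\<Sum>i\<in>UNIV. A i) = 0"
      by (simp add: sum_3 A_def J_def vec_eq_iff forall_2 n flip: add_divide_distrib)
    fix i j
    show "A i \<bullet> (a j - (1 / 3) *\<^sub>R (\<Sum>j\<in>UNIV. a j)) = (if i = j then 1 else 0) - 1 / 3"
    proof -
      have D: "(a 2 $ 1 - a 1 $ 1) * (a 3 $ 2 - a 1 $ 2) - (a 2 $ 2 - a 1 $ 2) * (a 3 $ 1 - a 1 $ 1) = d"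
        by (simp add: d_def cross2_def)
      have "3 * d * (A i \<bullet> (a j - (1 / 3) *\<^sub>R (\<Sum>j\<in>UNIV. a j))) = (if i = j then 2 * d else - d)"
        unfolding A_def J D[symmetric] using d exhaust_3[of i] exhaust_3[of j]
        by (auto simp: J D sum_3 n) (simp_all add: field_simps flip: D)
      then have "d * (3 * (A i \<bullet> (a j - (1 / 3) *\<^sub>R (\<Sum>j\<in>UNIV. a j)))) = d * (if i = j then 2 else - 1)"
        by (simp add: mult_ac split: if_splits)
      then have "3 * (A i \<bullet> (a j - (1 / 3) *\<^sub>R (\<Sum>j\<in>UNIV. a j))) = (if i = j then 2 else - 1)"
        using d unfolding mult_cancel_left by simp
      then show ?thesis by (simp split: if_splits)
    qed
  qed
  then show ?thesis by (rule that)
qed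

context triangle_frame
begin

lemma UNIV_3': "UNIV = {1, 2, 3::3}" using exhaust_3 by auto

lemma center_in_otri: "c \<in> otri c s"
  by (simp add: otri_def lam_def)

lemma aff_dim_ctri: "aff_dim (ctri c s) = 2"
proof -
  have "c \<in> interior (ctri c s)"
    using interior_maximal[OF otri_subset_ctri open_otri] center_in_otri by blast
  then have "interior (ctri c s) \<noteq> {}" by blast
  then show ?thesis using aff_dim_nonempty_interior by force
qed

lemma inj_vert: "s * s = 1 \<Longrightarrow> inj (vert c s)"
  by (rule injI) (metis lam_vert zero_neq_one)

lemma not_affine_dependent_vert: "s * s = 1 \<Longrightarrow> \<not> affine_dependent (range (vert c s))"
proof
  assume s: "s * s = 1" and "affine_dependent (range (vert c s))"
  then have "collinear {vert c s 1, vert c s 2, vert c s 3}"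
    by (simp add: collinear_3_eq_affine_dependent UNIV_3')
  then have "aff_dim (range (vert c s)) \<le> 1"
    by (simp add: collinear_aff_dim UNIV_3')
  moreover have "aff_dim (range (vert c s)) = 2"
    using aff_dim_ctri[of c s] unfolding ctri_eq_convex_hull[OF s] aff_dim_convex_hull .
  ultimately show False by simp
qed

section \<open>Faces of a triangle and the parallelogram condition\<close>

definition side :: "plane \<Rightarrow> real \<Rightarrow> 3 \<Rightarrow> plane set" where
  "side c s i = convex hull (vert c s ` (- {i}))"

lemma side_eq_segment:
  assumes "i \<noteq> k" "i \<noteq> l" "k \<noteq> l"
  shows "side c s i = closed_segment (vert c s k) (vert c s l)"
proof -
  have "- {i} = {k, l}" using triangle_indices[OF assms] assms by auto
  then show ?thesis by (simp add: side_def segment_convex_hull)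
qed

lemma face_of_ctri:
  assumes s: "s * s = 1"
  shows "F face_of ctri c s \<longleftrightarrow> (\<exists>I. F = convex hull (vert c s ` I))"
  unfolding ctri_eq_convex_hull[OF s] face_of_convex_hull_affine_independent[OF not_affine_dependent_vert[OF s]]
  by (metis subset_imageE subset_UNIV image_mono)

lemma aff_dim_convex_hull_vert:
  assumes s: "s * s = 1" shows "aff_dim (convex hull (vert c s ` I)) = int (card I) - 1"
proof -
  have "\<not> affine_dependent (vert c s ` I)"
    using not_affine_dependent_vert[OF s] affine_independent_subset[of "range (vert c s)"] by blast
  then show ?thesis
    using card_image[OF inj_on_subset[OF inj_vert[OF s] subset_UNIV], of c I]
    by (metis aff_dim_convex_hull affine_independent_iff_card)
qed

lemma edge_of_ctri:
  assumes s: "s * s = 1" shows "e edge_of ctri c s \<longleftrightarrow> (\<exists>i. e = side c s i)"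
proof
  assume "e edge_of ctri c s"
  then obtain I where I: "e = convex hull (vert c s ` I)" "card I = 2"
    unfolding edge_of_def face_of_ctri[OF s] using aff_dim_convex_hull_vert[OF s] by force
  then have "card (- I) = 1"
    by (simp add: Compl_eq_Diff_UNIV card_Diff_subset)
  then obtain i where "- I = {i}" by (auto simp: card_1_singleton_iff)
  then have "I = - {i}" by auto
  then show "\<exists>i. e = side c s i" using I by (auto simp: side_def)
next
  assume "\<exists>i. e = side c s i"
  then obtain i where e: "e = convex hull (vert c s ` (- {i}))" by (auto simp: side_def)
  have "card (- {i}) = 2" by (simp add: Compl_eq_Diff_UNIV card_Diff_subset)
  then show "e edge_of ctri c s"
    unfolding edge_of_def face_of_ctri[OF s] using aff_dim_convex_hull_vert[OF s] e by force
qed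

lemma lam_convex_hull_vert:
  assumes s: "s * s = 1" and "m \<notin> I" "x \<in> convex hull (vert c s ` I)" shows "lam c s m x = 0"
proof -
  have "convex hull (vert c s ` I) \<subseteq> {x. (s *\<^sub>R A m) \<bullet> x = - (1/3 - s * (A m \<bullet> c))}"
  proof (intro hull_minimal convex_hyperplane, clarsimp)
    fix j assume "j \<in> I"
    then have "m \<noteq> j" using assms(2) by auto
    then show "s * (A m \<bullet> vert c s j) = s * (A m \<bullet> c) - 1 / 3"
      using lam_vert[OF s, of c m j] by (simp add: lam_affine)
  qed
  then show ?thesis using assms(3) by (auto simp: lam_affine)
qed

lemma vert_mem_convex_hull:
  "s * s = 1 \<Longrightarrow> vert c s m \<in> convex hull (vert c s ` I) \<longleftrightarrow> m \<in> I"
  using lam_convex_hull_vert[of s m I "vert c s m" c] lam_vert[of s c m m] by (auto simp: hull_inc)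

lemma lam_side: "s * s = 1 \<Longrightarrow> x \<in> side c s i \<Longrightarrow> lam c s i x = 0"
  unfolding side_def by (rule lam_convex_hull_vert) auto

lemma side_subset_ctri: "s * s = 1 \<Longrightarrow> side c s i \<subseteq> ctri c s"
  unfolding side_def ctri_eq_convex_hull by (intro hull_mono) auto

lemma extreme_point_of_ctri: "s * s = 1 \<Longrightarrow> p extreme_point_of ctri c s \<longleftrightarrow> (\<exists>i. p = vert c s i)"
  by (auto simp: ctri_eq_convex_hull extreme_point_of_convex_hull_affine_independent[OF not_affine_dependent_vert])

lemma vert_in_ctri: "s * s = 1 \<Longrightarrow> vert c s i \<in> ctri c s"
  by (auto simp: ctri_def lam_vert)

text \<open>The coordinates of the first triangle are nonnegative at the vertices of the second. For
  equal orientations this makes the three numbers \<open>s * (A i \<bullet> (c' - c))\<close>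
  nonnegative, for opposite ones at least 1/3; but they sum to zero.\<close>

lemma ctri_inj:
  assumes s: "s * s = 1" "s' * s' = 1" and eq: "ctri c s = ctri c' s'"
  shows "c = c' \<and> s = s'"
proof -
  have v: "0 \<le> 1/3 + s * (A i \<bullet> (c' - c)) + s * s' * ((if i = j then 1 else 0) - 1/3)" for i j
  proof -
    have "vert c' s' j \<in> ctri c s" using vert_in_ctri[OF s(2)] eq by simp
    then have "0 \<le> lam c s i (vert c' s' j)" by (simp add: ctri_def)
    also have "\<dots> = 1/3 + s * (A i \<bullet> (c' - c)) + s * s' * (A i \<bullet> \<omega> j)"
      by (simp add: lam_def vert_def inner_add_right inner_diff_right algebra_simps)
    finally show ?thesis by (simp add: dual)
  qed
  have sum0: "(\<Sum>i\<in>UNIV. s * (A i \<bullet> (c' - c))) = 0"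
    by (simp flip: sum_distrib_left inner_sum_left add: sum_A)
  have "s * s' = 1 \<or> s * s' = -1" using s by (auto simp: square_eq_1_iff)
  then show ?thesis
  proof
    assume ss: "s * s' = 1"
    have "0 \<le> s * (A i \<bullet> (c' - c))" for i
    proof -
      obtain k where "i \<noteq> k" using other_indices by metis
      then show ?thesis using v[of i k] ss by simp
    qed
    then have "s * (A i \<bullet> (c' - c)) = 0" for i
      using sum0 sum_nonneg_eq_0_iff[of UNIV "\<lambda>i. s * (A i \<bullet> (c' - c))"] by auto
    then have "A i \<bullet> (c' - c) = 0" for i using s by (metis mult_cancel_left2 mult_eq_0_iff zero_neq_one)
    then have "c' - c = 0" using expand_\<omega>[of "c' - c"] by simp
    moreover have "s = s'" using ss s by (metis mult.assoc mult.commute mult_1)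
    ultimately show ?thesis by simp
  next
    assume ss: "s * s' = -1"
    have "s * (A i \<bullet> (c' - c)) \<ge> 1/3" for i using v[of i i] ss by simp
    then have "(\<Sum>i\<in>(UNIV::3 set). 1/3) \<le> (\<Sum>i\<in>UNIV. s * (A i \<bullet> (c' - c)))" by (intro sum_mono)
    then show ?thesis using sum0 by simp
  qed
qed

end

lemma extreme_point_of_convex_hull_insertI:
  fixes x :: "'a::euclidean_space"
  assumes "finite S" "\<And>y. y \<in> S \<Longrightarrow> f \<bullet> y < f \<bullet> x"
  shows "x extreme_point_of convex hull (insert x S)"
proof (rule extreme_point_of_convex_hull_insert[OF assms(1)])
  have "convex hull S \<subseteq> {y. f \<bullet> y < f \<bullet> x}"
    using assms by (intro hull_minimal convex_halfspace_lt) auto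
  then show "x \<notin> convex hull S" by auto
qed

text \<open>\<open>A 2\<close> and \<open>A 3\<close> are affine coordinates in which the corners
  form a unit square, and each corner is exposed by a combination of them with suitable
  signs.\<close>

lemma parallelogram_extreme_points:
  fixes a b c :: plane
  assumes "\<not> collinear {a, b, c}"
  shows "x \<in> {a, b, c, b + c - a} \<Longrightarrow> x extreme_point_of convex hull {a, b, c, b + c - a}"
    and "card {a, b, c, b + c - a} = 4"
proof -
  define v where "v i = (if i = 1 then a else if i = 2 then b else c)" for i :: 3
  note n = distinct_index_3
  have v: "v 1 = a" "v 2 = b" "v 3 = c" by (simp_all add: v_def n)
  obtain A where "triangle_frame (\<lambda>i. v i - (1 / 3) *\<^sub>R (\<Sum>j\<in>UNIV. v j)) A"
    using triangle_frame_exists[of v] assms v by metis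
  then interpret triangle_frame "\<lambda>i. v i - (1 / 3) *\<^sub>R (\<Sum>j\<in>UNIV. v j)" A .
  have d: "A i \<bullet> v j - A i \<bullet> v 1 = (if i = j then 1 else 0) - (if i = 1 then 1 else 0)" for i j
    using dual[of i j] dual[of i 1] by (simp add: inner_diff_right)
  have e: "A 2 \<bullet> b = A 2 \<bullet> a + 1" "A 2 \<bullet> c = A 2 \<bullet> a" "A 3 \<bullet> b = A 3 \<bullet> a" "A 3 \<bullet> c = A 3 \<bullet> a + 1"
    using d[of 2 2] d[of 2 3] d[of 3 2] d[of 3 3] by (simp_all add: v n)
  note e = e inner_add_left inner_add_right inner_diff_left inner_diff_right
  have "a extreme_point_of convex hull (insert a {b, c, b + c - a})"
    by (rule extreme_point_of_convex_hull_insertI[where f = "- A 2 - A 3"]) (auto simp: e)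
  moreover have "b extreme_point_of convex hull (insert b {a, c, b + c - a})"
    by (rule extreme_point_of_convex_hull_insertI[where f = "A 2 - A 3"]) (auto simp: e)
  moreover have "c extreme_point_of convex hull (insert c {a, b, b + c - a})"
    by (rule extreme_point_of_convex_hull_insertI[where f = "A 3 - A 2"]) (auto simp: e)
  moreover have "(b + c - a) extreme_point_of convex hull (insert (b + c - a) {a, b, c})"
    by (rule extreme_point_of_convex_hull_insertI[where f = "A 2 + A 3"]) (auto simp: e)
  ultimately show "x \<in> {a, b, c, b + c - a} \<Longrightarrow> x extreme_point_of convex hull {a, b, c, b + c - a}"
    by (auto simp: insert_commute)
  have "A 2 \<bullet> a \<noteq> A 2 \<bullet> b" "A 3 \<bullet> a \<noteq> A 3 \<bullet> c" "A 2 \<bullet> b \<noteq> A 2 \<bullet> c" "A 2 \<bullet> a \<noteq> A 2 \<bullet> (b + c - a)"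
    "A 3 \<bullet> b \<noteq> A 3 \<bullet> (b + c - a)" "A 2 \<bullet> c \<noteq> A 2 \<bullet> (b + c - a)"
    by (simp_all add: e)
  then have "a \<noteq> b" "a \<noteq> c" "b \<noteq> c" "a \<noteq> b + c - a" "b \<noteq> b + c - a" "c \<noteq> b + c - a"
    by metis+
  then show "card {a, b, c, b + c - a} = 4" by simp
qed

context triangle_frame
begin

lemma \<omega>_eq:
  assumes "i \<noteq> k" "i \<noteq> l" "k \<noteq> l" shows "\<omega> i = - \<omega> k - \<omega> l"
proof -
  have "\<omega> i + (\<omega> k + \<omega> l) = 0" using sum_\<omega> unfolding sum_triangle_indices[OF assms] .
  then show ?thesis by (simp only: eq_neg_iff_add_eq_0 diff_conv_add_uminus minus_add_distrib[symmetric])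
qed

lemma vert_neighbour:
  assumes "i \<noteq> k" "i \<noteq> l" "k \<noteq> l"
  shows "vert (c - s *\<^sub>R \<omega> i) (- s) k = vert c s l" "vert (c - s *\<^sub>R \<omega> i) (- s) l = vert c s k"
    "vert (c - s *\<^sub>R \<omega> i) (- s) i = vert c s k + vert c s l - vert c s i"
proof -
  note i = \<omega>_eq[OF assms]
  show "vert (c - s *\<^sub>R \<omega> i) (- s) k = vert c s l" "vert (c - s *\<^sub>R \<omega> i) (- s) l = vert c s k"
    "vert (c - s *\<^sub>R \<omega> i) (- s) i = vert c s k + vert c s l - vert c s i"
    by (simp_all add: vert_def i algebra_simps)
qed

text \<open>The extreme points of the union are among the three vertices of the first triangle and
  the remaining vertex \<open>q\<close> of \<open>K'\<close>, so these four are the corners of the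
  parallelogram. Three pairings into diagonals are conceivable. In the two wrong ones the midpoint
  of a side through vertex \<open>i\<close> would lie in \<open>K'\<close>, hence on the common
  edge, although its coordinate \<open>i\<close> is 1/2.\<close>

lemma neighbour_of_parallelogram:
  assumes s: "s * s = 1" and K': "2 simplex K'" "K' \<noteq> ctri c s"
    and face: "ctri c s \<inter> K' face_of ctri c s" "ctri c s \<inter> K' face_of K'"
    and e: "side c s i edge_of K'" and P: "parallelogram (ctri c s \<union> K')"
  shows "K' = ctri (c - s *\<^sub>R \<omega> i) (- s)"
proof -
  obtain k l where ikl: "i \<noteq> k" "i \<noteq> l" "k \<noteq> l" using other_indices by metis
  let ?v = "vert c s"
  have vinj: "?v m = ?v m' \<longleftrightarrow> m = m'" for m m' using inj_vert[OF s] by (simp add: inj_eq)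
  obtain C where C: "\<not> affine_dependent C" "card C = 3" "K' = convex hull C"
    using K'(1) unfolding simplex_def by auto
  have "?v k \<in> C" "?v l \<in> C"
  proof -
    have "?v k extreme_point_of side c s i" "?v l extreme_point_of side c s i"
      unfolding side_eq_segment[OF ikl] by (simp_all add: extreme_point_of_segment)
    then have "?v k extreme_point_of K'" "?v l extreme_point_of K'"
      using e unfolding edge_of_def by (meson extreme_point_of_face)+
    then show "?v k \<in> C" "?v l \<in> C"
      unfolding C by (auto simp: extreme_point_of_convex_hull_affine_independent[OF C(1)])
  qed
  moreover have "finite C" using C(2) by (metis card.infinite zero_neq_numeral)
  ultimately have "card (C - {?v k, ?v l}) = 1" using C(2) ikl vinj by (simp add: card_Diff_subset)
  then obtain q where "C - {?v k, ?v l} = {q}" by (auto simp: card_1_singleton_iff)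
  then have Cq: "C = {?v k, ?v l, q}" using \<open>?v k \<in> C\<close> \<open>?v l \<in> C\<close> by auto
  \<comment> \<open>The intersection is a face containing edge \<open>i\<close>. Were it the whole
    triangle, a face of \<open>K'\<close> would have full dimension and be all of
    \<open>K'\<close>.\<close>
  have int: "ctri c s \<inter> K' = side c s i"
  proof -
    obtain I where I: "ctri c s \<inter> K' = convex hull (?v ` I)" using face(1) face_of_ctri[OF s] by auto
    have "side c s i \<subseteq> ctri c s \<inter> K'" using side_subset_ctri[OF s] edge_of_imp_subset[OF e] by simp
    moreover have "?v m \<in> side c s i" if "m \<noteq> i" for m using that by (auto simp: side_def hull_inc)
    ultimately have "m \<in> I" if "m \<noteq> i" for m using that vert_mem_convex_hull[OF s] unfolding I by blast
    moreover have "i \<notin> I"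
    proof
      assume "i \<in> I"
      then have "m \<in> I" for m using \<open>\<And>m. m \<noteq> i \<Longrightarrow> m \<in> I\<close> by (cases "m = i") auto
      then have "I = UNIV" by blast
      then have "ctri c s \<inter> K' = ctri c s" using I ctri_eq_convex_hull[OF s] by simp
      then have "ctri c s face_of K'" using face(2) by simp
      then have "aff_dim (ctri c s) < aff_dim K'"
        using face_of_aff_dim_lt[OF convex_simplex[OF K'(1)]] K'(2) by metis
      then show False using aff_dim_ctri aff_dim_simplex[OF K'(1)] by simp
    qed
    ultimately have "I = - {i}" by auto
    then show ?thesis using I by (simp add: side_def)
  qed
  obtain a b d where abd: "\<not> collinear {a, b, d}" "ctri c s \<union> K' = convex hull {a, b, d, b + d - a}"
    using P unfolding parallelogram_def by auto
  have "{a, b, d, b + d - a} \<subseteq> {?v i, ?v k, ?v l, q}"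
  proof
    fix y assume "y \<in> {a, b, d, b + d - a}"
    then have y: "y extreme_point_of (ctri c s \<union> K')"
      unfolding abd(2) by (rule parallelogram_extreme_points(1)[OF abd(1)])
    then have "y extreme_point_of ctri c s \<or> y extreme_point_of K'"
      unfolding extreme_point_of_def by blast
    then show "y \<in> {?v i, ?v k, ?v l, q}"
      unfolding extreme_point_of_ctri[OF s] C(3) extreme_point_of_convex_hull_affine_independent[OF C(1)]
      unfolding Cq
    proof (elim disjE exE)
      fix m assume "y = ?v m"
      then show ?thesis using triangle_indices[OF ikl, of m] by (elim disjE) simp_all
    qed blast
  qed
  moreover have "card {?v i, ?v k, ?v l, q} \<le> 4"
    using card_length[of "[?v i, ?v k, ?v l, q]"] by simp
  ultimately have eq: "{a, b, d, b + d - a} = {?v i, ?v k, ?v l, q}"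
    using parallelogram_extreme_points(2)[OF abd(1)] by (intro card_seteq) auto
  have dist: "distinct [?v i, ?v k, ?v l, q]"
    using parallelogram_extreme_points(2)[OF abd(1)] unfolding eq
    by (intro card_distinct) simp
  \<comment> \<open>Diagonals of a parallelogram have equal sums of their end points, half the sum
    of all four corners; so the partner of vertex \<open>i\<close> determines the pairing.\<close>
  have "?v i + q = ?v k + ?v l \<or> ?v i + ?v k = ?v l + q \<or> ?v i + ?v l = ?v k + q"
  proof -
    define d' where "d' = b + d - a"
    have s': "a + d' = b + d" by (simp add: d'_def)
    have m: "a \<in> {?v i, ?v k, ?v l, q}" "b \<in> {?v i, ?v k, ?v l, q}" "d \<in> {?v i, ?v k, ?v l, q}" "d' \<in> {?v i, ?v k, ?v l, q}"
      unfolding eq[folded d'_def, symmetric] by blast+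
    have "card {a, b, d, d'} = card (set [a, b, d, d'])" by simp
    then have "distinct [a, b, d, d']"
      using parallelogram_extreme_points(2)[OF abd(1)] by (intro card_distinct) (simp add: d'_def)
    then have "(\<Sum>y\<in>{a, b, d, d'}. y) = a + b + d + d'" by (simp add: algebra_simps)
    moreover have "(\<Sum>y\<in>{?v i, ?v k, ?v l, q}. y) = ?v i + ?v k + ?v l + q" using dist by (simp add: algebra_simps)
    ultimately have total: "?v i + ?v k + ?v l + q = 2 *\<^sub>R (a + d')"
      using eq s' by (simp add: d'_def scaleR_2 algebra_simps)
    have "\<exists>p. p \<in> {a, b, d, d'} \<and> p \<noteq> ?v i \<and> ?v i + p = a + d'"
    proof -
      have "?v i \<in> {a, b, d, d'}" unfolding eq[folded d'_def] by blast
      then consider "?v i = a" | "?v i = b" | "?v i = d" | "?v i = d'" by blast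
      then show ?thesis
      proof cases
        case 1
        have "?v i + d' = a + d'" unfolding 1 by (rule refl)
        moreover have "d' \<noteq> ?v i" unfolding 1 using \<open>distinct [a, b, d, d']\<close> by force
        ultimately show ?thesis by blast
      next
        case 2
        have "?v i + d = a + d'" unfolding 2 s' by (rule refl)
        moreover have "d \<noteq> ?v i" unfolding 2 using \<open>distinct [a, b, d, d']\<close> by force
        ultimately show ?thesis by blast
      next
        case 3
        have "?v i + b = a + d'" unfolding 3 s' by (rule add.commute)
        moreover have "b \<noteq> ?v i" unfolding 3 using \<open>distinct [a, b, d, d']\<close> by force
        ultimately show ?thesis by blast
      next
        case 4
        have "?v i + a = a + d'" unfolding 4 by (rule add.commute)
        moreover have "a \<noteq> ?v i" unfolding 4 using \<open>distinct [a, b, d, d']\<close> by force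
        ultimately show ?thesis by blast
      qed
    qed
    then obtain p where p: "p \<in> {?v k, ?v l, q}" "?v i + p = a + d'"
      unfolding eq[folded d'_def] by blast
    have "?v i + ?v k + ?v l + q = (?v i + p) + (?v i + p)" using total p by (simp add: scaleR_2)
    then show ?thesis using p(1) by (auto simp: algebra_simps)
  qed
  moreover have no: False if H: "?v i + ?v k' = ?v l' + q" "k' \<noteq> i" "l' \<in> {k, l}" for k' l'
  proof -
    have "midpoint (?v i) (?v k') = midpoint (?v l') q" using H by (simp add: midpoint_def)
    moreover have "midpoint (?v i) (?v k') \<in> ctri c s"
      using closed_segment_subset[OF vert_in_ctri[OF s] vert_in_ctri[OF s] convex_ctri] midpoint_in_closed_segment by blast
    moreover have "midpoint (?v l') q \<in> K'"
    proof -
      have "closed_segment (?v l') q \<subseteq> K'"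
        using H(3) unfolding C Cq by (intro closed_segment_subset convex_convex_hull hull_inc) auto
      then show ?thesis by fastforce
    qed
    ultimately have "lam c s i (midpoint (?v i) (?v k')) = 0"
      using lam_side[OF s] int by auto
    moreover have "lam c s i (midpoint (?v i) (?v k')) = 1 / 2"
    proof -
      have "midpoint (?v i) (?v k') = linepath (?v i) (?v k') (1/2)"
        by (simp add: midpoint_def linepath_def scaleR_add_right)
      then show ?thesis using lam_linepath[of c s i "?v i" "?v k'" "1/2"] lam_vert[OF s] H(2) by simp
    qed
    ultimately show False by simp
  qed
  moreover have "?v i + ?v k \<noteq> ?v l + q" "?v i + ?v l \<noteq> ?v k + q"
    using no[of k l] no[of l k] ikl(1,2) by blast+
  ultimately have "?v i + q = ?v k + ?v l" by blast
  then have q: "q = ?v k + ?v l - ?v i" by (metis add_diff_cancel_left')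
  have U: "UNIV = {i, k, l}" using triangle_indices[OF ikl] by blast
  have "range (vert (c - s *\<^sub>R \<omega> i) (- s)) = {vert (c - s *\<^sub>R \<omega> i) (- s) i, vert (c - s *\<^sub>R \<omega> i) (- s) k, vert (c - s *\<^sub>R \<omega> i) (- s) l}"
    by (simp only: U image_insert image_empty)
  also have "\<dots> = C" unfolding vert_neighbour[OF ikl] Cq q by auto
  finally show ?thesis using C(3) ctri_eq_convex_hull[of "- s"] s by simp
qed

lemma mid_eq_linepath:
  assumes "i \<noteq> k" "i \<noteq> l" "k \<noteq> l"
  shows "mid i x = linepath (vert (fst x) (snd x) k) (vert (fst x) (snd x) l) (1/2)"
proof -
  note i = \<omega>_eq[OF assms]
  show ?thesis by (simp add: mid_def linepath_def vert_def i vec_eq_iff field_simps)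
qed

lemma A_vert_diff_eq: "s * s = 1 \<Longrightarrow> A i \<bullet> (vert c s k - vert c s l) = s * ((if i = k then 1 else 0) - (if i = l then 1 else 0))"
  by (simp add: vert_def dual inner_diff_right inner_add_right algebra_simps)

lemma normal_of_side:
  assumes s: "s * s = 1" and f: "f \<noteq> 0" "\<And>x y. x \<in> side c s i \<Longrightarrow> y \<in> side c s i \<Longrightarrow> f \<bullet> (x - y) = 0"
  obtains \<beta> where "\<beta> \<noteq> 0" "f = \<beta> *\<^sub>R A i"
proof -
  obtain k l where ikl: "i \<noteq> k" "i \<noteq> l" "k \<noteq> l" using other_indices by metis
  have "s * (f \<bullet> \<omega> k - f \<bullet> \<omega> l) = f \<bullet> (vert c s k - vert c s l)"
    by (simp add: vert_def inner_diff_right inner_add_right algebra_simps)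
  also have "\<dots> = 0" using ikl by (intro f(2)) (auto simp: side_def hull_inc)
  finally have q: "\<omega> l \<bullet> f = \<omega> k \<bullet> f" using s by (auto simp: inner_commute)
  have "A i + (A k + A l) = 0" using sum_A unfolding sum_triangle_indices[OF ikl] .
  then have Ai: "A k + A l = - A i" by (simp add: add_eq_0_iff)
  have "f = (\<omega> i \<bullet> f) *\<^sub>R A i + ((\<omega> k \<bullet> f) *\<^sub>R A k + (\<omega> l \<bullet> f) *\<^sub>R A l)"
    using expand_A[of f] unfolding sum_triangle_indices[OF ikl] by simp
  also have "\<dots> = (\<omega> i \<bullet> f) *\<^sub>R A i + (\<omega> k \<bullet> f) *\<^sub>R (A k + A l)" unfolding q scaleR_add_right ..
  finally have "f = (\<omega> i \<bullet> f - \<omega> k \<bullet> f) *\<^sub>R A i" unfolding Ai by (simp add: scaleR_diff_left)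
  then show ?thesis using f(1) that by (metis scaleR_zero_left)
qed

end

section \<open>The structure of a uniform mesh and its boundary\<close>

locale uniform_triangulation = triangle_frame +
  fixes \<Omega> :: "plane set" and \<T> :: "plane set set"
  assumes open_\<Omega>: "open \<Omega>" and connected_\<Omega>: "connected \<Omega>" and bounded_\<Omega>: "bounded \<Omega>"
    and regular_\<Omega>: "interior (closure \<Omega>) = \<Omega>" and nonempty_\<Omega>: "\<Omega> \<noteq> {}"
    and tri: "triangulation_of \<T> \<Omega>" and uniform: "uniform_mesh \<T>"
    and member: "\<exists>c s. s * s = 1 \<and> ctri c s \<in> \<T>"
begin

text \<open>The mesh through its triangles' centres and orientations; sums over the mesh become sums
  over this set, on which \<open>nb\<close> acts.\<close>

definition X :: "(plane \<times> real) set" where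
  "X = {x. snd x * snd x = 1 \<and> ctri (fst x) (snd x) \<in> \<T>}"

lemma finite_\<T>: "finite \<T>" and simplex_\<T>: "K \<in> \<T> \<Longrightarrow> 2 simplex K" and Union_\<T>: "\<Union>\<T> = closure \<Omega>"
  and face_\<T>: "K \<in> \<T> \<Longrightarrow> K' \<in> \<T> \<Longrightarrow> K \<inter> K' face_of K"
  using tri by (auto simp: triangulation_of_def triangulation_def)

lemma face_\<T>': "K \<in> \<T> \<Longrightarrow> K' \<in> \<T> \<Longrightarrow> K \<inter> K' face_of K'"
  using face_\<T>[of K' K] by (simp add: Int_commute)

lemma interior_subset_\<Omega>: "K \<in> \<T> \<Longrightarrow> interior K \<subseteq> \<Omega>"
  using Union_\<T> interior_mono[of K "closure \<Omega>"] regular_\<Omega> by blast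

lemma interior_nonempty: "K \<in> \<T> \<Longrightarrow> interior K \<noteq> {}"
proof -
  assume K: "K \<in> \<T>"
  have "aff_dim K = int (DIM(plane))" using aff_dim_simplex[OF simplex_\<T>[OF K]] by simp
  then have "affine hull K = UNIV" using aff_dim_eq_full by blast
  then have "interior K = rel_interior K" by (simp add: rel_interior_interior)
  moreover have "K \<noteq> {}" using \<open>aff_dim K = int (DIM(plane))\<close> by (auto simp: aff_dim_empty)
  ultimately show ?thesis
    using rel_interior_eq_empty[OF convex_simplex[OF simplex_\<T>[OF K]]] by simp
qed

lemma aff_dim_Int_less:
  assumes "K \<in> \<T>" "K' \<in> \<T>" "K \<noteq> K'" shows "aff_dim (K \<inter> K') < 2"
proof (cases "K \<inter> K' = K")
  case False
  then show ?thesis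
    using face_of_aff_dim_lt[OF convex_simplex[OF simplex_\<T>[OF assms(1)]] face_\<T>[OF assms(1,2)]]
      aff_dim_simplex[OF simplex_\<T>[OF assms(1)]] by simp
next
  case True
  then have "K face_of K'" using face_\<T>'[OF assms(1,2)] by simp
  then have "aff_dim K < aff_dim K'"
    using face_of_aff_dim_lt[OF convex_simplex[OF simplex_\<T>[OF assms(2)]]] assms(3) by simp
  then show ?thesis using assms aff_dim_simplex[OF simplex_\<T>] by simp
qed

lemma Int_edge_imp_neighbour:
  assumes s: "s * s = 1" and K: "ctri c s \<in> \<T>" "K' \<in> \<T>" "K' \<noteq> ctri c s" and e: "side c s i edge_of K'"
  shows "K' = ctri (c - s *\<^sub>R \<omega> i) (- s)"
proof (rule neighbour_of_parallelogram[OF s simplex_\<T>[OF K(2)] K(3) face_\<T>[OF K(1,2)] face_\<T>'[OF K(1,2)] e])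
  have "side c s i edge_of ctri c s" by (auto simp: edge_of_ctri[OF s])
  then show "parallelogram (ctri c s \<union> K')"
    using uniform K e unfolding uniform_mesh_def by metis
qed

lemma Int_positive_dim_imp_neighbour:
  assumes s: "s * s = 1" and K: "ctri c s \<in> \<T>" "K' \<in> \<T>" "K' \<noteq> ctri c s" and d: "0 < aff_dim (ctri c s \<inter> K')"
  obtains i where "ctri c s \<inter> K' = side c s i" "K' = ctri (c - s *\<^sub>R \<omega> i) (- s)"
proof -
  have "aff_dim (ctri c s \<inter> K') = 1" using d aff_dim_Int_less[OF K(1,2)] K(3) by simp
  then have e: "ctri c s \<inter> K' edge_of ctri c s" "ctri c s \<inter> K' edge_of K'"
    using face_\<T>[OF K(1,2)] face_\<T>'[OF K(1,2)] by (auto simp: edge_of_def)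
  then obtain i where i: "ctri c s \<inter> K' = side c s i" by (auto simp: edge_of_ctri[OF s])
  with e Int_edge_imp_neighbour[OF s K, of i] that show ?thesis by simp
qed

text \<open>All triangles of the mesh fit the frame. A fitting triangle and one that does not fit
  share no edge, since the parallelogram condition would make the latter fit as well; so the two
  families meet in finitely many points. Deleting these from the connected open domain leaves it
  connected, and hence one family is empty.\<close>

lemma \<T>_eq: "\<T> = (\<lambda>x. ctri (fst x) (snd x)) ` X"
proof -
  define G where "G = (\<lambda>x. ctri (fst x) (snd x)) ` X"
  have GT: "G \<subseteq> \<T>" by (auto simp: G_def X_def)
  define U V where "U = \<Union>G" and "V = \<Union>(\<T> - G)"
  have "finite G" using GT finite_\<T> finite_subset by blast
  have cl: "closed U" "closed V"
    unfolding U_def V_def using \<open>finite G\<close> finite_\<T> GT simplex_\<T> closed_simplex by (auto intro!: closed_Union)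
  have UV: "U \<union> V = closure \<Omega>" 
  proof -
    have "U \<union> V = \<Union>\<T>" using GT unfolding U_def V_def by blast
    then show ?thesis using Union_\<T> by simp
  qed
  have fin: "finite (K \<inter> K')" if "K \<in> G" "K' \<in> \<T> - G" for K K'
  proof -
    obtain x where x: "x \<in> X" "K = ctri (fst x) (snd x)" using \<open>K \<in> G\<close> by (auto simp: G_def)
    then have s: "snd x * snd x = 1" "ctri (fst x) (snd x) \<in> \<T>" by (auto simp: X_def)
    have "\<not> 0 < aff_dim (K \<inter> K')"
    proof
      assume d: "0 < aff_dim (K \<inter> K')"
      have K': "K' \<in> \<T>" "K' \<noteq> ctri (fst x) (snd x)" using that x by auto
      obtain i where "K' = ctri (fst x - snd x *\<^sub>R \<omega> i) (- snd x)"
        by (rule Int_positive_dim_imp_neighbour[OF s K' d[unfolded x]])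
      then have "K' \<in> G" unfolding G_def
        using that(2) s by (intro image_eqI[of _ _ "(fst x - snd x *\<^sub>R \<omega> i, - snd x)"]) (auto simp: X_def)
      then show False using that by simp
    qed
    then have "aff_dim (K \<inter> K') = -1 \<or> aff_dim (K \<inter> K') = 0"
      using aff_dim_geq[of "K \<inter> K'"] by linarith
    then show ?thesis
    proof
      assume "aff_dim (K \<inter> K') = -1"
      then have "K \<inter> K' = {}" using aff_dim_empty[of "K \<inter> K'"] by simp
      then show ?thesis by simp
    qed (auto simp: aff_dim_eq_0)
  qed
  have "U \<inter> V \<subseteq> (\<Union>K\<in>G. \<Union>K'\<in>\<T> - G. K \<inter> K')" by (auto simp: U_def V_def)
  moreover have "finite (\<Union>K\<in>G. \<Union>K'\<in>\<T> - G. K \<inter> K')" 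
    using \<open>finite G\<close> finite_\<T> fin by (intro finite_UN_I) auto
  ultimately have finUV: "finite (U \<inter> V)" using finite_subset by blast
  have "connected (\<Omega> - (U \<inter> V))"
    by (rule connected_open_diff_countable) (auto simp: open_\<Omega> connected_\<Omega> countable_finite finUV)
  moreover have "\<Omega> - (U \<inter> V) \<subseteq> U \<union> V" using UV closure_subset[of \<Omega>] by auto
  ultimately have "U \<inter> (\<Omega> - (U \<inter> V)) = {} \<or> V \<inter> (\<Omega> - (U \<inter> V)) = {}"
    using cl unfolding connected_closed by blast
  \<comment> \<open>The interior of a triangle is infinite, so it is not exhausted by the finitely
    many deleted points.\<close>
  moreover have ne: "W \<inter> (\<Omega> - (U \<inter> V)) \<noteq> {}" if "K \<in> \<T>" "K \<subseteq> W" for K W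
  proof -
    have "infinite (interior K)"
      using interior_nonempty[OF that(1)] open_interior finite_imp_not_open by blast
    then have "\<not> interior K \<subseteq> U \<inter> V" using finUV finite_subset by blast
    then obtain p where "p \<in> interior K" "p \<notin> U \<inter> V" by blast
    then show ?thesis using interior_subset_\<Omega>[OF that(1)] interior_subset[of K] that(2) by blast
  qed
  moreover obtain c s where "s * s = 1" "ctri c s \<in> \<T>" using member by blast
  then have "ctri c s \<in> G" by (auto simp: G_def X_def intro!: image_eqI[of _ _ "(c, s)"])
  then have "U \<inter> (\<Omega> - (U \<inter> V)) \<noteq> {}" using GT by (intro ne[of "ctri c s"]) (auto simp: U_def)
  ultimately have "V \<inter> (\<Omega> - (U \<inter> V)) = {}" by blast
  then have "\<T> - G = {}" using ne[of _ V] by (auto simp: V_def)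
  then show ?thesis using GT by (auto simp: G_def)
qed

lemma inj_ctri: "inj_on (\<lambda>x. ctri (fst x) (snd x)) X"
proof (rule inj_onI)
  fix x y assume "x \<in> X" "y \<in> X" "ctri (fst x) (snd x) = ctri (fst y) (snd y)"
  then have "fst x = fst y \<and> snd x = snd y" by (intro ctri_inj) (auto simp: X_def)
  then show "x = y" by (simp add: prod_eq_iff)
qed

lemma finite_X: "finite X"
  using finite_\<T> inj_ctri \<T>_eq finite_imageD by metis

lemma orient_X: "x \<in> X \<Longrightarrow> snd x * snd x = 1"
  by (simp add: X_def)

lemma ctri_X: "x \<in> X \<Longrightarrow> ctri (fst x) (snd x) \<in> \<T>"
  by (simp add: X_def)

lemma ctri_subset_closure: "x \<in> X \<Longrightarrow> ctri (fst x) (snd x) \<subseteq> closure \<Omega>"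
  using ctri_X Union_\<T> by blast

lemma otri_subset_\<Omega>: "x \<in> X \<Longrightarrow> otri (fst x) (snd x) \<subseteq> \<Omega>"
  using interior_subset_\<Omega>[OF ctri_X] interior_ctri[OF orient_X] by metis

lemma disjoint_otri:
  assumes "x \<in> X" "y \<in> X" "x \<noteq> y" shows "otri (fst x) (snd x) \<inter> otri (fst y) (snd y) = {}"
proof -
  let ?K = "ctri (fst x) (snd x)" and ?K' = "ctri (fst y) (snd y)"
  have ne: "?K \<noteq> ?K'" using assms inj_ctri by (auto dest: inj_onD)
  have "?K \<inter> ?K' \<noteq> ?K"
    using aff_dim_Int_less[OF ctri_X ctri_X ne] assms aff_dim_ctri by fastforce
  then have "(?K \<inter> ?K') \<inter> interior ?K = {}"
    by (intro face_of_disjoint_interior face_\<T> ctri_X assms) auto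
  then show ?thesis using interior_ctri[OF orient_X] assms otri_subset_ctri by blast
qed

lemma AE_in_otri: "AE p in lebesgue_on \<Omega>. \<exists>x\<in>X. p \<in> otri (fst x) (snd x)"
proof -
  have "AE p in lebesgue. \<forall>x\<in>X. \<forall>i. lam (fst x) (snd x) i p \<noteq> 0"
    using finite_X AE_all_not_edge[OF orient_X] by (intro AE_finite_allI) auto
  then have "AE p in lebesgue. p \<in> \<Omega> \<longrightarrow> (\<exists>x\<in>X. p \<in> otri (fst x) (snd x))"
  proof eventually_elim
    case (elim p)
    show ?case
    proof
      assume "p \<in> \<Omega>"
      then have "p \<in> \<Union>\<T>" using Union_\<T> closure_subset by blast
      then obtain K where "K \<in> \<T>" "p \<in> K" by blast
      moreover then obtain x where "x \<in> X" "K = ctri (fst x) (snd x)" using \<T>_eq by blast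
      ultimately have "x \<in> X" "p \<in> ctri (fst x) (snd x)" by simp_all
      then show "\<exists>x\<in>X. p \<in> otri (fst x) (snd x)"
        using elim by (intro bexI[of _ x]) (auto simp: otri_def ctri_def less_le)
    qed
  qed
  then show ?thesis using open_\<Omega> by (simp add: AE_restrict_space_iff)
qed

lemma integral_\<Omega>:
  fixes f :: "plane \<Rightarrow> real"
  assumes f: "integrable (lebesgue_on \<Omega>) f"
  shows "(LINT p|lebesgue_on \<Omega>. f p) = (\<Sum>x\<in>X. LINT p|lebesgue_on (otri (fst x) (snd x)). f p)"
    and "\<And>x. x \<in> X \<Longrightarrow> integrable (lebesgue_on (otri (fst x) (snd x))) f"
proof -
  let ?K = "\<lambda>x. otri (fst x) (snd x)"
  have \<Omega>: "\<Omega> \<in> sets lebesgue" using open_\<Omega> by auto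
  have i: "integrable lebesgue (\<lambda>p. indicator \<Omega> p *\<^sub>R f p)" using f \<Omega> by (simp add: integrable_restrict_space)
  have eq: "indicator (?K x) p *\<^sub>R (indicator \<Omega> p *\<^sub>R f p) = indicator (?K x) p *\<^sub>R f p" if "x \<in> X" for x p
    using otri_subset_\<Omega>[OF that] by (auto simp: indicator_def)
  have ix: "integrable lebesgue (\<lambda>p. indicator (?K x) p *\<^sub>R f p)" if "x \<in> X" for x
    using integrable_mult_indicator[OF sets_otri i, of "fst x" "snd x"] unfolding eq[OF that] .
  then show "integrable (lebesgue_on (?K x)) f" if "x \<in> X" for x
    using that sets_otri by (simp add: integrable_restrict_space)
  have "(LINT p|lebesgue. indicator \<Omega> p *\<^sub>R f p) = (LINT p|lebesgue. (\<Sum>x\<in>X. indicator (?K x) p *\<^sub>R f p))"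
  proof (rule integral_cong_AE)
    have "AE p in lebesgue. p \<in> \<Omega> \<longrightarrow> (\<exists>x\<in>X. p \<in> ?K x)"
      using AE_in_otri \<Omega> by (simp add: AE_restrict_space_iff)
    then show "AE p in lebesgue. indicator \<Omega> p *\<^sub>R f p = (\<Sum>x\<in>X. indicator (?K x) p *\<^sub>R f p)"
    proof eventually_elim
      case (elim p)
      show ?case
      proof (cases "p \<in> \<Omega>")
        case True
        then obtain x where x: "x \<in> X" "p \<in> ?K x" using elim by blast
        have "(\<Sum>x\<in>X. indicator (?K x) p *\<^sub>R f p) = (\<Sum>y\<in>X. if y = x then f p else 0)"
        proof (intro sum.cong refl)
          fix y assume "y \<in> X"
          then show "indicator (?K y) p *\<^sub>R f p = (if y = x then f p else 0)"
            using x disjoint_otri[of x y] by (cases "y = x") (auto simp: indicator_def)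
        qed
        then show ?thesis using x True finite_X by simp
      next
        case False
        then have "p \<notin> ?K x" if "x \<in> X" for x using otri_subset_\<Omega>[OF that] by blast
        then have "(\<Sum>x\<in>X. indicator (?K x) p *\<^sub>R f p) = 0" by (intro sum.neutral) auto
        then show ?thesis using False by simp
      qed
    qed
  qed (use i ix in auto)
  also have "\<dots> = (\<Sum>x\<in>X. LINT p|lebesgue. indicator (?K x) p *\<^sub>R f p)"
    by (rule Bochner_Integration.integral_sum) (rule ix)
  finally show "(LINT p|lebesgue_on \<Omega>. f p) = (\<Sum>x\<in>X. LINT p|lebesgue_on (?K x). f p)"
    using \<Omega> sets_otri by (simp add: integral_restrict_space)
qed

text \<open>The open common edge belongs to the domain because the domain is the interior of its
  closure; this is where slits are excluded.\<close>

lemma par_subset_\<Omega>: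
  assumes "x \<in> X" "nb i x \<in> X" shows "par (fst x) (snd x) i \<subseteq> \<Omega>"
proof -
  have "par (fst x) (snd x) i \<subseteq> ctri (fst x) (snd x) \<union> ctri (fst (nb i x)) (snd (nb i x))"
    using par_subset[OF orient_X[OF assms(1)]] by (auto simp: nb_def)
  also have "\<dots> \<subseteq> closure \<Omega>" using ctri_subset_closure assms by blast
  finally have "par (fst x) (snd x) i \<subseteq> interior (closure \<Omega>)" using open_par interior_maximal by blast
  then show ?thesis using regular_\<Omega> by simp
qed

text \<open>A point of the open edge inside the domain would lie in a second triangle. The common
  face contains a point that is on no other edge, so it contains edge \<open>i\<close>, and the
  second triangle would be the neighbour \<open>nb i x\<close>.\<close>

lemma unpaired_side_in_frontier:
  assumes x: "x \<in> X" "nb i x \<notin> X" and p: "p \<in> ctri (fst x) (snd x)" "\<And>m. lam (fst x) (snd x) m p = 0 \<longleftrightarrow> m = i"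
  shows "p \<in> frontier \<Omega>"
proof -
  let ?K = "ctri (fst x) (snd x)"
  note s = orient_X[OF x(1)]
  have "p \<notin> \<Omega>"
  proof
    assume "p \<in> \<Omega>"
    define C where "C = \<Union>(\<T> - {?K})"
    have "closed C" unfolding C_def using finite_\<T> simplex_\<T> closed_simplex by (intro closed_Union) auto
    have "p \<in> C"
    proof (rule ccontr)
      assume "p \<notin> C"
      have "\<Omega> \<subseteq> ?K \<union> C" using Union_\<T> closure_subset[of \<Omega>] unfolding C_def by blast
      then have "\<Omega> - C \<subseteq> ?K" by blast
      then have "p \<in> interior ?K"
        using \<open>p \<in> \<Omega>\<close> \<open>p \<notin> C\<close> open_Diff[OF open_\<Omega> \<open>closed C\<close>] interior_maximal by blast
      then show False using p(2)[of i] unfolding interior_ctri[OF s] otri_def mem_Collect_eq by (metis less_irrefl)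
    qed
    then obtain K' where K': "K' \<in> \<T>" "K' \<noteq> ?K" "p \<in> K'" unfolding C_def by blast
    obtain I where I: "?K \<inter> K' = convex hull (vert (fst x) (snd x) ` I)"
      using face_\<T>[OF ctri_X[OF x(1)] K'(1)] face_of_ctri[OF s] by blast
    have "p \<in> convex hull (vert (fst x) (snd x) ` I)" using p(1) K'(3) I by blast
    then have "m \<in> I" if "m \<noteq> i" for m using lam_convex_hull_vert[OF s] p(2) that by blast
    then have "card (- {i}) \<le> card I" by (intro card_mono) auto
    then have "2 \<le> card I" by (simp add: Compl_eq_Diff_UNIV card_Diff_subset)
    then have d: "0 < aff_dim (?K \<inter> K')" unfolding I aff_dim_convex_hull_vert[OF s] by simp
    obtain i' where i': "?K \<inter> K' = side (fst x) (snd x) i'" "K' = ctri (fst x - snd x *\<^sub>R \<omega> i') (- snd x)"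
      by (rule Int_positive_dim_imp_neighbour[OF s ctri_X[OF x(1)] K'(1,2) d])
    have "lam (fst x) (snd x) i' p = 0" by (rule lam_side[OF s]) (use i'(1) p(1) K'(3) in blast)
    then have "i' = i" using p(2) by simp
    then have "nb i x \<in> X" using i'(2) K'(1) s by (simp add: X_def nb_def)
    then show False using x(2) by simp
  qed
  moreover have "p \<in> closure \<Omega>" using ctri_subset_closure[OF x(1)] p(1) by blast
  ultimately show ?thesis by (simp add: frontier_def interior_open[OF open_\<Omega>])
qed

text \<open>Infinitely many points of the edge tending to its midpoint are distributed over finitely
  many segments. One segment receives infinitely many of them, contains the midpoint because it is
  closed, and has the direction of the edge because it contains two of them.\<close>

lemma unpaired_side_segment:
  assumes x: "x \<in> X" "nb i x \<notin> X"
    and S: "finite S" "\<And>s. s \<in> S \<Longrightarrow> \<exists>a b. s = closed_segment a b" "frontier \<Omega> = \<Union>S"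
  shows "\<exists>a b. closed_segment a b \<in> S \<and> a \<noteq> b \<and> mid i x \<in> closed_segment a b \<and> A i \<bullet> (b - a) = 0"
proof -
  obtain k l where ikl: "i \<noteq> k" "i \<noteq> l" "k \<noteq> l" using other_indices by metis
  let ?c = "fst x" and ?s = "snd x"
  note s = orient_X[OF x(1)]
  define q where "q = linepath (vert ?c ?s k) (vert ?c ?s l)"
  \<comment> \<open>The offset 3 keeps the parameters below 1.\<close>
  define t where "t n = 1/2 + 1 / real (n + 3)" for n
  have t: "0 < t n" "t n < 1" for n by (auto simp: t_def field_simps)
  have lq: "lam ?c ?s m (q u) = (if m = k then 1 - u else if m = l then u else 0)" for m u
    using ikl by (auto simp: q_def lam_linepath lam_vert[OF s])
  have "q (t n) \<in> frontier \<Omega>" for n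
  proof (rule unpaired_side_in_frontier[OF x])
    show "q (t n) \<in> ctri ?c ?s" using t[of n] by (simp add: ctri_def lq)
    show "lam ?c ?s m (q (t n)) = 0 \<longleftrightarrow> m = i" for m
      using t[of n] triangle_indices[OF ikl, of m] ikl by (auto simp: lq)
  qed
  then have "\<forall>n. \<exists>s\<in>S. q (t n) \<in> s" using S(3) by blast
  then obtain z where z: "\<And>n. z n \<in> S \<and> q (t n) \<in> z n" by metis
  have "finite (z ` UNIV)" using S(1) z finite_subset[of "range z" S] by blast
  then obtain n0 where N: "infinite {n \<in> UNIV. z n = z n0}"
    using pigeonhole_infinite[of "UNIV :: nat set" z] by auto
  obtain r :: "nat \<Rightarrow> nat" where r': "strict_mono r \<and> (\<forall>n. r n \<in> {n \<in> UNIV. z n = z n0})"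
    by (rule exE[OF infinite_enumerate[OF N]])
  then have r: "strict_mono r" "\<And>n. z (r n) = z n0" by auto
  obtain a b where ab: "z n0 = closed_segment a b" "z n0 \<in> S" using S(2) z by blast
  have qr: "q (t (r n)) \<in> closed_segment a b" for n using z[of "r n"] r(2)[of n] ab(1) by simp
  have "t \<longlonglongrightarrow> 1/2 + 0"
    unfolding t_def by (intro tendsto_add tendsto_const) real_asymp
  moreover have "isCont q (1/2)" unfolding q_def linepath_def by (intro continuous_intros)
  ultimately have "(\<lambda>n. q (t n)) \<longlonglongrightarrow> q (1/2)" using isCont_tendsto_compose by auto
  then have lim: "(\<lambda>n. q (t (r n))) \<longlonglongrightarrow> q (1/2)"
    using LIMSEQ_subseq_LIMSEQ[OF _ r(1), of "\<lambda>n. q (t n)"] by (simp add: o_def)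
  have "q (1/2) \<in> closed_segment a b" by (rule closed_sequentially[OF closed_segment qr lim])
  then have mid: "mid i x \<in> closed_segment a b" unfolding q_def mid_eq_linepath[OF ikl] .
  obtain \<alpha> where \<alpha>: "q (t (r 0)) - q (t (r 1)) = \<alpha> *\<^sub>R (b - a)"
    by (rule closed_segment_diff[OF qr qr])
  have d: "q (t (r 0)) - q (t (r 1)) = (t (r 0) - t (r 1)) *\<^sub>R (vert ?c ?s l - vert ?c ?s k)"
    by (simp add: q_def linepath_def algebra_simps)
  have "r 0 < r 1" using r(1) by (simp add: strict_mono_def)
  then have "t (r 0) - t (r 1) \<noteq> 0" by (simp add: t_def)
  moreover have "vert ?c ?s l - vert ?c ?s k \<noteq> 0" using inj_vert[OF s] ikl by (simp add: inj_eq)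
  ultimately have "\<alpha> *\<^sub>R (b - a) \<noteq> 0" using d \<alpha> by (metis scaleR_eq_0_iff)
  then have "\<alpha> \<noteq> 0" "a \<noteq> b" by auto
  moreover have "\<alpha> * (A i \<bullet> (b - a)) = (t (r 0) - t (r 1)) * (A i \<bullet> (vert ?c ?s l - vert ?c ?s k))"
    using d \<alpha> by (metis inner_scaleR_right)
  then have "\<alpha> * (A i \<bullet> (b - a)) = 0" using ikl by (simp add: A_vert_diff_eq[OF s])
  ultimately have "A i \<bullet> (b - a) = 0" by simp
  then show ?thesis using ab mid \<open>a \<noteq> b\<close> by (intro exI[of _ a] exI[of _ b]) simp
qed

lemma unpaired_trianglesI:
  assumes x: "x \<in> X" "nb i x \<notin> X" and f: "f = \<beta> *\<^sub>R A i" "\<beta> \<noteq> 0"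
  shows "ctri (fst x) (snd x) \<in> unpaired_triangles \<T> f"
proof -
  note s = orient_X[OF x(1)]
  have False if K': "K' \<in> \<T>" "K' \<noteq> ctri (fst x) (snd x)" and e: "e edge_of ctri (fst x) (snd x)" "e edge_of K'" and n: "unit_normal e f" for K' e
  proof -
    obtain m where m: "e = side (fst x) (snd x) m" using e(1) edge_of_ctri[OF s] by blast
    have "m = i"
    proof (rule ccontr)
      assume "m \<noteq> i"
      obtain k l where mkl: "m \<noteq> k" "m \<noteq> l" "k \<noteq> l" using other_indices by metis
      have "f \<bullet> (vert (fst x) (snd x) k - vert (fst x) (snd x) l) = 0"
        using n mkl unfolding unit_normal_def m side_def by (auto simp: hull_inc)
      then have "snd x * ((if i = k then 1 else 0) - (if i = l then 1 else 0)) = 0"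
        using f by (simp add: A_vert_diff_eq[OF s])
      then show False using triangle_indices[OF mkl, of i] mkl \<open>m \<noteq> i\<close> s by (auto split: if_splits)
    qed
    then have "K' = ctri (fst x - snd x *\<^sub>R \<omega> i) (- snd x)"
      using Int_edge_imp_neighbour[OF s ctri_X[OF x(1)] K'] e(2) m by blast
    then have "nb i x \<in> X" using K'(1) s by (simp add: X_def nb_def)
    then show False using x(2) by simp
  qed
  then show ?thesis using ctri_X[OF x(1)] unfolding unpaired_triangles_def by blast
qed

text \<open>An outer normal of edge \<open>i\<close> is a multiple of \<open>A i\<close> whose sign
  is fixed by the orientation of the triangle. Hence two different outer unit normals belong to
  different edges.\<close>

lemma outer_unit_normals_eq:
  assumes K: "K \<in> \<T>" and n: "n \<in> outer_unit_normals K" "n' \<in> outer_unit_normals K" "n \<noteq> n'"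
  obtains i j \<alpha> \<beta> where "i \<noteq> j" "n = \<alpha> *\<^sub>R A i" "n' = \<beta> *\<^sub>R A j" "\<alpha> \<noteq> 0" "\<beta> \<noteq> 0"
proof -
  obtain x where x: "x \<in> X" "K = ctri (fst x) (snd x)" using K \<T>_eq by blast
  note s = orient_X[OF x(1)]
  have *: "\<exists>i \<beta>. \<beta> \<noteq> 0 \<and> n = \<beta> *\<^sub>R A i \<and> norm n = 1 \<and> \<beta> * snd x \<le> 0" if n: "n \<in> outer_unit_normals K" for n
  proof -
    obtain e where e: "e edge_of K" "unit_normal e n" "\<And>p q. p \<in> K \<Longrightarrow> q \<in> e \<Longrightarrow> n \<bullet> (p - q) \<le> 0"
      using n unfolding outer_unit_normals_def by blast
    obtain i where i: "e = side (fst x) (snd x) i" using e(1) edge_of_ctri[OF s] x by blast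
    have "n \<noteq> 0" using e(2) by (auto simp: unit_normal_def)
    then obtain \<beta> where \<beta>: "\<beta> \<noteq> 0" "n = \<beta> *\<^sub>R A i"
      using normal_of_side[OF s] e(2) unfolding unit_normal_def i by blast
    obtain k where "i \<noteq> k" using other_indices by metis
    then have "n \<bullet> (vert (fst x) (snd x) i - vert (fst x) (snd x) k) \<le> 0"
      using x vert_in_ctri[OF s] by (intro e(3)) (auto simp: i side_def hull_inc)
    then have "\<beta> * snd x \<le> 0" using \<beta> \<open>i \<noteq> k\<close> by (simp add: A_vert_diff_eq[OF s])
    then show ?thesis using \<beta> e(2) by (auto simp: unit_normal_def)
  qed
  obtain i \<alpha> where 1: "\<alpha> \<noteq> 0" "n = \<alpha> *\<^sub>R A i" "norm n = 1" "\<alpha> * snd x \<le> 0" using *[OF n(1)] by blast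
  obtain j \<beta> where 2: "\<beta> \<noteq> 0" "n' = \<beta> *\<^sub>R A j" "norm n' = 1" "\<beta> * snd x \<le> 0" using *[OF n(2)] by blast
  have "i \<noteq> j"
  proof
    assume "i = j"
    have "\<bar>\<alpha>\<bar> * norm (A i) = \<bar>\<beta>\<bar> * norm (A i)" using 1 2 \<open>i = j\<close> by simp
    then have "\<bar>\<alpha>\<bar> = \<bar>\<beta>\<bar>" using A_nonzero by simp
    moreover have "\<alpha> \<noteq> - \<beta>"
    proof
      assume "\<alpha> = - \<beta>"
      then have "\<beta> * snd x = 0" using 1(4) 2(4) by simp
      then show False using 2(1) s by auto
    qed
    ultimately have "\<alpha> = \<beta>" by (auto simp: abs_if split: if_splits)
    then show False using n(3) 1(2) 2(2) \<open>i = j\<close> by simp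
  qed
  then show ?thesis using 1 2 that by blast
qed

text \<open>A point of the closed domain of maximal norm is a corner, and a vertex of each triangle it belongs
  to. The two neighbours of a triangle across the edges meeting there cannot both lie in the domain.\<close>

lemma kappa_pos:
  assumes "most_orthogonal_normals \<T> f1 f2" shows "0 < kappa \<Omega> \<T> f1 f2"
proof -
  obtain K where "K \<in> \<T>" "f1 \<in> outer_unit_normals K" "f2 \<in> outer_unit_normals K" "f1 \<noteq> f2"
    using assms unfolding most_orthogonal_normals_def by blast
  then obtain i1 i2 \<beta>1 \<beta>2 where f: "i1 \<noteq> i2" "f1 = \<beta>1 *\<^sub>R A i1" "f2 = \<beta>2 *\<^sub>R A i2" "\<beta>1 \<noteq> 0" "\<beta>2 \<noteq> 0"
    by (rule outer_unit_normals_eq)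
  obtain i3 where i3: "i1 \<noteq> i3" "i2 \<noteq> i3"
  proof -
    obtain k l where "i1 \<noteq> k" "i1 \<noteq> l" "k \<noteq> l" using other_indices by metis
    then show ?thesis using that[of k] that[of l] by blast
  qed
  have "compact (closure \<Omega>)" "closure \<Omega> \<noteq> {}" using bounded_\<Omega> nonempty_\<Omega> by (auto simp: compact_closure)
  then obtain p where p: "p \<in> closure \<Omega>" "\<And>y. y \<in> closure \<Omega> \<Longrightarrow> norm y \<le> norm p"
    using continuous_attains_sup[of "closure \<Omega>" norm] continuous_on_norm_id by blast
  \<comment> \<open>A displacement that makes no obtuse angle with \<open>p\<close> increases the
    norm. Consequently, of two opposite displacements at most one stays in the closed
    domain.\<close>
  have far: False if "v \<noteq> 0" "p + v \<in> closure \<Omega>" "0 \<le> v \<bullet> p" for v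
  proof -
    have "norm (p + v) ^ 2 = norm p ^ 2 + 2 * (v \<bullet> p) + norm v ^ 2"
      by (simp add: power2_norm_eq_inner inner_add_left inner_add_right inner_commute)
    moreover have "0 < norm v ^ 2" using that(1) by simp
    ultimately have "norm p ^ 2 < norm (p + v) ^ 2" using that(3) by linarith
    then have "norm p < norm (p + v)" by (rule power2_less_imp_less) simp
    then show False using p(2)[OF that(2)] by simp
  qed
  have far2: "p + v \<notin> closure \<Omega> \<or> p - v \<notin> closure \<Omega>" if "v \<noteq> 0" for v
    using far[of v] far[of "- v"] that by (cases "0 \<le> v \<bullet> p") auto
  have "p \<notin> \<Omega>"
  proof
    assume "p \<in> \<Omega>"
    then obtain e where e: "0 < e" "cball p e \<subseteq> \<Omega>" using open_\<Omega> open_contains_cball by blast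
    define v where "v = (if p = 0 then e *\<^sub>R axis 1 1 else (e / norm p) *\<^sub>R p)"
    have "norm v = e" using e(1) by (auto simp: v_def)
    then have "p + v \<in> cball p e" by (simp add: dist_norm)
    then have "p + v \<in> closure \<Omega>" using e(2) closure_subset[of \<Omega>] by blast
    moreover have "0 \<le> v \<bullet> p" using e(1) by (auto simp: v_def)
    moreover have "v \<noteq> 0" using \<open>norm v = e\<close> e(1) by auto
    ultimately show False using far by blast
  qed
  then have pf: "p \<in> frontier \<Omega>" using p(1) by (simp add: frontier_def interior_open[OF open_\<Omega>])
  \<comment> \<open>If the domain were a half plane near \<open>p\<close>, its boundary line would
    lie in the closure on both sides of \<open>p\<close>.\<close>
  have corner: "domain_corner \<Omega> p"
    unfolding domain_corner_def
  proof (intro conjI pf notI, elim exE conjE)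
    fix n r assume n: "n \<noteq> 0" and r: "0 < (r::real)" and eq: "\<Omega> \<inter> ball p r = {x. n \<bullet> (x - p) < 0} \<inter> ball p r"
    define w :: plane where "w = vector [- n $ 2, n $ 1]"
    have nw: "n \<bullet> w = 0" by (simp add: w_def inner_vec_def sum_2)
    have w0: "w \<noteq> 0" using n by (auto simp: w_def vec_eq_iff forall_2)
    have "p + t *\<^sub>R w \<in> closure \<Omega>" if t: "\<bar>t\<bar> * norm w < r" for t
    proof -
      define z where "z m = p + t *\<^sub>R w - (1 / real (m + 1)) *\<^sub>R n" for m
      have lim: "z \<longlonglongrightarrow> p + t *\<^sub>R w - 0 *\<^sub>R n"
        unfolding z_def by (intro tendsto_intros) real_asymp
      then have lim': "z \<longlonglongrightarrow> p + t *\<^sub>R w" by simp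
      moreover have "p + t *\<^sub>R w \<in> ball p r" using t by (simp add: dist_norm)
      ultimately have ev: "\<forall>\<^sub>F m in sequentially. z m \<in> ball p r"
        using topological_tendstoD open_ball by blast
      have neg: "n \<bullet> (z m - p) < 0" for m
        using n nw by (simp add: z_def inner_diff_right inner_add_right)
      from ev have "\<forall>\<^sub>F m in sequentially. z m \<in> closure \<Omega>"
      proof eventually_elim
        case (elim m)
        then have "z m \<in> {x. n \<bullet> (x - p) < 0} \<inter> ball p r" using neg by simp
        then show ?case using closure_subset[of \<Omega>] unfolding eq[symmetric] by blast
      qed
      then show ?thesis
        using Lim_in_closed_set[OF closed_closure _ _ lim'] by simp
    qed
    from this[of "r / (2 * norm w)"] this[of "- (r / (2 * norm w))"] w0 r
    have "p + (r / (2 * norm w)) *\<^sub>R w \<in> closure \<Omega>" "p - (r / (2 * norm w)) *\<^sub>R w \<in> closure \<Omega>"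
      by (simp_all add: field_simps)
    moreover have "(r / (2 * norm w)) *\<^sub>R w \<noteq> 0" using w0 r by simp
    ultimately show False using far2 by blast
  qed
  have extreme: "p extreme_point_of K" if K: "K \<in> \<T>" "p \<in> K" for K
    unfolding extreme_point_of_def
  proof (intro conjI K(2) ballI notI)
    fix a b assume ab: "a \<in> K" "b \<in> K" "p \<in> open_segment a b"
    then have "a \<noteq> b" by auto
    obtain u where u: "0 < u" "u < 1" "p = (1 - u) *\<^sub>R a + u *\<^sub>R b" using ab(3) by (auto simp: in_segment)
    have "K \<subseteq> closure \<Omega>" using K(1) Union_\<T> by blast
    then have "a \<in> closure \<Omega>" "b \<in> closure \<Omega>" using ab by auto
    moreover have "a = p + (- u) *\<^sub>R (b - a)" "b = p + (1 - u) *\<^sub>R (b - a)"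
      unfolding u(3) by (simp_all add: algebra_simps)
    ultimately have *: "p + (- u) *\<^sub>R (b - a) \<in> closure \<Omega>" "p + (1 - u) *\<^sub>R (b - a) \<in> closure \<Omega>" by metis+
    have "(- u) *\<^sub>R (b - a) \<noteq> 0" "(1 - u) *\<^sub>R (b - a) \<noteq> 0" using u \<open>a \<noteq> b\<close> by auto
    moreover have "0 \<le> ((- u) *\<^sub>R (b - a)) \<bullet> p \<or> 0 \<le> ((1 - u) *\<^sub>R (b - a)) \<bullet> p"
      using u(1,2) by (cases "0 \<le> (b - a) \<bullet> p") (auto simp: mult_nonneg_nonpos)
    ultimately show False using far * by blast
  qed
  obtain K where K: "K \<in> \<T>" "p \<in> K" using p(1) Union_\<T> by blast
  then obtain x where x: "x \<in> X" "K = ctri (fst x) (snd x)" using \<T>_eq by blast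
  then obtain j where j: "p = vert (fst x) (snd x) j"
    using extreme[OF K] extreme_point_of_ctri[OF orient_X[OF x(1)]] by blast
  \<comment> \<open>Here \<open>p\<close> is the vertex common to the edges \<open>i1\<close> and
    \<open>i2\<close>. The vertices gained by crossing these edges are \<open>p\<close> plus and
    minus the same vector, so one of the two neighbours is missing.\<close>
  have paired: "\<exists>i\<in>{i1, i2}. nb i y \<notin> X" if y: "y \<in> X" "p = vert (fst y) (snd y) i3" for y
  proof (rule ccontr)
    assume "\<not> ?thesis"
    then have n: "nb i1 y \<in> X" "nb i2 y \<in> X" by auto
    let ?v = "vert (fst y) (snd y)"
    have "vert (fst (nb i y)) (snd (nb i y)) i \<in> closure \<Omega>" if "nb i y \<in> X" for i
      using ctri_subset_closure[OF that] vert_in_ctri[OF orient_X[OF that]] by blast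
    from this[OF n(1)] this[OF n(2)]
    have "?v i2 + ?v i3 - ?v i1 \<in> closure \<Omega>" "?v i1 + ?v i3 - ?v i2 \<in> closure \<Omega>"
      using vert_neighbour(3)[of i1 i2 i3] vert_neighbour(3)[of i2 i1 i3] f(1) i3 by (auto simp: nb_def)
    then have "p + (?v i2 - ?v i1) \<in> closure \<Omega>" "p - (?v i2 - ?v i1) \<in> closure \<Omega>"
      using y(2) by (simp_all add: algebra_simps)
    moreover have "?v i2 - ?v i1 \<noteq> 0" using inj_vert[OF orient_X[OF y(1)]] f(1) by (auto simp: inj_eq)
    ultimately show False using far2 by blast
  qed
  have "\<exists>y\<in>X. \<exists>i\<in>{i1, i2}. nb i y \<notin> X \<and> (\<exists>m. p = vert (fst y) (snd y) m)"
  proof (cases "j = i3")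
    case True
    then show ?thesis using paired[OF x(1)] j x(1) by blast
  next
    case False
    then have "j = i1 \<or> j = i2" using triangle_indices[of i1 i2 i3 j] f(1) i3 by blast
    \<comment> \<open>The edge \<open>i\<close> contains \<open>p\<close>. Crossing it exchanges the
      labels of its two end points, so that in the neighbour \<open>p\<close> becomes the vertex
      \<open>i3\<close> and the previous case applies.\<close>
    then obtain i where i: "i \<in> {i1, i2}" "i \<noteq> j" "i \<noteq> i3" "j \<noteq> i3"
      using f(1) i3 by blast
    show ?thesis
    proof (cases "nb i x \<in> X")
      case True
      have "vert (fst (nb i x)) (snd (nb i x)) i3 = p"
        using vert_neighbour(2)[of i j i3] i by (simp add: nb_def j)
      then show ?thesis using paired[OF True] True by metis
    qed (use i j x(1) in blast)
  qed
  then obtain y i m where y: "y \<in> X" "i \<in> {i1, i2}" "nb i y \<notin> X" "p = vert (fst y) (snd y) m" by blast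
  have "ctri (fst y) (snd y) \<in> unpaired_triangles \<T> f1 \<union> unpaired_triangles \<T> f2"
    using y(2) unpaired_trianglesI[OF y(1,3)] f(2-5) by auto
  then have "p \<in> boundary_points \<Omega> \<T> f1 f2"
    unfolding boundary_points_def using pf y(4) extreme_point_of_ctri[OF orient_X[OF y(1)]] by blast
  then have "p \<in> {p \<in> boundary_points \<Omega> \<T> f1 f2. domain_corner \<Omega> p}" using corner by blast
  \<comment> \<open>Finiteness has to be shown because the cardinality of an infinite set is 0 by
    convention.\<close>
  moreover have "finite {p \<in> boundary_points \<Omega> \<T> f1 f2. domain_corner \<Omega> p}"
  proof (rule finite_subset)
    show "{p \<in> boundary_points \<Omega> \<T> f1 f2. domain_corner \<Omega> p} \<subseteq> (\<Union>x\<in>X. range (vert (fst x) (snd x)))"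
    proof
      fix q assume "q \<in> {p \<in> boundary_points \<Omega> \<T> f1 f2. domain_corner \<Omega> p}"
      then obtain K where K: "K \<in> \<T>" "q extreme_point_of K"
        unfolding boundary_points_def unpaired_triangles_def by blast
      then obtain x where x: "x \<in> X" "K = ctri (fst x) (snd x)" using \<T>_eq by blast
      have "\<exists>i. q = vert (fst x) (snd x) i"
        using K(2) unfolding x(2) extreme_point_of_ctri[OF orient_X[OF x(1)]] .
      then show "q \<in> (\<Union>x\<in>X. range (vert (fst x) (snd x)))" using x(1) by auto
    qed
  qed (use finite_X in auto)
  ultimately show ?thesis unfolding kappa_def by (metis card_gt_0_iff empty_iff)
qed

end

section \<open>Second derivatives and the Slobodeckij seminorm\<close>

lemma mixed_difference_quotient:
  assumes \<phi>: "smooth \<phi>" and h: "0 < h"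
  obtains \<xi> \<eta> where "0 < \<xi>" "\<xi> < h" "0 < \<eta>" "\<eta> < h"
    "\<phi> (x + h *\<^sub>R axis i 1 + h *\<^sub>R axis j 1) - \<phi> (x + h *\<^sub>R axis i 1) - \<phi> (x + h *\<^sub>R axis j 1) + \<phi> x =
      h * h * pd j (pd i \<phi>) (x + \<xi> *\<^sub>R axis i 1 + \<eta> *\<^sub>R axis j 1)"
proof -
  let ?e = "axis i 1 :: plane" and ?f = "axis j 1 :: plane"
  note d = smooth_differentiable[OF \<phi>] and d' = smooth_differentiable[OF smooth_pd[OF \<phi>]]
  define F where "F t = \<phi> ((x + h *\<^sub>R ?f) + t *\<^sub>R ?e) - \<phi> (x + t *\<^sub>R ?e)" for t
  have F: "(F has_real_derivative pd i \<phi> ((x + h *\<^sub>R ?f) + t *\<^sub>R ?e) - pd i \<phi> (x + t *\<^sub>R ?e)) (at t)" for t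
    unfolding F_def by (intro DERIV_diff DERIV_slice d)
  obtain \<xi> where \<xi>: "0 < \<xi>" "\<xi> < h" "F h - F 0 = (h - 0) * (pd i \<phi> ((x + h *\<^sub>R ?f) + \<xi> *\<^sub>R ?e) - pd i \<phi> (x + \<xi> *\<^sub>R ?e))"
    using MVT2[OF h F] by blast
  define G where "G t = pd i \<phi> ((x + \<xi> *\<^sub>R ?e) + t *\<^sub>R ?f)" for t
  have G: "(G has_real_derivative pd j (pd i \<phi>) ((x + \<xi> *\<^sub>R ?e) + t *\<^sub>R ?f)) (at t)" for t
    unfolding G_def by (intro DERIV_slice d')
  obtain \<eta> where \<eta>: "0 < \<eta>" "\<eta> < h" "G h - G 0 = (h - 0) * pd j (pd i \<phi>) ((x + \<xi> *\<^sub>R ?e) + \<eta> *\<^sub>R ?f)"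
    using MVT2[OF h G] by blast
  have "pd i \<phi> ((x + h *\<^sub>R ?f) + \<xi> *\<^sub>R ?e) - pd i \<phi> (x + \<xi> *\<^sub>R ?e) = G h - G 0"
    by (simp add: G_def add_ac)
  then have "F h - F 0 = h * h * pd j (pd i \<phi>) (x + \<xi> *\<^sub>R ?e + \<eta> *\<^sub>R ?f)"
    using \<xi>(3) \<eta>(3) by simp
  moreover have "F h - F 0 = \<phi> (x + h *\<^sub>R ?e + h *\<^sub>R ?f) - \<phi> (x + h *\<^sub>R ?e) - \<phi> (x + h *\<^sub>R ?f) + \<phi> x"
    by (simp add: F_def add_ac)
  ultimately show ?thesis using that \<xi>(1,2) \<eta>(1,2) by metis
qed

text \<open>The second mixed difference is symmetric in the two directions. Applying the mean value
  theorem twice, in either order, evaluates its quotient near \<open>x\<close>, and both second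
  derivatives are continuous.\<close>

lemma pd_commute:
  assumes \<phi>: "smooth \<phi>" shows "pd i (pd j \<phi>) x = pd j (pd i \<phi>) x"
proof -
  define h where "h n = 1 / real (Suc n)" for n
  have h: "0 < h n" for n by (simp add: h_def)
  let ?D = "\<lambda>n. \<phi> (x + h n *\<^sub>R axis i 1 + h n *\<^sub>R axis j 1) - \<phi> (x + h n *\<^sub>R axis i 1) - \<phi> (x + h n *\<^sub>R axis j 1) + \<phi> x"
  have lim: "(\<lambda>n. ?D n / (h n * h n)) \<longlonglongrightarrow> pd b (pd a \<phi>) x"
    if D: "\<And>n. \<exists>\<xi> \<eta>. 0 < \<xi> \<and> \<xi> < h n \<and> 0 < \<eta> \<and> \<eta> < h n \<and> ?D n = h n * h n * pd b (pd a \<phi>) (x + \<xi> *\<^sub>R axis a 1 + \<eta> *\<^sub>R axis b 1)" for a b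
  proof -
    obtain \<xi> \<eta> where \<xi>\<eta>: "\<And>n. 0 < \<xi> n \<and> \<xi> n < h n \<and> 0 < \<eta> n \<and> \<eta> n < h n \<and> ?D n = h n * h n * pd b (pd a \<phi>) (x + \<xi> n *\<^sub>R axis a 1 + \<eta> n *\<^sub>R axis b 1)"
      using D by metis
    have h0: "h \<longlonglongrightarrow> 0" unfolding h_def by real_asymp
    have "\<xi> \<longlonglongrightarrow> 0" "\<eta> \<longlonglongrightarrow> 0"
      by (rule tendsto_sandwich[OF _ _ tendsto_const h0]; use \<xi>\<eta> in \<open>auto intro!: always_eventually less_imp_le\<close>)+
    then have "(\<lambda>n. x + \<xi> n *\<^sub>R axis a 1 + \<eta> n *\<^sub>R axis b 1) \<longlonglongrightarrow> x + 0 *\<^sub>R axis a 1 + 0 *\<^sub>R axis b 1"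
      by (intro tendsto_intros)
    moreover have "isCont (pd b (pd a \<phi>)) x"
      using smooth_continuous[OF smooth_pd[OF smooth_pd[OF \<phi>]], of UNIV] by (simp add: continuous_on_eq_continuous_at)
    ultimately have "(\<lambda>n. pd b (pd a \<phi>) (x + \<xi> n *\<^sub>R axis a 1 + \<eta> n *\<^sub>R axis b 1)) \<longlonglongrightarrow> pd b (pd a \<phi>) x"
      using isCont_tendsto_compose by auto
    moreover have "?D n / (h n * h n) = pd b (pd a \<phi>) (x + \<xi> n *\<^sub>R axis a 1 + \<eta> n *\<^sub>R axis b 1)" for n
    proof -
      have "?D n = h n * h n * pd b (pd a \<phi>) (x + \<xi> n *\<^sub>R axis a 1 + \<eta> n *\<^sub>R axis b 1)" using \<xi>\<eta> by blast
      then show ?thesis using h[of n] by simp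
    qed
    ultimately show ?thesis by simp
  qed
  have 1: "(\<lambda>n. ?D n / (h n * h n)) \<longlonglongrightarrow> pd j (pd i \<phi>) x"
  proof (rule lim)
    fix n show "\<exists>\<xi> \<eta>. 0 < \<xi> \<and> \<xi> < h n \<and> 0 < \<eta> \<and> \<eta> < h n \<and> ?D n = h n * h n * pd j (pd i \<phi>) (x + \<xi> *\<^sub>R axis i 1 + \<eta> *\<^sub>R axis j 1)"
      by (rule mixed_difference_quotient[OF \<phi> h[of n], of x i j]) blast
  qed
  have 2: "(\<lambda>n. ?D n / (h n * h n)) \<longlonglongrightarrow> pd i (pd j \<phi>) x"
  proof (rule lim)
    fix n
    have "?D n = \<phi> (x + h n *\<^sub>R axis j 1 + h n *\<^sub>R axis i 1) - \<phi> (x + h n *\<^sub>R axis j 1) - \<phi> (x + h n *\<^sub>R axis i 1) + \<phi> x"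
      by (simp add: add_ac)
    then show "\<exists>\<xi> \<eta>. 0 < \<xi> \<and> \<xi> < h n \<and> 0 < \<eta> \<and> \<eta> < h n \<and> ?D n = h n * h n * pd i (pd j \<phi>) (x + \<xi> *\<^sub>R axis j 1 + \<eta> *\<^sub>R axis i 1)"
      using mixed_difference_quotient[OF \<phi> h[of n], of x j i] by metis
  qed
  show ?thesis using LIMSEQ_unique[OF 2 1] .
qed

text \<open>The first order identity is tested with \<open>pd l \<phi>\<close>. As
  \<open>mpd\<close> always differentiates in the second variable first, one mixed case needs the
  symmetry of second derivatives.\<close>

lemma has_weak_deriv_second:
  assumes 1: "has_weak_deriv U (unit_index j) v G" and 2: "has_weak_deriv U \<alpha> v g"
    and \<alpha>: "fst \<alpha> = fst (unit_index j) + fst (unit_index l)" "snd \<alpha> = snd (unit_index j) + snd (unit_index l)"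
  shows "has_weak_deriv U (unit_index l) G g"
  unfolding has_weak_deriv_def
proof (intro conjI allI impI)
  fix \<phi> assume \<phi>: "test_function U \<phi>"
  have "smooth \<phi>" using \<phi> by (simp add: test_function_def)
  have "mpd \<alpha> \<phi> = pd j (pd l \<phi>)"
  proof -
    have "j = 1 \<or> j = 2" "l = 1 \<or> l = 2" using exhaust_2 by auto
    then show ?thesis
      unfolding mpd_def \<alpha> unit_index_def
      by (elim disjE) (simp_all add: numeral_2_eq_2 fun_eq_iff pd_commute[OF \<open>smooth \<phi>\<close>, of 2 1])
  qed
  moreover have "mi_order \<alpha> = 2" using \<alpha> by (simp add: mi_order_def unit_index_def split: if_splits)
  moreover have "(LINT x|lebesgue_on U. v x * mpd \<alpha> \<phi> x) = (- 1) ^ mi_order \<alpha> * (LINT x|lebesgue_on U. g x * \<phi> x)"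
    using 2 \<phi> unfolding has_weak_deriv_def by blast
  ultimately have "(LINT x|lebesgue_on U. v x * pd j (pd l \<phi>) x) = (LINT x|lebesgue_on U. g x * \<phi> x)"
    by simp
  moreover have "(LINT x|lebesgue_on U. v x * pd j (pd l \<phi>) x) = - (LINT x|lebesgue_on U. G x * pd l \<phi> x)"
    using 1 test_function_pd[OF \<phi>, of l] by (simp add: has_weak_deriv_def)
  ultimately show "(LINT x|lebesgue_on U. G x * mpd (unit_index l) \<phi> x) =
      (- 1) ^ mi_order (unit_index l) * (LINT x|lebesgue_on U. g x * \<phi> x)"
    by simp
qed (use 1 2 in \<open>auto simp: has_weak_deriv_def\<close>)

lemma AE_const_open:
  assumes "open (U :: plane set)" "U \<noteq> {}" "AE x in lebesgue_on U. P" shows P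
proof (rule ccontr)
  assume "\<not> P"
  then have "AE x in lebesgue. x \<notin> U" using assms(1,3) by (simp add: AE_restrict_space_iff)
  then have "negligible U" using assms(1) by (simp add: negligible_iff_null_sets AE_iff_null_sets[symmetric])
  then show False using open_not_negligible assms(1,2) by blast
qed

text \<open>The mean of \<open>g\<close> against a fixed test function is controlled by integration by parts, the deviation
  from this mean by the seminorm.\<close>

lemma slobodeckij_half_bounds_L2_norm:
  assumes U: "open U" "bounded U" "U \<noteq> {}"
  shows "\<exists>C>0. \<forall>G g M l. L2 U g \<and> has_weak_deriv U (unit_index l) G g \<and> 0 \<le> M \<and>
      (AE x in lebesgue_on U. \<bar>G x\<bar> \<le> M) \<and> slobodeckij (1/2) U g < \<infinity> \<longrightarrow>
      L2_norm U g \<le> C * (sqrt (enn2real (slobodeckij (1/2) U g)) + M)"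
proof -
  have Um: "U \<in> sets lebesgue" and Ul: "U \<in> lmeasurable" using U by (auto simp: lmeasurable_open)
  have one: "locally_integrable U (\<lambda>x. 1 :: real)"
    using smooth_imp_has_weak_deriv[OF smooth_const U(1)] by (simp add: has_weak_deriv_def)
  have "\<not> (AE x in lebesgue_on U. (1::real) = 0)"
    using AE_const_open[OF U(1,3)] by fastforce
  then obtain \<phi> where \<phi>: "test_function U \<phi>" "(LINT x|lebesgue_on U. 1 * \<phi> x) \<noteq> 0"
    using weak_zero_imp_AE_zero[OF U(1) one] by blast
  have s\<phi>: "smooth \<phi>" using \<phi>(1) by (simp add: test_function_def)
  define m where "m = (LINT x|lebesgue_on U. \<phi> x)"
  have m: "m \<noteq> 0" using \<phi>(2) by (simp add: m_def)
  have one_int: "integrable (lebesgue_on U) (\<lambda>x. b :: real)" for b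
    using Ul by (simp add: integrable_restrict_space fmeasurableD integrable_on_const lmeasurable_iff_integrable)
  have \<phi>_int: "integrable (lebesgue_on U) (\<lambda>x. \<psi> x)" if "smooth \<psi>" for \<psi>
    using integrable_mult_smooth[OF one_int that U(2) Um, of 1] by simp
  \<comment> \<open>The summand 1 makes \<open>P\<close> positive, as it is going to be a
    denominator.\<close>
  define P where "P = (LINT x|lebesgue_on U. (\<phi> x)\<^sup>2) + 1"
  have P: "0 < P" unfolding P_def by (intro add_nonneg_pos Bochner_Integration.integral_nonneg) auto
  obtain D where D: "0 < D" "\<And>x y. x \<in> U \<Longrightarrow> y \<in> U \<Longrightarrow> norm (x - y) \<le> D"
  proof (rule that[of "diameter U + 1"])
    show "0 < diameter U + 1" using diameter_ge_0[OF U(2)] by simp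
    show "norm (x - y) \<le> diameter U + 1" if "x \<in> U" "y \<in> U" for x y
      using diameter_bounded_bound[OF U(2) that] by (simp add: dist_norm)
  qed
  have "\<exists>B\<ge>0. \<forall>x l. \<bar>pd l \<phi> x\<bar> \<le> B"
  proof -
    have "\<exists>B. \<forall>x. \<bar>pd l \<phi> x\<bar> \<le> B" for l
    proof -
      have "compact (closure {x. \<phi> x \<noteq> 0})" using \<phi>(1) by (simp add: test_function_def)
      then have "compact (pd l \<phi> ` closure {x. \<phi> x \<noteq> 0})"
        by (intro compact_continuous_image smooth_continuous smooth_pd s\<phi>)
      then obtain B where B: "\<And>x. x \<in> closure {x. \<phi> x \<noteq> 0} \<Longrightarrow> \<bar>pd l \<phi> x\<bar> \<le> B"
        using compact_imp_bounded[of "pd l \<phi> ` closure {x. \<phi> x \<noteq> 0}"] unfolding bounded_iff by auto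
      have "\<bar>pd l \<phi> x\<bar> \<le> max B 0" for x
        using B[of x] pd_eq_0_off_support[of x \<phi> l] by (cases "x \<in> closure {x. \<phi> x \<noteq> 0}") auto
      then show ?thesis by blast
    qed
    then obtain B where B: "\<And>l x. \<bar>pd l \<phi> x\<bar> \<le> B l" by metis
    have "\<bar>pd l \<phi> x\<bar> \<le> (\<Sum>l\<in>UNIV. B l)" for l x
      using B[of l x] member_le_sum[of l UNIV B] order_trans[OF abs_ge_zero B] by fastforce
    moreover have "0 \<le> (\<Sum>l\<in>UNIV. B l)" using order_trans[OF abs_ge_zero B] by (intro sum_nonneg) blast
    ultimately show ?thesis by (intro exI[of _ "\<Sum>l\<in>UNIV. B l"] conjI allI)
  qed
  then obtain B where B: "0 \<le> B" "\<And>x l. \<bar>pd l \<phi> x\<bar> \<le> B" by auto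
  define \<mu> where "\<mu> = measure lebesgue U"
  \<comment> \<open>The square of \<open>g * m\<close> is split into the deviation from
    \<open>a\<close> and \<open>a\<close> itself, each with a factor 2; this explains the two
    summands and the denominator.\<close>
  define c where "c = (2 * P * D ^ 3 + 2 * (B * \<mu>)\<^sup>2 * \<mu>) / m\<^sup>2"
  have int1: "(LINT x|lebesgue_on U. b) = b * \<mu>" for b :: real
    using Um by (simp add: \<mu>_def measure_restrict_space)
  have \<mu>0: "0 \<le> \<mu>" by (simp add: \<mu>_def)
  have c: "0 < c" using m P D \<mu>0 by (auto simp: c_def intro!: divide_pos_pos add_pos_nonneg)
  have "L2_norm U g \<le> sqrt c * (sqrt (enn2real (slobodeckij (1/2) U g)) + M)"
    if g: "L2 U g" and wd: "has_weak_deriv U (unit_index l) G g" and M: "0 \<le> M" "AE x in lebesgue_on U. \<bar>G x\<bar> \<le> M"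
      and fin: "slobodeckij (1/2) U g < \<infinity>" for G g M l
  proof -
    define S where "S = enn2real (slobodeckij (1/2) U g)"
    have S: "slobodeckij (1/2) U g = ennreal S" "0 \<le> S" using fin by (auto simp: S_def)
    define a where "a = (LINT x|lebesgue_on U. g x * \<phi> x)"
    have gm [measurable]: "g \<in> borel_measurable (lebesgue_on U)" using g by (simp add: L2_real_def)
    have gi: "integrable (lebesgue_on U) g" "integrable (lebesgue_on U) (\<lambda>x. (g x)\<^sup>2)"
      using g Ul by (auto intro: L2_integrable simp: L2_real_def)
    have a: "\<bar>a\<bar> \<le> M * B * \<mu>"
    proof -
      have "a = - (LINT x|lebesgue_on U. G x * pd l \<phi> x)"
        using wd \<phi>(1) by (simp add: has_weak_deriv_def a_def)
      moreover have "\<bar>LINT x|lebesgue_on U. G x * pd l \<phi> x\<bar> \<le> (LINT x|lebesgue_on U. M * B)"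
      proof (cases "integrable (lebesgue_on U) (\<lambda>x. G x * pd l \<phi> x)")
        case True
        have "AE x in lebesgue_on U. norm (G x * pd l \<phi> x) \<le> M * B"
          using M(2) by eventually_elim (use B M(1) in \<open>auto simp: abs_mult intro!: mult_mono\<close>)
        then have "(LINT x|lebesgue_on U. norm (G x * pd l \<phi> x)) \<le> (LINT x|lebesgue_on U. M * B)"
          by (intro integral_mono_AE integrable_norm True one_int)
        then have "norm (LINT x|lebesgue_on U. G x * pd l \<phi> x) \<le> (LINT x|lebesgue_on U. M * B)"
          by (rule order_trans[OF integral_norm_bound])
        then show ?thesis by simp
      next
        \<comment> \<open>A function that is not integrable has integral 0 by convention.\<close>
        case False
        then show ?thesis using M(1) B(1) by (simp add: not_integrable_integral_eq int1 \<mu>_def)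
      qed
      ultimately show ?thesis unfolding int1 by simp
    qed
    \<comment> \<open>\<open>g x * m - a\<close> is the integral of
      \<open>(g x - g y) * \<phi> y\<close> over \<open>y\<close>. Cauchy--Schwarz separates
      \<open>\<phi>\<close>, and the kernel, of exponent \<open>2 + 2 * (1/2) = 3\<close>, is
      inserted at the cost of \<open>D ^ 3\<close>. The second alternative is the case where the
      inner integral diverges.\<close>
    have point: "(g x * m - a)\<^sup>2 / (P * D ^ 3) \<le> enn2real (\<integral>\<^sup>+y. ennreal ((g x - g y)\<^sup>2 / norm (x - y) powr 3) \<partial>lebesgue_on U) \<or>
        (\<integral>\<^sup>+y. ennreal ((g x - g y)\<^sup>2 / norm (x - y) powr 3) \<partial>lebesgue_on U) = \<infinity>" if x: "x \<in> U" for x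
    proof (cases "(\<integral>\<^sup>+y. ennreal ((g x - g y)\<^sup>2 / norm (x - y) powr 3) \<partial>lebesgue_on U) = \<infinity>")
      case False
      define k where "k = enn2real (\<integral>\<^sup>+y. ennreal ((g x - g y)\<^sup>2 / norm (x - y) powr 3) \<partial>lebesgue_on U)"
      have k: "(\<integral>\<^sup>+y. ennreal ((g x - g y)\<^sup>2 / norm (x - y) powr 3) \<partial>lebesgue_on U) = ennreal k" "0 \<le> k"
        using False by (auto simp: k_def less_top)
      have [measurable]: "(\<lambda>y. norm (x - y) powr 3) \<in> borel_measurable (lebesgue_on U)"
      proof -
        have "(\<lambda>y. norm (x - y) ^ 3) \<in> borel_measurable (lebesgue_on U)"
          by (rule continuous_imp_measurable_on_sets_lebesgue[OF _ Um]) (intro continuous_intros)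
        then show ?thesis by (simp add: powr_numeral)
      qed
      have i2: "integrable (lebesgue_on U) (\<lambda>y. (g x - g y)\<^sup>2)"
        using gi one_int[of "(g x)\<^sup>2"] by (simp add: power2_diff)
      have "g x * m - a = (LINT y|lebesgue_on U. (g x - g y) * \<phi> y)"
      proof -
        have "integrable (lebesgue_on U) (\<lambda>y. g y * \<phi> y)"
          by (rule integrable_mult_smooth[OF gi(1) s\<phi> U(2) Um])
        then show ?thesis using \<phi>_int[OF s\<phi>] by (simp add: m_def a_def left_diff_distrib)
      qed
      then have "\<bar>g x * m - a\<bar> \<le> sqrt (LINT y|lebesgue_on U. (g x - g y)\<^sup>2) * sqrt (LINT y|lebesgue_on U. (\<phi> y)\<^sup>2)"
        using cauchy_schwarz_integral[of "\<lambda>y. g x - g y" "lebesgue_on U" \<phi>] i2 \<phi>_int[OF s\<phi>]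
          \<phi>_int[OF smooth_mult[OF s\<phi> s\<phi>]] by (simp add: power2_eq_square)
      then have "(g x * m - a)\<^sup>2 \<le> (sqrt (LINT y|lebesgue_on U. (g x - g y)\<^sup>2) * sqrt (LINT y|lebesgue_on U. (\<phi> y)\<^sup>2))\<^sup>2"
        by (metis abs_ge_zero power2_abs power_mono)
      also have "\<dots> = (LINT y|lebesgue_on U. (g x - g y)\<^sup>2) * (LINT y|lebesgue_on U. (\<phi> y)\<^sup>2)"
        by (simp add: power_mult_distrib)
      also have "\<dots> \<le> (D ^ 3 * k) * P"
      proof (intro mult_mono)
        have "ennreal (LINT y|lebesgue_on U. (g x - g y)\<^sup>2) = (\<integral>\<^sup>+y. ennreal ((g x - g y)\<^sup>2) \<partial>lebesgue_on U)"
          using i2 by (intro nn_integral_eq_integral[symmetric]) auto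
        also have "\<dots> \<le> (\<integral>\<^sup>+y. ennreal (D ^ 3) * ennreal ((g x - g y)\<^sup>2 / norm (x - y) powr 3) \<partial>lebesgue_on U)"
        proof (rule nn_integral_mono)
          fix y assume "y \<in> space (lebesgue_on U)"
          then have y: "y \<in> U" by simp
          have "(g x - g y)\<^sup>2 \<le> D ^ 3 * ((g x - g y)\<^sup>2 / norm (x - y) powr 3)"
          proof (cases "x = y")
            case False
            then have n: "0 < norm (x - y)" by simp
            then have "norm (x - y) powr 3 = norm (x - y) ^ 3" by simp
            also have "\<dots> \<le> D ^ 3" using D(2)[OF x y] by (intro power_mono) auto
            finally have "norm (x - y) powr 3 * (g x - g y)\<^sup>2 \<le> D ^ 3 * (g x - g y)\<^sup>2" by (rule mult_right_mono) simp
            then show ?thesis using n by (simp add: pos_le_divide_eq mult.commute)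
          qed simp
          then show "ennreal ((g x - g y)\<^sup>2) \<le> ennreal (D ^ 3) * ennreal ((g x - g y)\<^sup>2 / norm (x - y) powr 3)"
            using D(1) by (simp add: ennreal_mult[symmetric] ennreal_leI)
        qed
        also have "\<dots> = ennreal (D ^ 3) * ennreal k"
          unfolding k(1)[symmetric] by (rule nn_integral_cmult) measurable
        finally show "(LINT y|lebesgue_on U. (g x - g y)\<^sup>2) \<le> D ^ 3 * k"
          using k(2) D(1) by (simp add: ennreal_mult[symmetric] ennreal_le_iff)
      qed (use k D P in \<open>auto simp: P_def\<close>)
      finally have "(g x * m - a)\<^sup>2 / (P * D ^ 3) \<le> k"
        using P D(1) by (simp add: pos_divide_le_eq mult_ac)
      then show ?thesis by (simp add: k_def)
    qed simp
    have imi: "integrable (lebesgue_on U) (\<lambda>x. (g x * m - a)\<^sup>2)"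
      using gi one_int[of "a\<^sup>2"] by (simp add: power2_diff power_mult_distrib mult_ac)
    have "(\<integral>\<^sup>+x. ennreal ((g x * m - a)\<^sup>2 / (P * D ^ 3)) \<partial>lebesgue_on U) \<le> slobodeckij (1/2) U g"
      unfolding slobodeckij_def
    proof (rule nn_integral_mono)
      fix x assume "x \<in> space (lebesgue_on U)"
      then have "x \<in> U" by simp
      from point[OF this]
      show "ennreal ((g x * m - a)\<^sup>2 / (P * D ^ 3)) \<le> (\<integral>\<^sup>+y. ennreal ((g x - g y)\<^sup>2 / norm (x - y) powr (2 + 2 * (1/2))) \<partial>lebesgue_on U)"
      proof
        assume "(g x * m - a)\<^sup>2 / (P * D ^ 3) \<le> enn2real (\<integral>\<^sup>+y. ennreal ((g x - g y)\<^sup>2 / norm (x - y) powr 3) \<partial>lebesgue_on U)"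
        then have "ennreal ((g x * m - a)\<^sup>2 / (P * D ^ 3)) \<le> ennreal (enn2real (\<integral>\<^sup>+y. ennreal ((g x - g y)\<^sup>2 / norm (x - y) powr 3) \<partial>lebesgue_on U))"
          by (rule ennreal_leI)
        also have "\<dots> \<le> (\<integral>\<^sup>+y. ennreal ((g x - g y)\<^sup>2 / norm (x - y) powr 3) \<partial>lebesgue_on U)"
          by (cases "(\<integral>\<^sup>+y. ennreal ((g x - g y)\<^sup>2 / norm (x - y) powr 3) \<partial>lebesgue_on U)") auto
        finally show ?thesis by simp
      qed simp
    qed
    then have "ennreal (LINT x|lebesgue_on U. (g x * m - a)\<^sup>2 / (P * D ^ 3)) \<le> ennreal S"
      unfolding S(1) using imi P D(1) by (subst (asm) nn_integral_eq_integral) auto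
    then have "(LINT x|lebesgue_on U. (g x * m - a)\<^sup>2) / (P * D ^ 3) \<le> S"
      using S(2) by (simp add: ennreal_le_iff)
    then have I: "(LINT x|lebesgue_on U. (g x * m - a)\<^sup>2) \<le> P * D ^ 3 * S"
      using P D(1) by (simp add: pos_divide_le_eq mult_ac)
    have "m\<^sup>2 * (LINT x|lebesgue_on U. (g x)\<^sup>2) = (LINT x|lebesgue_on U. m\<^sup>2 * (g x)\<^sup>2)" by simp
    also have "\<dots> \<le> (LINT x|lebesgue_on U. 2 * (g x * m - a)\<^sup>2 + 2 * a\<^sup>2)"
    proof (rule integral_mono)
      fix x
      have "0 \<le> (g x * m - a - a)\<^sup>2" by simp
      then show "m\<^sup>2 * (g x)\<^sup>2 \<le> 2 * (g x * m - a)\<^sup>2 + 2 * a\<^sup>2" by (simp add: power2_eq_square algebra_simps)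
    qed (use gi imi one_int in auto)
    also have "\<dots> = 2 * (LINT x|lebesgue_on U. (g x * m - a)\<^sup>2) + 2 * a\<^sup>2 * \<mu>"
      using imi one_int int1 by simp
    also have "\<dots> \<le> 2 * (P * D ^ 3 * S) + 2 * (M * B * \<mu>)\<^sup>2 * \<mu>"
      using I \<mu>0 a by (intro add_mono mult_left_mono mult_right_mono) (auto intro: abs_le_square_iff[THEN iffD1, OF order_trans[OF _ abs_ge_self]])
    also have "\<dots> \<le> (2 * P * D ^ 3 + 2 * (B * \<mu>)\<^sup>2 * \<mu>) * (sqrt S + M)\<^sup>2"
    proof -
      have "S \<le> (sqrt S + M)\<^sup>2" "M\<^sup>2 \<le> (sqrt S + M)\<^sup>2"
        using S(2) M(1) by (auto simp: power2_sum)
      then have "2 * P * D ^ 3 * S + 2 * (B * \<mu>)\<^sup>2 * \<mu> * M\<^sup>2 \<le> 2 * P * D ^ 3 * (sqrt S + M)\<^sup>2 + 2 * (B * \<mu>)\<^sup>2 * \<mu> * (sqrt S + M)\<^sup>2"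
        using P D(1) \<mu>0 by (intro add_mono mult_left_mono) auto
      then show ?thesis by (simp add: power_mult_distrib algebra_simps)
    qed
    finally have "(LINT x|lebesgue_on U. (g x)\<^sup>2) \<le> c * (sqrt S + M)\<^sup>2"
      using m by (simp add: c_def field_simps)
    then have "L2_norm U g \<le> sqrt (c * (sqrt S + M)\<^sup>2)"
      by (simp add: L2_norm_real_def)
    also have "\<dots> = sqrt c * (sqrt S + M)" using S(2) M(1) by (simp add: real_sqrt_mult)
    finally show ?thesis by (simp add: S_def)
  qed
  then show ?thesis using c by (intro exI[of _ "sqrt c"]) auto
qed

section \<open>The error of the Raviart--Thomas solution\<close>

lemma integral_mult_test_cong_AE:
  assumes v: "locally_integrable U v" and eq: "AE x in lebesgue_on U. v x = w x" and U: "open U" and \<psi>: "smooth \<psi>"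
  shows "(LINT x|lebesgue_on U. v x * \<psi> x) = (LINT x|lebesgue_on U. w x * (\<psi> x :: real))"
proof (rule integral_cong_AE)
  have "\<psi> \<in> borel_measurable (lebesgue_on U)"
    using U by (intro continuous_imp_measurable_on_sets_lebesgue smooth_continuous \<psi>) auto
  then show "(\<lambda>x. v x * \<psi> x) \<in> borel_measurable (lebesgue_on U)" "(\<lambda>x. w x * \<psi> x) \<in> borel_measurable (lebesgue_on U)"
    using locally_integrable_measurable[OF v U] locally_integrable_measurable[OF locally_integrable_cong_AE[OF v eq U] U] by auto
  show "AE x in lebesgue_on U. v x * \<psi> x = w x * \<psi> x" using eq by eventually_elim simp
qed

lemma has_weak_deriv_cong_AE:
  assumes wd: "has_weak_deriv U (unit_index j) v g" and eq: "AE x in lebesgue_on U. v x = w x" and U: "open U"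
  shows "has_weak_deriv U (unit_index j) w g"
  unfolding has_weak_deriv_def
proof (intro conjI allI impI)
  have l: "locally_integrable U v" using wd by (simp add: has_weak_deriv_def)
  show "locally_integrable U w" by (rule locally_integrable_cong_AE[OF l eq U])
  fix \<phi> assume \<phi>: "test_function U \<phi>"
  then have "(LINT x|lebesgue_on U. v x * pd j \<phi> x) = (LINT x|lebesgue_on U. w x * pd j \<phi> x)"
    by (intro integral_mult_test_cong_AE l eq U smooth_pd) (simp add: test_function_def)
  then show "(LINT x|lebesgue_on U. w x * mpd (unit_index j) \<phi> x) =
      (- 1) ^ mi_order (unit_index j) * (LINT x|lebesgue_on U. g x * \<phi> x)"
    using wd \<phi> by (simp add: has_weak_deriv_def)
qed (use wd in \<open>simp add: has_weak_deriv_def\<close>)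

lemma has_weak_div_cong_AE:
  assumes wd: "has_weak_div U V d" and eq: "AE x in lebesgue_on U. V x = W x" "AE x in lebesgue_on U. d x = e x" and U: "open U"
  shows "has_weak_div U W e"
  unfolding has_weak_div_def
proof (intro conjI allI impI)
  have l: "locally_integrable U V" "locally_integrable U d" using wd by (simp_all add: has_weak_div_def)
  show lW: "locally_integrable U W" and "locally_integrable U e"
    by (rule locally_integrable_cong_AE[OF l(1) eq(1) U], rule locally_integrable_cong_AE[OF l(2) eq(2) U])
  fix \<phi> assume \<phi>: "test_function U \<phi>"
  have m: "(\<lambda>x. (\<Sum>i\<in>UNIV. Z x $ i * pd i \<phi> x)) \<in> borel_measurable (lebesgue_on U)" if "locally_integrable U Z" for Z :: "plane \<Rightarrow> plane"
  proof -
    have "pd i \<phi> \<in> borel_measurable (lebesgue_on U)" for i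
      using U \<phi> by (intro continuous_imp_measurable_on_sets_lebesgue smooth_continuous smooth_pd) (auto simp: test_function_def)
    moreover have "(\<lambda>x. Z x $ i) \<in> borel_measurable (lebesgue_on U)" for i
      by (rule locally_integrable_measurable[OF locally_integrable_nth[OF that] U])
    ultimately show ?thesis by (intro borel_measurable_sum borel_measurable_times)
  qed
  have "(LINT x|lebesgue_on U. (\<Sum>i\<in>UNIV. V x $ i * pd i \<phi> x)) = (LINT x|lebesgue_on U. (\<Sum>i\<in>UNIV. W x $ i * pd i \<phi> x))"
    by (rule integral_cong_AE[OF m[OF l(1)] m[OF lW]]) (use eq(1) in \<open>eventually_elim, simp\<close>)
  moreover have "(LINT x|lebesgue_on U. d x * \<phi> x) = (LINT x|lebesgue_on U. e x * \<phi> x)"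
    using \<phi> by (intro integral_mult_test_cong_AE l eq U) (simp add: test_function_def)
  ultimately show "(LINT x|lebesgue_on U. (\<Sum>i\<in>UNIV. W x $ i * pd i \<phi> x)) = - (LINT x|lebesgue_on U. e x * \<phi> x)"
    using wd \<phi> by (simp add: has_weak_div_def)
qed

lemma has_weak_div_weak_div: "has_weak_div U V d \<Longrightarrow> has_weak_div U V (weak_div U V)"
  unfolding weak_div_def by (rule someI[of "has_weak_div U V"])

lemma has_weak_div_componentwise:
  assumes wd: "\<And>k. has_weak_deriv U (unit_index k) (\<lambda>x. V x $ k) (G k)" and U: "open U"
  shows "has_weak_div U V (\<lambda>x. \<Sum>k\<in>UNIV. G k x)"
proof -
  have "has_weak_div U (\<lambda>x. 0) (\<lambda>x. 0)"
    by (auto simp: has_weak_div_def locally_integrable_def)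
  note neg = has_weak_div_diff[OF this has_weak_deriv_imp_weak_div[OF wd[of 2]] U]
  from has_weak_div_diff[OF has_weak_deriv_imp_weak_div[OF wd[of 1]] neg U]
  have "has_weak_div U (\<lambda>x. V x $ 1 *\<^sub>R axis 1 1 - (0 - V x $ 2 *\<^sub>R axis 2 1)) (\<lambda>x. G 1 x - (0 - G 2 x))" .
  moreover have "V x $ 1 *\<^sub>R axis 1 1 - (0 - V x $ 2 *\<^sub>R axis 2 1) = V x" for x
    by (simp add: vec_eq_iff forall_2 axis_def)
  ultimately show ?thesis by (simp add: sum_2)
qed

lemma has_weak_deriv_affine:
  assumes "open U"
  shows "has_weak_deriv U (unit_index j) (\<lambda>x. (a + b *\<^sub>R x) $ k) (\<lambda>x. if j = k then b else 0)"
proof -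
  let ?\<phi> = "\<lambda>x::plane. (a + b *\<^sub>R x) $ k"
  have e: "?\<phi> = (\<lambda>x. a $ k + (b *\<^sub>R axis k 1) \<bullet> x)" by (auto simp: inner_axis' fun_eq_iff)
  have "smooth ?\<phi>" unfolding e by (intro smooth_intros)
  moreover have "pd j ?\<phi> = (\<lambda>x. if j = k then b else 0)"
  proof
    fix x
    have "(?\<phi> has_derivative (\<lambda>h. (b *\<^sub>R axis k 1) \<bullet> h)) (at x)"
      unfolding e by (auto intro!: derivative_eq_intros)
    from pd_eq[OF this] show "pd j ?\<phi> x = (if j = k then b else 0)" by (simp add: inner_axis_axis)
  qed
  ultimately show ?thesis using smooth_imp_has_weak_deriv[of ?\<phi> U j] assms by simp
qed

lemma L2_nth:
  fixes V :: "'a::euclidean_space \<Rightarrow> plane"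
  assumes V: "L2 U V" shows "L2 U (\<lambda>x. V x $ k)"
proof -
  have m: "(\<lambda>x. V x $ k) \<in> borel_measurable (lebesgue_on U)"
  proof (rule measurable_compose[of V _ borel])
    show "V \<in> borel_measurable (lebesgue_on U)" using V by (simp add: L2_def)
    show "(\<lambda>v::plane. v $ k) \<in> borel_measurable borel"
      by (intro borel_measurable_continuous_onI continuous_intros)
  qed
  moreover have "integrable (lebesgue_on U) (\<lambda>x. (V x $ k)\<^sup>2)"
  proof (rule Bochner_Integration.integrable_bound)
    show "integrable (lebesgue_on U) (\<lambda>x. (norm (V x))\<^sup>2)" using V by (simp add: L2_def)
    show "AE x in lebesgue_on U. norm ((V x $ k)\<^sup>2) \<le> norm ((norm (V x))\<^sup>2)"
      using component_le_norm_cart[of "V _" k] by (auto intro!: AE_I2 abs_le_square_iff[THEN iffD1])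
  qed (use m in measurable)
  ultimately show ?thesis by (simp add: L2_real_def)
qed

lemma integrable_inner_L2:
  fixes V W :: "'a::euclidean_space \<Rightarrow> plane"
  assumes "L2 U V" "L2 U W" shows "integrable (lebesgue_on U) (\<lambda>x. V x \<bullet> W x)"
proof -
  have "integrable (lebesgue_on U) (\<lambda>x. V x $ k * W x $ k)" for k
    using L2_nth[OF assms(1), of k] L2_nth[OF assms(2), of k] by (intro integrable_mult_L2) (auto simp: L2_real_def)
  then show ?thesis by (simp add: inner_vec_def)
qed

lemma L2_vec_diff:
  fixes V W :: "'a::euclidean_space \<Rightarrow> plane"
  assumes "L2 U V" "L2 U W" shows "L2 U (\<lambda>x. V x - W x)"
proof -
  have "integrable (lebesgue_on U) (\<lambda>x. (norm (V x))\<^sup>2 - 2 * (V x \<bullet> W x) + (norm (W x))\<^sup>2)"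
    using assms integrable_inner_L2[OF assms] by (simp add: L2_def)
  moreover have "(norm (V x - W x))\<^sup>2 = (norm (V x))\<^sup>2 - 2 * (V x \<bullet> W x) + (norm (W x))\<^sup>2" for x
    by (simp add: power2_norm_eq_inner inner_diff_left inner_diff_right inner_commute)
  moreover have "(\<lambda>x. V x - W x) \<in> borel_measurable (lebesgue_on U)"
    using assms unfolding L2_def by (intro borel_measurable_diff) auto
  ultimately show ?thesis by (simp add: L2_def)
qed

lemma AE_lebesgue_on_subset:
  assumes "AE x in lebesgue_on U. P x" "V \<subseteq> U" "U \<in> sets lebesgue" "V \<in> sets lebesgue"
  shows "AE x in lebesgue_on V. P x"
proof -
  have "AE x in lebesgue. x \<in> U \<longrightarrow> P x" using assms(1,3) by (simp add: AE_restrict_space_iff)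
  then have "AE x in lebesgue. x \<in> V \<longrightarrow> P x" by eventually_elim (use assms(2) in auto)
  then show ?thesis using assms(4) by (simp add: AE_restrict_space_iff)
qed

context uniform_triangulation
begin

section \<open>Raviart--Thomas functions on a uniform mesh\<close>

lemma sets_\<Omega>: "\<Omega> \<in> sets lebesgue"
  using open_\<Omega> by auto

lemma RT_imp_affine:
  assumes "x \<in> X" "\<pi> \<in> RT \<Omega> \<T>"
  obtains a b where "AE p in lebesgue_on (otri (fst x) (snd x)). \<pi> p = a + b *\<^sub>R p"
proof -
  obtain a b where "AE p in lebesgue_on (ctri (fst x) (snd x)). \<pi> p = a + b *\<^sub>R p"
    using assms ctri_X[OF assms(1)] unfolding RT_def by blast
  then have "AE p in lebesgue_on (otri (fst x) (snd x)). \<pi> p = a + b *\<^sub>R p"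
    using closed_ctri by (intro AE_lebesgue_on_subset[OF _ otri_subset_ctri _ sets_otri]) auto
  then show ?thesis by (rule that)
qed

lemma RT_imp_L2: "\<pi> \<in> RT \<Omega> \<T> \<Longrightarrow> L2 \<Omega> \<pi>"
  by (auto simp: RT_def H_div_def)

lemma triangle_indicator_in_U_RT:
  assumes x: "x \<in> X" shows "indicator (otri (fst x) (snd x)) \<in> U_RT \<Omega> \<T>"
  unfolding U_RT_def
proof (intro CollectI conjI ballI)
  let ?K = "otri (fst x) (snd x)"
  show "L2 \<Omega> (indicator ?K :: plane \<Rightarrow> real)"
  proof -
    have "(\<lambda>p. (indicator ?K p :: real)\<^sup>2) = indicator ?K" by (auto simp: indicator_def fun_eq_iff)
    moreover have "integrable (lebesgue_on \<Omega>) (indicator ?K :: plane \<Rightarrow> real)"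
      using otri_subset_\<Omega>[OF x] sets_\<Omega> lmeasurable_otri[OF orient_X[OF x]]
      by (simp add: integrable_restrict_space lmeasurable_iff_integrable indicator_inter_arith[symmetric] Int_absorb1)
    ultimately show ?thesis by (auto simp: L2_real_def)
  qed
  fix K' assume "K' \<in> \<T>"
  then obtain y where y: "y \<in> X" "K' = ctri (fst y) (snd y)" using \<T>_eq by blast
  have "AE p in lebesgue_on K'. indicator ?K p = (if y = x then 1 else 0 :: real)"
  proof -
    have "AE p in lebesgue. p \<in> K' \<longrightarrow> indicator ?K p = (if y = x then 1 else 0 :: real)"
      using AE_all_not_edge[OF orient_X[OF y(1)], of "fst y" 0]
    proof eventually_elim
      case (elim p)
      show ?case
      proof
        assume "p \<in> K'"
        then have "p \<in> otri (fst y) (snd y)" using elim y(2) by (auto simp: otri_def ctri_def less_le)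
        then show "indicator ?K p = (if y = x then 1 else 0 :: real)"
          using disjoint_otri[OF x y(1)] by (auto simp: indicator_def)
      qed
    qed
    moreover have "K' \<in> sets lebesgue" using y(2) closed_ctri by auto
    ultimately show ?thesis by (simp add: AE_restrict_space_iff)
  qed
  then show "\<exists>c. AE p in lebesgue_on K'. indicator ?K p = (c::real)" by blast
qed

lemma AE_\<Omega>I:
  assumes "\<And>x. x \<in> X \<Longrightarrow> AE p in lebesgue_on (otri (fst x) (snd x)). P p"
  shows "AE p in lebesgue_on \<Omega>. P p"
proof -
  have "AE p in lebesgue. p \<in> otri (fst x) (snd x) \<longrightarrow> P p" if "x \<in> X" for x
    using assms[OF that] sets_otri by (simp add: AE_restrict_space_iff)
  then have "AE p in lebesgue. \<forall>x\<in>X. p \<in> otri (fst x) (snd x) \<longrightarrow> P p"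
    using finite_X by (intro AE_finite_allI)
  moreover have "AE p in lebesgue. p \<in> \<Omega> \<longrightarrow> (\<exists>x\<in>X. p \<in> otri (fst x) (snd x))"
    using AE_in_otri sets_\<Omega> by (simp add: AE_restrict_space_iff)
  ultimately have "AE p in lebesgue. p \<in> \<Omega> \<longrightarrow> P p" by eventually_elim blast
  then show ?thesis using sets_\<Omega> by (simp add: AE_restrict_space_iff)
qed

lemma RT_weak_div:
  assumes x: "x \<in> X" and \<tau>: "\<tau> \<in> RT \<Omega> \<T>" and ab: "AE p in lebesgue_on (otri (fst x) (snd x)). \<tau> p = a + b *\<^sub>R p"
  shows "AE p in lebesgue_on (otri (fst x) (snd x)). weak_div \<Omega> \<tau> p = 2 * b"
proof -
  let ?K = "otri (fst x) (snd x)"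
  obtain d where "has_weak_div \<Omega> \<tau> d" using \<tau> by (auto simp: RT_def H_div_def)
  then have 1: "has_weak_div ?K \<tau> (weak_div \<Omega> \<tau>)"
    by (intro has_weak_div_subset[OF has_weak_div_weak_div open_otri open_\<Omega> otri_subset_\<Omega>[OF x]])
  have "has_weak_div ?K (\<lambda>p. a + b *\<^sub>R p) (\<lambda>p. \<Sum>k\<in>(UNIV::2 set). b)"
  proof (rule has_weak_div_componentwise[OF _ open_otri])
    show "has_weak_deriv ?K (unit_index k) (\<lambda>p. (a + b *\<^sub>R p) $ k) (\<lambda>p. b)" for k
      using has_weak_deriv_affine[OF open_otri, of "fst x" "snd x" k a b k] by simp
  qed
  moreover have "AE p in lebesgue_on ?K. a + b *\<^sub>R p = \<tau> p" using ab by eventually_elim simp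
  ultimately have 2: "has_weak_div ?K \<tau> (\<lambda>p. 2 * b)"
    by (rule has_weak_div_cong_AE[OF _ _ _ open_otri]) simp
  show ?thesis by (rule has_weak_div_unique[OF 1 2 open_otri])
qed

lemma L2_inner_triangle_indicator:
  assumes x: "x \<in> X"
  shows "L2_inner \<Omega> (indicator (otri (fst x) (snd x))) d = (LINT p|lebesgue_on (otri (fst x) (snd x)). (d p :: real))"
proof -
  let ?K = "otri (fst x) (snd x)"
  have eq: "indicator \<Omega> p *\<^sub>R (indicator ?K p \<bullet> d p) = indicator ?K p *\<^sub>R d p" for p
    using otri_subset_\<Omega>[OF x] by (auto simp: indicator_def)
  have "L2_inner \<Omega> (indicator ?K) d = (LINT p|lebesgue. indicator \<Omega> p *\<^sub>R (indicator ?K p \<bullet> d p))"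
    unfolding L2_inner_def using sets_\<Omega> by (intro integral_restrict_space) simp
  also have "\<dots> = (LINT p|lebesgue. indicator ?K p *\<^sub>R d p)" by (simp only: eq)
  also have "\<dots> = (LINT p|lebesgue_on ?K. d p)"
    using sets_otri by (intro integral_restrict_space[symmetric]) simp
  finally show ?thesis .
qed

end

section \<open>Divergence and orthogonality of the error\<close>

locale mixed_problem = uniform_triangulation +
  fixes f u uh :: "plane \<Rightarrow> real" and \<sigma> \<sigma>h \<pi> :: "plane \<Rightarrow> plane" and G :: "2 \<Rightarrow> 2 \<Rightarrow> plane \<Rightarrow> real"
  assumes sol: "mixed_solution \<Omega> f \<sigma> u" "discrete_mixed_solution \<Omega> \<T> f \<sigma>h uh"
    and F: "fortin_interpolant \<Omega> \<T> \<sigma> \<pi>"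
    and wd: "\<And>j k. has_weak_deriv \<Omega> (unit_index j) (\<lambda>p. \<sigma> p $ k) (G j k)"
    and L: "\<And>k. L2 \<Omega> (\<lambda>p. \<sigma> p $ k)" "\<And>j k. L2 \<Omega> (G j k)"
begin

text \<open>The Fortin condition on one triangle in terms of edge functionals. The gradient of
  \<open>\<pi>\<close> is \<open>b\<close> times the identity matrix, and \<open>A e\<close> stands
  for the normal of edge \<open>e\<close>.\<close>

definition no_edge_flux :: "plane \<times> real \<Rightarrow> real \<Rightarrow> bool" where
  "no_edge_flux x b \<longleftrightarrow> (\<forall>e. (\<Sum>k\<in>UNIV. A e $ k * edge_functional (fst x) (snd x) e (\<lambda>p. \<pi> p $ k - \<sigma> p $ k)
      (\<lambda>j p. (if j = k then b else 0) - G j k p)) = 0)"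

lemma RT: "\<pi> \<in> RT \<Omega> \<T>" "\<sigma>h \<in> RT \<Omega> \<T>"
  using F sol by (auto simp: fortin_interpolant_def discrete_mixed_solution_def)

text \<open>The condition is formulated with a trace along each edge;
  \<open>edge_trace_functional\<close> replaces its mean, component by component, by the edge
  functional, with \<open>A e\<close> normalised as the unit normal.\<close>

lemma fortin_edge_functional:
  assumes x: "x \<in> X"
    and ab: "AE p in lebesgue_on (otri (fst x) (snd x)). \<pi> p = a + b *\<^sub>R p"
  shows "no_edge_flux x b"
  unfolding no_edge_flux_def
proof
  fix e :: 3
  let ?c = "fst x" and ?s = "snd x"
  let ?K = "otri ?c ?s"
  note s = orient_X[OF x]
  obtain k l where ekl: "e \<noteq> k" "e \<noteq> l" "k \<noteq> l" using other_indices by metis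
  let ?p = "vert ?c ?s k" and ?q = "vert ?c ?s l"
  define n where "n = (1 / norm (A e)) *\<^sub>R A e"
  have "closed_segment ?p ?q edge_of ctri ?c ?s"
    using edge_of_ctri[OF s] side_eq_segment[OF ekl] by metis
  moreover have "unit_normal (closed_segment ?p ?q) n"
    unfolding unit_normal_def
  proof (intro conjI ballI)
    show "norm n = 1" using A_nonzero by (simp add: n_def)
    fix y z assume "y \<in> closed_segment ?p ?q" "z \<in> closed_segment ?p ?q"
    then have "lam ?c ?s e y = 0" "lam ?c ?s e z = 0"
      using lam_side[OF s] side_eq_segment[OF ekl] by metis+
    then have "?s * (A e \<bullet> (y - z)) = 0"
      using lam_diff[of ?c ?s e z "y - z"] by simp
    then have "A e \<bullet> (y - z) = 0" using s by auto
    then show "n \<bullet> (y - z) = 0" by (simp add: n_def)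
  qed
  ultimately obtain g where g: "\<And>m. has_edge_trace (ctri ?c ?s) ?p ?q (\<lambda>y. (\<pi> y - \<sigma> y) $ m) (\<lambda>y. g y $ m)"
      "edge_integral ?p ?q (\<lambda>y. g y \<bullet> n) = 0"
    using F ctri_X[OF x] unfolding fortin_interpolant_def by blast
  have sub: "?K \<subseteq> \<Omega>" by (rule otri_subset_\<Omega>[OF x])
  have L\<pi>: "L2 \<Omega> (\<lambda>p. \<pi> p $ m)" for m
    by (rule L2_nth[OF RT_imp_L2[OF RT(1)]])
  have trace: "edge_functional ?c ?s e (\<lambda>p. \<pi> p $ m - \<sigma> p $ m) (\<lambda>j p. (if j = m then b else 0) - G j m p)
      = 2 * area * (LINT t|lebesgue_on {0..1}. g (linepath ?p ?q t) $ m)" for m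
  proof (rule edge_trace_functional[OF s ekl])
    show "has_edge_trace (ctri ?c ?s) ?p ?q (\<lambda>p. \<pi> p $ m - \<sigma> p $ m) (\<lambda>y. g y $ m)" using g(1)[of m] by simp
    have \<pi>_wd: "has_weak_deriv ?K (unit_index j) (\<lambda>p. \<pi> p $ m) (\<lambda>p. if j = m then b else 0)" for j
    proof (rule has_weak_deriv_cong_AE[OF has_weak_deriv_affine[OF open_otri] _ open_otri])
      show "AE p in lebesgue_on ?K. (a + b *\<^sub>R p) $ m = \<pi> p $ m" using ab by eventually_elim simp
    qed
    show "has_weak_deriv ?K (unit_index j) (\<lambda>p. \<pi> p $ m - \<sigma> p $ m) (\<lambda>p. (if j = m then b else 0) - G j m p)" for j
      by (rule has_weak_deriv_diff[OF \<pi>_wd has_weak_deriv_subset[OF wd open_otri open_\<Omega> sub]]) (simp_all add: open_otri)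
    show "L2 ?K (\<lambda>p. \<pi> p $ m - \<sigma> p $ m)"
      by (intro L2_diff L2_subset[OF _ sub sets_otri sets_\<Omega>] L\<pi> L)
    show "L2 ?K (\<lambda>p. (if j = m then b else 0) - G j m p)" for j
      by (intro L2_diff L2_subset[OF _ sub sets_otri sets_\<Omega>] L L2_smooth_otri[OF s smooth_const])
  qed
  have gi: "integrable (lebesgue_on {0..1}) (\<lambda>t. g (linepath ?p ?q t) $ m)" for m
  proof -
    have "L2 {0..1} ((\<lambda>y. g y $ m) \<circ> linepath ?p ?q)" using g(1)[of m] by (simp add: has_edge_trace_def)
    from L2_integrable[OF this] show ?thesis by (simp add: o_def)
  qed
  have "(LINT t|lebesgue_on {0..1}. g (linepath ?p ?q t) \<bullet> n) = 0"
    using g(2) inj_vert[OF s, of ?c] ekl by (auto simp: edge_integral_def inj_eq)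
  moreover have "g (linepath ?p ?q t) \<bullet> n = (1 / norm (A e)) * (\<Sum>m\<in>UNIV. A e $ m * g (linepath ?p ?q t) $ m)" for t
    by (simp add: n_def inner_vec_def mult.commute sum_divide_distrib)
  ultimately have "(LINT t|lebesgue_on {0..1}. (\<Sum>m\<in>UNIV. A e $ m * g (linepath ?p ?q t) $ m)) = 0"
    using A_nonzero[of e] by simp
  then have "(\<Sum>m\<in>UNIV. A e $ m * (LINT t|lebesgue_on {0..1}. g (linepath ?p ?q t) $ m)) = 0"
    using gi by (subst (asm) Bochner_Integration.integral_sum) auto
  then have "2 * area * (\<Sum>m\<in>UNIV. A e $ m * (LINT t|lebesgue_on {0..1}. g (linepath ?p ?q t) $ m)) = 0" by simp
  then show "(\<Sum>k\<in>UNIV. A e $ k * edge_functional ?c ?s e (\<lambda>p. \<pi> p $ k - \<sigma> p $ k)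
      (\<lambda>j p. (if j = k then b else 0) - G j k p)) = 0"
    unfolding trace by (simp add: sum_distrib_left mult_ac)
qed

text \<open>The commuting property of the Fortin interpolation: summing the vanishing fluxes by the
  Gauss formula equates the integrals of the divergences of \<open>\<sigma>\<close> and
  \<open>\<pi>\<close>, and the latter is constantly \<open>2 * b\<close>.\<close>

lemma integral_weak_div_eq:
  assumes x: "x \<in> X"
    and ab: "AE p in lebesgue_on (otri (fst x) (snd x)). \<pi> p = a + b *\<^sub>R p"
  shows "(LINT p|lebesgue_on (otri (fst x) (snd x)). weak_div \<Omega> \<sigma> p) = 2 * area * b"
proof -
  let ?c = "fst x" and ?s = "snd x"
  let ?K = "otri ?c ?s"
  note s = orient_X[OF x]
  have sub: "?K \<subseteq> \<Omega>" by (rule otri_subset_\<Omega>[OF x])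
  have int: "integrable (lebesgue_on ?K) v" if "L2 \<Omega> v" for v :: "plane \<Rightarrow> real"
    by (rule L2_integrable[OF L2_subset[OF that sub sets_otri sets_\<Omega>] lmeasurable_otri[OF s]])
  have L\<pi>: "L2 \<Omega> (\<lambda>p. \<pi> p $ m)" for m
    by (rule L2_nth[OF RT_imp_L2[OF RT(1)]])
  have const: "integrable (lebesgue_on ?K) (\<lambda>p. r :: real)" for r by (rule integrable_smooth_otri[OF s smooth_const])
  let ?E = "\<lambda>e k. edge_functional ?c ?s e (\<lambda>p. \<pi> p $ k - \<sigma> p $ k) (\<lambda>j p. (if j = k then b else 0) - G j k p)"
  have div: "AE p in lebesgue_on ?K. weak_div \<Omega> \<sigma> p = (\<Sum>k\<in>UNIV. G k k p)"
  proof (rule AE_lebesgue_on_subset[OF _ sub sets_\<Omega> sets_otri])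
    have "has_weak_div \<Omega> \<sigma> (\<lambda>p. \<Sum>k\<in>UNIV. G k k p)" by (rule has_weak_div_componentwise[OF wd open_\<Omega>])
    then show "AE p in lebesgue_on \<Omega>. weak_div \<Omega> \<sigma> p = (\<Sum>k\<in>UNIV. G k k p)"
      by (intro has_weak_div_unique[OF has_weak_div_weak_div _ open_\<Omega>])
  qed
  have "0 = (\<Sum>e\<in>UNIV. ?s * (\<Sum>k\<in>UNIV. A e $ k * ?E e k))"
    using fortin_edge_functional[OF x ab] by (simp add: no_edge_flux_def)
  also have "\<dots> = (\<Sum>k\<in>UNIV. \<Sum>e\<in>UNIV. (?s * A e $ k) * ?E e k)"
    unfolding sum_distrib_left by (subst sum.swap) (simp only: mult.assoc)
  also have "\<dots> = (\<Sum>k\<in>UNIV. - (LINT p|lebesgue_on ?K. (if k = k then b else 0) - G k k p))"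
    by (intro sum.cong refl gauss_edge_functional[OF s] Bochner_Integration.integrable_diff int L L\<pi> const)
  also have "\<dots> = (\<Sum>k\<in>UNIV. (LINT p|lebesgue_on ?K. G k k p)) - 2 * area * b"
    using int[OF L(2)] const integral_otri_const[OF s, of ?c b] by (simp add: sum_subtractf)
  also have "(\<Sum>k\<in>UNIV. (LINT p|lebesgue_on ?K. G k k p)) = (LINT p|lebesgue_on ?K. (\<Sum>k\<in>UNIV. G k k p))"
    using int[OF L(2)] by (subst Bochner_Integration.integral_sum) auto
  also have "\<dots> = (LINT p|lebesgue_on ?K. weak_div \<Omega> \<sigma> p)"
  proof (rule integral_cong_AE)
    show m: "(\<lambda>p. \<Sum>k\<in>UNIV. G k k p) \<in> borel_measurable (lebesgue_on ?K)"
      using int[OF L(2)] by (intro borel_measurable_sum borel_measurable_integrable)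
    have "has_weak_div \<Omega> \<sigma> (weak_div \<Omega> \<sigma>)"
      by (rule has_weak_div_weak_div[OF has_weak_div_componentwise[OF wd open_\<Omega>]])
    then have "weak_div \<Omega> \<sigma> \<in> borel_measurable (lebesgue_on \<Omega>)"
      by (intro locally_integrable_measurable open_\<Omega>) (simp add: has_weak_div_def)
    then show "weak_div \<Omega> \<sigma> \<in> borel_measurable (lebesgue_on ?K)" by (rule measurable_restrict_mono[OF _ sub])
    show "AE p in lebesgue_on ?K. (\<Sum>k\<in>UNIV. G k k p) = weak_div \<Omega> \<sigma> p" using div by eventually_elim simp
  qed
  finally show ?thesis by simp
qed

text \<open>On each triangle the divergences of \<open>\<sigma>h\<close> and \<open>\<pi>\<close>
  are constants with the same integral as \<open>f\<close>: the one by the discrete equation, the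
  other by the commuting property and the continuous equation. So the coefficients of the position
  vector coincide and the difference is constant.\<close>

lemma rt_error:
  obtains \<tau> b where "\<And>x. x \<in> X \<Longrightarrow> AE p in lebesgue_on (otri (fst x) (snd x)). \<sigma>h p - \<pi> p = \<tau> x"
    and "\<And>x. x \<in> X \<Longrightarrow> no_edge_flux x (b x)"
    and "has_weak_div \<Omega> (\<lambda>p. \<sigma>h p - \<pi> p) (\<lambda>p. 0)"
proof -
  define Q where "Q x t b \<longleftrightarrow> (AE p in lebesgue_on (otri (fst x) (snd x)). \<sigma>h p - \<pi> p = t) \<and>
      no_edge_flux x b \<and> (AE p in lebesgue_on (otri (fst x) (snd x)). weak_div \<Omega> \<sigma>h p - weak_div \<Omega> \<pi> p = 0)" for x t b
  have "\<exists>t b. Q x t b" if x: "x \<in> X" for x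
  proof -
    let ?K = "otri (fst x) (snd x)"
    note s = orient_X[OF x]
    obtain a b where ab: "AE p in lebesgue_on ?K. \<pi> p = a + b *\<^sub>R p" by (rule RT_imp_affine[OF x RT(1)])
    obtain a' b' where ab': "AE p in lebesgue_on ?K. \<sigma>h p = a' + b' *\<^sub>R p" by (rule RT_imp_affine[OF x RT(2)])
    note d\<pi> = RT_weak_div[OF x RT(1) ab] and dh = RT_weak_div[OF x RT(2) ab']
    have "2 * area * b' = (LINT p|lebesgue_on ?K. 2 * b')" by (simp only: integral_otri_const[OF s] mult_ac)
    also have "\<dots> = (LINT p|lebesgue_on ?K. weak_div \<Omega> \<sigma>h p)"
    proof (rule integral_cong_AE)
      obtain d where "has_weak_div \<Omega> \<sigma>h d" using RT(2) by (auto simp: RT_def H_div_def)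
      then have "weak_div \<Omega> \<sigma>h \<in> borel_measurable (lebesgue_on \<Omega>)"
        using has_weak_div_weak_div by (intro locally_integrable_measurable open_\<Omega>) (auto simp: has_weak_div_def)
      then show "weak_div \<Omega> \<sigma>h \<in> borel_measurable (lebesgue_on ?K)"
        by (rule measurable_restrict_mono[OF _ otri_subset_\<Omega>[OF x]])
      show "AE p in lebesgue_on ?K. 2 * b' = weak_div \<Omega> \<sigma>h p" using dh by eventually_elim simp
    qed simp
    also have "\<dots> = L2_inner \<Omega> (indicator ?K) (weak_div \<Omega> \<sigma>h)" by (simp add: L2_inner_triangle_indicator[OF x])
    also have "\<dots> = L2_inner \<Omega> f (indicator ?K)"
      using sol(2) triangle_indicator_in_U_RT[OF x] unfolding discrete_mixed_solution_def by blast
    also have "\<dots> = L2_inner \<Omega> (indicator ?K) (weak_div \<Omega> \<sigma>)"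
      using sol(1) triangle_indicator_in_U_RT[OF x] unfolding mixed_solution_def U_RT_def by simp
    also have "\<dots> = 2 * area * b"
      unfolding L2_inner_triangle_indicator[OF x] by (rule integral_weak_div_eq[OF x ab])
    finally have "b' = b" using area_pos by simp
    have "AE p in lebesgue_on ?K. \<sigma>h p - \<pi> p = a' - a" using ab ab' by eventually_elim (simp add: \<open>b' = b\<close>)
    moreover have "AE p in lebesgue_on ?K. weak_div \<Omega> \<sigma>h p - weak_div \<Omega> \<pi> p = 0"
      using d\<pi> dh by eventually_elim (simp add: \<open>b' = b\<close>)
    ultimately have "Q x (a' - a) b"
      using fortin_edge_functional[OF x ab] by (simp add: Q_def)
    then show ?thesis by blast
  qed
  then obtain \<tau> b where "\<And>x. x \<in> X \<Longrightarrow> Q x (\<tau> x) (b x)" by metis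
  note * = this[unfolded Q_def]
  have "has_weak_div \<Omega> (\<lambda>p. \<sigma>h p - \<pi> p) (\<lambda>p. 0)"
  proof (rule has_weak_div_cong_AE[OF has_weak_div_diff[OF _ _ open_\<Omega>] _ _ open_\<Omega>])
    show "has_weak_div \<Omega> \<sigma>h (weak_div \<Omega> \<sigma>h)" "has_weak_div \<Omega> \<pi> (weak_div \<Omega> \<pi>)"
      using RT has_weak_div_weak_div by (auto simp: RT_def H_div_def)
    show "AE p in lebesgue_on \<Omega>. weak_div \<Omega> \<sigma>h p - weak_div \<Omega> \<pi> p = 0" using * by (intro AE_\<Omega>I) simp
  qed simp
  then show ?thesis using * by (intro that[of \<tau> b]) simp_all
qed

text \<open>The error is a divergence free field of the discrete space, hence admissible in both
  problems, and the terms with \<open>u\<close> and \<open>uh\<close> drop out. It is therefore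
  orthogonal to both \<open>\<sigma>\<close> and \<open>\<sigma>h\<close>.\<close>

lemma rt_error_orthogonal:
  assumes div: "has_weak_div \<Omega> (\<lambda>p. \<sigma>h p - \<pi> p) (\<lambda>p. 0)"
  shows "(LINT p|lebesgue_on \<Omega>. (\<sigma> p - \<pi> p) \<bullet> (\<sigma>h p - \<pi> p)) = (LINT p|lebesgue_on \<Omega>. (norm (\<sigma>h p - \<pi> p))\<^sup>2)"
    and "L2 \<Omega> \<sigma>" "L2 \<Omega> (\<lambda>p. \<sigma>h p - \<pi> p)"
proof -
  let ?\<tau> = "\<lambda>p. \<sigma>h p - \<pi> p"
  show L: "L2 \<Omega> \<sigma>" "L2 \<Omega> ?\<tau>"
    using sol by (auto simp: mixed_solution_def H_div_def intro: L2_vec_diff RT_imp_L2 RT)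
  have "L2 \<Omega> (\<lambda>p. 0 :: real)" by (simp add: L2_real_def)
  then have Hd: "?\<tau> \<in> H_div \<Omega>" using L(2) div unfolding H_div_def by blast
  moreover have "\<exists>a b. AE p in lebesgue_on K. ?\<tau> p = a + b *\<^sub>R p" if "K \<in> \<T>" for K
  proof -
    obtain a b a' b' where "AE p in lebesgue_on K. \<pi> p = a + b *\<^sub>R p" "AE p in lebesgue_on K. \<sigma>h p = a' + b' *\<^sub>R p"
      using RT \<open>K \<in> \<T>\<close> unfolding RT_def by blast
    then have "AE p in lebesgue_on K. ?\<tau> p = (a' - a) + (b' - b) *\<^sub>R p"
      by eventually_elim (simp add: algebra_simps)
    then show ?thesis by blast
  qed
  ultimately have \<tau>: "?\<tau> \<in> RT \<Omega> \<T>" by (simp add: RT_def)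
  have "AE p in lebesgue_on \<Omega>. weak_div \<Omega> ?\<tau> p = 0"
    by (rule has_weak_div_unique[OF has_weak_div_weak_div[OF div] div open_\<Omega>])
  then have "AE p in lebesgue_on \<Omega>. w p \<bullet> weak_div \<Omega> ?\<tau> p = 0" for w
    by eventually_elim simp
  then have zero: "L2_inner \<Omega> w (weak_div \<Omega> ?\<tau>) = 0" for w
    unfolding L2_inner_def by (rule integral_eq_zero_AE)
  have "L2_inner \<Omega> \<sigma> ?\<tau> = 0" using sol(1) Hd zero unfolding mixed_solution_def by force
  moreover have "L2_inner \<Omega> \<sigma>h ?\<tau> = 0" using sol(2) \<tau> zero unfolding discrete_mixed_solution_def by force
  ultimately have "(LINT p|lebesgue_on \<Omega>. \<sigma> p \<bullet> ?\<tau> p) = 0" "(LINT p|lebesgue_on \<Omega>. \<sigma>h p \<bullet> ?\<tau> p) = 0"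
    by (simp_all add: L2_inner_def)
  moreover have "(\<sigma> p - \<pi> p) \<bullet> ?\<tau> p = \<sigma> p \<bullet> ?\<tau> p - \<sigma>h p \<bullet> ?\<tau> p + (norm (?\<tau> p))\<^sup>2" for p
    by (simp add: power2_norm_eq_inner inner_diff_left)
  moreover have "integrable (lebesgue_on \<Omega>) (\<lambda>p. (norm (?\<tau> p))\<^sup>2)" using L(2) by (simp add: L2_def)
  ultimately show "(LINT p|lebesgue_on \<Omega>. (\<sigma> p - \<pi> p) \<bullet> ?\<tau> p) = (LINT p|lebesgue_on \<Omega>. (norm (?\<tau> p))\<^sup>2)"
    using integrable_inner_L2[OF L] integrable_inner_L2[OF RT_imp_L2[OF RT(2)] L(2)] by simp
qed

end

section \<open>The error bound for given weights\<close>

locale uniform_triangulation_size = uniform_triangulation + triangle_frame_size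

locale mixed_problem_size = mixed_problem + uniform_triangulation_size
begin

text \<open>The square of the norm \<open>T\<close> is written with the local integrals of
  \<open>\<sigma> - \<pi>\<close>; local consistency and the discrete bound estimate these by
  \<open>T\<close> times the right hand side, and one factor \<open>T\<close> is cancelled. 414 is
  54 plus 360.\<close>

lemma error_bound:
  fixes \<chi>' :: "3 \<Rightarrow> plane \<Rightarrow> real" and w :: "plane \<times> real \<Rightarrow> real"
  assumes wd2: "\<And>l j k. has_weak_deriv \<Omega> (unit_index l) (G j k) (g l j k)" and Lg: "\<And>l j k. L2 \<Omega> (g l j k)"
    and M: "\<And>j k. AE p in lebesgue_on \<Omega>. \<bar>G j k p\<bar> \<le> M"
    and \<chi>': "\<And>j p. 0 \<le> \<chi>' j p \<and> \<chi>' j p \<le> 1"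
    and w: "\<And>x i k j. x \<in> X \<Longrightarrow> \<bar>\<chi>' j (mid i x) - \<chi>' j (mid k x)\<bar> \<le> w x"
    and bd: "\<And>x i. x \<in> X \<Longrightarrow> nb i x \<notin> X \<Longrightarrow> (\<forall>j. \<chi>' j (mid i x) = (if j = i then 1 else 0)) \<or> 1 \<le> w x"
  shows "L2_norm \<Omega> (\<lambda>p. \<sigma>h p - \<pi> p) \<le>
    414 * \<rho>\<^sup>2 * (h\<^sup>2 * L2_norm \<Omega> (\<lambda>p. \<Sum>l\<in>UNIV. \<Sum>j\<in>UNIV. \<Sum>k\<in>UNIV. \<bar>g l j k p\<bar>) + h * M * sqrt (\<Sum>x\<in>X. area * (w x)\<^sup>2))"
proof -
  define \<Gamma> where "\<Gamma> p = (\<Sum>l\<in>UNIV. \<Sum>j\<in>UNIV. \<Sum>k\<in>UNIV. \<bar>g l j k p\<bar>)" for p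
  let ?K = "\<lambda>x. otri (fst x) (snd x)"
  obtain \<tau> b where \<tau>: "\<And>x. x \<in> X \<Longrightarrow> AE p in lebesgue_on (?K x). \<sigma>h p - \<pi> p = \<tau> x"
    and edges: "\<And>x. x \<in> X \<Longrightarrow> no_edge_flux x (b x)"
    and div: "has_weak_div \<Omega> (\<lambda>p. \<sigma>h p - \<pi> p) (\<lambda>p. 0)"
      proof (rule rt_error)
    fix \<tau> b
    assume 1: "\<And>x. x \<in> X \<Longrightarrow> AE p in lebesgue_on (?K x). \<sigma>h p - \<pi> p = \<tau> x" and 2: "\<And>x. x \<in> X \<Longrightarrow> no_edge_flux x (b x)"
      and 3: "has_weak_div \<Omega> (\<lambda>p. \<sigma>h p - \<pi> p) (\<lambda>p. 0)"
    show thesis by (rule that[OF 1 2 3])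
  qed
  note orth = rt_error_orthogonal[OF div]
  have L\<pi>: "L2 \<Omega> \<pi>" by (rule RT_imp_L2[OF RT(1)])
  have int: "integrable (lebesgue_on U) v" if "L2 \<Omega> v" "U \<subseteq> \<Omega>" "U \<in> lmeasurable" for v :: "plane \<Rightarrow> real" and U
    by (rule L2_integrable[OF L2_subset[OF that(1,2) fmeasurableD[OF that(3)] sets_\<Omega>] that(3)])
  have intK: "integrable (lebesgue_on (?K x)) v" if "x \<in> X" "L2 \<Omega> v" for v :: "plane \<Rightarrow> real" and x
    by (rule int[OF that(2) otri_subset_\<Omega>[OF that(1)] lmeasurable_otri[OF orient_X[OF that(1)]]])
  have L\<Gamma>: "L2 \<Omega> \<Gamma>" unfolding \<Gamma>_def by (intro L2_sum L2_abs Lg)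
  have \<Gamma>_le: "(\<Sum>l\<in>UNIV. \<bar>g l j k p\<bar>) \<le> \<Gamma> p" for j k p
  proof -
    have "\<bar>g l j k p\<bar> \<le> (\<Sum>k\<in>UNIV. \<bar>g l j k p\<bar>)" for l by (rule member_le_sum) auto
    also have "(\<Sum>k\<in>UNIV. \<bar>g l j k p\<bar>) \<le> (\<Sum>j\<in>UNIV. \<Sum>k\<in>UNIV. \<bar>g l j k p\<bar>)" for l
      by (rule member_le_sum[of j UNIV "\<lambda>j. \<Sum>k\<in>UNIV. \<bar>g l j k p\<bar>"]) (auto intro: sum_nonneg)
    finally show ?thesis unfolding \<Gamma>_def by (intro sum_mono)
  qed
  have \<Gamma>0: "0 \<le> \<Gamma> p" for p unfolding \<Gamma>_def by (intro sum_nonneg) auto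
  define t where "t x = norm (\<tau> x)" for x
  define T where "T = L2_norm \<Omega> (\<lambda>p. \<sigma>h p - \<pi> p)"
  define E e where "E x = (LINT p|lebesgue_on (?K x). \<Gamma> p)" and "e x = L2_norm (?K x) \<Gamma>" for x
  define H where "H x i j k = lam_moment (fst x) (snd x) i (G j k)" for x i j k
  have T0: "0 \<le> T" by (simp add: T_def L2_norm_def)
  have T2: "T\<^sup>2 = (LINT p|lebesgue_on \<Omega>. (norm (\<sigma>h p - \<pi> p))\<^sup>2)"
    by (simp add: T_def L2_norm_def)
  have T2_sum: "T\<^sup>2 = (\<Sum>x\<in>X. area * (t x)\<^sup>2)"
  proof -
    have i: "integrable (lebesgue_on \<Omega>) (\<lambda>p. (norm (\<sigma>h p - \<pi> p))\<^sup>2)" using orth(3) by (simp add: L2_def)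
    have "(LINT p|lebesgue_on (?K x). (norm (\<sigma>h p - \<pi> p))\<^sup>2) = area * (t x)\<^sup>2" if x: "x \<in> X" for x
    proof -
      have "(LINT p|lebesgue_on (?K x). (norm (\<sigma>h p - \<pi> p))\<^sup>2) = (LINT p|lebesgue_on (?K x). (t x)\<^sup>2)"
      proof (rule integral_cong_AE)
        show "(\<lambda>p. (norm (\<sigma>h p - \<pi> p))\<^sup>2) \<in> borel_measurable (lebesgue_on (?K x))"
          by (rule borel_measurable_integrable[OF integral_\<Omega>(2)[OF i x]])
        show "AE p in lebesgue_on (?K x). (norm (\<sigma>h p - \<pi> p))\<^sup>2 = (t x)\<^sup>2"
          using \<tau>[OF x] by eventually_elim (simp add: t_def)
      qed simp
      then show ?thesis by (simp only: integral_otri_const[OF orient_X[OF x]])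
    qed
    then show ?thesis unfolding T2 integral_\<Omega>(1)[OF i] by simp
  qed
  have T2_orth: "T\<^sup>2 = (\<Sum>x\<in>X. \<Sum>k\<in>UNIV. \<tau> x $ k * (LINT p|lebesgue_on (?K x). \<sigma> p $ k - \<pi> p $ k))"
  proof -
    have Ld: "L2 \<Omega> (\<lambda>p. \<sigma> p - \<pi> p)" by (rule L2_vec_diff[OF orth(2) L\<pi>])
    have i: "integrable (lebesgue_on \<Omega>) (\<lambda>p. (\<sigma> p - \<pi> p) \<bullet> (\<sigma>h p - \<pi> p))"
      by (rule integrable_inner_L2[OF Ld orth(3)])
    have "(LINT p|lebesgue_on (?K x). (\<sigma> p - \<pi> p) \<bullet> (\<sigma>h p - \<pi> p)) =
        (\<Sum>k\<in>UNIV. \<tau> x $ k * (LINT p|lebesgue_on (?K x). \<sigma> p $ k - \<pi> p $ k))" if x: "x \<in> X" for x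
    proof -
      have ik: "integrable (lebesgue_on (?K x)) (\<lambda>p. \<sigma> p $ k - \<pi> p $ k)" for k
        using intK[OF x L2_nth[OF Ld, of k]] by simp
      have "(LINT p|lebesgue_on (?K x). (\<sigma> p - \<pi> p) \<bullet> (\<sigma>h p - \<pi> p)) =
          (LINT p|lebesgue_on (?K x). (\<Sum>k\<in>UNIV. \<tau> x $ k * (\<sigma> p $ k - \<pi> p $ k)))"
      proof (rule integral_cong_AE)
        show "(\<lambda>p. (\<sigma> p - \<pi> p) \<bullet> (\<sigma>h p - \<pi> p)) \<in> borel_measurable (lebesgue_on (?K x))"
          by (rule borel_measurable_integrable[OF integral_\<Omega>(2)[OF i x]])
        show "(\<lambda>p. \<Sum>k\<in>UNIV. \<tau> x $ k * (\<sigma> p $ k - \<pi> p $ k)) \<in> borel_measurable (lebesgue_on (?K x))"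
          by (intro borel_measurable_integrable Bochner_Integration.integrable_sum integrable_mult_right ik)
        show "AE p in lebesgue_on (?K x). (\<sigma> p - \<pi> p) \<bullet> (\<sigma>h p - \<pi> p) = (\<Sum>k\<in>UNIV. \<tau> x $ k * (\<sigma> p $ k - \<pi> p $ k))"
          using \<tau>[OF x] by eventually_elim (simp add: inner_vec_def mult.commute)
      qed
      also have "\<dots> = (\<Sum>k\<in>UNIV. LINT p|lebesgue_on (?K x). \<tau> x $ k * (\<sigma> p $ k - \<pi> p $ k))"
        by (intro Bochner_Integration.integral_sum integrable_mult_right ik)
      finally show ?thesis by simp
    qed
    then show ?thesis unfolding T2 orth(1)[symmetric] integral_\<Omega>(1)[OF i] by simp
  qed
  have E0: "0 \<le> E x" for x unfolding E_def by (intro Bochner_Integration.integral_nonneg \<Gamma>0)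
  have Ee: "E x \<le> sqrt area * e x" if x: "x \<in> X" for x
  proof -
    have "(LINT p|lebesgue_on (?K x). \<bar>\<Gamma> p\<bar>) \<le> sqrt (measure lebesgue (?K x)) * L2_norm (?K x) \<Gamma>"
      by (rule integral_abs_le_L2_norm[OF L2_subset[OF L\<Gamma> otri_subset_\<Omega>[OF x] sets_otri sets_\<Omega>] lmeasurable_otri[OF orient_X[OF x]]])
    then show ?thesis using \<Gamma>0 by (simp add: E_def e_def measure_otri[OF orient_X[OF x]])
  qed
  have e_sum: "(\<Sum>x\<in>X. (e x)\<^sup>2) = (L2_norm \<Omega> \<Gamma>)\<^sup>2"
  proof -
    have "integrable (lebesgue_on \<Omega>) (\<lambda>p. (\<Gamma> p)\<^sup>2)" using L\<Gamma> by (simp add: L2_real_def)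
    from integral_\<Omega>(1)[OF this] have "(LINT p|lebesgue_on \<Omega>. (\<Gamma> p)\<^sup>2) = (\<Sum>x\<in>X. (e x)\<^sup>2)"
      by (simp add: e_def L2_norm_real_def)
    moreover have "(L2_norm \<Omega> \<Gamma>)\<^sup>2 = (LINT p|lebesgue_on \<Omega>. (\<Gamma> p)\<^sup>2)"
      unfolding L2_norm_real_def by (intro real_sqrt_pow2 Bochner_Integration.integral_nonneg) simp
    ultimately show ?thesis by simp
  qed
  have disc: "\<bar>\<Sum>x\<in>X. \<Sum>i\<in>UNIV. snd x * (A i \<bullet> \<tau> x) * mu i (H x i)\<bar> \<le>
      360 * \<rho>\<^sup>2 * sqrt (\<Sum>x\<in>X. area * (norm (\<tau> x))\<^sup>2) *
      (h\<^sup>2 * sqrt (\<Sum>x\<in>X. (e x)\<^sup>2) + h * M * sqrt (\<Sum>x\<in>X. area * (w x)\<^sup>2))"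
  proof (rule discrete_bound[OF finite_X orient_X _ _ _ _ _ \<chi>' w bd])
    fix x i assume x: "x \<in> X" and nx: "nb i x \<in> X"
    note s = orient_X[OF x]
    have sub: "par (fst x) (snd x) i \<subseteq> \<Omega>" by (rule par_subset_\<Omega>[OF x nx])
    have lm: "par (fst x) (snd x) i \<in> lmeasurable"
      by (intro bounded_set_imp_lmeasurable bounded_par[OF s] sets_par)
    have nbx: "fst (nb i x) = fst x - snd x *\<^sub>R \<omega> i" "snd (nb i x) = - snd x" by (simp_all add: nb_def)
    show "A i \<bullet> \<tau> (nb i x) = A i \<bullet> \<tau> x"
    proof (rule normal_continuity[symmetric, OF s has_weak_div_subset[OF div open_par open_\<Omega> sub]])
      show "integrable (lebesgue_on (par (fst x) (snd x) i)) (\<lambda>p. (\<sigma>h p - \<pi> p) $ j)" for j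
        by (rule int[OF L2_nth[OF orth(3)] sub lm])
      show "AE p in lebesgue_on (?K x). \<sigma>h p - \<pi> p = \<tau> x" by (rule \<tau>[OF x])
      show "AE p in lebesgue_on (otri (fst x - snd x *\<^sub>R \<omega> i) (- snd x)). \<sigma>h p - \<pi> p = \<tau> (nb i x)"
        using \<tau>[OF nx] unfolding nbx .
    qed
    fix j k
    have i\<Gamma>: "integrable (lebesgue_on (par (fst x) (snd x) i)) \<Gamma>" by (rule int[OF L\<Gamma> sub lm])
    have "\<bar>lam_moment (fst x) (snd x) i (G j k) - lam_moment (fst x - snd x *\<^sub>R \<omega> i) (- snd x) i (G j k)\<bar>
        \<le> h * (LINT p|lebesgue_on (par (fst x) (snd x) i). \<Gamma> p)"
      by (rule lam_moment_neighbour_bound[OF s diam has_weak_deriv_subset[OF wd2 open_par open_\<Omega> sub] int[OF L(2) sub lm] int[OF Lg sub lm] i\<Gamma> \<Gamma>_le]) simp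
    then show "\<bar>H x i j k - H (nb i x) i j k\<bar> \<le> h * (E x + E (nb i x))"
      unfolding H_def E_def nbx integral_par(1)[OF s i\<Gamma>] .
  next
    fix x assume x: "x \<in> X"
    note s = orient_X[OF x] and sub = otri_subset_\<Omega>[OF x]
    show "0 \<le> E x \<and> E x \<le> sqrt area * e x" using E0 Ee[OF x] by simp
    fix l i j k
    show "\<bar>H x l j k - H x i j k\<bar> \<le> h * E x"
      unfolding H_def E_def
      by (rule lam_moment_diff_bound[OF s diam has_weak_deriv_subset[OF wd2 open_otri open_\<Omega> sub] intK[OF x L(2)] intK[OF x Lg] intK[OF x L\<Gamma>] \<Gamma>_le]) simp
    show "\<bar>H x i j k\<bar> \<le> M * area"
    proof -
      have i1: "integrable (lebesgue_on (?K x)) (\<lambda>p. G j k p * lam (fst x) (snd x) i p)"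
        by (rule integrable_mult_smooth[OF intK[OF x L(2)] smooth_lam bounded_otri[OF s] sets_otri])
      have "(LINT p|lebesgue_on (?K x). norm (G j k p * lam (fst x) (snd x) i p)) \<le> (LINT p|lebesgue_on (?K x). M)"
      proof (rule integral_mono_AE[OF integrable_norm[OF i1] integrable_smooth_otri[OF s smooth_const]])
        have "AE p in lebesgue_on (?K x). \<bar>G j k p\<bar> \<le> M"
          by (rule AE_lebesgue_on_subset[OF M sub sets_\<Omega> sets_otri])
        moreover have "AE p in lebesgue_on (?K x). p \<in> ?K x" using sets_otri by (intro AE_I2) simp
        ultimately show "AE p in lebesgue_on (?K x). norm (G j k p * lam (fst x) (snd x) i p) \<le> M"
        proof eventually_elim
          case (elim p)
          have "\<bar>G j k p\<bar> * \<bar>lam (fst x) (snd x) i p\<bar> \<le> M * 1"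
            using elim(1) lam_bounds(1)[OF elim(2), of i] lam_bounds(2)[OF s elim(2), of i] by (intro mult_mono) auto
          then show ?case by (simp add: abs_mult)
        qed
      qed
      then have "norm (LINT p|lebesgue_on (?K x). G j k p * lam (fst x) (snd x) i p) \<le> (LINT p|lebesgue_on (?K x). M)"
        by (rule order_trans[OF integral_norm_bound])
      then show ?thesis by (simp only: H_def lam_moment_def integral_otri_const[OF s] real_norm_def mult.commute)
    qed
  qed
  have loc: "\<bar>(\<Sum>k\<in>UNIV. \<tau> x $ k * (LINT p|lebesgue_on (?K x). \<sigma> p $ k - \<pi> p $ k)) -
      (\<Sum>i\<in>UNIV. snd x * (A i \<bullet> \<tau> x) * mu i (H x i))\<bar> \<le> 54 * \<rho>\<^sup>2 * h\<^sup>2 * (t x * E x)" if x: "x \<in> X" for x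
  proof -
    note s = orient_X[OF x] and sub = otri_subset_\<Omega>[OF x]
    have "\<bar>(\<Sum>k\<in>UNIV. \<tau> x $ k * (LINT p|lebesgue_on (?K x). \<sigma> p $ k - \<pi> p $ k)) -
      (\<Sum>i\<in>UNIV. snd x * (A i \<bullet> \<tau> x) * mu i (\<lambda>j k. lam_moment (fst x) (snd x) i (G j k)))\<bar>
      \<le> 54 * \<rho>\<^sup>2 * h\<^sup>2 * norm (\<tau> x) * (LINT p|lebesgue_on (?K x). \<Gamma> p)"
      by (rule local_consistency_bound[OF s intK[OF x L(1)] intK[OF x L(2)] has_weak_deriv_subset[OF wd2 open_otri open_\<Omega> sub]
        intK[OF x Lg] intK[OF x L\<Gamma>] \<Gamma>_le intK[OF x L2_nth[OF L\<pi>]] edges[OF x, unfolded no_edge_flux_def, rule_format]]) simp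
    then show ?thesis unfolding H_def t_def E_def by (simp only: mult.assoc)
  qed
  have tE: "(\<Sum>x\<in>X. t x * E x) \<le> T * L2_norm \<Omega> \<Gamma>"
  proof -
    have "(\<Sum>x\<in>X. t x * E x) \<le> (\<Sum>x\<in>X. (sqrt area * t x) * e x)"
    proof (rule sum_mono)
      fix x assume "x \<in> X"
      then have "t x * E x \<le> t x * (sqrt area * e x)" by (intro mult_left_mono Ee) (simp_all add: t_def)
      then show "t x * E x \<le> (sqrt area * t x) * e x" by (simp only: mult_ac)
    qed
    also have "\<dots> \<le> sqrt (\<Sum>x\<in>X. (sqrt area * t x)\<^sup>2) * sqrt (\<Sum>x\<in>X. (e x)\<^sup>2)" by (rule cauchy_schwarz_sum)
    also have "(\<Sum>x\<in>X. (sqrt area * t x)\<^sup>2) = T\<^sup>2" using area_pos by (simp add: T2_sum power_mult_distrib)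
    also have "sqrt (T\<^sup>2) * sqrt (\<Sum>x\<in>X. (e x)\<^sup>2) = T * L2_norm \<Omega> \<Gamma>"
      using T0 by (simp add: e_sum L2_norm_def)
    finally show ?thesis .
  qed
  define N W where "N = L2_norm \<Omega> \<Gamma>" and "W = M * sqrt (\<Sum>x\<in>X. area * (w x)\<^sup>2)"
  have N0: "0 \<le> N" by (simp add: N_def L2_norm_def)
  have "\<bar>T\<^sup>2 - (\<Sum>x\<in>X. \<Sum>i\<in>UNIV. snd x * (A i \<bullet> \<tau> x) * mu i (H x i))\<bar> \<le> (\<Sum>x\<in>X. 54 * \<rho>\<^sup>2 * h\<^sup>2 * (t x * E x))"
    unfolding T2_orth sum_subtractf[symmetric] by (rule order_trans[OF sum_abs sum_mono]) (rule loc)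
  also have "\<dots> = 54 * \<rho>\<^sup>2 * h\<^sup>2 * (\<Sum>x\<in>X. t x * E x)" by (rule sum_distrib_left[symmetric])
  also have "\<dots> \<le> 54 * \<rho>\<^sup>2 * h\<^sup>2 * (T * N)" unfolding N_def by (intro mult_left_mono tE) auto
  finally have 1: "T\<^sup>2 - (\<Sum>x\<in>X. \<Sum>i\<in>UNIV. snd x * (A i \<bullet> \<tau> x) * mu i (H x i)) \<le> 54 * \<rho>\<^sup>2 * h\<^sup>2 * (T * N)" by simp
  have "sqrt (\<Sum>x\<in>X. area * (norm (\<tau> x))\<^sup>2) = T" using T2_sum T0 by (simp add: t_def real_sqrt_unique)
  then have 2: "(\<Sum>x\<in>X. \<Sum>i\<in>UNIV. snd x * (A i \<bullet> \<tau> x) * mu i (H x i)) \<le> 360 * \<rho>\<^sup>2 * T * (h\<^sup>2 * N + h * W)"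
    using disc N0 by (simp add: e_sum N_def W_def mult.assoc)
  have "T * T \<le> T * (54 * \<rho>\<^sup>2 * (h\<^sup>2 * N) + 360 * \<rho>\<^sup>2 * (h\<^sup>2 * N + h * W))"
    using 1 2 by (simp add: power2_eq_square algebra_simps)
  then have T_le: "T \<le> 54 * \<rho>\<^sup>2 * (h\<^sup>2 * N) + 360 * \<rho>\<^sup>2 * (h\<^sup>2 * N + h * W)" if "T \<noteq> 0"
    using that T0 by (simp add: mult_le_cancel_left_pos)
  have W0: "0 \<le> W"
  proof -
    have "X \<noteq> {}" using member by (auto simp: X_def)
    then obtain x where x: "x \<in> X" by blast
    \<comment> \<open>\<open>M\<close> bounds an absolute value almost everywhere on a set of
      positive measure.\<close>
    have "0 \<le> M"
    proof (rule ccontr)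
      assume "\<not> 0 \<le> M"
      have "AE p in lebesgue_on (?K x). \<bar>G 1 1 p\<bar> \<le> M"
        by (rule AE_lebesgue_on_subset[OF M otri_subset_\<Omega>[OF x] sets_\<Omega> sets_otri])
      then have "AE p in lebesgue_on (?K x). False" by eventually_elim (use \<open>\<not> 0 \<le> M\<close> in linarith)
      then have "(LINT p|lebesgue_on (?K x). 1) = (LINT p|lebesgue_on (?K x). (0::real))"
        by (intro integral_cong_AE) (auto elim: eventually_mono)
      then show False using integral_otri_const[OF orient_X[OF x], of "fst x" 1] area_pos by simp
    qed
    then show ?thesis using area_pos by (auto simp: W_def intro!: mult_nonneg_nonneg sum_nonneg)
  qed
  have "T \<le> 414 * \<rho>\<^sup>2 * (h\<^sup>2 * N + h * W)"
  proof (cases "T = 0")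
    case True
    then show ?thesis using N0 W0 h_pos by simp
  next
    case False
    have "0 \<le> 54 * \<rho>\<^sup>2 * (h * W)" using W0 h_pos by simp
    then show ?thesis using T_le[OF False] by (simp add: algebra_simps)
  qed
  then show ?thesis unfolding T_def N_def W_def \<Gamma>_def by (simp only: mult.assoc)
qed

end

section \<open>Shape regularity of the frame and the choice of weights\<close>

context uniform_triangulation
begin

text \<open>Along the diameter of a contained ball in direction \<open>A i\<close> the coordinate
  \<open>i\<close> changes by the diameter times \<open>norm (A i)\<close>, while it varies between
  0 and 1 on the triangle.\<close>

lemma inball_diameter_le:
  assumes x: "x \<in> X"
  shows "0 \<le> inball_diameter (ctri (fst x) (snd x))" "inball_diameter (ctri (fst x) (snd x)) \<le> 1 / norm (A i)"
proof -
  let ?c = "fst x" and ?s = "snd x"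
  note s = orient_X[OF x]
  let ?R = "{2 * r | r. r \<ge> 0 \<and> (\<exists>p. cball p r \<subseteq> ctri ?c ?s)}"
  have le: "y \<le> 1 / norm (A i)" if y: "y \<in> ?R" for y
  proof -
    obtain r p where r: "y = 2 * r" "0 \<le> r" "cball p r \<subseteq> ctri ?c ?s" using y by blast
    have A: "0 < norm (A i)" using A_nonzero by simp
    define d where "d = (r / norm (A i)) *\<^sub>R A i"
    have nd: "norm d = r" using A r(2) by (simp add: d_def)
    have Ad: "A i \<bullet> d = r * norm (A i)" using A by (simp add: d_def dot_square_norm power2_eq_square)
    have "p + d \<in> cball p r" "p + (- d) \<in> cball p r" by (simp_all add: dist_norm nd)
    then have in_K: "p + d \<in> ctri ?c ?s" "p + (- d) \<in> ctri ?c ?s" using r(3) by blast+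
    have lam1: "lam ?c ?s i q \<le> 1" if "q \<in> ctri ?c ?s" for q
    proof -
      have "lam ?c ?s i q \<le> (\<Sum>j\<in>UNIV. lam ?c ?s j q)"
        using that by (intro member_le_sum) (auto simp: ctri_def)
      then show ?thesis by (simp add: sum_lam)
    qed
    have lam0: "0 \<le> lam ?c ?s i q" if "q \<in> ctri ?c ?s" for q using that by (simp add: ctri_def)
    have eq: "lam ?c ?s i (p + d) = lam ?c ?s i p + ?s * (r * norm (A i))" "lam ?c ?s i (p + (- d)) = lam ?c ?s i p - ?s * (r * norm (A i))"
      using lam_diff[of ?c ?s i p d] lam_diff[of ?c ?s i p "- d"] unfolding inner_minus_right Ad by simp_all
    have "\<bar>2 * (?s * (r * norm (A i)))\<bar> \<le> 1"
      using lam0[OF in_K(1)] lam0[OF in_K(2)] lam1[OF in_K(1)] lam1[OF in_K(2)] unfolding eq by (simp add: abs_le_iff)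
    moreover have "\<bar>?s\<bar> = 1" using s by (auto simp: square_eq_1_iff)
    ultimately have "2 * r * norm (A i) \<le> 1" using r(2) by (simp add: abs_mult)
    then show ?thesis using A r(1) by (simp add: pos_le_divide_eq)
  qed
  have zero: "0 \<in> ?R"
    using vert_in_ctri[OF s, of ?c 1] by (intro CollectI exI[of _ 0] conjI exI[of _ "vert ?c ?s 1"]) auto
  show "0 \<le> inball_diameter (ctri ?c ?s)" unfolding inball_diameter_def
    by (rule cSup_upper[OF zero]) (use le in \<open>auto simp: bdd_above_def\<close>)
  show "inball_diameter (ctri ?c ?s) \<le> 1 / norm (A i)" unfolding inball_diameter_def
  proof (rule cSup_least)
    show "?R \<noteq> {}" using zero by blast
  qed (rule le)
qed

text \<open>Applied to a triangle of largest diameter, shape regularity gives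
  \<open>h \<le> \<gamma> / norm (A i)\<close>; the frame belongs to all triangles, so one triangle
  is enough.\<close>

lemma uniform_triangulation_size_mesh_size:
  assumes "shape_regular \<gamma> \<T>"
  shows "uniform_triangulation_size \<omega> A \<Omega> \<T> (mesh_size \<T>) \<gamma>"
proof -
  have T: "\<T> \<noteq> {}" using member by blast
  have le: "diameter K \<le> mesh_size \<T>" if "K \<in> \<T>" for K
    using finite_\<T> that by (simp add: mesh_size_def)
  obtain c s where cs: "s * s = 1" "ctri c s \<in> \<T>" using member by blast
  have d: "norm (\<omega> a - \<omega> b) \<le> mesh_size \<T>" for a b
  proof -
    have "dist (vert c s a) (vert c s b) \<le> diameter (ctri c s)"
      by (intro diameter_bounded_bound compact_imp_bounded compact_ctri vert_in_ctri cs)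
    then have "norm (\<omega> a - \<omega> b) \<le> diameter (ctri c s)" by (simp add: dist_norm norm_vert_diff[OF cs(1)])
    then show ?thesis using le[OF cs(2)] by linarith
  qed
  have pos: "0 < mesh_size \<T>"
  proof -
    have "A 1 \<bullet> (\<omega> 1 - \<omega> 2) = 1" by (simp add: inner_diff_right dual)
    then have "0 < norm (\<omega> 1 - \<omega> 2)" by auto
    then show ?thesis using d[of 1 2] by linarith
  qed
  have "mesh_size \<T> \<in> diameter ` \<T>"
    unfolding mesh_size_def using finite_\<T> T by (intro Max_in) auto
  then obtain K where K: "K \<in> \<T>" "mesh_size \<T> = diameter K" by blast
  then obtain x where x: "x \<in> X" "K = ctri (fst x) (snd x)" using \<T>_eq by blast
  have A: "norm (A i) \<le> \<gamma> / mesh_size \<T>" for i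
  proof -
    have h: "mesh_size \<T> \<le> \<gamma> * inball_diameter K" using assms K by (simp add: shape_regular_def)
    have i: "0 \<le> inball_diameter K" "inball_diameter K \<le> 1 / norm (A i)" using inball_diameter_le[OF x(1)] x(2) by simp_all
    have "0 < \<gamma>"
    proof (rule ccontr)
      assume "\<not> 0 < \<gamma>"
      then have "\<gamma> * inball_diameter K \<le> 0" using i(1) by (simp add: mult_nonpos_nonneg)
      then show False using h pos by linarith
    qed
    then have "\<gamma> * inball_diameter K \<le> \<gamma> * (1 / norm (A i))" using i(2) by (intro mult_left_mono) auto
    then have "mesh_size \<T> \<le> \<gamma> / norm (A i)" using h by simp
    moreover have "0 < norm (A i)" using A_nonzero by simp
    ultimately show ?thesis using pos by (simp add: pos_le_divide_eq mult.commute)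
  qed
  show ?thesis
    by (intro uniform_triangulation_size.intro triangle_frame_size.intro triangle_frame_size_axioms.intro
        uniform_triangulation_axioms triangle_frame_axioms d pos A)
qed

end

lemma uniform_mesh_frame:
  assumes U: "polygonal_domain U" and \<T>: "triangulation_of \<T> U" "uniform_mesh \<T>" "shape_regular \<gamma> \<T>"
  obtains \<omega> A where "uniform_triangulation_size \<omega> A U \<T> (mesh_size \<T>) \<gamma>"
proof -
  have "\<Union>\<T> \<noteq> {}" using \<T>(1) U closure_subset[of U] by (auto simp: triangulation_of_def polygonal_domain_def)
  then obtain K where K: "K \<in> \<T>" by blast
  then have "2 simplex K" using \<T>(1) by (simp add: triangulation_of_def)
  then obtain C where C: "\<not> affine_dependent C" "card C = 3" "K = convex hull C" unfolding simplex_def by auto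
  obtain p q r where pqr: "C = {p, q, r}" "p \<noteq> q" "p \<noteq> r" "q \<noteq> r" using C(2) by (auto simp: card_3_iff)
  define a where "a i = (if i = 1 then p else if i = 2 then q else r)" for i :: 3
  note n = distinct_index_3
  have a: "a 1 = p" "a 2 = q" "a 3 = r" by (simp_all add: a_def n)
  have "\<not> collinear {a 1, a 2, a 3}"
    using C(1) pqr unfolding a by (auto simp: collinear_3_eq_affine_dependent)
  then obtain A where fr: "triangle_frame (\<lambda>i. a i - (1 / 3) *\<^sub>R (\<Sum>j\<in>UNIV. a j)) A" by (rule triangle_frame_exists)
  define \<omega> where "\<omega> i = a i - (1 / 3) *\<^sub>R (\<Sum>j\<in>UNIV. a j)" for i
  interpret triangle_frame \<omega> A using fr unfolding \<omega>_def .
  have "vert ((1 / 3) *\<^sub>R (\<Sum>j\<in>UNIV. a j)) 1 i = a i" for i by (simp add: vert_def \<omega>_def)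
  then have "range (vert ((1 / 3) *\<^sub>R (\<Sum>j\<in>UNIV. a j)) 1) = C"
    unfolding pqr UNIV_3' by (simp add: a)
  then have K_eq: "ctri ((1 / 3) *\<^sub>R (\<Sum>j\<in>UNIV. a j)) 1 = K" using C(3) ctri_eq_convex_hull[of 1] by simp
  have "uniform_triangulation \<omega> A U \<T>"
  proof
    show "open U" "connected U" "bounded U" "interior (closure U) = U" "U \<noteq> {}"
      using U by (simp_all add: polygonal_domain_def)
    show "\<exists>c s. s * s = 1 \<and> ctri c s \<in> \<T>"
      by (rule exI[of _ "(1 / 3) *\<^sub>R (\<Sum>j\<in>UNIV. a j)"], rule exI[of _ 1]) (simp add: K_eq K)
  qed (use \<T> in auto)
  then show ?thesis by (rule that[OF uniform_triangulation.uniform_triangulation_size_mesh_size[OF _ \<T>(3)]])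
qed

context uniform_triangulation_size
begin

lemma dist_mid_le: "x \<in> X \<Longrightarrow> dist (fst x) (mid i x) \<le> h / 2"
  and dist_mid_mid_le: "x \<in> X \<Longrightarrow> dist (mid i x) (mid k x) \<le> h / 2"
proof -
  assume x: "x \<in> X"
  have s: "\<bar>snd x\<bar> = 1" using orient_X[OF x] by (auto simp: square_eq_1_iff)
  show "dist (fst x) (mid i x) \<le> h / 2"
    using norm_\<omega>[of i] s by (simp add: mid_def dist_norm)
  have "mid i x - mid k x = - (snd x / 2) *\<^sub>R (\<omega> i - \<omega> k)" by (simp add: mid_def algebra_simps)
  then have "dist (mid i x) (mid k x) = norm (\<omega> i - \<omega> k) / 2" using s by (simp only: dist_norm norm_scaleR) simp
  then show "dist (mid i x) (mid k x) \<le> h / 2" using diam[of i k] by simp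
qed

lemma mid_in_ctri: "x \<in> X \<Longrightarrow> mid i x \<in> ctri (fst x) (snd x)"
proof -
  assume x: "x \<in> X"
  obtain k l where ikl: "i \<noteq> k" "i \<noteq> l" "k \<noteq> l" using other_indices by metis
  have "linepath (vert (fst x) (snd x) k) (vert (fst x) (snd x) l) (1/2) \<in> closed_segment (vert (fst x) (snd x) k) (vert (fst x) (snd x) l)"
    by (auto simp: linepath_def in_segment intro!: exI[of _ "1/2"])
  then show ?thesis
    using closed_segment_subset[OF vert_in_ctri vert_in_ctri convex_ctri, OF orient_X[OF x] orient_X[OF x]]
    unfolding mid_eq_linepath[OF ikl] by blast
qed

lemma otri_subset_cball: "x \<in> X \<Longrightarrow> otri (fst x) (snd x) \<subseteq> cball (fst x) h"
proof -
  assume x: "x \<in> X"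
  have s: "\<bar>snd x\<bar> = 1" using orient_X[OF x] by (auto simp: square_eq_1_iff)
  have "range (vert (fst x) (snd x)) \<subseteq> cball (fst x) h"
    using norm_\<omega> s by (auto simp: vert_def dist_norm)
  then have "ctri (fst x) (snd x) \<subseteq> cball (fst x) h"
    unfolding ctri_eq_convex_hull[OF orient_X[OF x]] by (intro hull_minimal convex_cball)
  then show ?thesis using otri_subset_ctri by blast
qed

text \<open>The variation of the weights over a triangle is estimated trivially by 1 within distance
  \<open>2 * h\<close> of \<open>Z\<close>, and by the Lipschitz bound \<open>C * h / d\<close> at
  larger distances \<open>d\<close>. Midpoints are within \<open>h / 2\<close> of the centre and of
  each other, so the distance of a midpoint from \<open>Z\<close> is still at least
  \<open>d / 2\<close>.\<close>

lemma cutoff_weights: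
  fixes \<chi>' :: "3 \<Rightarrow> plane \<Rightarrow> real"
  assumes Z: "finite Z" "Z \<noteq> {}" and C: "0 < C" and h: "h \<le> h0" "h0 < 1"
    and D: "\<And>x. x \<in> closure \<Omega> \<Longrightarrow> infdist x Z \<le> D" "1 \<le> D"
    and \<chi>': "\<And>j p. 0 \<le> \<chi>' j p \<and> \<chi>' j p \<le> 1"
    and \<chi>S: "\<And>j p x. p \<in> S \<Longrightarrow> x \<in> closed_segment (fst p) (snd p) - Z \<Longrightarrow> \<chi>' j x = (if A j \<bullet> (snd p - fst p) = 0 then 1 else 0)"
    and \<chi>L: "\<And>j x y. x \<in> closure \<Omega> \<Longrightarrow> \<bar>\<chi>' j x - \<chi>' j y\<bar> * infdist x Z \<le> C * dist x y"
    and S: "\<And>x i. x \<in> X \<Longrightarrow> nb i x \<notin> X \<Longrightarrow> \<exists>p\<in>S. fst p \<noteq> snd p \<and> mid i x \<in> closed_segment (fst p) (snd p) \<and> A i \<bullet> (snd p - fst p) = 0"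
  obtains w where "\<And>x i k j. x \<in> X \<Longrightarrow> \<bar>\<chi>' j (mid i x) - \<chi>' j (mid k x)\<bar> \<le> w x"
    and "\<And>x i. x \<in> X \<Longrightarrow> nb i x \<notin> X \<Longrightarrow> (\<forall>j. \<chi>' j (mid i x) = (if j = i then 1 else 0)) \<or> 1 \<le> w x"
    and "(\<Sum>x\<in>X. area * (w x)\<^sup>2) \<le> (1 + C\<^sup>2) * 36 * real (card Z) * ((log 2 D + 1) / \<bar>ln h0\<bar> + 2) * h\<^sup>2 * \<bar>ln h\<bar>"
proof -
  define w where "w x = (if infdist (fst x) Z < 2 * h then 1 else C * h / infdist (fst x) Z)" for x :: "plane \<times> real"
  have near: "\<bar>infdist (fst x) Z - infdist (mid i x) Z\<bar> \<le> h / 2" if "x \<in> X" for x i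
    using infdist_lipschitz[of "fst x" Z "mid i x"] dist_mid_le[OF that, of i] by linarith
  have 1: "\<bar>\<chi>' j (mid i x) - \<chi>' j (mid k x)\<bar> \<le> w x" if x: "x \<in> X" for x i k j
  proof (cases "infdist (fst x) Z < 2 * h")
    case True
    then show ?thesis using \<chi>'[of j "mid i x"] \<chi>'[of j "mid k x"] by (simp add: w_def abs_le_iff)
  next
    case False
    define d where "d = infdist (fst x) Z"
    have d: "2 * h \<le> d" "0 < d" using False h_pos by (simp_all add: d_def)
    have m: "mid i x \<in> closure \<Omega>" using mid_in_ctri[OF x] ctri_subset_closure[OF x] by blast
    have "\<bar>\<chi>' j (mid i x) - \<chi>' j (mid k x)\<bar> * (d / 2) \<le> \<bar>\<chi>' j (mid i x) - \<chi>' j (mid k x)\<bar> * infdist (mid i x) Z"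
    proof (rule mult_left_mono)
      show "d / 2 \<le> infdist (mid i x) Z" using near[OF x, of i] d(1) h_pos unfolding d_def[symmetric] by linarith
    qed simp
    also have "\<dots> \<le> C * dist (mid i x) (mid k x)" by (rule \<chi>L[OF m])
    also have "\<dots> \<le> C * (h / 2)" using C dist_mid_mid_le[OF x] by (intro mult_left_mono) auto
    finally have "\<bar>\<chi>' j (mid i x) - \<chi>' j (mid k x)\<bar> * d \<le> C * h" by simp
    then show ?thesis using False d(2) by (simp add: w_def d_def[symmetric] pos_le_divide_eq)
  qed
  have 2: "(\<forall>j. \<chi>' j (mid i x) = (if j = i then 1 else 0)) \<or> 1 \<le> w x" if x: "x \<in> X" "nb i x \<notin> X" for x i
  proof -
    obtain p where p: "p \<in> S" "fst p \<noteq> snd p" "mid i x \<in> closed_segment (fst p) (snd p)" "A i \<bullet> (snd p - fst p) = 0"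
      using S[OF x] by blast
    show ?thesis
    proof (cases "mid i x \<in> Z")
      case True
      then have "infdist (mid i x) Z = 0" by (rule infdist_zero)
      then have "infdist (fst x) Z < 2 * h" using near[OF x(1), of i] h_pos by (simp add: abs_le_iff)
      then show ?thesis by (simp add: w_def)
    next
      case False
      \<comment> \<open>If two of the three vectors \<open>A\<close> were orthogonal to the segment,
        the third would be as well because they sum to zero, and the segment would
        degenerate.\<close>
      have "A j \<bullet> (snd p - fst p) \<noteq> 0" if "j \<noteq> i" for j
      proof
        assume j: "A j \<bullet> (snd p - fst p) = 0"
        obtain l where l: "l \<noteq> i" "l \<noteq> j" using other_indices[of i] that by metis
        have "A i + (A j + A l) = 0"
          using sum_A sum_triangle_indices[of i j l A] that l by metis
        then have "A i \<bullet> (snd p - fst p) + (A j \<bullet> (snd p - fst p) + A l \<bullet> (snd p - fst p)) = 0"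
          by (simp only: inner_add_left[symmetric] inner_zero_left)
        then have "A l \<bullet> (snd p - fst p) = 0" using j p(4) by simp
        then have "A m \<bullet> (snd p - fst p) = 0" for m
          using triangle_indices[of i j l m] that l j p(4) by metis
        then have "snd p - fst p = 0" using expand_\<omega>[of "snd p - fst p"] by simp
        then show False using p(2) by simp
      qed
      then have "\<chi>' j (mid i x) = (if j = i then 1 else 0)" for j
        using \<chi>S[OF p(1), of "mid i x" j] False p(3,4) by auto
      then show ?thesis by blast
    qed
  qed
  have "(\<Sum>x\<in>X. measure lebesgue (otri (fst x) (snd x)) * (if infdist (fst x) Z < 2 * h then 1 else C * h / infdist (fst x) Z)\<^sup>2)
    \<le> (1 + C\<^sup>2) * 36 * real (card Z) * ((log 2 D + 1) / \<bar>ln h0\<bar> + 2) * h\<^sup>2 * \<bar>ln h\<bar>"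
  proof (rule log_sum_bound[OF finite_X])
    show "otri (fst x) (snd x) \<in> lmeasurable" if "x \<in> X" for x by (rule lmeasurable_otri[OF orient_X[OF that]])
    show "infdist (fst x) Z \<le> D" if "x \<in> X" for x
      using otri_subset_\<Omega>[OF that] center_in_otri closure_subset by (intro D) blast
  qed (use otri_subset_cball disjoint_otri Z h h_pos D C in auto)
  moreover have "(\<Sum>x\<in>X. area * (w x)\<^sup>2) = (\<Sum>x\<in>X. measure lebesgue (otri (fst x) (snd x)) * (if infdist (fst x) Z < 2 * h then 1 else C * h / infdist (fst x) Z)\<^sup>2)"
    by (intro sum.cong refl) (simp only: measure_otri[OF orient_X] w_def)
  ultimately show ?thesis using that[of w, OF 1 2] by simp
qed

end

section \<open>The error estimate\<close>

lemma L2_norm_nonneg: "0 \<le> L2_norm U v"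
  by (simp add: L2_norm_def)

lemma L2_norm_add_le:
  fixes v w :: "plane \<Rightarrow> real"
  assumes v: "L2 U v" and w: "L2 U w"
  shows "L2_norm U (\<lambda>x. v x + w x) \<le> L2_norm U v + L2_norm U w"
proof -
  have vw: "integrable (lebesgue_on U) (\<lambda>x. v x * w x)" "integrable (lebesgue_on U) (\<lambda>x. (v x)\<^sup>2)" "integrable (lebesgue_on U) (\<lambda>x. (w x)\<^sup>2)"
    using v w by (auto intro: integrable_mult_L2 simp: L2_real_def)
  have sq: "(LINT x|lebesgue_on U. (u x)\<^sup>2) = (L2_norm U u)\<^sup>2" for u :: "plane \<Rightarrow> real"
    unfolding L2_norm_real_def by (intro real_sqrt_pow2[symmetric] Bochner_Integration.integral_nonneg) simp
  have "(LINT x|lebesgue_on U. v x * w x) \<le> L2_norm U v * L2_norm U w"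
    using cauchy_schwarz_integral[of v "lebesgue_on U" w] v w by (auto simp: L2_real_def L2_norm_real_def)
  moreover have "(LINT x|lebesgue_on U. (v x + w x)\<^sup>2) = (L2_norm U v)\<^sup>2 + (L2_norm U w)\<^sup>2 + 2 * (LINT x|lebesgue_on U. v x * w x)"
    using vw by (simp add: power2_sum sq mult.assoc)
  ultimately have "(LINT x|lebesgue_on U. (v x + w x)\<^sup>2) \<le> (L2_norm U v + L2_norm U w)\<^sup>2"
    by (simp add: power2_sum)
  then show ?thesis
    unfolding L2_norm_real_def[of U "\<lambda>x. v x + w x"]
    using L2_norm_nonneg[of U v] L2_norm_nonneg[of U w] by (intro real_le_lsqrt) auto
qed

lemma L2_norm_sum_le:
  fixes v :: "'i \<Rightarrow> plane \<Rightarrow> real"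
  assumes "\<And>i. L2 U (v i)" shows "L2_norm U (\<lambda>x. \<Sum>i\<in>I. v i x) \<le> (\<Sum>i\<in>I. L2_norm U (v i))"
proof (induction I rule: infinite_finite_induct)
  case (insert i I)
  have "L2_norm U (\<lambda>x. v i x + (\<Sum>i\<in>I. v i x)) \<le> L2_norm U (v i) + L2_norm U (\<lambda>x. \<Sum>i\<in>I. v i x)"
    by (intro L2_norm_add_le L2_sum assms)
  then show ?case using insert by simp
qed (simp_all add: L2_norm_real_def)

text \<open>The triangle inequality for the 8 = 2 * 2 * 2 index combinations.\<close>

lemma L2_norm_abs_sum_le:
  fixes g :: "2 \<Rightarrow> 2 \<Rightarrow> 2 \<Rightarrow> plane \<Rightarrow> real"
  assumes L: "\<And>l j k. L2 U (g l j k)" and b: "\<And>l j k. L2_norm U (g l j k) \<le> b"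
  shows "L2_norm U (\<lambda>p. \<Sum>l\<in>UNIV. \<Sum>j\<in>UNIV. \<Sum>k\<in>UNIV. \<bar>g l j k p\<bar>) \<le> 8 * b"
proof -
  have a: "L2_norm U (\<lambda>p. \<bar>g l j k p\<bar>) \<le> b" for l j k using b[of l j k] by (simp add: L2_norm_real_def)
  have k: "L2_norm U (\<lambda>p. \<Sum>k\<in>UNIV. \<bar>g l j k p\<bar>) \<le> 2 * b" for l j
    using order_trans[OF L2_norm_sum_le sum_mono, of U "\<lambda>k p. \<bar>g l j k p\<bar>" UNIV "\<lambda>_. b"] L2_abs[OF L] a by simp
  have j: "L2_norm U (\<lambda>p. \<Sum>j\<in>UNIV. \<Sum>k\<in>UNIV. \<bar>g l j k p\<bar>) \<le> 4 * b" for l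
  proof -
    have "L2_norm U (\<lambda>p. \<Sum>j\<in>UNIV. \<Sum>k\<in>UNIV. \<bar>g l j k p\<bar>) \<le> (\<Sum>j\<in>UNIV. L2_norm U (\<lambda>p. \<Sum>k\<in>UNIV. \<bar>g l j k p\<bar>))"
      by (rule L2_norm_sum_le) (rule L2_sum[OF L2_abs[OF L]])
    also have "\<dots> \<le> (\<Sum>j\<in>(UNIV::2 set). 2 * b)" by (rule sum_mono) (rule k)
    finally show ?thesis by simp
  qed
  have "L2_norm U (\<lambda>p. \<Sum>l\<in>UNIV. \<Sum>j\<in>UNIV. \<Sum>k\<in>UNIV. \<bar>g l j k p\<bar>) \<le> (\<Sum>l\<in>UNIV. L2_norm U (\<lambda>p. \<Sum>j\<in>UNIV. \<Sum>k\<in>UNIV. \<bar>g l j k p\<bar>))"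
    by (rule L2_norm_sum_le) (rule L2_sum[OF L2_sum[OF L2_abs[OF L]]])
  also have "\<dots> \<le> (\<Sum>l\<in>(UNIV::2 set). 4 * b)" by (rule sum_mono) (rule j)
  finally show ?thesis by simp
qed

text \<open>The Sobolev space provides some square integrable weak derivative; uniqueness transfers
  this to the one selected by \<open>weak_deriv\<close>.\<close>

lemma sobolev_space_weak_deriv:
  assumes v: "sobolev_space s \<Omega> v" and \<alpha>: "mi_order \<alpha> \<le> nat \<lfloor>s\<rfloor>" and U: "open \<Omega>"
  shows "has_weak_deriv \<Omega> \<alpha> v (weak_deriv \<Omega> \<alpha> v)" "L2 \<Omega> (weak_deriv \<Omega> \<alpha> v)"
proof -
  obtain g where g: "L2 \<Omega> g" "has_weak_deriv \<Omega> \<alpha> v g" using v \<alpha> unfolding sobolev_space_def by blast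
  show wd: "has_weak_deriv \<Omega> \<alpha> v (weak_deriv \<Omega> \<alpha> v)" by (rule has_weak_deriv_weak_deriv[OF g(2)])
  have m: "weak_deriv \<Omega> \<alpha> v \<in> borel_measurable (lebesgue_on \<Omega>)"
    using wd by (intro locally_integrable_measurable U) (simp add: has_weak_deriv_def)
  have "AE x in lebesgue_on \<Omega>. (g x)\<^sup>2 = (weak_deriv \<Omega> \<alpha> v x)\<^sup>2"
    using has_weak_deriv_unique[OF g(2) wd U] by eventually_elim simp
  then have "integrable (lebesgue_on \<Omega>) (\<lambda>x. (weak_deriv \<Omega> \<alpha> v x)\<^sup>2)"
    using g(1) m by (subst integrable_cong_AE[symmetric]) (auto simp: L2_real_def)
  then show "L2 \<Omega> (weak_deriv \<Omega> \<alpha> v)" using m by (simp add: L2_real_def)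
qed

lemma sqrt_slobodeckij_le_seminorm:
  assumes "mi_order \<alpha> = 2"
  shows "sqrt (enn2real (slobodeckij (1/2) U (weak_deriv U \<alpha> (\<lambda>x. \<tau> x $ k)))) \<le> sobolev_seminorm_vec (5/2) U \<tau>"
proof -
  have f: "frac (5/2 :: real) = 1/2" "nat \<lfloor>5/2 :: real\<rfloor> = 2" by (simp_all add: frac_def)
  have "enn2real (slobodeckij (1/2) U (weak_deriv U \<alpha> (\<lambda>x. \<tau> x $ k))) \<le>
      (\<Sum>\<alpha> | mi_order \<alpha> = 2. enn2real (slobodeckij (1/2) U (weak_deriv U \<alpha> (\<lambda>x. \<tau> x $ k))))"
    using assms finite_mi_order by (intro member_le_sum) auto
  then have "sqrt (enn2real (slobodeckij (1/2) U (weak_deriv U \<alpha> (\<lambda>x. \<tau> x $ k)))) \<le> sobolev_seminorm (5/2) U (\<lambda>x. \<tau> x $ k)"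
    unfolding sobolev_seminorm_def f by (simp add: real_sqrt_le_mono)
  also have "\<dots> \<le> sobolev_seminorm_vec (5/2) U \<tau>"
  proof -
    have "(sobolev_seminorm (5/2) U (\<lambda>x. \<tau> x $ k))\<^sup>2 \<le> (\<Sum>i\<in>UNIV. (sobolev_seminorm (5/2) U (\<lambda>x. \<tau> x $ i))\<^sup>2)"
      by (rule member_le_sum[of k UNIV "\<lambda>k. (sobolev_seminorm (5/2) U (\<lambda>x. \<tau> x $ k))\<^sup>2"]) auto
    then show ?thesis unfolding sobolev_seminorm_vec_def by (rule real_le_rsqrt)
  qed
  finally show ?thesis .
qed

lemma AE_weak_deriv_le_W_inf:
  "AE x in lebesgue_on U. ereal \<bar>weak_deriv U (unit_index j) (\<lambda>y. \<tau> y $ k) x\<bar> \<le> W_inf_seminorm_vec 1 U \<tau>"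
proof -
  let ?e = "\<lambda>(i, \<alpha>). esssup (lebesgue_on U) (\<lambda>x. ereal \<bar>weak_deriv U \<alpha> (\<lambda>y. \<tau> y $ i) x\<bar>)"
  have "?e (k, unit_index j) \<le> W_inf_seminorm_vec 1 U \<tau>"
    unfolding W_inf_seminorm_vec_def by (rule SUP_upper) simp
  then have le: "esssup (lebesgue_on U) (\<lambda>x. ereal \<bar>weak_deriv U (unit_index j) (\<lambda>y. \<tau> y $ k) x\<bar>) \<le> W_inf_seminorm_vec 1 U \<tau>"
    by simp
  show ?thesis
    using esssup_AE[of "\<lambda>x. ereal \<bar>weak_deriv U (unit_index j) (\<lambda>y. \<tau> y $ k) x\<bar>" "lebesgue_on U"]
    by eventually_elim (rule order_trans[OF _ le])
qed

text \<open>A segment determines its end points up to order.\<close>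

lemma finite_segment_endpoints:
  fixes S :: "plane set set"
  assumes "finite S" shows "finite {p. closed_segment (fst p) (snd p) \<in> S}"
proof -
  have "finite {p. closed_segment (fst p) (snd p) = (s :: plane set)}" for s
  proof (cases "\<exists>p :: plane \<times> plane. closed_segment (fst p) (snd p) = s")
    case True
    then obtain a b where s: "closed_segment a b = s" by auto
    have "{p. closed_segment (fst p) (snd p) = s} \<subseteq> {a, b} \<times> {a, b}"
      unfolding s[symmetric] closed_segment_eq by (auto simp: doubleton_eq_iff)
    then show ?thesis by (rule finite_subset) simp
  qed simp
  then have "finite (\<Union>s\<in>S. {p. closed_segment (fst p) (snd p) = s})" using assms by blast
  moreover have "{p. closed_segment (fst p) (snd p) \<in> S} = (\<Union>s\<in>S. {p. closed_segment (fst p) (snd p) = s})" by blast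
  ultimately show ?thesis by simp
qed

theorem theorem3p1:
  fixes \<Omega> :: "(real^2) set" and \<gamma> h0 :: real
  assumes "polygonal_domain \<Omega>" and "0 < h0" and "h0 < 1"
  shows "\<exists>C>0. \<forall>\<T> f \<sigma> u \<sigma>h uh \<pi> f1 f2.
    triangulation_of \<T> \<Omega> \<and> shape_regular \<gamma> \<T> \<and> uniform_mesh \<T> \<and> mesh_size \<T> \<le> h0 \<and>
    most_orthogonal_normals \<T> f1 f2 \<and>
    L2 \<Omega> f \<and> mixed_solution \<Omega> f \<sigma> u \<and> sobolev_space_vec (5/2) \<Omega> \<sigma> \<and>
    discrete_mixed_solution \<Omega> \<T> f \<sigma>h uh \<and> fortin_interpolant \<Omega> \<T> \<sigma> \<pi>
    \<longrightarrow>
    ereal (L2_norm \<Omega> (\<lambda>x. \<sigma>h x - \<pi> x)) \<le>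
    ereal (C * (mesh_size \<T>)\<^sup>2) *
      (ereal (sobolev_seminorm_vec (5/2) \<Omega> \<sigma>) +
       ereal (real (kappa \<Omega> \<T> f1 f2) * sqrt \<bar>ln (mesh_size \<T>)\<bar>) * W_inf_seminorm_vec 1 \<Omega> \<sigma>)"
proof -
  have \<Omega>: "open \<Omega>" "bounded \<Omega>" "\<Omega> \<noteq> {}" using assms(1) by (simp_all add: polygonal_domain_def)
  have "\<exists>\<S>. finite \<S> \<and> (\<forall>s\<in>\<S>. \<exists>a b. s = closed_segment a b) \<and> frontier \<Omega> = \<Union>\<S>"
    using assms(1) by (simp add: polygonal_domain_def)
  then obtain \<S> where "finite \<S> \<and> (\<forall>s\<in>\<S>. \<exists>a b. s = closed_segment a b) \<and> frontier \<Omega> = \<Union>\<S>"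
    by (rule exE)
  then have \<S>: "finite \<S>" "\<And>s. s \<in> \<S> \<Longrightarrow> \<exists>a b. s = closed_segment a b" "frontier \<Omega> = \<Union>\<S>"
    by simp_all
  \<comment> \<open>Degenerate segments have no direction and are left out; an edge on the frontier
    always yields a segment with distinct end points.\<close>
  define S where "S = {p. closed_segment (fst p) (snd p) \<in> \<S>} \<inter> {p. fst p \<noteq> snd p}"
  define P where "P Z C f \<chi>' \<longleftrightarrow> (\<forall>x. 0 \<le> \<chi>' x \<and> \<chi>' x \<le> 1) \<and>
      (\<forall>p\<in>S. \<forall>x\<in>closed_segment (fst p) (snd p) - Z. \<chi>' x = (if f \<bullet> (snd p - fst p) = 0 then 1 else 0)) \<and>
      (\<forall>x\<in>closure \<Omega>. \<forall>y. \<bar>\<chi>' x - \<chi>' y\<bar> * infdist x Z \<le> C * dist x y)" for Z C f and \<chi>' :: "plane \<Rightarrow> real"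
  \<comment> \<open>\<open>Z\<close> and \<open>C\<close> are obtained before the direction
    \<open>f\<close>, so that they are the same for every mesh of the domain; the weights themselves
    may depend on the mesh.\<close>
  have "\<exists>Z C. finite Z \<and> Z \<noteq> {} \<and> 0 < C \<and> (\<forall>f. \<exists>\<chi>'. P Z C f \<chi>')"
    unfolding P_def
  proof (rule segment_cutoff)
    show "finite S" unfolding S_def using finite_segment_endpoints[OF \<S>(1)] by blast
    show "bounded (closure \<Omega>)" by (rule bounded_closure[OF \<Omega>(2)])
    show "fst p \<noteq> snd p" if "p \<in> S" for p using that by (simp add: S_def)
    show "closed_segment (fst p) (snd p) \<subseteq> closure \<Omega>" if "p \<in> S" for p
      using that \<S>(3) unfolding S_def frontier_def by blast
  qed
  then obtain Z C1 where Z: "finite Z" "Z \<noteq> {}" "0 < C1" and cut: "\<And>f. \<exists>\<chi>'. P Z C1 f \<chi>'"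
    by blast
  obtain C2 where C2': "0 < C2 \<and> (\<forall>G g M l. L2 \<Omega> g \<and> has_weak_deriv \<Omega> (unit_index l) G g \<and> 0 \<le> M \<and>
      (AE x in lebesgue_on \<Omega>. \<bar>G x\<bar> \<le> M) \<and> slobodeckij (1/2) \<Omega> g < \<infinity> \<longrightarrow>
      L2_norm \<Omega> g \<le> C2 * (sqrt (enn2real (slobodeckij (1/2) \<Omega> g)) + M))"
    by (rule exE[OF slobodeckij_half_bounds_L2_norm[OF \<Omega>]])
  have C2: "0 < C2" by (rule conjunct1[OF C2'])
  have slob: "L2_norm \<Omega> g \<le> C2 * (sqrt (enn2real (slobodeckij (1/2) \<Omega> g)) + M)"
    if "L2 \<Omega> g" "has_weak_deriv \<Omega> (unit_index l) G g" "0 \<le> M" "AE x in lebesgue_on \<Omega>. \<bar>G x\<bar> \<le> M"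
      "slobodeckij (1/2) \<Omega> g < \<infinity>" for G g M l
    using C2'[THEN conjunct2, THEN spec[of _ G], THEN spec[of _ g], THEN spec[of _ M], THEN spec[of _ l]] that by blast
  obtain z0 where z0: "z0 \<in> Z" using Z(2) by blast
  have "bounded (closure \<Omega>)" by (rule bounded_closure[OF \<Omega>(2)])
  then obtain B where B: "\<And>x. x \<in> closure \<Omega> \<Longrightarrow> dist z0 x \<le> B" using bounded_any_center by blast
  define D where "D = max 1 B"
  have D: "infdist x Z \<le> D" if "x \<in> closure \<Omega>" for x
    using infdist_le[OF z0, of x] B[OF that] by (simp add: D_def dist_commute)
  have D1: "1 \<le> D" by (simp add: D_def)
  define q0 where "q0 = sqrt \<bar>ln h0\<bar>"
  have q0: "0 < q0" using assms by (simp add: q0_def)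
  define C3 where "C3 = (1 + C1\<^sup>2) * 36 * real (card Z) * ((log 2 D + 1) / \<bar>ln h0\<bar> + 2)"
  have C3: "0 \<le> C3" unfolding C3_def by (intro mult_nonneg_nonneg add_nonneg_nonneg divide_nonneg_nonneg) (auto simp: D_def)
  \<comment> \<open>The two terms with \<open>8 * C2\<close> come from the second derivatives,
    bounded by the fractional seminorm and by the gradient bound; the latter is divided by
    \<open>q0\<close> to be charged to the logarithmic term. The last summand comes from the
    weights.\<close>
  define K where "K = 8 * C2 + 8 * C2 / q0 + sqrt C3"
  have K: "0 \<le> K" using C2 q0 C3 by (simp add: K_def)
  define C where "C = 414 * \<gamma>\<^sup>2 * K + 1"
  have C: "0 < C" using K by (simp add: C_def add_nonneg_pos)
  show ?thesis
  proof (intro exI[of _ C] conjI allI impI C)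
    fix \<T> f \<sigma> u \<sigma>h uh \<pi> f1 f2
    assume H: "triangulation_of \<T> \<Omega> \<and> shape_regular \<gamma> \<T> \<and> uniform_mesh \<T> \<and> mesh_size \<T> \<le> h0 \<and>
      most_orthogonal_normals \<T> f1 f2 \<and>
      L2 \<Omega> f \<and> mixed_solution \<Omega> f \<sigma> u \<and> sobolev_space_vec (5/2) \<Omega> \<sigma> \<and>
      discrete_mixed_solution \<Omega> \<T> f \<sigma>h uh \<and> fortin_interpolant \<Omega> \<T> \<sigma> \<pi>"
    define h where "h = mesh_size \<T>"
    obtain \<omega> A where "uniform_triangulation_size \<omega> A \<Omega> \<T> (mesh_size \<T>) \<gamma>"
      using uniform_mesh_frame[OF assms(1)] H by blast
    then interpret uniform_triangulation_size \<omega> A \<Omega> \<T> h \<gamma> unfolding h_def .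
    have h: "0 < h" "h \<le> h0" using h_pos H by (simp_all add: h_def)
    define q where "q = sqrt \<bar>ln h\<bar>"
    have q: "q0 \<le> q" "0 < q"
    proof -
      have "ln h \<le> ln h0" "ln h0 < 0" using h assms by simp_all
      then show "q0 \<le> q" by (simp add: q_def q0_def)
      then show "0 < q" using q0 by linarith
    qed
    define \<kappa> where "\<kappa> = real (kappa \<Omega> \<T> f1 f2)"
    have \<kappa>: "1 \<le> \<kappa>" using kappa_pos[of f1 f2] H by (simp add: \<kappa>_def)
    define s where "s = sobolev_seminorm_vec (5/2) \<Omega> \<sigma>"
    define G where "G j k = weak_deriv \<Omega> (unit_index j) (\<lambda>x. \<sigma> x $ k)" for j k
    define \<alpha> where "\<alpha> l j = (fst (unit_index j) + fst (unit_index l), snd (unit_index j) + snd (unit_index l))" for l j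
    have \<alpha>2: "mi_order (\<alpha> l j) = 2" for l j by (simp add: \<alpha>_def mi_order_def unit_index_def)
    define g where "g l j k = weak_deriv \<Omega> (\<alpha> l j) (\<lambda>x. \<sigma> x $ k)" for l j k
    have sob: "sobolev_space (5/2) \<Omega> (\<lambda>x. \<sigma> x $ k)" for k using H by (simp add: sobolev_space_vec_def)
    have n: "nat \<lfloor>5/2 :: real\<rfloor> = 2" "frac (5/2 :: real) = 1/2" by (simp_all add: frac_def)
    have wdG: "has_weak_deriv \<Omega> (unit_index j) (\<lambda>x. \<sigma> x $ k) (G j k)" and LG: "L2 \<Omega> (G j k)" for j k
      unfolding G_def using sobolev_space_weak_deriv[OF sob _ \<Omega>(1), of "unit_index j" k] by (simp_all add: n)
    have wdg0: "has_weak_deriv \<Omega> (\<alpha> l j) (\<lambda>x. \<sigma> x $ k) (g l j k)" and Lg: "L2 \<Omega> (g l j k)" for l j k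
      unfolding g_def using sobolev_space_weak_deriv[OF sob _ \<Omega>(1), of "\<alpha> l j" k] by (simp_all add: n \<alpha>2)
    have wdg: "has_weak_deriv \<Omega> (unit_index l) (G j k) (g l j k)" for l j k
      by (rule has_weak_deriv_second[OF wdG wdg0]) (simp_all add: \<alpha>_def)
    have fin: "slobodeckij (1/2) \<Omega> (g l j k) < \<infinity>" for l j k
    proof -
      have "0 < (1/2 :: real) \<longrightarrow> (\<forall>\<alpha>. mi_order \<alpha> = 2 \<longrightarrow> slobodeckij (1/2) \<Omega> (weak_deriv \<Omega> \<alpha> (\<lambda>x. \<sigma> x $ k)) < \<infinity>)"
        using sob[of k] unfolding sobolev_space_def n by (elim conjE)
      then have "\<forall>\<alpha>. mi_order \<alpha> = 2 \<longrightarrow> slobodeckij (1/2) \<Omega> (weak_deriv \<Omega> \<alpha> (\<lambda>x. \<sigma> x $ k)) < \<infinity>"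
        by (rule mp) simp
      from mp[OF spec[OF this] \<alpha>2[of l j]] show ?thesis unfolding g_def .
    qed
    have L\<sigma>: "L2 \<Omega> (\<lambda>x. \<sigma> x $ k)" for k using sob[of k] by (simp add: sobolev_space_def)
    interpret mixed_problem_size \<omega> A \<Omega> \<T> f u uh \<sigma> \<sigma>h \<pi> G h \<gamma>
      by (intro mixed_problem_size.intro mixed_problem.intro mixed_problem_axioms.intro uniform_triangulation_axioms
          uniform_triangulation_size_axioms wdG L\<sigma> LG) (simp_all add: H)
    have AE_G: "AE x in lebesgue_on \<Omega>. ereal \<bar>G j k x\<bar> \<le> W_inf_seminorm_vec 1 \<Omega> \<sigma>" for j k
      unfolding G_def by (rule AE_weak_deriv_le_W_inf)
    have W0: "0 \<le> W_inf_seminorm_vec 1 \<Omega> \<sigma>"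
    proof (rule AE_const_open[OF \<Omega>(1,3)])
      show "AE x in lebesgue_on \<Omega>. 0 \<le> W_inf_seminorm_vec 1 \<Omega> \<sigma>"
        using AE_G[of 1 1] by eventually_elim (rule order_trans, simp_all)
    qed
    have "ereal (L2_norm \<Omega> (\<lambda>x. \<sigma>h x - \<pi> x)) \<le> ereal (C * h\<^sup>2) * (ereal s + ereal (\<kappa> * q) * W_inf_seminorm_vec 1 \<Omega> \<sigma>)"
    proof (cases "W_inf_seminorm_vec 1 \<Omega> \<sigma>")
      case PInf
      \<comment> \<open>For an unbounded gradient the right hand side is infinite, but only because
        \<open>\<kappa>\<close> and the logarithm are strictly positive: in \<open>ereal\<close> the
        product of 0 and infinity is 0.\<close>
      have "0 < \<kappa> * q" "0 < C * h\<^sup>2" using \<kappa> q C h by simp_all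
      moreover have "ereal r * \<infinity> = \<infinity>" if "0 < r" for r using that by simp
      ultimately have "ereal (\<kappa> * q) * \<infinity> = \<infinity>" "ereal (C * h\<^sup>2) * \<infinity> = \<infinity>" by blast+
      moreover have "ereal s + \<infinity> = \<infinity>" by simp
      ultimately show ?thesis unfolding PInf by (simp only: ereal_less_eq)
    next
      case MInf
      then show ?thesis using W0 by simp
    next
      case (real M)
      then have M0: "0 \<le> M" using W0 by simp
      have AE_M: "AE x in lebesgue_on \<Omega>. \<bar>G j k x\<bar> \<le> M" for j k
        using AE_G[of j k] unfolding real by simp
      have s_ge: "sqrt (enn2real (slobodeckij (1/2) \<Omega> (g l j k))) \<le> s" for l j k
        unfolding g_def s_def by (rule sqrt_slobodeckij_le_seminorm[OF \<alpha>2])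
      then have s0: "0 \<le> s" using order_trans[OF real_sqrt_ge_zero] enn2real_nonneg by blast
      have "L2_norm \<Omega> (g l j k) \<le> C2 * (s + M)" for l j k
        using C2 s_ge[of l j k] by (intro order_trans[OF slob[OF Lg wdg M0 AE_M fin]] mult_left_mono add_right_mono) auto
      then have N: "L2_norm \<Omega> (\<lambda>p. \<Sum>l\<in>UNIV. \<Sum>j\<in>UNIV. \<Sum>k\<in>UNIV. \<bar>g l j k p\<bar>) \<le> 8 * (C2 * (s + M))"
        by (intro L2_norm_abs_sum_le Lg)
      have "\<forall>j. \<exists>\<chi>'. P Z C1 (A j) \<chi>'" using cut by blast
      from choice[OF this] obtain \<chi>' where P\<chi>: "\<And>j. P Z C1 (A j) (\<chi>' j)" by blast
      have \<chi>': "0 \<le> \<chi>' j x \<and> \<chi>' j x \<le> 1" for j x using P\<chi>[of j] unfolding P_def by blast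
      have \<chi>S: "\<chi>' j x = (if A j \<bullet> (snd p - fst p) = 0 then 1 else 0)"
        if "p \<in> S" "x \<in> closed_segment (fst p) (snd p) - Z" for j p x using P\<chi>[of j] that unfolding P_def by blast
      have \<chi>L: "\<bar>\<chi>' j x - \<chi>' j y\<bar> * infdist x Z \<le> C1 * dist x y" if "x \<in> closure \<Omega>" for j x y
        using P\<chi>[of j] that unfolding P_def by blast
      have seg: "\<exists>p\<in>S. fst p \<noteq> snd p \<and> mid i x \<in> closed_segment (fst p) (snd p) \<and> A i \<bullet> (snd p - fst p) = 0"
        if x: "x \<in> X" "nb i x \<notin> X" for x i
      proof -
        obtain a b where "closed_segment a b \<in> \<S>" "a \<noteq> b" "mid i x \<in> closed_segment a b" "A i \<bullet> (b - a) = 0"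
          using unpaired_side_segment[OF x \<S>] by blast
        then show ?thesis by (intro bexI[of _ "(a, b)"]) (simp_all add: S_def)
      qed
      obtain w where w: "\<And>x i k j. x \<in> X \<Longrightarrow> \<bar>\<chi>' j (mid i x) - \<chi>' j (mid k x)\<bar> \<le> w x"
          "\<And>x i. x \<in> X \<Longrightarrow> nb i x \<notin> X \<Longrightarrow> (\<forall>j. \<chi>' j (mid i x) = (if j = i then 1 else 0)) \<or> 1 \<le> w x"
          "(\<Sum>x\<in>X. area * (w x)\<^sup>2) \<le> C3 * h\<^sup>2 * \<bar>ln h\<bar>"
      proof (rule cutoff_weights[OF Z h(2) assms(3) D D1 \<chi>' \<chi>S \<chi>L seg])
        fix w
        assume 1: "\<And>x i k j. x \<in> X \<Longrightarrow> \<bar>\<chi>' j (mid i x) - \<chi>' j (mid k x)\<bar> \<le> w x"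
          and 2: "\<And>x i. x \<in> X \<Longrightarrow> nb i x \<notin> X \<Longrightarrow> (\<forall>j. \<chi>' j (mid i x) = (if j = i then 1 else 0)) \<or> 1 \<le> w x"
          and 3: "(\<Sum>x\<in>X. area * (w x)\<^sup>2) \<le> (1 + C1\<^sup>2) * 36 * real (card Z) * ((log 2 D + 1) / \<bar>ln h0\<bar> + 2) * h\<^sup>2 * \<bar>ln h\<bar>"
        show thesis by (rule that[OF 1 2 3[folded C3_def]])
      qed
      have "sqrt (\<Sum>x\<in>X. area * (w x)\<^sup>2) \<le> sqrt (C3 * h\<^sup>2 * \<bar>ln h\<bar>)" by (rule real_sqrt_le_mono[OF w(3)])
      also have "\<dots> = sqrt C3 * h * q" using h by (simp add: real_sqrt_mult q_def)
      finally have sw: "sqrt (\<Sum>x\<in>X. area * (w x)\<^sup>2) \<le> sqrt C3 * h * q" .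
      have "L2_norm \<Omega> (\<lambda>p. \<sigma>h p - \<pi> p) \<le>
        414 * \<gamma>\<^sup>2 * (h\<^sup>2 * L2_norm \<Omega> (\<lambda>p. \<Sum>l\<in>UNIV. \<Sum>j\<in>UNIV. \<Sum>k\<in>UNIV. \<bar>g l j k p\<bar>) + h * M * sqrt (\<Sum>x\<in>X. area * (w x)\<^sup>2))"
        by (rule error_bound[OF wdg Lg AE_M \<chi>' w(1,2)])
      also have "\<dots> \<le> 414 * \<gamma>\<^sup>2 * (h\<^sup>2 * (8 * (C2 * (s + M))) + h * M * (sqrt C3 * h * q))"
        using N sw h M0 by (intro mult_left_mono add_mono mult_nonneg_nonneg) auto
      also have "\<dots> = 414 * \<gamma>\<^sup>2 * h\<^sup>2 * (8 * C2 * (s + M) + sqrt C3 * (M * q))"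
        by (simp add: power2_eq_square algebra_simps)
      also have "\<dots> \<le> 414 * \<gamma>\<^sup>2 * h\<^sup>2 * (K * (s + \<kappa> * q * M))"
      proof (rule mult_left_mono)
        \<comment> \<open>Both occurrences of \<open>M\<close> are charged to this term:
          \<open>M * q\<close> because \<open>\<kappa>\<close> is at least 1, and \<open>M\<close>
          alone because \<open>q\<close> is at least \<open>q0\<close>.\<close>
        define m where "m = \<kappa> * q * M"
        have "1 * (M * q) \<le> \<kappa> * (M * q)" using \<kappa> M0 q by (intro mult_right_mono) auto
        then have m1: "M * q \<le> m" by (simp add: m_def mult_ac)
        have "M * q0 \<le> M * q" using q M0 by (intro mult_left_mono) auto
        then have "M * q0 \<le> m" using m1 by linarith
        then have m2: "M \<le> m / q0" using q0 by (simp add: pos_le_divide_eq)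
        have m0: "0 \<le> m" using m1 M0 q by (intro order_trans[OF _ m1]) simp
        have "8 * C2 * M \<le> 8 * C2 * (m / q0)" using C2 m2 by (intro mult_left_mono) auto
        moreover have "sqrt C3 * (M * q) \<le> sqrt C3 * m" using C3 m1 by (intro mult_left_mono) auto
        moreover have "0 \<le> 8 * C2 * m" "0 \<le> (8 * C2 / q0) * s" "0 \<le> sqrt C3 * s" using C2 m0 q0 s0 C3 by simp_all
        ultimately show "8 * C2 * (s + M) + sqrt C3 * (M * q) \<le> K * (s + \<kappa> * q * M)"
          unfolding m_def[symmetric] K_def by (simp add: algebra_simps add_divide_distrib)
      qed simp
      also have "\<dots> = (414 * \<gamma>\<^sup>2 * K) * (h\<^sup>2 * (s + \<kappa> * q * M))" by (simp only: mult_ac)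
      also have "\<dots> \<le> C * (h\<^sup>2 * (s + \<kappa> * q * M))"
        using s0 \<kappa> q M0 by (intro mult_right_mono mult_nonneg_nonneg add_nonneg_nonneg) (auto simp: C_def)
      finally show ?thesis
        unfolding real by (simp add: mult.assoc)
    qed
    then show "ereal (L2_norm \<Omega> (\<lambda>x. \<sigma>h x - \<pi> x)) \<le> ereal (C * (mesh_size \<T>)\<^sup>2) *
      (ereal (sobolev_seminorm_vec (5/2) \<Omega> \<sigma>) +
       ereal (real (kappa \<Omega> \<T> f1 f2) * sqrt \<bar>ln (mesh_size \<T>)\<bar>) * W_inf_seminorm_vec 1 \<Omega> \<sigma>)"
      unfolding q_def \<kappa>_def s_def h_def .
  qed
qed

end
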